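(* Let $f\in L_2(\Omega)$, let $(u,\lambda)\in U\times\Lambda$ be the unique solution of $$a(u,v)+b(\lambda,v)=(f,v)_\Omega,\qquad b(\mu,u)=0\qquad\text{for all }(v,\mu)\in U\times\Lambda,$$ and let $(u_h,\lambda_h)\in U_h\times\Lambda_h$ be the unique solution of $$a(u_h,v_h)+b(\lambda_h,v_h)=(f,v_h)_\Omega,\qquad b(\mu_h,u_h)=0\qquad\text{for all }(v_h,\mu_h)\in U_h\times\Lambda_h.$$ For $T\in\mathcal T$ set $$\rho(T)^2=\|(1-\Pi_T^0)(u_h-f)\|_T^2+\varepsilon^2\|(1-\Pi_T^0)\nabla u_h\|_T^2+\varepsilon\|[u_h]\|_{\partial T}^2+\varepsilon^2h_T\|[\nabla u_h\times\boldsymbol n]\|_{\partial T}^2.$$ Then there is a constant $C>0$, independent of $\varepsilon$ and of the mesh except for its shape-regularity, such that for any $T\in\mathcal T$ $$\rho(T)^2\le C\Big(\|u-u_h\|_{\Omega_T}^2+\varepsilon^2\|\nabla_{\mathcal T}(u-u_h)\|_{\Omega_T}^2+\min_{v_h\in P^0(T)}\|u-v_h\|_T^2+\min_{\boldsymbol\tau_h\in P^0(T)^d}\varepsilon^2\|\nabla_{\mathcal T}u-\boldsymbol\tau_h\|_T^2+\|(1-\Pi_T^0)f\|_T^2\Big).$$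
   Context: $\Omega\subseteq\mathbb R^d$ ($d=2,3$) is a bounded open Lipschitz domain with polygonal/polyhedral boundary, $0<\varepsilon\le 1$; $(\cdot,\cdot)_T$ and $\|\cdot\|_T$ are the $L_2(T)$ inner product and norm. $\mathcal T$ is a conforming mesh of $\Omega$ into shape-regular simplices ($\max_{T\in\mathcal T}h_T^d/|T|\le\kappa$), $h_T=\mathrm{diam}(T)$. $\Omega_T=\mathrm{int}\big(\bigcup\{\overline{T'}:T'\in\mathcal T,\ \overline T\cap\overline{T'}\ne\emptyset\}\big)$. Continuous spaces: $\boldsymbol H(\mathrm{div};\Omega)=\{\boldsymbol\tau\in L_2(\Omega)^d: \mathrm{div}\,\boldsymbol\tau\in L_2(\Omega)\}$. $U:=H^1(\mathcal T)=\{v\in L_2(\Omega): v|_T\in H^1(T)\ \forall T\in\mathcal T\}$ with piecewise gradient $\nabla_{\mathcal T}$. $\mathrm{tr}^{\mathrm{div}}_{\mathcal T}:\boldsymbol H(\mathrm{div};\Omega)\to (H^1(\mathcal T))'$, $\langle \mathrm{tr}^{\mathrm{div}}_{\mathcal T}\boldsymbol\tau,v\rangle_{\partial\mathcal T}=\sum_{T}[(\mathrm{div}\,\boldsymbol\tau,v)_T+(\boldsymbol\tau,\nabla v)_T]$. $\Lambda:=\mathrm{tr}^{\mathrm{div}}_{\mathcal T}(\boldsymbol H(\mathrm{div};\Omega))$. Bilinear forms: $a(u,v)=\varepsilon^2(\nabla_{\mathcal T}u,\nabla_{\mathcal T}v)_\Omega+(u,v)_\Omega$, $b(\lambda,v)=-\varepsilon\langle\lambda,v\rangle_{\partial\mathcal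 T}$. Discrete spaces: $P^p(T)$ denotes polynomials on $T$ of degree $\le p$. $\Lambda_h=\mathrm{tr}^{\mathrm{div}}_{\mathcal T}(\boldsymbol{RT}^0(\mathcal T))$, with $\boldsymbol{RT}^0(\mathcal T)=\{\boldsymbol\tau\in\boldsymbol H(\mathrm{div};\Omega):\boldsymbol\tau|_T\in P^0(T)^d+\boldsymbol xP^0(T)\ \forall T\in\mathcal T\}$. For $T\in\mathcal T$ let $\mathcal V_T$ be its vertices, $\mathcal F_T$ its facets, $\eta_z^T$ the barycentric coordinate of $z\in\mathcal V_T$; for $F\in\mathcal F_T$ let $z_F^T$ be the vertex opposite $F$, and set $\eta_F^T=\prod_{z\in\mathcal V_T\setminus\{z_F^T\}}\eta_z^T$, $d_F^T=\eta^T_{z_F^T}$, $\eta_{F,\varepsilon}^T=\exp(-(h_T/\varepsilon)d_F^T)\,\eta_F^T$, $\eta_T=\prod_{z\in\mathcal V_T}\eta_z^T$. Then $U_h=\prod_{T\in\mathcal T}U_{h,\varepsilon}(T)$ with $U_{h,\varepsilon}(T)=P^1(T)+\mathrm{span}\{\eta^T_{F,\varepsilon}:F\in\mathcal F_T\}+\mathrm{span}\{\eta_T\}$ if $\varepsilon<h_T$, and $U_{h,\varepsilon}(T)=P^1(T)+\mathrm{span}\{\eta^T_{F}:F\in\mathcal F_T\}+\mathrm{span}\{\eta_T\}$ if $\varepsilon\ge h_T$. $\Pi_T^0$ is the $L_2(T)$-orthogonal projection onto constants (applied componentwise to vectors). $[v]$ denotes the jump of $v$ across a facet and $[\nabla v\times\boldsymbol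 n]$ the jump of the tangential component of the gradient; on boundary facets jumps reduce to traces. These jumps are taken facet by facet on $\partial T$. *)

theory Defs
  imports "HOL-Analysis.Analysis"
begin

text \<open>
  Elements of Lebesgue and Sobolev spaces are represented by functions on the whole space, of which
  only the values almost everywhere on the set under consideration matter. Scalar and vector fields
  are treated alike; on \<open>real\<close> the inner product is multiplication.
\<close>

definition L2 :: "(real ^ 'n) set \<Rightarrow> (real ^ 'n \<Rightarrow> 'b :: euclidean_space) set" where
  "L2 S = {v. v \<in> borel_measurable (lebesgue_on S) \<and>
              integrable (lebesgue_on S) (\<lambda>x. (norm (v x))\<^sup>2)}"

definition l2_inner ::
    "(real ^ 'n) set \<Rightarrow> (real ^ 'n \<Rightarrow> 'b :: euclidean_space) \<Rightarrow> (real ^ 'n \<Rightarrow> 'b) \<Rightarrow> real" where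
  "l2_inner S v w = (LINT x | lebesgue_on S. v x \<bullet> w x)"

definition l2_norm :: "(real ^ 'n) set \<Rightarrow> (real ^ 'n \<Rightarrow> 'b :: euclidean_space) \<Rightarrow> real" where
  "l2_norm S v = sqrt (l2_inner S v v)"

definition partial_deriv :: "'n \<Rightarrow> (real ^ 'n \<Rightarrow> real) \<Rightarrow> real ^ 'n \<Rightarrow> real" where
  "partial_deriv i v x = frechet_derivative v (at x) (axis i 1)"

definition gradient :: "(real ^ 'n \<Rightarrow> real) \<Rightarrow> real ^ 'n \<Rightarrow> real ^ 'n" where
  "gradient v x = (\<chi> i. partial_deriv i v x)"

text \<open>Total differentiability of all iterated partial derivatives amounts to infinite smoothness.\<close>

definition smooth :: "(real ^ 'n \<Rightarrow> real) \<Rightarrow> bool" where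
  "smooth \<phi> \<longleftrightarrow> (\<forall>is x. foldr partial_deriv is \<phi> differentiable (at x))"

definition test_functions :: "(real ^ 'n) set \<Rightarrow> (real ^ 'n \<Rightarrow> real) set" where
  "test_functions S = {\<phi>. smooth \<phi> \<and> (\<exists>K. compact K \<and> K \<subseteq> S \<and> (\<forall>x. x \<notin> K \<longrightarrow> \<phi> x = 0))}"

definition is_weak_gradient ::
    "(real ^ 'n) set \<Rightarrow> (real ^ 'n \<Rightarrow> real) \<Rightarrow> (real ^ 'n \<Rightarrow> real ^ 'n) \<Rightarrow> bool" where
  "is_weak_gradient S v g \<longleftrightarrow> g \<in> L2 S \<and>
     (\<forall>\<phi> \<in> test_functions S. \<forall>i.
        l2_inner S v (partial_deriv i \<phi>) = - l2_inner S (\<lambda>x. g x $ i) \<phi>)"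

definition weak_gradient ::
    "(real ^ 'n) set \<Rightarrow> (real ^ 'n \<Rightarrow> real) \<Rightarrow> real ^ 'n \<Rightarrow> real ^ 'n" where
  "weak_gradient S v = (SOME g. is_weak_gradient S v g)"

definition H1 :: "(real ^ 'n) set \<Rightarrow> (real ^ 'n \<Rightarrow> real) set" where
  "H1 S = {v \<in> L2 S. \<exists>g. is_weak_gradient S v g}"

definition is_weak_divergence ::
    "(real ^ 'n) set \<Rightarrow> (real ^ 'n \<Rightarrow> real ^ 'n) \<Rightarrow> (real ^ 'n \<Rightarrow> real) \<Rightarrow> bool" where
  "is_weak_divergence S \<tau> w \<longleftrightarrow> w \<in> L2 S \<and>
     (\<forall>\<phi> \<in> test_functions S. l2_inner S \<tau> (gradient \<phi>) = - l2_inner S w \<phi>)"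

definition weak_divergence ::
    "(real ^ 'n) set \<Rightarrow> (real ^ 'n \<Rightarrow> real ^ 'n) \<Rightarrow> real ^ 'n \<Rightarrow> real" where
  "weak_divergence S \<tau> = (SOME w. is_weak_divergence S \<tau> w)"

definition Hdiv :: "(real ^ 'n) set \<Rightarrow> (real ^ 'n \<Rightarrow> real ^ 'n) set" where
  "Hdiv S = {\<tau> \<in> L2 S. \<exists>w. is_weak_divergence S \<tau> w}"

text \<open>
  Near each boundary point \<open>x\<close>, in the orthogonal coordinates \<open>x + y + t *\<^sub>R e\<close> with
  \<open>y\<close> perpendicular to \<open>e\<close>, the set is the strict epigraph of a Lipschitz function.
\<close>

definition lipschitz_boundary :: "(real ^ 'n) set \<Rightarrow> bool" where
  "lipschitz_boundary \<Omega> \<longleftrightarrow>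
     (\<forall>x \<in> frontier \<Omega>. \<exists>e \<gamma> L r. norm e = 1 \<and> 0 < r \<and> L-lipschitz_on {y. e \<bullet> y = 0} \<gamma> \<and>
        (\<forall>y t. e \<bullet> y = 0 \<and> norm y < r \<and> \<bar>t\<bar> < r \<longrightarrow>
           (x + y + t *\<^sub>R e \<in> \<Omega> \<longleftrightarrow> \<gamma> y < t)))"

definition polyhedral_boundary :: "(real ^ 'n) set \<Rightarrow> bool" where
  "polyhedral_boundary \<Omega> \<longleftrightarrow>
     (\<exists>\<P>. finite \<P> \<and> (\<forall>P \<in> \<P>. polytope P \<and> aff_dim P = int CARD('n) - 1) \<and> frontier \<Omega> = \<Union> \<P>)"

definition polyhedral_lipschitz_domain :: "(real ^ 'n) set \<Rightarrow> bool" where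
  "polyhedral_lipschitz_domain \<Omega> \<longleftrightarrow>
     \<Omega> \<noteq> {} \<and> open \<Omega> \<and> connected \<Omega> \<and> bounded \<Omega> \<and> lipschitz_boundary \<Omega> \<and> polyhedral_boundary \<Omega>"

text \<open>Mesh elements are open simplices.\<close>

definition conforming_mesh :: "(real ^ 'n) set \<Rightarrow> (real ^ 'n) set set \<Rightarrow> bool" where
  "conforming_mesh \<Omega> \<T> \<longleftrightarrow>
     finite \<T> \<and> disjoint \<T> \<and>
     (\<forall>T \<in> \<T>. T \<subseteq> \<Omega> \<and> (\<exists>S. int CARD('n) simplex S \<and> T = interior S)) \<and>
     closure \<Omega> = (\<Union>T \<in> \<T>. closure T) \<and>
     (\<forall>T \<in> \<T>. \<forall>T' \<in> \<T>. (closure T \<inter> closure T') face_of closure T \<and>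
                         (closure T \<inter> closure T') face_of closure T')"

definition shape_regular :: "real \<Rightarrow> (real ^ 'n) set set \<Rightarrow> bool" where
  "shape_regular \<kappa> \<T> \<longleftrightarrow> (\<forall>T \<in> \<T>. diameter T ^ CARD('n) / measure lebesgue T \<le> \<kappa>)"

definition patch :: "(real ^ 'n) set set \<Rightarrow> (real ^ 'n) set \<Rightarrow> (real ^ 'n) set" where
  "patch \<T> T = interior (\<Union> {closure T' | T'. T' \<in> \<T> \<and> closure T \<inter> closure T' \<noteq> {}})"

definition H1_broken :: "(real ^ 'n) set \<Rightarrow> (real ^ 'n) set set \<Rightarrow> (real ^ 'n \<Rightarrow> real) set" where
  "H1_broken \<Omega> \<T> = {v \<in> L2 \<Omega>. \<forall>T \<in> \<T>. v \<in> H1 T}"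

text \<open>The elements are disjoint, so at most one summand is nonzero at each point.\<close>

definition broken_gradient ::
    "(real ^ 'n) set set \<Rightarrow> (real ^ 'n \<Rightarrow> real) \<Rightarrow> real ^ 'n \<Rightarrow> real ^ 'n" where
  "broken_gradient \<T> v x = (\<Sum>T \<in> \<T>. indicat_real T x *\<^sub>R weak_gradient T v x)"

text \<open>
  Functionals on the broken space are represented by functions that are \<open>undefined\<close> off that space,
  so that equality of representatives is equality of functionals.
\<close>

definition tr_div :: "(real ^ 'n) set \<Rightarrow> (real ^ 'n) set set \<Rightarrow>
    (real ^ 'n \<Rightarrow> real ^ 'n) \<Rightarrow> (real ^ 'n \<Rightarrow> real) \<Rightarrow> real" where
  "tr_div \<Omega> \<T> \<tau> = (\<lambda>v \<in> H1_broken \<Omega> \<T>.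
     \<Sum>T \<in> \<T>. l2_inner T (weak_divergence \<Omega> \<tau>) v + l2_inner T \<tau> (weak_gradient T v))"

definition trace_space ::
    "(real ^ 'n) set \<Rightarrow> (real ^ 'n) set set \<Rightarrow> ((real ^ 'n \<Rightarrow> real) \<Rightarrow> real) set" where
  "trace_space \<Omega> \<T> = tr_div \<Omega> \<T> ` Hdiv \<Omega>"

definition form_a :: "(real ^ 'n) set \<Rightarrow> (real ^ 'n) set set \<Rightarrow> real \<Rightarrow>
    (real ^ 'n \<Rightarrow> real) \<Rightarrow> (real ^ 'n \<Rightarrow> real) \<Rightarrow> real" where
  "form_a \<Omega> \<T> \<epsilon> u v =
     \<epsilon>\<^sup>2 * l2_inner \<Omega> (broken_gradient \<T> u) (broken_gradient \<T> v) + l2_inner \<Omega> u v"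

definition form_b ::
    "real \<Rightarrow> ((real ^ 'n \<Rightarrow> real) \<Rightarrow> real) \<Rightarrow> (real ^ 'n \<Rightarrow> real) \<Rightarrow> real" where
  "form_b \<epsilon> \<mu> v = - \<epsilon> * \<mu> v"

definition mixed_solution :: "(real ^ 'n) set \<Rightarrow> (real ^ 'n) set set \<Rightarrow> real \<Rightarrow>
    (real ^ 'n \<Rightarrow> real) set \<Rightarrow> ((real ^ 'n \<Rightarrow> real) \<Rightarrow> real) set \<Rightarrow> (real ^ 'n \<Rightarrow> real) \<Rightarrow>
    (real ^ 'n \<Rightarrow> real) \<Rightarrow> ((real ^ 'n \<Rightarrow> real) \<Rightarrow> real) \<Rightarrow> bool" where
  "mixed_solution \<Omega> \<T> \<epsilon> V M f u l \<longleftrightarrow>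
     u \<in> V \<and> l \<in> M \<and>
     (\<forall>v \<in> V. form_a \<Omega> \<T> \<epsilon> u v + form_b \<epsilon> l v = l2_inner \<Omega> f v) \<and>
     (\<forall>\<mu> \<in> M. form_b \<epsilon> \<mu> u = 0)"

definition P0 :: "(real ^ 'n \<Rightarrow> 'b) set" where
  "P0 = {\<lambda>x. c | c. True}"

definition P1 :: "(real ^ 'n \<Rightarrow> real) set" where
  "P1 = {\<lambda>x. c + a \<bullet> x | c a. True}"

definition RT0 :: "(real ^ 'n) set \<Rightarrow> (real ^ 'n) set set \<Rightarrow> (real ^ 'n \<Rightarrow> real ^ 'n) set" where
  "RT0 \<Omega> \<T> = {\<tau> \<in> Hdiv \<Omega>. \<forall>T \<in> \<T>. \<exists>a \<in> P0. \<exists>c \<in> P0. \<forall>x \<in> T. \<tau> x = a x + c x *\<^sub>R x}"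

definition discrete_trace_space ::
    "(real ^ 'n) set \<Rightarrow> (real ^ 'n) set set \<Rightarrow> ((real ^ 'n \<Rightarrow> real) \<Rightarrow> real) set" where
  "discrete_trace_space \<Omega> \<T> = tr_div \<Omega> \<T> ` RT0 \<Omega> \<T>"

definition vertices :: "(real ^ 'n) set \<Rightarrow> (real ^ 'n) set" where
  "vertices T = {z. z extreme_point_of closure T}"

definition facets :: "(real ^ 'n) set \<Rightarrow> (real ^ 'n) set set" where
  "facets T = {F. F facet_of closure T}"

text \<open>
  The weights exist and are unique for every point of the space; they are affine functions of the
  point.
\<close>

definition barycentric :: "(real ^ 'n) set \<Rightarrow> real ^ 'n \<Rightarrow> real ^ 'n \<Rightarrow> real" where
  "barycentric T z x =
     (SOME c. sum c (vertices T) = 1 \<and> (\<Sum>y \<in> vertices T. c y *\<^sub>R y) = x) z"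

definition opposite_vertex :: "(real ^ 'n) set \<Rightarrow> (real ^ 'n) set \<Rightarrow> real ^ 'n" where
  "opposite_vertex T F = (THE z. z \<in> vertices T \<and> z \<notin> F)"

definition facet_bubble :: "(real ^ 'n) set \<Rightarrow> (real ^ 'n) set \<Rightarrow> real ^ 'n \<Rightarrow> real" where
  "facet_bubble T F x = (\<Prod>z \<in> vertices T - {opposite_vertex T F}. barycentric T z x)"

definition facet_bubble_eps ::
    "real \<Rightarrow> (real ^ 'n) set \<Rightarrow> (real ^ 'n) set \<Rightarrow> real ^ 'n \<Rightarrow> real" where
  "facet_bubble_eps \<epsilon> T F x =
     exp (- (diameter T / \<epsilon>) * barycentric T (opposite_vertex T F) x) * facet_bubble T F x"

definition element_bubble :: "(real ^ 'n) set \<Rightarrow> real ^ 'n \<Rightarrow> real" where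
  "element_bubble T x = (\<Prod>z \<in> vertices T. barycentric T z x)"

definition local_space :: "real \<Rightarrow> (real ^ 'n) set \<Rightarrow> (real ^ 'n \<Rightarrow> real) set" where
  "local_space \<epsilon> T =
     {\<lambda>x. p x
          + (\<Sum>F \<in> facets T. \<alpha> F *
               (if \<epsilon> < diameter T then facet_bubble_eps \<epsilon> T F x else facet_bubble T F x))
          + \<beta> * element_bubble T x | p \<alpha> \<beta>. p \<in> P1}"

definition discrete_space :: "real \<Rightarrow> (real ^ 'n) set set \<Rightarrow> (real ^ 'n \<Rightarrow> real) set" where
  "discrete_space \<epsilon> \<T> = {v. \<forall>T \<in> \<T>. \<exists>w \<in> local_space \<epsilon> T. \<forall>x \<in> T. v x = w x}"

definition Pi0 :: "(real ^ 'n) set \<Rightarrow> (real ^ 'n \<Rightarrow> real) \<Rightarrow> real ^ 'n \<Rightarrow> real" where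
  "Pi0 T v = (THE p. p \<in> P0 \<and> (\<forall>q \<in> P0. l2_inner T (\<lambda>x. v x - p x) q = 0))"

definition Pi0_vec :: "(real ^ 'n) set \<Rightarrow> (real ^ 'n \<Rightarrow> real ^ 'n) \<Rightarrow> real ^ 'n \<Rightarrow> real ^ 'n" where
  "Pi0_vec T v x = (\<chi> i. Pi0 T (\<lambda>y. v y $ i) x)"

text \<open>Determined up to sign; the definitions below do not depend on the sign.\<close>

definition unit_normal :: "(real ^ 'n) set \<Rightarrow> real ^ 'n" where
  "unit_normal F = (SOME n. norm n = 1 \<and> (\<forall>x \<in> F. \<forall>y \<in> F. n \<bullet> (x - y) = 0))"

text \<open>
  Surface measure on a flat facet: by Fubini, the surface measure of \<open>A \<subseteq> F\<close> is the volume of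
  the right prism of height one over \<open>A\<close>, so it is the image of the volume measure on the prism
  over \<open>F\<close> under the orthogonal projection onto the hyperplane of \<open>F\<close>.
\<close>

definition surface_measure :: "(real ^ 'n) set \<Rightarrow> (real ^ 'n) measure" where
  "surface_measure F =
     distr (lebesgue_on {x + t *\<^sub>R unit_normal F | x t. x \<in> F \<and> 0 \<le> t \<and> t \<le> 1})
           (restrict_space borel F) (closest_point (affine hull F))"

definition l2_norm_facet :: "(real ^ 'n) set \<Rightarrow> (real ^ 'n \<Rightarrow> 'b :: euclidean_space) \<Rightarrow> real" where
  "l2_norm_facet F w = sqrt (LINT x | surface_measure F. (norm (w x))\<^sup>2)"

text \<open>One-sided trace, for functions that extend continuously from \<open>T\<close> to its closure.\<close>

definition elem_trace ::
    "(real ^ 'n) set \<Rightarrow> (real ^ 'n \<Rightarrow> 'b :: euclidean_space) \<Rightarrow> real ^ 'n \<Rightarrow> 'b" where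
  "elem_trace T v x = Lim (at x within T) v"

text \<open>
  A facet of \<open>T\<close> is a facet of exactly one other element if it is interior and of none if it lies on
  the boundary, where the jump is thus the trace.
\<close>

definition jump :: "(real ^ 'n) set set \<Rightarrow> (real ^ 'n) set \<Rightarrow> (real ^ 'n) set \<Rightarrow>
    (real ^ 'n \<Rightarrow> 'b :: euclidean_space) \<Rightarrow> real ^ 'n \<Rightarrow> 'b" where
  "jump \<T> T F v x =
     elem_trace T v x - (\<Sum>T' \<in> {T' \<in> \<T>. T' \<noteq> T \<and> F \<in> facets T'}. elem_trace T' v x)"

text \<open>
  The tangential component \<open>w - (w \<bullet> n) *\<^sub>R n\<close>, which in two and three dimensions has the same
  length as the (scalar or vector) product of \<open>w\<close> and the unit normal \<open>n\<close>.
\<close>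

definition tangential :: "(real ^ 'n) set \<Rightarrow> real ^ 'n \<Rightarrow> real ^ 'n" where
  "tangential F w = w - (w \<bullet> unit_normal F) *\<^sub>R unit_normal F"

text \<open>
  Here \<open>v\<close> is a discrete function, smooth on each open element, so its gradient is the classical one.
\<close>

definition indicator_sq :: "(real ^ 'n) set set \<Rightarrow> real \<Rightarrow> (real ^ 'n \<Rightarrow> real) \<Rightarrow>
    (real ^ 'n \<Rightarrow> real) \<Rightarrow> (real ^ 'n) set \<Rightarrow> real" where
  "indicator_sq \<T> \<epsilon> f v T =
     (l2_norm T (\<lambda>x. (v x - f x) - Pi0 T (\<lambda>y. v y - f y) x))\<^sup>2
     + \<epsilon>\<^sup>2 * (l2_norm T (\<lambda>x. gradient v x - Pi0_vec T (gradient v) x))\<^sup>2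
     + \<epsilon> * (\<Sum>F \<in> facets T. (l2_norm_facet F (jump \<T> T F v))\<^sup>2)
     + \<epsilon>\<^sup>2 * diameter T *
         (\<Sum>F \<in> facets T. (l2_norm_facet F (\<lambda>x. tangential F (jump \<T> T F (gradient v) x)))\<^sup>2)"

end

theory Submission
  imports Defs
begin

text \<open>
  No trace of \<open>u\<close> is available, so the jump \<open>q\<close> of \<open>u\<^sub>h\<close> across a facet \<open>F\<close> is estimated by duality.
  Let \<open>\<tau>\<close> be a field in \<open>Hdiv\<close> supported on the elements that share \<open>F\<close>, with normal
  component \<open>r\<close> on \<open>F\<close> and zero on their other facets. Conformity of \<open>u\<close> turns the pairing of \<open>\<tau>\<close>
  with \<open>u\<^sub>h\<close> into both the integral of \<open>r * q\<close> over \<open>F\<close> and a volume integral of \<open>u - u\<^sub>h\<close> and its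
  broken gradient against \<open>div \<tau>\<close> and \<open>\<tau>\<close>.

  If \<open>\<epsilon>\<close> is smaller than the diameter of one of these elements, then \<open>r = q\<close> and \<open>\<tau>\<close> is cut off to a
  layer of width \<open>\<epsilon>\<close>. Otherwise \<open>\<tau>\<close> is divergence free; its normal component is then \<open>q\<close> minus a
  constant, which suffices because the conformity of \<open>u\<^sub>h\<close> with the lowest-order Raviart-Thomas fields
  makes the mean of \<open>q\<close> over \<open>F\<close> vanish. In both cases \<open>q\<close> lies in a space of
  fixed finite dimension (affine functions and one bubble), so its coefficients, and hence \<open>\<tau>\<close> and the
  tangential gradient jump, are controlled by the \<open>L2\<close> norm of \<open>q\<close>. The volume terms follow from the
  best approximation property of \<open>Pi0\<close>.
\<close>

subsection \<open>Continuously differentiable functions\<close>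

text \<open>Every integration by parts over an element is reduced to lines parallel to an edge. In
  the direction \<open>z1 - z0\<close> only the barycentric coordinates of \<open>z0\<close> and
  \<open>z1\<close> vary, so this edge vector is tangential to all facets except the two opposite
  \<open>z0\<close> and \<open>z1\<close>, and the factor \<open>bary z1\<close> vanishes on the
  second. Sums of such edge fields are therefore fluxes through a single facet, whatever their
  coefficients. The exponentials of the discrete space need no special treatment: on its own facet
  the exponential is 1 and the bubbles of the other facets vanish there, so the traces do not see
  \<epsilon>. The two regimes come from the weights. The jump carries \<epsilon>, the tangential
  jump \<epsilon>^2 h, which an inverse estimate turns into \<epsilon>^2 / h. A layer of width
  \<epsilon> balances a field against its divergence as long as it fits. For \<epsilon> above the
  diameters the weight \<epsilon>^2 / h dominates, and a divergence of natural size 1 / h would put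
  the factor (\<epsilon> / h)^2 in front of the error of \<open>u\<close>; hence the divergence-free
  fields.\<close>

definition C1_with_gradient :: "(real ^ 'n \<Rightarrow> real) \<Rightarrow> (real ^ 'n \<Rightarrow> real ^ 'n) \<Rightarrow> bool" where
  "C1_with_gradient f g \<longleftrightarrow>
     (\<forall>x. (f has_derivative (\<lambda>h. g x \<bullet> h)) (at x)) \<and> continuous_on UNIV g"

lemma C1_has_derivative: "C1_with_gradient f g \<Longrightarrow> (f has_derivative (\<lambda>h. g x \<bullet> h)) (at x within S)"
  unfolding C1_with_gradient_def using has_derivative_at_withinI by blast

lemma C1_continuous: "C1_with_gradient f g \<Longrightarrow> continuous_on S f"
  by (meson C1_has_derivative has_derivative_continuous continuous_at_imp_continuous_on)

lemma C1_continuous_gradient: "C1_with_gradient f g \<Longrightarrow> continuous_on S g"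
  unfolding C1_with_gradient_def using continuous_on_subset by blast

lemma gradient_eqI:
  assumes "(f has_derivative (\<lambda>h. g \<bullet> h)) (at x)"
  shows "gradient f x = g"
  using frechet_derivative_at[OF assms]
  by (auto simp: gradient_def partial_deriv_def vec_eq_iff inner_axis fun_eq_iff)
     (metis inner_axis inner_real_def mult.right_neutral)

lemma C1_withI:
  assumes "\<And>x. (f has_derivative f' x) (at x)" "\<And>x h. f' x h = g x \<bullet> h" "continuous_on UNIV g"
  shows "C1_with_gradient f g"
proof -
  have "f' x = (\<lambda>h. g x \<bullet> h)" for x using assms(2) by blast
  then show ?thesis using assms(1,3) unfolding C1_with_gradient_def by metis
qed

lemma C1_const: "C1_with_gradient (\<lambda>x. c) (\<lambda>x. 0)"
  by (simp add: C1_with_gradient_def)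

lemma C1_affine: "C1_with_gradient (\<lambda>x. c + a \<bullet> x) (\<lambda>x. a)"
  by (auto simp: C1_with_gradient_def intro!: derivative_eq_intros)

lemma C1_add:
  assumes "C1_with_gradient f f'" "C1_with_gradient g g'"
  shows "C1_with_gradient (\<lambda>x. f x + g x) (\<lambda>x. f' x + g' x)"
  by (rule C1_withI, rule has_derivative_add[OF C1_has_derivative[OF assms(1)] C1_has_derivative[OF assms(2)]])
     (auto simp: inner_add_left intro!: continuous_intros C1_continuous_gradient[OF assms(1)]
        C1_continuous_gradient[OF assms(2)])

lemma C1_mult:
  assumes "C1_with_gradient f f'" "C1_with_gradient g g'"
  shows "C1_with_gradient (\<lambda>x. f x * g x) (\<lambda>x. f x *\<^sub>R g' x + g x *\<^sub>R f' x)"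
  using assms C1_continuous[OF assms(1)] C1_continuous[OF assms(2)]
  unfolding C1_with_gradient_def
  by (auto simp: inner_add_left fun_eq_iff intro!: continuous_intros derivative_eq_intros)

lemma C1_cmult:
  assumes "C1_with_gradient f f'"
  shows "C1_with_gradient (\<lambda>x. c * f x) (\<lambda>x. c *\<^sub>R f' x)"
  using C1_mult[OF C1_const[of c] assms] by simp

lemma C1_sum:
  assumes "\<And>i. i \<in> I \<Longrightarrow> C1_with_gradient (f i) (f' i)"
  shows "C1_with_gradient (\<lambda>x. \<Sum>i\<in>I. f i x) (\<lambda>x. \<Sum>i\<in>I. f' i x)"
  by (rule C1_withI, rule has_derivative_sum[OF C1_has_derivative[OF assms]])
     (auto simp: inner_sum_left intro!: continuous_intros C1_continuous_gradient[OF assms])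

lemma C1_prod:
  assumes "finite I" "\<And>i. i \<in> I \<Longrightarrow> C1_with_gradient (f i) (f' i)"
  shows "C1_with_gradient (\<lambda>x. \<Prod>i\<in>I. f i x) (\<lambda>x. \<Sum>i\<in>I. (\<Prod>j\<in>I - {i}. f j x) *\<^sub>R f' i x)"
proof -
  have "continuous_on UNIV (f i)" if "i \<in> I" for i using C1_continuous assms that by blast
  then have "continuous_on UNIV (\<lambda>x. \<Sum>i\<in>I. (\<Prod>j\<in>I - {i}. f j x) *\<^sub>R f' i x)"
    using assms C1_continuous_gradient by (intro continuous_intros) blast+
  moreover have "((\<lambda>x. \<Prod>i\<in>I. f i x) has_derivative
      (\<lambda>h. (\<Sum>i\<in>I. (\<Prod>j\<in>I - {i}. f j x) *\<^sub>R f' i x) \<bullet> h)) (at x)" for x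
    using has_derivative_prod[of I f "\<lambda>i h. f' i x \<bullet> h" x UNIV] C1_has_derivative[OF assms(2)]
    by (simp add: inner_sum_left mult.commute)
  ultimately show ?thesis unfolding C1_with_gradient_def by blast
qed

lemma C1_compose:
  assumes "C1_with_gradient f f'" "\<And>t. (\<phi> has_real_derivative \<phi>' t) (at t)" "continuous_on UNIV \<phi>'"
  shows "C1_with_gradient (\<lambda>x. \<phi> (f x)) (\<lambda>x. \<phi>' (f x) *\<^sub>R f' x)"
proof -
  have "continuous_on UNIV (\<lambda>x. \<phi>' (f x))"
    by (rule continuous_on_compose2[OF assms(3) C1_continuous[OF assms(1)]]) auto
  then have "continuous_on UNIV (\<lambda>x. \<phi>' (f x) *\<^sub>R f' x)"
    using C1_continuous_gradient[OF assms(1)] by (intro continuous_intros)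
  moreover have "((\<lambda>x. \<phi> (f x)) has_derivative (\<lambda>h. (\<phi>' (f x) *\<^sub>R f' x) \<bullet> h)) (at x)" for x
    using has_derivative_compose[OF C1_has_derivative[OF assms(1)]
        assms(2)[of "f x", unfolded has_field_derivative_def]] by simp
  ultimately show ?thesis unfolding C1_with_gradient_def by blast
qed

lemma C1_along_line:
  assumes "C1_with_gradient f f'"
  shows "((\<lambda>t. f (x + t *\<^sub>R e)) has_real_derivative (f' (x + t *\<^sub>R e) \<bullet> e)) (at t)"
proof -
  have "((\<lambda>t. x + t *\<^sub>R e) has_derivative (\<lambda>s. s *\<^sub>R e)) (at t)"
    by (auto intro!: derivative_eq_intros)
  from has_derivative_compose[OF this C1_has_derivative[OF assms]]
  moreover have "(\<lambda>s. f' (x + t *\<^sub>R e) \<bullet> (s *\<^sub>R e)) = (*) (f' (x + t *\<^sub>R e) \<bullet> e)"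
    by (auto simp: fun_eq_iff)
  ultimately show ?thesis unfolding has_field_derivative_def by simp
qed

lemma C1_lipschitz_on_compact_convex:
  assumes "C1_with_gradient f f'" "compact S" "convex S"
  obtains L where "L \<ge> 0" "\<And>x y. x \<in> S \<Longrightarrow> y \<in> S \<Longrightarrow> \<bar>f x - f y\<bar> \<le> L * norm (x - y)"
proof -
  obtain B where B: "\<And>x. x \<in> S \<Longrightarrow> norm (f' x) \<le> B"
    using compact_imp_bounded[OF compact_continuous_image[OF C1_continuous_gradient[OF assms(1)] assms(2)]]
    by (auto simp: bounded_iff)
  \<comment> \<open>The maximum guards against an empty \<open>S\<close>, where \<open>B\<close> may
    be negative.\<close>
  have "\<bar>f x - f y\<bar> \<le> max 0 B * norm (x - y)" if "x \<in> S" "y \<in> S" for x y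
  proof -
    have "norm (f x - f y) \<le> max 0 B * norm (x - y)"
    proof (rule differentiable_bound[OF assms(3) C1_has_derivative[OF assms(1)] _ that])
      fix z assume "z \<in> S"
      have "norm (f' z \<bullet> h) \<le> max 0 B * norm h" for h
        using Cauchy_Schwarz_ineq2[of "f' z" h] B[OF \<open>z \<in> S\<close>]
        by (smt (verit) mult_right_mono norm_ge_zero real_norm_def)
      then show "onorm ((\<bullet>) (f' z)) \<le> max 0 B" by (intro onorm_bound) auto
    qed
    then show ?thesis by simp
  qed
  then show ?thesis using that[of "max 0 B"] by simp
qed

subsection \<open>Integrals of directional derivatives and shears\<close>

text \<open>The difference quotients along \<open>e\<close> have integral zero by translation
  invariance, and the Lipschitz bound dominates them, so the integral passes to the limit. The
  derivative is required only almost everywhere, which allows kinks of \<open>G\<close> across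
  hyperplanes.\<close>

lemma integral_directional_derivative_eq_0:
  fixes G D :: "'a::euclidean_space \<Rightarrow> real"
  assumes G: "G \<in> borel_measurable borel" and D: "D \<in> borel_measurable borel"
    and bnd: "\<And>x. \<bar>G x\<bar> \<le> B" and supp: "\<And>x. R < norm x \<Longrightarrow> G x = 0"
    and lip: "\<And>x t. 0 \<le> t \<Longrightarrow> t \<le> 1 \<Longrightarrow> \<bar>G (x + t *\<^sub>R e) - G x\<bar> \<le> L * t"
    and deriv: "AE x in lborel. ((\<lambda>t. G (x + t *\<^sub>R e)) has_real_derivative D x) (at 0)"
  shows "integrable lborel D" "integral\<^sup>L lborel D = 0"
proof -
  define h where "h k = inverse (real (Suc k))" for k
  have h: "0 < h k" "h k \<le> 1" for k by (auto simp: h_def field_simps)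
  define s where "s k x = (G (x + h k *\<^sub>R e) - G x) / h k" for k x
  note [measurable] = G D
  have [measurable]: "s k \<in> borel_measurable borel" for k unfolding s_def by measurable
  \<comment> \<open>The shifts have length at most \<open>norm e\<close>, so all difference
    quotients vanish outside this ball.\<close>
  define w where "w x = L * indicat_real (cball 0 (R + norm e)) x" for x :: 'a
  have L0: "L \<ge> 0" using lip[of 1 0] by simp
  have "integrable lborel (\<lambda>x::'a. indicat_real (cball 0 (R + norm e)) x)"
    by (rule integrable_real_indicator) (use emeasure_bounded_finite[OF bounded_cball] in \<open>auto simp: top.not_eq_extremum\<close>)
  then have w: "integrable lborel w" unfolding w_def by simp
  have intG: "integrable lborel G"
  proof (rule Bochner_Integration.integrable_bound)
    have "integrable lborel (\<lambda>x::'a. indicat_real (cball 0 R) x)"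
      by (rule integrable_real_indicator) (use emeasure_bounded_finite[OF bounded_cball] in \<open>auto simp: top.not_eq_extremum\<close>)
    then show "integrable lborel (\<lambda>x::'a. B * indicat_real (cball 0 R) x)" by simp
    show "AE x in lborel. norm (G x) \<le> norm (B * indicat_real (cball 0 R) x)"
    proof (rule AE_I2)
      fix x
      show "norm (G x) \<le> norm (B * indicat_real (cball 0 R) x)"
        using bnd[of x] supp[of x] by (cases "norm x \<le> R") (auto simp: indicator_def)
    qed
  qed simp
  have shift: "integrable lborel (\<lambda>x. G (x + v))" "integral\<^sup>L lborel (\<lambda>x. G (x + v)) = integral\<^sup>L lborel G" for v
  proof -
    have "integrable (distr lborel borel ((+) v)) G" using intG by (simp add: lborel_distr_plus)
    then show "integrable lborel (\<lambda>x. G (x + v))"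
      by (subst (asm) integrable_distr_eq) (auto simp: add.commute)
    have "integral\<^sup>L (distr lborel borel ((+) v)) G = integral\<^sup>L lborel (\<lambda>x. G (v + x))"
      by (rule integral_distr) auto
    then show "integral\<^sup>L lborel (\<lambda>x. G (x + v)) = integral\<^sup>L lborel G"
      by (simp add: lborel_distr_plus add.commute)
  qed
  have s0: "integral\<^sup>L lborel (s k) = 0" for k
    unfolding s_def using shift[of "h k *\<^sub>R e"] intG by simp
  have lim: "AE x in lborel. (\<lambda>k. s k x) \<longlonglongrightarrow> D x"
    using deriv
  proof eventually_elim
    case (elim x)
    have "filterlim h (at 0) sequentially"
      unfolding h_def filterlim_at using LIMSEQ_inverse_real_of_nat by auto
    from filterlim_compose[OF elim[unfolded has_field_derivative_iff] this]
    show ?case unfolding s_def by simp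
  qed
  have dom: "AE x in lborel. norm (s k x) \<le> w x" for k
  proof (rule AE_I2)
    fix x
    show "norm (s k x) \<le> w x"
    proof (cases "norm x \<le> R + norm e")
      case True
      then show ?thesis using lip[of "h k" x] h[of k] by (simp add: s_def w_def field_simps)
    next
      case False
      have "norm (h k *\<^sub>R e) \<le> norm e" using h[of k] by (simp add: mult_left_le_one_le)
      moreover have "norm (x + h k *\<^sub>R e) \<ge> norm x - norm (h k *\<^sub>R e)"
        using norm_triangle_ineq4[of "x + h k *\<^sub>R e" "h k *\<^sub>R e"] by simp
      ultimately have "R < norm (x + h k *\<^sub>R e)" using False by linarith
      moreover have "R < norm x" using False norm_ge_zero[of e] by linarith
      ultimately show ?thesis using supp by (simp add: s_def w_def False L0)
    qed
  qed
  show "integrable lborel D"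
    by (rule integrable_dominated_convergence[OF _ _ w lim dom]) auto
  have "(\<lambda>k. integral\<^sup>L lborel (s k)) \<longlonglongrightarrow> integral\<^sup>L lborel D"
    by (rule integral_dominated_convergence[OF _ _ w lim dom]) auto
  then show "integral\<^sup>L lborel D = 0" using s0 by (simp add: LIMSEQ_const_iff)
qed

section \<open>Change of variables under shears\<close>

lemma det_rank_one_update:
  fixes n w :: "real ^ 'n"
  assumes "norm n = 1"
  shows "det (matrix (\<lambda>x. x + (n \<bullet> x) *\<^sub>R w)) = 1 + n \<bullet> w"
proof -
  fix k :: 'n
  \<comment> \<open>An orthogonal map taking \<open>n\<close> to a coordinate vector conjugates the
    given map to one whose matrix differs from the identity in a single column; Cramer's rule
    evaluates its determinant.\<close>
  have "norm (axis k (1::real) :: real ^ 'n) = 1" by simp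
  with assms obtain f where f: "orthogonal_transformation f" "f n = axis k (1::real)"
    using orthogonal_transformation_exists_1 by metis
  have linf: "linear f" using f(1) orthogonal_transformation_linear by blast
  let ?A = "\<lambda>x. x + (n \<bullet> x) *\<^sub>R w" and ?B = "\<lambda>y. y + (y $ k) *\<^sub>R f w"
  have linA: "linear ?A" by (auto simp: linear_iff algebra_simps inner_add_right)
  have linB: "linear ?B" by (auto simp: linear_iff algebra_simps)
  have nk: "n \<bullet> x = f x $ k" for x
  proof -
    have "n \<bullet> x = f n \<bullet> f x" using f(1) by (simp add: orthogonal_transformation_def)
    then show ?thesis by (simp add: f(2) inner_axis')
  qed
  have "f \<circ> ?A = ?B \<circ> f"
    using linf by (auto simp: fun_eq_iff nk linear_add linear_cmul)
  then have "matrix f ** matrix ?A = matrix ?B ** matrix f"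
    by (simp only: matrix_compose[OF linA linf, symmetric] matrix_compose[OF linf linB, symmetric])
  then have "det (matrix f) * det (matrix ?A) = det (matrix ?B) * det (matrix f)"
    by (simp only: det_mul[symmetric])
  moreover have "det (matrix f) \<noteq> 0"
    using orthogonal_transformation_inj[OF f(1)] det_nz_iff_inj[OF linf] by blast
  ultimately have "det (matrix ?A) = det (matrix ?B)" by (simp add: mult.commute)
  also have "matrix ?B = (\<chi> i j. if j = k then (mat 1 *v (axis k 1 + f w)) $ i else mat 1 $ i $ j)"
    unfolding matrix_vector_mul_lid by (auto simp: matrix_def vec_eq_iff mat_def axis_def)
  also have "det \<dots> = (axis k 1 + f w) $ k * det (mat 1 :: real^'n^'n)" by (rule cramer_lemma)
  also have "\<dots> = 1 + n \<bullet> w" by (simp add: nk axis_def)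
  finally show ?thesis .
qed

lemma prod_Basis_cart:
  fixes f :: "real ^ 'n \<Rightarrow> 'a::comm_monoid_mult"
  shows "prod f Basis = (\<Prod>i\<in>UNIV. f (axis i 1))"
proof -
  have "(Basis :: (real ^ 'n) set) = range (\<lambda>i. axis i 1)"
    by (auto simp: Basis_vec_def)
  moreover have "inj (\<lambda>i. axis i 1 :: real ^ 'n)"
    by (simp add: axis_eq_axis inj_on_def)
  ultimately show ?thesis
    using prod.reindex[of "\<lambda>i. axis i 1 :: real ^ 'n" UNIV f] by (simp only: o_def)
qed

text \<open>Boxes pull back to boxes with permuted corners, so renaming coordinates preserves
  volume. This moves volume formulas between index types of equal size.\<close>

lemma lborel_distr_reindex:
  fixes \<sigma> :: "'m::finite \<Rightarrow> 'n::finite"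
  assumes \<sigma>: "bij \<sigma>"
  shows "distr lborel borel (\<lambda>x::real ^ 'n. (\<chi> j. x $ \<sigma> j) :: real ^ 'm) = lborel"
proof (rule lborel_eqI[symmetric])
  let ?R = "\<lambda>x::real ^ 'n. (\<chi> j. x $ \<sigma> j) :: real ^ 'm"
  have [measurable]: "?R \<in> borel \<rightarrow>\<^sub>M borel"
    by (intro borel_measurable_continuous_onI continuous_intros)
  fix l u :: "real ^ 'm"
  assume le: "\<And>b. b \<in> Basis \<Longrightarrow> l \<bullet> b \<le> u \<bullet> b"
  have le': "l $ j \<le> u $ j" for j
    using le[of "axis j 1"] by (simp add: inner_axis)
  define l' u' :: "real ^ 'n" where "l' = (\<chi> i. l $ inv \<sigma> i)" and "u' = (\<chi> i. u $ inv \<sigma> i)"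
  have vim: "?R -` box l u = box l' u'"
  proof -
    have "(\<forall>j. l $ j < x $ \<sigma> j \<and> x $ \<sigma> j < u $ j) \<longleftrightarrow> (\<forall>i. l $ inv \<sigma> i < x $ i \<and> x $ i < u $ inv \<sigma> i)" for x :: "real ^ 'n"
    proof -
      have "inv \<sigma> (\<sigma> j) = j" "\<sigma> (inv \<sigma> i) = i" for i j
        using \<sigma> by (simp_all add: bij_is_inj bij_is_surj surj_f_inv_f)
      then show ?thesis by metis
    qed
    then show ?thesis by (auto simp: mem_box_cart l'_def u'_def)
  qed
  have "emeasure (distr lborel borel ?R) (box l u) = emeasure lborel (box l' u')"
    by (subst emeasure_distr) (auto simp: vim)
  also have "\<dots> = (\<Prod>b\<in>Basis. (u' - l') \<bullet> b)"
    using le' by (subst emeasure_lborel_box) (auto simp: Basis_vec_def inner_axis l'_def u'_def)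
  also have "(\<Prod>b\<in>Basis. (u' - l') \<bullet> b) = (\<Prod>i\<in>UNIV. u $ inv \<sigma> i - l $ inv \<sigma> i)"
    by (simp add: prod_Basis_cart inner_axis l'_def u'_def)
  also have "\<dots> = (\<Prod>j\<in>UNIV. u $ j - l $ j)"
    using prod.reindex[of "inv \<sigma>" UNIV "\<lambda>j. u $ j - l $ j"] \<sigma>
    by (simp add: bij_imp_bij_inv bij_is_inj bij_is_surj o_def)
  also have "\<dots> = (\<Prod>b\<in>Basis. (u - l) \<bullet> b)"
    by (simp add: prod_Basis_cart inner_axis)
  finally show "emeasure (distr lborel borel ?R) (box l u) = (\<Prod>b\<in>Basis. (u - l) \<bullet> b)" .
qed simp

text \<open>The Sherman-Morrison formula for a rank-one perturbation of the identity, together with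
  the determinant of the inverse.\<close>

lemma shear_inverse:
  fixes n w :: "'a::real_inner"
  assumes "norm n = 1" "1 + n \<bullet> w \<noteq> 0"
  defines "v \<equiv> (- 1 / (1 + n \<bullet> w)) *\<^sub>R w"
  shows "(x + (n \<bullet> x) *\<^sub>R w) + (n \<bullet> (x + (n \<bullet> x) *\<^sub>R w)) *\<^sub>R v = x"
    and "(x + (n \<bullet> x) *\<^sub>R v) + (n \<bullet> (x + (n \<bullet> x) *\<^sub>R v)) *\<^sub>R w = x"
    and "1 + n \<bullet> v = 1 / (1 + n \<bullet> w)"
proof -
  show v: "1 + n \<bullet> v = 1 / (1 + n \<bullet> w)" using assms(2) by (simp add: v_def field_simps)
  define c where "c = - 1 / (1 + n \<bullet> w)"
  have vc: "v = c *\<^sub>R w" by (simp add: v_def c_def)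
  have c: "c + c * (n \<bullet> w) = - 1" using assms(2) by (simp add: c_def field_simps)
  have "(x + (n \<bullet> x) *\<^sub>R w) + (n \<bullet> (x + (n \<bullet> x) *\<^sub>R w)) *\<^sub>R v
      = x + ((n \<bullet> x) * (1 + (c + c * (n \<bullet> w)))) *\<^sub>R w"
    by (simp add: vc inner_add_right algebra_simps)
  then show "(x + (n \<bullet> x) *\<^sub>R w) + (n \<bullet> (x + (n \<bullet> x) *\<^sub>R w)) *\<^sub>R v = x"
    unfolding c by simp
  have "(x + (n \<bullet> x) *\<^sub>R v) + (n \<bullet> (x + (n \<bullet> x) *\<^sub>R v)) *\<^sub>R w
      = x + ((n \<bullet> x) * (1 + (c + c * (n \<bullet> w)))) *\<^sub>R w"
    by (simp add: vc inner_add_right algebra_simps)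
  then show "(x + (n \<bullet> x) *\<^sub>R v) + (n \<bullet> (x + (n \<bullet> x) *\<^sub>R v)) *\<^sub>R w = x"
    unfolding c by simp
qed

text \<open>The preimage of a box under the shear is its image under the inverse shear, whose volume
  the determinant gives. The sort is the one of \<open>measure_linear_image\<close>; the next two
  lemmas pass to \<open>'n\<close>.\<close>

lemma lborel_shear_wellorder:
  fixes n w :: "real ^ 'm::{finite,wellorder}"
  assumes n: "norm n = 1" and nz: "1 + n \<bullet> w \<noteq> 0"
  shows "lborel = density (distr lborel borel (\<lambda>x. x + (n \<bullet> x) *\<^sub>R w)) (\<lambda>_. \<bar>1 + n \<bullet> w\<bar>)"
proof (rule lborel_eqI)
  let ?A = "\<lambda>x. x + (n \<bullet> x) *\<^sub>R w"
  define v where "v = (- 1 / (1 + n \<bullet> w)) *\<^sub>R w"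
  note inv = shear_inverse[OF n nz, folded v_def]
  let ?B = "\<lambda>x. x + (n \<bullet> x) *\<^sub>R v"
  have linB: "linear ?B" by (auto simp: linear_iff algebra_simps inner_add_right)
  have [measurable]: "?A \<in> borel \<rightarrow>\<^sub>M borel"
    by (intro borel_measurable_continuous_onI continuous_intros)
  fix l u :: "real ^ 'm::_"
  assume le: "\<And>b. b \<in> Basis \<Longrightarrow> l \<bullet> b \<le> u \<bullet> b"
  have vim: "?A -` box l u = ?B ` box l u"
  proof (intro set_eqI iffI)
    fix x assume "x \<in> ?A -` box l u"
    then show "x \<in> ?B ` box l u" using inv(1)[of x] by (intro image_eqI[where x = "?A x"]) auto
  next
    fix x assume "x \<in> ?B ` box l u"
    then obtain y where y: "y \<in> box l u" "x = ?B y" by blast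
    then have "?A x = y" by (simp only: inv(2))
    then show "x \<in> ?A -` box l u" using y(1) by simp
  qed
  have lm: "box l u \<in> lmeasurable" by simp
  have "emeasure (distr lborel borel ?A) (box l u) = emeasure lborel (?B ` box l u)"
    by (subst emeasure_distr) (auto simp: vim)
  also have "\<dots> = emeasure lebesgue (?B ` box l u)"
  proof -
    have "?A -` box l u \<in> sets borel" by (rule measurable_sets_borel[of ?A borel]) auto
    then show ?thesis by (simp add: vim)
  qed
  also have "\<dots> = ennreal (measure lebesgue (?B ` box l u))"
    by (intro emeasure_eq_measure2 measurable_linear_image linB lm)
  also have "measure lebesgue (?B ` box l u) = \<bar>1 + n \<bullet> v\<bar> * measure lebesgue (box l u)"
    using measure_linear_image[OF linB lm] det_rank_one_update[OF n] by simp
  finally have e: "emeasure (distr lborel borel ?A) (box l u) = ennreal (\<bar>1 + n \<bullet> v\<bar> * measure lborel (box l u))"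
    by simp
  have "emeasure (density (distr lborel borel ?A) (\<lambda>_. \<bar>1 + n \<bullet> w\<bar>)) (box l u)
     = ennreal \<bar>1 + n \<bullet> w\<bar> * ennreal (\<bar>1 + n \<bullet> v\<bar> * measure lborel (box l u))"
    by (simp add: emeasure_density_const e)
  also have "\<dots> = ennreal (measure lborel (box l u))"
  proof -
    have "\<bar>1 + n \<bullet> w\<bar> * \<bar>1 + n \<bullet> v\<bar> = 1" using inv(3) nz by (simp add: abs_mult[symmetric])
    then show ?thesis by (simp add: ennreal_mult'[symmetric] mult.assoc[symmetric])
  qed
  finally show "emeasure (density (distr lborel borel ?A) (\<lambda>_. \<bar>1 + n \<bullet> w\<bar>)) (box l u) = (\<Prod>b\<in>Basis. (u - l) \<bullet> b)"
    using le by (simp add: measure_lborel_box_eq)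
qed simp

text \<open>Renaming coordinates is an isometry, so it conjugates a shear to a shear with the same
  value of \<open>n \<bullet> w\<close>.\<close>

lemma lborel_shear_reindex:
  fixes n w :: "real ^ 'n" and \<sigma> :: "'m::{finite,wellorder} \<Rightarrow> 'n"
  assumes \<sigma>: "bij \<sigma>" and n: "norm n = 1" and nz: "1 + n \<bullet> w \<noteq> 0"
  shows "lborel = density (distr lborel borel (\<lambda>x. x + (n \<bullet> x) *\<^sub>R w)) (\<lambda>_. \<bar>1 + n \<bullet> w\<bar>)"
proof -
  define R where "R x = (\<chi> j. x $ \<sigma> j)" for x :: "real ^ 'n"
  define R' where "R' y = (\<chi> i. y $ inv \<sigma> i)" for y :: "real ^ 'm::_"
  have inv: "inv \<sigma> (\<sigma> j) = j" "\<sigma> (inv \<sigma> i) = i" for i j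
    using \<sigma> by (simp_all add: bij_is_inj bij_is_surj surj_f_inv_f)
  have RR: "R' (R x) = x" for x by (simp add: R_def R'_def inv)
  have R_inner: "R x \<bullet> R y = x \<bullet> y" for x y
    unfolding inner_vec_def R_def
    using sum.reindex_bij_betw[OF \<sigma>, of "\<lambda>i. x $ i \<bullet> y $ i"] by simp
  have [measurable]: "R \<in> borel \<rightarrow>\<^sub>M borel"
    unfolding R_def[abs_def] by (intro borel_measurable_continuous_onI continuous_intros)
  have [measurable]: "R' \<in> borel \<rightarrow>\<^sub>M borel"
    unfolding R'_def[abs_def] by (intro borel_measurable_continuous_onI continuous_intros)
  let ?A = "\<lambda>x. x + (n \<bullet> x) *\<^sub>R w" and ?A' = "\<lambda>y. y + (R n \<bullet> y) *\<^sub>R R w"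
  have [measurable]: "?A \<in> borel \<rightarrow>\<^sub>M borel" "?A' \<in> borel \<rightarrow>\<^sub>M borel"
    by (intro borel_measurable_continuous_onI continuous_intros)+
  have R'A: "R' (?A' (R x)) = ?A x" for x
    unfolding R_inner by (simp add: R_def R'_def vec_eq_iff inv)
  have dR: "distr lborel borel R = lborel" unfolding R_def[abs_def] by (rule lborel_distr_reindex[OF \<sigma>])
  have dR': "distr lborel borel R' = lborel"
    unfolding R'_def[abs_def] by (rule lborel_distr_reindex) (simp add: \<sigma> bij_imp_bij_inv)
  have "norm (R n) = 1" using n R_inner by (simp add: norm_eq_1)
  then have sh: "lborel = density (distr lborel borel ?A') (\<lambda>_. \<bar>1 + n \<bullet> w\<bar>)"
    using lborel_shear_wellorder[of "R n" "R w"] nz by (simp add: R_inner)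
  have "lborel = distr (density (distr lborel borel ?A') (\<lambda>_. \<bar>1 + n \<bullet> w\<bar>)) borel R'"
    using dR' sh by simp
  also have "\<dots> = density (distr (distr lborel borel ?A') borel R') (\<lambda>_. \<bar>1 + n \<bullet> w\<bar>)"
  proof (rule measure_eqI)
    fix B :: "(real ^ 'n) set"
    assume "B \<in> sets (distr (density (distr lborel borel ?A') (\<lambda>_. \<bar>1 + n \<bullet> w\<bar>)) borel R')"
    then have B[measurable]: "B \<in> sets borel" by simp
    have [measurable]: "R' -` B \<in> sets borel" by (rule measurable_sets_borel[of R' borel]) auto
    show "emeasure (distr (density (distr lborel borel ?A') (\<lambda>_. \<bar>1 + n \<bullet> w\<bar>)) borel R') B
       = emeasure (density (distr (distr lborel borel ?A') borel R') (\<lambda>_. \<bar>1 + n \<bullet> w\<bar>)) B"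
      by (simp add: emeasure_distr emeasure_density_const)
  qed simp
  also have "distr (distr lborel borel ?A') borel R' = distr (distr (distr lborel borel R) borel ?A') borel R'"
    by (simp add: dR)
  also have "\<dots> = distr lborel borel ?A"
    by (simp add: distr_distr o_def R'A)
  finally show ?thesis .
qed

lemma lborel_shear:
  fixes n w :: "real ^ 'n"
  assumes dim: "CARD('n) = 2 \<or> CARD('n) = 3" and n: "norm n = 1" and nz: "1 + n \<bullet> w \<noteq> 0"
  shows "lborel = density (distr lborel borel (\<lambda>x. x + (n \<bullet> x) *\<^sub>R w)) (\<lambda>_. \<bar>1 + n \<bullet> w\<bar>)"
  using dim
proof
  assume "CARD('n) = 2"
  then have "card (UNIV :: 2 set) = CARD('n)" by simp
  then obtain \<sigma> :: "2 \<Rightarrow> 'n" where "bij \<sigma>"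
    using finite_same_card_bij[of "UNIV :: 2 set" "UNIV :: 'n set"] by auto
  then show ?thesis using lborel_shear_reindex n nz by blast
next
  assume "CARD('n) = 3"
  then have "card (UNIV :: 3 set) = CARD('n)" by simp
  then obtain \<sigma> :: "3 \<Rightarrow> 'n" where "bij \<sigma>"
    using finite_same_card_bij[of "UNIV :: 3 set" "UNIV :: 'n set"] by auto
  then show ?thesis using lborel_shear_reindex n nz by blast
qed

text \<open>The shear fixes the hyperplane through \<open>a\<close> orthogonal to \<open>n\<close>.
  It serves to straighten an oblique prism over a facet and to stretch a right one.\<close>

lemma integral_shear:
  fixes n w a :: "real ^ 'n" and f :: "real ^ 'n \<Rightarrow> real"
  assumes dim: "CARD('n) = 2 \<or> CARD('n) = 3" and n: "norm n = 1" and nz: "1 + n \<bullet> w \<noteq> 0"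
    and f: "f \<in> borel_measurable borel"
  shows "(\<integral>x. f x \<partial>lborel) = \<bar>1 + n \<bullet> w\<bar> * (\<integral>x. f (x + (n \<bullet> (x - a)) *\<^sub>R w) \<partial>lborel)"
proof -
  note [measurable] = f
  let ?A = "\<lambda>x. x + (n \<bullet> x) *\<^sub>R w"
  have [measurable]: "?A \<in> borel \<rightarrow>\<^sub>M borel"
    by (intro borel_measurable_continuous_onI continuous_intros)
  define g where "g x = f (x - (n \<bullet> a) *\<^sub>R w)" for x
  have [measurable]: "g \<in> borel_measurable borel" unfolding g_def by measurable
  have "(\<integral>x. f x \<partial>lborel) = (\<integral>x. f x \<partial>distr lborel borel ((+) (- (n \<bullet> a) *\<^sub>R w)))"
    by (simp only: lborel_distr_plus)
  also have "\<dots> = (\<integral>x. f (- (n \<bullet> a) *\<^sub>R w + x) \<partial>lborel)"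
    by (rule integral_distr) auto
  also have "\<dots> = (\<integral>x. g x \<partial>lborel)" by (simp add: g_def)
  also have "\<dots> = (\<integral>x. g x \<partial>density (distr lborel borel ?A) (\<lambda>_. \<bar>1 + n \<bullet> w\<bar>))"
    using lborel_shear[OF dim n nz] by simp
  also have "\<dots> = \<bar>1 + n \<bullet> w\<bar> * (\<integral>x. g x \<partial>distr lborel borel ?A)"
    by (subst integral_density) auto
  also have "(\<integral>x. g x \<partial>distr lborel borel ?A) = (\<integral>x. g (?A x) \<partial>lborel)"
    by (rule integral_distr) auto
  also have "(\<lambda>x. g (?A x)) = (\<lambda>x. f (x + (n \<bullet> (x - a)) *\<^sub>R w))"
    by (simp add: g_def inner_diff_right algebra_simps)
  finally show ?thesis .
qed

lemma integrable_bounded_on: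
  fixes f :: "'a::euclidean_space \<Rightarrow> 'b::euclidean_space"
  assumes "S \<in> lmeasurable" "f \<in> borel_measurable (lebesgue_on S)" "\<And>x. x \<in> S \<Longrightarrow> norm (f x) \<le> B"
  shows "integrable (lebesgue_on S) f"
proof -
  interpret finite_measure "lebesgue_on S"
    using assms(1) by (rule finite_measure_lebesgue_on)
  show ?thesis using assms by (intro integrable_const_bound[where B = B]) auto
qed

lemma integral_lebesgue_on_borel:
  fixes f :: "'a::euclidean_space \<Rightarrow> real"
  assumes f: "f \<in> borel_measurable borel" and S: "S \<in> sets borel"
  shows "(LINT x|lebesgue_on S. f x) = (\<integral>x. indicator S x * f x \<partial>lborel)"
proof -
  have "(LINT x|lebesgue_on S. f x) = (LINT x|lebesgue. indicator S x *\<^sub>R f x)"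
    using S by (subst integral_restrict_space) (auto simp: set_lebesgue_integral_def)
  also have "\<dots> = (\<integral>x. indicator S x * f x \<partial>lborel)"
    using f S by (subst integral_completion) auto
  finally show ?thesis .
qed

subsection \<open>Simplices and barycentric coordinates\<close>

text \<open>The dimension enters through the shears and through the explicit bubble fields. Mesh
  elements instantiate \<open>C\<close> by \<open>vertices T\<close>.\<close>

locale simplex_element =
  fixes T C :: "(real ^ 'n) set"
  assumes aff_ind: "\<not> affine_dependent C"
    and card_C: "card C = Suc (CARD('n))"
    and T_eq: "T = interior (convex hull C)"
    and dim: "CARD('n) = 2 \<or> CARD('n) = 3"
begin

abbreviation bary :: "real ^ 'n \<Rightarrow> real ^ 'n \<Rightarrow> real" where "bary \<equiv> barycentric T"

abbreviation facet :: "real ^ 'n \<Rightarrow> (real ^ 'n) set" where "facet z \<equiv> convex hull (C - {z})"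

text \<open>Barycentric coordinates are affine on the whole space, so the gradient can be read off
  from the values at the origin and at the unit vectors.\<close>

definition bary_grad :: "real ^ 'n \<Rightarrow> real ^ 'n" where
  "bary_grad z = (\<chi> i. bary z (axis i 1) - bary z 0)"

text \<open>The coordinate falls from 1 at \<open>z\<close> to 0 on the opposite facet, so this is
  the distance of \<open>z\<close> from the hyperplane of that facet.\<close>

definition height :: "real ^ 'n \<Rightarrow> real" where "height z = 1 / norm (bary_grad z)"

lemma fin: "finite C" using aff_ind aff_independent_finite by blast

lemma C_nonempty: "C \<noteq> {}" using card_C by auto

lemma T_mem: "x \<in> T \<longleftrightarrow> (\<exists>u. (\<forall>x \<in> C. 0 < u x) \<and> sum u C = 1 \<and> (\<Sum>x\<in>C. u x *\<^sub>R x) = x)"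
  using interior_convex_hull_explicit_minimal[OF aff_ind] card_C by (subst T_eq) simp

lemma T_nonempty: "T \<noteq> {}"
proof -
  have "\<exists>u :: real ^ 'n \<Rightarrow> real. (\<forall>x \<in> C. 0 < u x) \<and> sum u C = 1"
    by (rule exI[of _ "\<lambda>_. 1 / real (card C)"]) (use fin C_nonempty in \<open>auto simp: card_gt_0_iff\<close>)
  then show ?thesis using T_mem by blast
qed

lemma closure_T: "closure T = convex hull C"
  using T_nonempty fin convex_closure_interior[of "convex hull C"]
  by (simp add: T_eq compact_imp_closed finite_imp_compact_convex_hull)

lemma vertices_eq: "vertices T = C"
  unfolding vertices_def closure_T using extreme_point_of_convex_hull_affine_independent[OF aff_ind] by simp

lemma affine_hull_C: "affine hull C = UNIV"
  using affine_independent_span_eq[OF aff_ind] card_C by simp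

text \<open>\<open>barycentric\<close> selects some weights; affine independence leaves no freedom,
  so any weights with the right sum and combination agree with it.\<close>

lemma bary_unique:
  assumes "sum c C = 1" "(\<Sum>z\<in>C. c z *\<^sub>R z) = x" "z \<in> C"
  shows "bary z x = c z"
proof -
  let ?P = "\<lambda>c. sum c (vertices T) = 1 \<and> (\<Sum>y \<in> vertices T. c y *\<^sub>R y) = x"
  have "?P c" using assms by (simp add: vertices_eq)
  then have P: "?P (Eps ?P)" by (rule someI[of ?P])
  let ?U = "\<lambda>y. Eps ?P y - c y"
  have "sum ?U C = 0" "(\<Sum>y\<in>C. ?U y *\<^sub>R y) = 0"
    using P assms by (auto simp: vertices_eq sum_subtractf algebra_simps)
  then have "?U z = 0" using aff_ind assms(3) unfolding affine_dependent_explicit_finite[OF fin] by blast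
  then show ?thesis by (simp add: barycentric_def)
qed

lemma bary_ex: "\<exists>c. sum c C = 1 \<and> (\<Sum>z\<in>C. c z *\<^sub>R z) = x"
  using affine_hull_C unfolding affine_hull_finite[OF fin] by blast

lemma bary_sum: "(\<Sum>z\<in>C. bary z x) = 1" and bary_comb: "(\<Sum>z\<in>C. bary z x *\<^sub>R z) = x"
proof -
  obtain c where c: "sum c C = 1" "(\<Sum>z\<in>C. c z *\<^sub>R z) = x" using bary_ex by blast
  have "bary z x = c z" if "z \<in> C" for z using bary_unique c that by blast
  then show "(\<Sum>z\<in>C. bary z x) = 1" "(\<Sum>z\<in>C. bary z x *\<^sub>R z) = x" using c by auto
qed

lemma bary_vertex: "z \<in> C \<Longrightarrow> a \<in> C \<Longrightarrow> bary z a = (if z = a then 1 else 0)"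
  by (rule bary_unique) (use fin in \<open>auto simp: if_distrib[of "\<lambda>c. c *\<^sub>R _"] sum.delta cong: if_cong\<close>)

lemma bary_add: assumes "z \<in> C" shows "bary z (x + y) = bary z x + bary z y - bary z 0"
proof -
  have "bary z (x + y) = (\<lambda>z. bary z x + bary z y - bary z 0) z"
  proof (rule bary_unique[OF _ _ assms])
    show "(\<Sum>z\<in>C. bary z x + bary z y - bary z 0) = 1"
      by (simp add: sum.distrib sum_subtractf bary_sum)
    show "(\<Sum>z\<in>C. (bary z x + bary z y - bary z 0) *\<^sub>R z) = x + y"
      by (simp add: sum.distrib sum_subtractf bary_comb scaleR_add_left scaleR_diff_left)
  qed
  then show ?thesis .
qed

lemma bary_scale: assumes "z \<in> C" shows "bary z (r *\<^sub>R x) = r * bary z x + (1 - r) * bary z 0"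
proof -
  have "bary z (r *\<^sub>R x) = (\<lambda>z. r * bary z x + (1 - r) * bary z 0) z"
  proof (rule bary_unique[OF _ _ assms])
    show "(\<Sum>z\<in>C. r * bary z x + (1 - r) * bary z 0) = 1"
      by (simp add: sum.distrib bary_sum flip: sum_distrib_left)
    show "(\<Sum>z\<in>C. (r * bary z x + (1 - r) * bary z 0) *\<^sub>R z) = r *\<^sub>R x"
      by (simp add: sum.distrib bary_comb scaleR_add_left flip: scaleR_scaleR scaleR_sum_right)
  qed
  then show ?thesis .
qed

lemma bary_affine: assumes z: "z \<in> C" shows "bary z (x + h) = bary z x + bary_grad z \<bullet> h"
proof -
  define L where "L h = bary z h - bary z 0" for h
  have "linear L" unfolding L_def
    by (rule linearI) (simp_all add: bary_add[OF z] bary_scale[OF z] algebra_simps)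
  then have l: "linear L" .
  have "L h = (\<Sum>i\<in>UNIV. h $ i * L (axis i 1))"
  proof -
    have "L h = L (\<Sum>i\<in>UNIV. h $ i *\<^sub>R axis i 1)"
      using basis_expansion[of h] by (simp add: scalar_mult_eq_scaleR)
    then show ?thesis by (simp add: linear_sum[OF l] linear_cmul[OF l])
  qed
  then have "L h = bary_grad z \<bullet> h"
    by (simp add: bary_grad_def inner_vec_def L_def mult.commute)
  then show ?thesis by (simp add: L_def bary_add[OF z])
qed

lemma bary_affine0: assumes z: "z \<in> C" shows "bary z x = bary z 0 + bary_grad z \<bullet> x"
  using bary_affine[OF z, of 0 x] by simp

lemma bary_line: "z \<in> C \<Longrightarrow> bary z (x + t *\<^sub>R h) = bary z x + t * (bary_grad z \<bullet> h)"
  by (simp add: bary_affine)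

lemma C1_bary: "z \<in> C \<Longrightarrow> C1_with_gradient (bary z) (\<lambda>x. bary_grad z)"
proof -
  assume z: "z \<in> C"
  have "(\<lambda>x. bary z 0 + bary_grad z \<bullet> x) = bary z"
    by (rule ext, rule bary_affine0[OF z, symmetric])
  then show ?thesis using C1_affine[of "bary z 0" "bary_grad z"] by (simp only:)
qed

lemma bary_grad_diff: assumes "z \<in> C" "a \<in> C" "b \<in> C"
  shows "bary_grad z \<bullet> (a - b) = (if z = a then 1 else 0) - (if z = b then 1 else 0)"
  using bary_affine[OF assms(1), of b "a - b"] assms by (simp add: bary_vertex)

lemma bary_grad_inner_diff: "z \<in> C \<Longrightarrow> bary_grad z \<bullet> (x - y) = bary z x - bary z y"
  using bary_affine[of z y "x - y"] by simp

lemma C_other: assumes "z \<in> C" obtains a where "a \<in> C" "a \<noteq> z"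
proof -
  have "card (C - {z}) > 0" using assms card_C fin by simp
  then show ?thesis using that by (auto simp: card_gt_0_iff)
qed

lemma bary_grad_nz: assumes "z \<in> C" shows "bary_grad z \<noteq> 0"
proof -
  obtain a where "a \<in> C" "a \<noteq> z" using C_other assms by blast
  then have "bary_grad z \<bullet> (a - z) = -1" using bary_grad_diff[of z a z] assms by auto
  then show ?thesis by auto
qed

lemma height_pos: "z \<in> C \<Longrightarrow> 0 < height z" by (simp add: height_def bary_grad_nz)

lemma T_bary: "T = {x. \<forall>z\<in>C. 0 < bary z x}"
proof -
  have "x \<in> T \<longleftrightarrow> (\<forall>z\<in>C. 0 < bary z x)" for x
  proof
    assume "x \<in> T"
    then obtain u where u: "\<forall>x \<in> C. 0 < u x" "sum u C = 1" "(\<Sum>x\<in>C. u x *\<^sub>R x) = x"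
      unfolding T_mem by blast
    then show "\<forall>z\<in>C. 0 < bary z x" using bary_unique[OF u(2,3)] by auto
  next
    assume "\<forall>z\<in>C. 0 < bary z x"
    then have "(\<forall>z \<in> C. 0 < bary z x) \<and> (\<Sum>z\<in>C. bary z x) = 1 \<and> (\<Sum>z\<in>C. bary z x *\<^sub>R z) = x"
      using bary_sum bary_comb by blast
    then show "x \<in> T" unfolding T_mem by (intro exI[of _ "\<lambda>z. bary z x"])
  qed
  then show ?thesis by blast
qed

lemma hull_bary: "convex hull C = {x. \<forall>z\<in>C. 0 \<le> bary z x}"
proof -
  have "x \<in> convex hull C \<longleftrightarrow> (\<forall>z\<in>C. 0 \<le> bary z x)" for x
  proof
    assume "x \<in> convex hull C"
    then obtain u where u: "\<forall>x \<in> C. 0 \<le> u x" "sum u C = 1" "(\<Sum>x\<in>C. u x *\<^sub>R x) = x"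
      unfolding convex_hull_finite[OF fin] by blast
    then show "\<forall>z\<in>C. 0 \<le> bary z x" using bary_unique[OF u(2,3)] by auto
  next
    assume "\<forall>z\<in>C. 0 \<le> bary z x"
    then have "(\<forall>z \<in> C. 0 \<le> bary z x) \<and> (\<Sum>z\<in>C. bary z x) = 1 \<and> (\<Sum>z\<in>C. bary z x *\<^sub>R z) = x"
      using bary_sum bary_comb by blast
    then show "x \<in> convex hull C" unfolding convex_hull_finite[OF fin] mem_Collect_eq
      by (intro exI[of _ "\<lambda>z. bary z x"])
  qed
  then show ?thesis by blast
qed

lemma facet_comb:
  assumes z0: "z0 \<in> C" and "sum u (C - {z0}) = 1" "(\<Sum>z\<in>C - {z0}. u z *\<^sub>R z) = x"
  shows "bary z0 x = 0" "\<And>z. z \<in> C - {z0} \<Longrightarrow> bary z x = u z"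
proof -
  let ?c = "u(z0 := 0)"
  have "sum ?c C = 1" "(\<Sum>z\<in>C. ?c z *\<^sub>R z) = x"
  proof -
    have "sum ?c (C - {z0}) = sum u (C - {z0})" "(\<Sum>z\<in>C - {z0}. ?c z *\<^sub>R z) = (\<Sum>z\<in>C - {z0}. u z *\<^sub>R z)"
      by (auto intro: sum.cong)
    then show "sum ?c C = 1" "(\<Sum>z\<in>C. ?c z *\<^sub>R z) = x"
      using assms by (simp_all add: sum.remove[OF fin z0])
  qed
  then have c: "bary z x = ?c z" if "z \<in> C" for z using bary_unique[of ?c x z] that by blast
  show "bary z0 x = 0" using c[OF z0] by simp
  show "\<And>z. z \<in> C - {z0} \<Longrightarrow> bary z x = u z" using c by auto
qed

lemma facet_bary: assumes z0: "z0 \<in> C"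
  shows "facet z0 = {x. bary z0 x = 0 \<and> (\<forall>z\<in>C. 0 \<le> bary z x)}"
proof -
  have "x \<in> facet z0 \<longleftrightarrow> bary z0 x = 0 \<and> (\<forall>z\<in>C. 0 \<le> bary z x)" for x
  proof
    assume "x \<in> facet z0"
    then obtain u where u: "\<forall>x \<in> C - {z0}. 0 \<le> u x" "sum u (C - {z0}) = 1" "(\<Sum>x\<in>C - {z0}. u x *\<^sub>R x) = x"
      using convex_hull_finite[of "C - {z0}"] fin by auto
    have "0 \<le> bary z x" if "z \<in> C" for z
      using facet_comb[OF z0 u(2,3)] u(1) that by (cases "z = z0") auto
    then show "bary z0 x = 0 \<and> (\<forall>z\<in>C. 0 \<le> bary z x)"
      using facet_comb(1)[OF z0 u(2,3)] by blast
  next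
    assume a: "bary z0 x = 0 \<and> (\<forall>z\<in>C. 0 \<le> bary z x)"
    have "(\<Sum>z\<in>C - {z0}. bary z x) = 1" "(\<Sum>z\<in>C - {z0}. bary z x *\<^sub>R z) = x"
      using bary_sum[of x] bary_comb[of x] a
        sum.remove[OF fin z0, of "\<lambda>z. bary z x"] sum.remove[OF fin z0, of "\<lambda>z. bary z x *\<^sub>R z"] by simp_all
    moreover have "finite (C - {z0})" using fin by simp
    ultimately show "x \<in> facet z0"
      unfolding convex_hull_finite[OF \<open>finite (C - {z0})\<close>] mem_Collect_eq
      using a by (intro exI[of _ "\<lambda>z. bary z x"]) auto
  qed
  then show ?thesis by blast
qed

lemma affine_hull_facet: assumes z0: "z0 \<in> C"
  shows "affine hull (facet z0) = {x. bary z0 x = 0}"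
proof -
  have f: "finite (C - {z0})" using fin by simp
  have "x \<in> affine hull (C - {z0}) \<longleftrightarrow> bary z0 x = 0" for x
  proof
    assume "x \<in> affine hull (C - {z0})"
    then show "bary z0 x = 0" unfolding affine_hull_finite[OF f] using facet_comb[OF z0] by blast
  next
    assume a: "bary z0 x = 0"
    have "(\<Sum>z\<in>C - {z0}. bary z x) = 1" "(\<Sum>z\<in>C - {z0}. bary z x *\<^sub>R z) = x"
      using bary_sum[of x] bary_comb[of x] a
        sum.remove[OF fin z0, of "\<lambda>z. bary z x"] sum.remove[OF fin z0, of "\<lambda>z. bary z x *\<^sub>R z"] by simp_all
    then show "x \<in> affine hull (C - {z0})" unfolding affine_hull_finite[OF f] mem_Collect_eq
      by (intro exI[of _ "\<lambda>z. bary z x"]) auto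
  qed
  then show ?thesis by (auto simp: affine_hull_convex_hull)
qed

lemma facets_eq: "facets T = {facet z | z. z \<in> C}"
proof -
  have "facet z \<noteq> {}" if "z \<in> C" for z using C_other[OF that] by auto
  then show ?thesis
    unfolding facets_def closure_T using facet_of_convex_hull_affine_independent[OF aff_ind] by blast
qed

lemma vertex_in_facet_iff: "z \<in> C \<Longrightarrow> a \<in> C \<Longrightarrow> a \<in> facet z \<longleftrightarrow> a \<noteq> z"
  by (auto simp: facet_bary bary_vertex)

lemma facet_inj: "z \<in> C \<Longrightarrow> a \<in> C \<Longrightarrow> facet z = facet a \<longleftrightarrow> z = a"
  using vertex_in_facet_iff[of z a] vertex_in_facet_iff[of a a] by auto

lemma opposite_vertex_eq: assumes "z \<in> C" shows "opposite_vertex T (facet z) = z"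
  unfolding opposite_vertex_def vertices_eq
  using assms vertex_in_facet_iff by (intro the_equality) auto

lemma open_T: "open T" by (simp add: T_eq)

lemma bounded_T: "bounded T"
proof -
  have "bounded (convex hull C)" using fin by (simp add: bounded_convex_hull finite_imp_bounded)
  then show ?thesis unfolding T_eq by (rule bounded_interior)
qed

lemma T_lmeasurable: "T \<in> lmeasurable" using open_T bounded_T by (simp add: lmeasurable_open)

lemma T_borel: "T \<in> sets borel" using open_T by simp

lemma T_subset_hull: "T \<subseteq> convex hull C" by (simp add: T_eq interior_subset)

lemma bary_le_1: assumes "x \<in> convex hull C" "z \<in> C" shows "bary z x \<le> 1"
proof -
  have "bary z x \<le> (\<Sum>z\<in>C. bary z x)"
    using assms fin by (intro member_le_sum) (auto simp: hull_bary)
  then show ?thesis by (simp add: bary_sum)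
qed

lemma diameter_pos: "0 < diameter T"
proof -
  have "measure lebesgue T > 0 \<or> True" by simp
  obtain x where x: "x \<in> T" using T_nonempty by blast
  then obtain e where e: "e > 0" "cball x e \<subseteq> T" using open_T by (meson open_contains_cball)
  fix i :: 'n
  have "x + e *\<^sub>R axis i 1 \<in> T" using e by (intro subsetD[OF e(2)]) (simp add: dist_norm)
  then have "dist (x + e *\<^sub>R axis i 1) x \<le> diameter T"
    using x bounded_T by (intro diameter_bounded_bound)
  then show ?thesis using e by (simp add: dist_norm)
qed

lemma norm_diff_hull_le_diameter:
  assumes "x \<in> convex hull C" "y \<in> convex hull C" shows "norm (x - y) \<le> diameter T"
proof -
  have "dist x y \<le> diameter (closure T)"
    using assms bounded_closure[OF bounded_T] by (intro diameter_bounded_bound) (simp_all only: closure_T)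
  then show ?thesis using diameter_closure[OF bounded_T] by (simp only: dist_norm)
qed

lemma C_hull: "z \<in> C \<Longrightarrow> z \<in> convex hull C" by (simp add: hull_inc)

lemma bary_continuous: "z \<in> C \<Longrightarrow> continuous_on S (bary z)"
  by (rule C1_continuous[OF C1_bary])

lemma bary_borel: "z \<in> C \<Longrightarrow> bary z \<in> borel_measurable borel"
  by (rule borel_measurable_continuous_onI[OF bary_continuous])

lemma negligible_bary_level: "z \<in> C \<Longrightarrow> negligible {x. bary z x = c}"
proof -
  assume z: "z \<in> C"
  have "{x. bary z x = c} = {x. bary_grad z \<bullet> x = c - bary z 0}"
  proof (rule Collect_cong)
    fix x show "(bary z x = c) = (bary_grad z \<bullet> x = c - bary z 0)"
      using bary_affine0[OF z, of x] by linarith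
  qed
  then show ?thesis using negligible_hyperplane[of "bary_grad z" "c - bary z 0"] bary_grad_nz[OF z] by simp
qed

text \<open>Subtracting the multiple of \<open>bary_grad z0\<close> that matches \<open>v\<close> on
  the edges at \<open>z0\<close> leaves a vector with the same inner product with all vertices,
  hence with all points, among them 0. So that vector vanishes.\<close>

lemma inner_orthogonal_facet:
  assumes z0: "z0 \<in> C" and orth: "\<And>x y. x \<in> facet z0 \<Longrightarrow> y \<in> facet z0 \<Longrightarrow> v \<bullet> (x - y) = 0"
  obtains c where "v = c *\<^sub>R bary_grad z0"
proof -
  obtain a where a: "a \<in> C" "a \<noteq> z0" using C_other z0 by blast
  define c where "c = - (v \<bullet> (a - z0))"
  have av: "v \<bullet> (z - z0) = - c" if "z \<in> C" "z \<noteq> z0" for z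
  proof -
    have "v \<bullet> (z - a) = 0" using orth a that by (simp add: hull_inc)
    then show ?thesis by (simp add: c_def inner_diff_right)
  qed
  let ?w = "v - c *\<^sub>R bary_grad z0"
  have "?w \<bullet> (z - z0) = 0" if "z \<in> C" for z
    using av[OF that] bary_grad_diff[OF z0 that z0] by (cases "z = z0") (auto simp: inner_diff_left)
  then have wz: "?w \<bullet> z = ?w \<bullet> z0" if "z \<in> C" for z using that by (simp add: inner_diff_right)
  have "?w \<bullet> x = ?w \<bullet> z0" for x
  proof -
    have "?w \<bullet> x = ?w \<bullet> (\<Sum>z\<in>C. bary z x *\<^sub>R z)" by (simp add: bary_comb)
    also have "\<dots> = (\<Sum>z\<in>C. bary z x * (?w \<bullet> z0))" using wz by (simp add: inner_sum_right)
    also have "\<dots> = ?w \<bullet> z0" by (simp add: bary_sum flip: sum_distrib_right)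
    finally show ?thesis .
  qed
  then have "?w \<bullet> ?w = ?w \<bullet> 0" by metis
  then have "?w = 0" by simp
  then show ?thesis using that[of c] by simp
qed

text \<open>\<open>unit_normal\<close> is a choice with undetermined sign, so only the modulus of
  its factor relative to \<open>bary_grad z0\<close> is fixed.\<close>

lemma unit_normal_facet:
  assumes z0: "z0 \<in> C"
  shows "norm (unit_normal (facet z0)) = 1"
    "\<exists>c. unit_normal (facet z0) = c *\<^sub>R bary_grad z0 \<and> \<bar>c\<bar> = height z0"
proof -
  let ?P = "\<lambda>n. norm n = 1 \<and> (\<forall>x \<in> facet z0. \<forall>y \<in> facet z0. n \<bullet> (x - y) = 0)"
  have "?P (bary_grad z0 /\<^sub>R norm (bary_grad z0))"
    using bary_grad_nz[OF z0] bary_grad_inner_diff[OF z0] facet_bary[OF z0] by auto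
  then have P: "?P (unit_normal (facet z0))" unfolding unit_normal_def by (rule someI[of ?P])
  then show "norm (unit_normal (facet z0)) = 1" by blast
  obtain c where c: "unit_normal (facet z0) = c *\<^sub>R bary_grad z0"
    using inner_orthogonal_facet[OF z0, of "unit_normal (facet z0)"] P by blast
  then have "\<bar>c\<bar> * norm (bary_grad z0) = 1" using P by (metis norm_scaleR)
  then have "\<bar>c\<bar> = height z0" using bary_grad_nz[OF z0] by (simp add: height_def field_simps)
  with c show "\<exists>c. unit_normal (facet z0) = c *\<^sub>R bary_grad z0 \<and> \<bar>c\<bar> = height z0" by blast
qed

end

section \<open>Integration by parts along an edge\<close>

context simplex_element
begin

text \<open>The set swept by the facet opposite \<open>z0\<close> under translation by
  \<open>t *\<^sub>R (z1 - z0)\<close> for t from 0 to 1: the translation lowers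
  \<open>bary z0\<close> by t, raises \<open>bary z1\<close> by t and keeps the other
  coordinates.\<close>

definition oblique_prism :: "real ^ 'n \<Rightarrow> real ^ 'n \<Rightarrow> (real ^ 'n) set" where
  "oblique_prism z0 z1 = {x. (\<forall>z\<in>C - {z0, z1}. 0 \<le> bary z x) \<and> 0 \<le> bary z0 x + bary z1 x
     \<and> - 1 \<le> bary z0 x \<and> bary z0 x \<le> 0}"

lemma bary_edge:
  assumes "z0 \<in> C" "z1 \<in> C" "z1 \<noteq> z0" "z \<in> C"
  shows "bary z (x + t *\<^sub>R (z1 - z0)) = bary z x + t * ((if z = z1 then 1 else 0) - (if z = z0 then 1 else 0))"
  by (simp add: bary_line bary_grad_diff assms)

lemma closed_bary_ge: "z \<in> C \<Longrightarrow> closed {x. c \<le> bary z x}"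
  by (intro closed_Collect_le continuous_on_const bary_continuous)

text \<open>The left integrand is the derivative of \<open>bary z1 * k\<close> along
  \<open>e\<close>. A line in this direction leaves \<open>T\<close> through the facets opposite
  \<open>z0\<close> and \<open>z1\<close>, and \<open>bary z1\<close> is zero on the second, so only
  the first contributes. Its contribution still has the form of a volume integral, over the oblique
  prism.\<close>

lemma edge_derivative_integral:
  assumes z0: "z0 \<in> C" and z1: "z1 \<in> C" and ne: "z1 \<noteq> z0" and k: "C1_with_gradient k k'"
  defines "e \<equiv> z1 - z0"
  shows "(\<integral>x. indicator T x * (k x + bary z1 x * (k' x \<bullet> e)) \<partial>lborel) =
    (\<integral>x. indicator (oblique_prism z0 z1) x *
        (bary z1 (x + bary z0 x *\<^sub>R e) * k (x + bary z0 x *\<^sub>R e)) \<partial>lborel)"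
    and "integrable lborel (\<lambda>x. indicator T x * (k x + bary z1 x * (k' x \<bullet> e)))"
proof -
  define b0 b1 where "b0 = bary z0" and "b1 = bary z1"
  define Q where "Q = {x. (\<forall>z\<in>C - {z0, z1}. 0 \<le> bary z x) \<and> 0 \<le> b0 x + b1 x}"
  define m where "m x = max 0 (1 - max 0 (- b0 x))" for x
  define q where "q x = max 0 (min (b1 x) (b0 x + b1 x))" for x
  define X where "X x = x + (q x - b1 x) *\<^sub>R e" for x
  \<comment> \<open>On \<open>T\<close> this is \<open>bary z1 * k\<close>. Beyond the facet it keeps its value on the facet along the direction
    \<open>e\<close>, times a factor that decays linearly to zero. The integral of its derivative along \<open>e\<close>
    vanishes, and the decay yields the surface term.\<close>
  define G where "G x = indicator Q x * (m x * q x * k (X x))" for x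
  have e0: "b0 (x + t *\<^sub>R e) = b0 x - t" and e1: "b1 (x + t *\<^sub>R e) = b1 x + t" for x t
    unfolding b0_def b1_def e_def using ne by (simp_all add: bary_edge[OF z0 z1 ne] z0 z1)
  have ez: "bary z (x + t *\<^sub>R e) = bary z x" if "z \<in> C - {z0, z1}" for z x t
    unfolding e_def using that by (simp add: bary_edge[OF z0 z1 ne])
  have Qline: "x + t *\<^sub>R e \<in> Q \<longleftrightarrow> x \<in> Q" for x t
    unfolding Q_def using ez e0 e1 by auto
  have [continuous_intros]: "continuous_on S b0" "continuous_on S b1" for S
    unfolding b0_def b1_def using bary_continuous z0 z1 by auto
  have [measurable]: "b0 \<in> borel_measurable borel" "b1 \<in> borel_measurable borel"
    unfolding b0_def b1_def using bary_borel z0 z1 by auto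
  have "Q = (\<Inter>z\<in>C - {z0, z1}. {x. 0 \<le> bary z x}) \<inter> {x. 0 \<le> b0 x + b1 x}"
    unfolding Q_def by auto
  moreover have "closed \<dots>"
    by (intro closed_Int closed_INT ballI closed_bary_ge closed_Collect_le continuous_intros) auto
  ultimately have Qc: "closed Q" by simp
  then have [measurable]: "Q \<in> sets borel" by simp
  have "oblique_prism z0 z1 = Q \<inter> {x. - 1 \<le> bary z0 x} \<inter> {x. b0 x \<le> 0}"
    unfolding Q_def oblique_prism_def by (auto simp: b0_def b1_def)
  moreover have "closed \<dots>"
    by (intro closed_Int Qc closed_bary_ge closed_Collect_le continuous_intros z0)
  ultimately have [measurable]: "oblique_prism z0 z1 \<in> sets borel" by simp
  have [measurable]: "k \<in> borel_measurable borel" "k' \<in> borel_measurable borel" "T \<in> sets borel"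
    using C1_continuous[OF k] C1_continuous_gradient[OF k] T_borel
    by (auto intro: borel_measurable_continuous_onI)
  have Xmeas[measurable]: "X \<in> borel_measurable borel"
    unfolding X_def q_def by measurable
  have Gmeas: "G \<in> borel_measurable borel"
    unfolding G_def m_def q_def by measurable
  define D where "D x = indicator T x * (k x + b1 x * (k' x \<bullet> e)) -
      indicator (oblique_prism z0 z1) x * (b1 (x + b0 x *\<^sub>R e) * k (x + b0 x *\<^sub>R e))" for x
  have Dmeas: "D \<in> borel_measurable borel" unfolding D_def by measurable
  have cH: "compact (convex hull C)" and vH: "convex (convex hull C)"
    using fin by (simp_all add: finite_imp_compact_convex_hull)
  obtain L0 where L0: "L0 \<ge> 0" "\<And>x y. x \<in> convex hull C \<Longrightarrow> y \<in> convex hull C \<Longrightarrow> \<bar>k x - k y\<bar> \<le> L0 * norm (x - y)"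
    using C1_lipschitz_on_compact_convex[OF k cH vH] by blast
  obtain K where K: "\<And>x. x \<in> convex hull C \<Longrightarrow> norm (k x) \<le> K"
    using compact_imp_bounded[OF compact_continuous_image[OF C1_continuous[OF k] cH]] by (auto simp: bounded_iff)
  obtain R where R: "\<And>x. x \<in> convex hull C \<Longrightarrow> norm x \<le> R"
    using compact_imp_bounded[OF cH] by (auto simp: bounded_iff)
  \<comment> \<open>The clamped point stays in the closed simplex, so bounds for \<open>k\<close>
    there suffice although \<open>G\<close> is defined through an unbounded cylinder.\<close>
  have XH: "X x \<in> convex hull C" if "x \<in> Q" for x
    unfolding hull_bary mem_Collect_eq
  proof
    fix z assume z: "z \<in> C"
    consider "z = z0" | "z = z1" | "z \<in> C - {z0, z1}" using z by blast
    then show "0 \<le> bary z (X x)"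
    proof cases
      case 1 then show ?thesis using e0[of x "q x - b1 x"] that by (auto simp: X_def b0_def[symmetric] q_def Q_def)
    next
      case 2 then show ?thesis using e1[of x "q x - b1 x"] by (auto simp: X_def b1_def[symmetric] q_def)
    next
      case 3 then show ?thesis using ez[OF 3, of x "q x - b1 x"] that by (auto simp: X_def Q_def)
    qed
  qed
  have Kx: "\<bar>k (X x)\<bar> \<le> K" if "x \<in> Q" for x using K[OF XH[OF that]] by simp
  have qX: "b1 (X x) = q x" for x using e1[of x "q x - b1 x"] by (simp add: X_def)
  have q1: "0 \<le> q x" "q x \<le> 1" if "x \<in> Q" for x
    using bary_le_1[OF XH[OF that] z1] qX[of x] by (auto simp: q_def b1_def)
  have m1: "0 \<le> m x" "m x \<le> 1" for x by (auto simp: m_def)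
  have K0: "0 \<le> K" using K[OF C_hull[OF z0]] norm_ge_zero order_trans by blast
  have bnd: "\<bar>G x\<bar> \<le> K" for x
  proof (cases "x \<in> Q")
    case True
    have "\<bar>m x * q x\<bar> \<le> 1" using m1[of x] q1[OF True] by (simp add: abs_mult mult_le_one)
    then have "\<bar>m x * q x\<bar> * \<bar>k (X x)\<bar> \<le> 1 * K" using Kx[OF True] by (intro mult_mono) auto
    then show ?thesis using True by (simp add: G_def abs_mult)
  qed (simp add: G_def K0)
  have supp: "G x = 0" if "R + norm e < norm x" for x
  proof (rule ccontr)
    assume "G x \<noteq> 0"
    then have x: "x \<in> Q" "m x \<noteq> 0" "q x \<noteq> 0" by (auto simp: G_def indicator_def split: if_splits)
    then have "\<bar>q x - b1 x\<bar> \<le> 1" by (auto simp: m_def q_def Q_def max_def min_def split: if_splits)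
    then have "norm ((q x - b1 x) *\<^sub>R e) \<le> norm e" by (simp add: mult_left_le_one_le)
    moreover have "norm (X x) \<le> R" using R XH x by blast
    moreover have "norm x \<le> norm (X x) + norm ((q x - b1 x) *\<^sub>R e)"
      using norm_triangle_ineq4[of "X x" "(q x - b1 x) *\<^sub>R e"] by (simp add: X_def)
    ultimately show False using that by linarith
  qed
  have lip: "\<bar>G (x + t *\<^sub>R e) - G x\<bar> \<le> (2 * K + L0 * norm e) * t" if t: "0 \<le> t" "t \<le> 1" for x t
  proof (cases "x \<in> Q")
    case True
    define y where "y = x + t *\<^sub>R e"
    have y: "y \<in> Q" using True Qline y_def by blast
    have b: "b0 y = b0 x - t" "b1 y = b1 x + t" using e0 e1 y_def by auto
    have dm: "\<bar>m y - m x\<bar> \<le> t" using t by (auto simp: m_def b max_def)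
    have dq: "\<bar>q y - q x\<bar> \<le> t" using t by (auto simp: q_def b max_def min_def)
    have "X y - X x = (q y - q x) *\<^sub>R e" 
      unfolding X_def b(2) by (simp add: y_def algebra_simps)
    then have "\<bar>k (X y) - k (X x)\<bar> \<le> L0 * (\<bar>q y - q x\<bar> * norm e)"
      using L0(2)[OF XH[OF y] XH[OF True]] by simp
    also have "\<dots> \<le> L0 * (t * norm e)" using dq L0(1) by (intro mult_left_mono mult_right_mono) auto
    finally have dk: "\<bar>k (X y) - k (X x)\<bar> \<le> L0 * (t * norm e)" .
    have "G y - G x = (m y - m x) * q y * k (X y) + m x * (q y - q x) * k (X y) + m x * q x * (k (X y) - k (X x))"
      using True y by (simp add: G_def algebra_simps)
    also have "\<bar>\<dots>\<bar> \<le> \<bar>(m y - m x) * q y * k (X y)\<bar> + \<bar>m x * (q y - q x) * k (X y)\<bar> + \<bar>m x * q x * (k (X y) - k (X x))\<bar>"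
      by linarith
    also have "\<dots> \<le> t * 1 * K + 1 * t * K + 1 * 1 * (L0 * (t * norm e))"
      unfolding abs_mult using dm dq dk m1[of x] q1[OF y] q1[OF True] Kx[OF y] t K0
      by (intro add_mono mult_mono) (auto intro: mult_nonneg_nonneg)
    finally show ?thesis by (simp add: y_def algebra_simps)
  next
    case False
    then show ?thesis using Qline[of x t] t K0 L0(1) by (simp add: G_def)
  qed
  \<comment> \<open>Along lines in direction \<open>e\<close>, the factors \<open>m\<close> and
    \<open>q\<close> can have kinks only on these hyperplanes.\<close>
  have neg: "negligible ((\<Union>z\<in>C. {x. bary z x = 0}) \<union> {x. bary z0 x = -1})"
    using negligible_bary_level z0 fin by (intro negligible_Un negligible_Union) auto
  have "AE x in lborel. x \<notin> (\<Union>z\<in>C. {x. bary z x = 0}) \<union> {x. bary z0 x = -1}"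
  proof -
    have "closed ((\<Union>z\<in>C. {x. bary z x = 0}) \<union> {x. bary z0 x = -1})"
      using fin z0 by (intro closed_Un closed_UN ballI closed_Collect_eq bary_continuous continuous_intros) auto
    then have "(\<Union>z\<in>C. {x. bary z x = 0}) \<union> {x. bary z0 x = -1} \<in> null_sets lborel"
      using neg by (simp add: negligible_iff_null_sets null_sets_completion_iff)
    then show ?thesis by (rule AE_not_in)
  qed
  then have deriv: "AE x in lborel. ((\<lambda>t. G (x + t *\<^sub>R e)) has_real_derivative D x) (at 0)"
  proof eventually_elim
    case (elim x)
    have nz: "bary z x \<noteq> 0" if "z \<in> C" for z using elim that by blast
    have b0nz: "b0 x \<noteq> 0" and b1nz: "b1 x \<noteq> 0" and b0m: "b0 x \<noteq> -1" using nz z0 z1 elim by (auto simp: b0_def b1_def)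
    have Tpos: "0 < bary z x" if "x \<in> T" "z \<in> C" for z
      using that by (subst (asm) T_bary) blast
    have TQ: "x \<in> Q" if "x \<in> T"
      using Tpos[OF that, THEN less_imp_le] z0 z1 by (simp add: Q_def b0_def b1_def)
    have PQ: "x \<in> oblique_prism z0 z1 \<longleftrightarrow> x \<in> Q \<and> - 1 \<le> b0 x \<and> b0 x \<le> 0"
      by (auto simp: oblique_prism_def Q_def b0_def b1_def)
    have zero: ?case if "D x = 0" "d > 0" "\<And>t. \<bar>t\<bar> < d \<Longrightarrow> G (x + t *\<^sub>R e) = 0" for d
    proof -
      have "eventually (\<lambda>t. G (x + t *\<^sub>R e) = (\<lambda>t. 0) t) (nhds (0::real))"
        unfolding eventually_nhds_metric using that by (auto simp: dist_real_def)
      then have "((\<lambda>t. G (x + t *\<^sub>R e)) has_real_derivative 0) (at 0)"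
        by (subst DERIV_cong_ev[OF refl _ refl]) auto
      then show ?thesis using that by simp
    qed
    show ?case
    proof (cases "x \<in> Q")
      case False
      then have "x \<notin> T" "x \<notin> oblique_prism z0 z1" using TQ PQ by auto
      then show ?thesis using False Qline by (intro zero[of 1]) (auto simp: D_def G_def)
    next
      case xQ: True
      \<comment> \<open>In this order: the edge of the cylinder, where \<open>q\<close> vanishes
        along the whole line; the far side of the facet opposite \<open>z1\<close>; the open
        simplex; the far side of the facet opposite \<open>z0\<close>, where the decay takes
        place.\<close>
      consider "b0 x + b1 x = 0" | "b0 x + b1 x > 0" "b1 x < 0" | "b1 x > 0" "b0 x > 0" | "b0 x + b1 x > 0" "b0 x < 0"
        using xQ b0nz b1nz by (auto simp: Q_def) linarith
      then show ?thesis
      proof cases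
        case 1
        have "b1 (x + b0 x *\<^sub>R e) = 0" using e1[of x "b0 x"] 1 by simp
        moreover have "x \<notin> T" using 1 z0 z1 Tpos[OF _ z0] Tpos[OF _ z1] unfolding b0_def b1_def by force
        moreover have "q (x + t *\<^sub>R e) = 0" for t using e0[of x t] e1[of x t] 1 by (simp add: q_def)
        ultimately show ?thesis by (intro zero[of 1]) (auto simp: D_def G_def)
      next
        case 2
        have "x \<notin> T" using 2 Tpos[OF _ z1] unfolding b1_def by force
        moreover have "x \<notin> oblique_prism z0 z1" using 2 PQ by auto
        moreover have "q (x + t *\<^sub>R e) = 0" if "\<bar>t\<bar> < - b1 x" for t
          using e1[of x t] that by (auto simp: q_def)
        ultimately show ?thesis using 2 by (intro zero[of "- b1 x"]) (auto simp: D_def G_def)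
      next
        case 3
        have xT: "x \<in> T"
        proof -
          have "0 < bary z x" if "z \<in> C" for z
            using nz[OF that] 3 xQ that by (cases "z = z0 \<or> z = z1") (force simp: b0_def b1_def Q_def)+
          then show ?thesis by (subst T_bary) blast
        qed
        have xP: "x \<notin> oblique_prism z0 z1" using 3 PQ by auto
        define d where "d = min (b0 x) (b1 x)"
        have "G (x + t *\<^sub>R e) = (b1 x + t) * k (x + t *\<^sub>R e)" if "\<bar>t\<bar> < d" for t
        proof -
          have "m (x + t *\<^sub>R e) = 1" "q (x + t *\<^sub>R e) = b1 x + t"
            using that e0[of x t] e1[of x t] by (auto simp: m_def q_def d_def)
          then show ?thesis using xQ Qline[of x t] e1[of x t] by (simp add: G_def X_def)
        qed
        then have ev: "eventually (\<lambda>t. G (x + t *\<^sub>R e) = (b1 x + t) * k (x + t *\<^sub>R e)) (nhds (0::real))"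
          unfolding eventually_nhds_metric using 3 by (intro exI[of _ d]) (auto simp: d_def dist_real_def)
        have "((\<lambda>t. (b1 x + t) * k (x + t *\<^sub>R e)) has_real_derivative (k x + b1 x * (k' x \<bullet> e))) (at 0)"
          using C1_along_line[OF k, of x e 0]
          by (auto intro!: derivative_eq_intros)
        then show ?thesis using ev xT xP
          by (subst DERIV_cong_ev[OF refl ev refl]) (simp add: D_def)
      next
        case 4
        have xT: "x \<notin> T" using 4 Tpos[OF _ z0] unfolding b0_def by force
        have qX': "q (x + t *\<^sub>R e) = b0 x + b1 x \<and> X (x + t *\<^sub>R e) = x + b0 x *\<^sub>R e" if "\<bar>t\<bar> < - b0 x" for t
        proof
          show "q (x + t *\<^sub>R e) = b0 x + b1 x" using that 4 e0[of x t] e1[of x t] by (auto simp: q_def)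
          then show "X (x + t *\<^sub>R e) = x + b0 x *\<^sub>R e" using e1[of x t] by (simp add: X_def algebra_simps)
        qed
        show ?thesis
        proof (cases "b0 x < -1")
          case True
          then have "x \<notin> oblique_prism z0 z1" using PQ by auto
          moreover have "m (x + t *\<^sub>R e) = 0" if "\<bar>t\<bar> < - 1 - b0 x" for t
            using that e0[of x t] by (auto simp: m_def)
          ultimately show ?thesis using True xT by (intro zero[of "- 1 - b0 x"]) (auto simp: D_def G_def)
        next
          case False
          then have xP: "x \<in> oblique_prism z0 z1" and b: "b0 x > -1" using PQ xQ 4 b0m by auto
          define d where "d = min (- b0 x) (1 + b0 x)"
          have "G (x + t *\<^sub>R e) = (1 + b0 x - t) * ((b0 x + b1 x) * k (x + b0 x *\<^sub>R e))" if "\<bar>t\<bar> < d" for t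
          proof -
            have "m (x + t *\<^sub>R e) = 1 + b0 x - t"
              using that e0[of x t] by (auto simp: m_def d_def)
            then show ?thesis using xQ Qline[of x t] qX'[of t] that by (simp add: G_def d_def)
          qed
          then have ev: "eventually (\<lambda>t. G (x + t *\<^sub>R e) = (1 + b0 x - t) * ((b0 x + b1 x) * k (x + b0 x *\<^sub>R e))) (nhds (0::real))"
            unfolding eventually_nhds_metric using 4 b by (intro exI[of _ d]) (auto simp: d_def dist_real_def)
          have "((\<lambda>t. (1 + b0 x - t) * ((b0 x + b1 x) * k (x + b0 x *\<^sub>R e))) has_real_derivative
               - ((b0 x + b1 x) * k (x + b0 x *\<^sub>R e))) (at 0)"
            by (auto intro!: derivative_eq_intros)
          moreover have "b1 (x + b0 x *\<^sub>R e) = b0 x + b1 x" using e1[of x "b0 x"] by simp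
          ultimately show ?thesis using xT xP
            by (subst DERIV_cong_ev[OF refl ev refl]) (simp add: D_def)
        qed
      qed
    qed
  qed
  note D0 = integral_directional_derivative_eq_0[OF Gmeas Dmeas bnd supp lip deriv]
  have "bounded ((\<lambda>x. k x + b1 x * (k' x \<bullet> e)) ` (convex hull C))"
    by (intro compact_imp_bounded compact_continuous_image cH continuous_intros C1_continuous[OF k] C1_continuous_gradient[OF k])
  then obtain M where M: "\<And>x. x \<in> convex hull C \<Longrightarrow> norm (k x + b1 x * (k' x \<bullet> e)) \<le> M"
    by (auto simp: bounded_iff)
  have i1: "integrable lborel (\<lambda>x. indicator T x * (k x + b1 x * (k' x \<bullet> e)))"
  proof (rule Bochner_Integration.integrable_bound)
    show "integrable lborel (\<lambda>x. M * indicat_real T x)"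
      using emeasure_bounded_finite[OF bounded_T] by (auto simp: top.not_eq_extremum)
    show "AE x in lborel. norm (indicat_real T x * (k x + b1 x * (k' x \<bullet> e))) \<le> norm (M * indicat_real T x)"
      using M T_subset_hull by (intro AE_I2) (force simp: indicator_def)
  qed simp
  then have i2: "integrable lborel (\<lambda>x. indicator (oblique_prism z0 z1) x * (b1 (x + b0 x *\<^sub>R e) * k (x + b0 x *\<^sub>R e)))"
    using Bochner_Integration.integrable_diff[OF i1 D0(1)] by (simp add: D_def)
  show "(\<integral>x. indicator T x * (k x + bary z1 x * (k' x \<bullet> e)) \<partial>lborel) =
    (\<integral>x. indicator (oblique_prism z0 z1) x *
        (bary z1 (x + bary z0 x *\<^sub>R e) * k (x + bary z0 x *\<^sub>R e)) \<partial>lborel)"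
    using D0(2) Bochner_Integration.integral_diff[OF i1 i2] by (simp add: D_def b0_def b1_def)
  show "integrable lborel (\<lambda>x. indicator T x * (k x + bary z1 x * (k' x \<bullet> e)))"
    using i1 by (simp add: b1_def)
qed

end

subsection \<open>Surface integrals over a facet\<close>

lemma measure_homothety:
  fixes S :: "(real ^ 'n) set"
  assumes "0 \<le> \<theta>"
  shows "measure lebesgue ((\<lambda>x. a + \<theta> *\<^sub>R (x - a)) ` S) = \<theta> ^ CARD('n) * measure lebesgue S"
proof -
  have "(\<lambda>x. a + \<theta> *\<^sub>R (x - a)) ` S = (\<lambda>x. \<theta> *\<^sub>R x + (a - \<theta> *\<^sub>R a)) ` S"
    by (simp add: algebra_simps)
  then show ?thesis
    using assms measure_lebesgue_affine[of \<theta> "a - \<theta> *\<^sub>R a" S] by simp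
qed

context simplex_element
begin

text \<open>Orthogonal projection onto the hyperplane of the facet opposite \<open>z\<close>:
  \<open>height z\<close> is the reciprocal norm of \<open>bary_grad z\<close>, so the subtracted
  multiple lowers the coordinate exactly to 0.\<close>

definition foot :: "real ^ 'n \<Rightarrow> real ^ 'n \<Rightarrow> real ^ 'n" where
  "foot z y = y - (bary z y * (height z)\<^sup>2) *\<^sub>R bary_grad z"

definition prism :: "real ^ 'n \<Rightarrow> (real ^ 'n) set" where
  "prism z = {x + t *\<^sub>R unit_normal (facet z) | x t. x \<in> facet z \<and> 0 \<le> t \<and> t \<le> 1}"

text \<open>\<open>prism\<close> is the set used in \<open>surface_measure\<close>; its height is
  one, so its volume is the surface measure of the facet.\<close>

definition area :: "real ^ 'n \<Rightarrow> real" where "area z = measure lebesgue (prism z)"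

lemma card_ge_2: "2 \<le> CARD('n)" and card_le_3: "CARD('n) \<le> 3" using dim by auto

lemma bary_foot: assumes z: "z \<in> C" shows "bary z (foot z y) = 0"
proof -
  have "bary z (foot z y) = bary z y - bary z y * (height z)\<^sup>2 * (norm (bary_grad z))\<^sup>2"
    using bary_line[OF z, of y "- (bary z y * (height z)\<^sup>2)" "bary_grad z"]
    by (simp add: foot_def power2_norm_eq_inner)
  then show ?thesis using bary_grad_nz[OF z] by (simp add: height_def power_divide)
qed

lemma foot_continuous: "z \<in> C \<Longrightarrow> continuous_on S (foot z)"
  unfolding foot_def by (intro continuous_intros bary_continuous)

text \<open>Coordinates adapted to a facet: \<open>foot z y\<close> is the base point and
  \<open>c * bary z y\<close> the signed distance along the selected normal. The factor
  \<open>c\<close> absorbs the unknown sign of that normal.\<close>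

lemma normal_coeff:
  assumes z: "z \<in> C"
  obtains c where "unit_normal (facet z) = c *\<^sub>R bary_grad z" "\<bar>c\<bar> = height z" "c\<^sup>2 = (height z)\<^sup>2"
    "\<And>y. y = foot z y + (c * bary z y) *\<^sub>R unit_normal (facet z)"
    "\<And>x t. bary z x = 0 \<Longrightarrow> c * bary z (x + t *\<^sub>R unit_normal (facet z)) = t"
    "\<And>x t. bary z x = 0 \<Longrightarrow> foot z (x + t *\<^sub>R unit_normal (facet z)) = x"
    "prism z = {y. foot z y \<in> facet z \<and> 0 \<le> c * bary z y \<and> c * bary z y \<le> 1}"
proof -
  obtain c where c: "unit_normal (facet z) = c *\<^sub>R bary_grad z" "\<bar>c\<bar> = height z"
    using unit_normal_facet[OF z] by blast
  have c2: "c\<^sup>2 = (height z)\<^sup>2" using c(2) by (metis power2_abs)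
  have H: "(height z)\<^sup>2 * (bary_grad z \<bullet> bary_grad z) = 1"
    using bary_grad_nz[OF z] by (simp add: height_def power_divide power2_norm_eq_inner[symmetric])
  have 1: "y = foot z y + (c * bary z y) *\<^sub>R unit_normal (facet z)" for y
    using c2 by (simp add: foot_def c(1) power2_eq_square algebra_simps)
  have 2: "c * bary z (x + t *\<^sub>R unit_normal (facet z)) = t" if "bary z x = 0" for x t
  proof -
    have "c * bary z (x + t *\<^sub>R unit_normal (facet z)) = t * (c\<^sup>2 * (bary_grad z \<bullet> bary_grad z))"
      by (simp add: bary_line[OF z] that c(1) power2_eq_square)
    then show ?thesis using H c2 by simp
  qed
  have 3: "foot z (x + t *\<^sub>R unit_normal (facet z)) = x" if "bary z x = 0" for x t
    using 1[of "x + t *\<^sub>R unit_normal (facet z)"] 2[OF that, of t] by simp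
  have "prism z = {y. foot z y \<in> facet z \<and> 0 \<le> c * bary z y \<and> c * bary z y \<le> 1}"
  proof -
  have "y \<in> prism z \<longleftrightarrow> foot z y \<in> facet z \<and> 0 \<le> c * bary z y \<and> c * bary z y \<le> 1" for y
  proof
    assume "y \<in> prism z"
    then obtain x t where "y = x + t *\<^sub>R unit_normal (facet z)" "x \<in> facet z" "0 \<le> t" "t \<le> 1"
      unfolding prism_def by blast
    then show "foot z y \<in> facet z \<and> 0 \<le> c * bary z y \<and> c * bary z y \<le> 1"
      using 2 3 by (simp add: facet_bary[OF z])
  next
    assume "foot z y \<in> facet z \<and> 0 \<le> c * bary z y \<and> c * bary z y \<le> 1"
    then show "y \<in> prism z" unfolding prism_def using 1[of y] by blast
  qed
  then show ?thesis by blast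
  qed
  then show ?thesis using that[OF c c2 1 2 3] by blast
qed

lemma prism_foot: assumes z: "z \<in> C" and y: "y \<in> prism z" shows "foot z y \<in> facet z"
proof -
  obtain c where "prism z = {y. foot z y \<in> facet z \<and> 0 \<le> c * bary z y \<and> c * bary z y \<le> 1}"
    by (rule normal_coeff[OF z])
  then show ?thesis using y by blast
qed

lemma closed_facet: "closed (facet z)"
  using fin by (simp add: compact_imp_closed finite_imp_compact_convex_hull)

lemma facet_subset_hull: "facet z \<subseteq> convex hull C" by (simp add: hull_mono)

lemma closed_prism: assumes z: "z \<in> C" shows "closed (prism z)"
proof -
  obtain c where "prism z = {y. foot z y \<in> facet z \<and> 0 \<le> c * bary z y \<and> c * bary z y \<le> 1}"
    by (rule normal_coeff[OF z])
  then have "prism z = foot z -` facet z \<inter> ({y. 0 \<le> c * bary z y} \<inter> {y. c * bary z y \<le> 1})" by auto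
  moreover have "closed \<dots>"
    using continuous_closed_vimage[OF closed_facet] foot_continuous[OF z, of UNIV] bary_continuous[OF z]
    by (intro closed_Int closed_Collect_le continuous_intros)
       (auto simp: continuous_on_eq_continuous_at closed_facet)
  ultimately show ?thesis by simp
qed

lemma bounded_prism: assumes z: "z \<in> C" shows "bounded (prism z)"
proof -
  obtain R where R: "\<And>x. x \<in> facet z \<Longrightarrow> norm x \<le> R"
    using fin compact_imp_bounded[OF finite_imp_compact_convex_hull[of "C - {z}"]] by (auto simp: bounded_iff)
  have "norm y \<le> R + 1" if y: "y \<in> prism z" for y
  proof -
    obtain x t where "y = x + t *\<^sub>R unit_normal (facet z)" "x \<in> facet z" "0 \<le> t" "t \<le> 1"
      using y unfolding prism_def by blast
    then show ?thesis
      using R[of x] norm_triangle_ineq[of x "t *\<^sub>R unit_normal (facet z)"] unit_normal_facet(1)[OF z] by simp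
  qed
  then show ?thesis by (auto simp: bounded_iff)
qed

lemma prism_borel: "z \<in> C \<Longrightarrow> prism z \<in> sets borel" using closed_prism by simp

lemma closest_point_prism:
  assumes z: "z \<in> C" and y: "y \<in> prism z"
  shows "closest_point (affine hull (facet z)) y = foot z y"
proof (rule closest_point_unique[symmetric])
  show "convex (affine hull (facet z))" by (simp add: affine_imp_convex)
  show "closed (affine hull (facet z))" by simp
  show "foot z y \<in> affine hull (facet z)" by (rule hull_inc[OF prism_foot[OF assms]])
  show "\<forall>x\<in>affine hull (facet z). dist y (foot z y) \<le> dist y x"
  proof
    fix x assume "x \<in> affine hull (facet z)"
    then have x: "bary z x = 0" unfolding affine_hull_facet[OF z] by simp
    let ?s = "bary z y * (height z)\<^sup>2"
    have y: "y = foot z y + ?s *\<^sub>R bary_grad z" by (simp add: foot_def)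
    have "bary_grad z \<bullet> (foot z y - x) = 0"
      using bary_grad_inner_diff[OF z, of "foot z y" x] x bary_foot[OF z] by simp
    then have orth: "orthogonal (?s *\<^sub>R bary_grad z) (foot z y - x)" by (simp add: orthogonal_def)
    have "y - x = ?s *\<^sub>R bary_grad z + (foot z y - x)" using y by (simp add: algebra_simps)
    then have "(norm (y - x))\<^sup>2 = (norm (?s *\<^sub>R bary_grad z))\<^sup>2 + (norm (foot z y - x))\<^sup>2"
      using norm_add_Pythagorean[OF orth] by (simp only:)
    moreover have "y - foot z y = ?s *\<^sub>R bary_grad z" by (simp add: foot_def)
    ultimately have "(norm (y - foot z y))\<^sup>2 \<le> (norm (y - x))\<^sup>2" by (simp del: norm_scaleR)
    then have "norm (y - foot z y) \<le> norm (y - x)" by (rule power2_le_imp_le) simp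
    then show "dist y (foot z y) \<le> dist y x" by (simp only: dist_norm)
  qed
qed

lemma foot_borel: "z \<in> C \<Longrightarrow> foot z \<in> borel \<rightarrow>\<^sub>M borel"
  by (rule borel_measurable_continuous_onI[OF foot_continuous])

text \<open>Surface integrals become volume integrals over the prism, to which the shear formula
  applies.\<close>

lemma surface_integral:
  fixes g :: "real ^ 'n \<Rightarrow> real"
  assumes z: "z \<in> C" and g: "g \<in> borel_measurable borel"
  shows "(LINT s|surface_measure (facet z). g s) = (\<integral>y. indicator (prism z) y * g (foot z y) \<partial>lborel)"
proof -
  let ?M = "lebesgue_on (prism z)" and ?N = "restrict_space borel (facet z)"
  let ?p = "closest_point (affine hull (facet z))"
  note [measurable] = g foot_borel[OF z] prism_borel[OF z]
  have fm: "foot z \<in> ?M \<rightarrow>\<^sub>M borel"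
    by (intro measurable_restrict_space1 measurable_completion) simp
  have "?p \<in> ?M \<rightarrow>\<^sub>M borel \<longleftrightarrow> foot z \<in> ?M \<rightarrow>\<^sub>M borel"
    by (rule measurable_cong) (simp add: closest_point_prism[OF z] del: affine_hull_convex_hull)
  then have pm: "?p \<in> ?M \<rightarrow>\<^sub>M ?N"
    using fm prism_foot[OF z] closest_point_prism[OF z]
    by (intro measurable_restrict_space2) (auto simp del: affine_hull_convex_hull)
  have gm: "g \<in> borel_measurable ?N" by (rule measurable_restrict_space1[OF g])
  have "(LINT s|surface_measure (facet z). g s) = (LINT y|?M. g (?p y))"
    unfolding surface_measure_def prism_def[symmetric] by (rule integral_distr[OF pm gm])
  also have "\<dots> = (LINT y|?M. g (foot z y))"
    by (rule Bochner_Integration.integral_cong) (auto simp: closest_point_prism[OF z] simp del: affine_hull_convex_hull)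
  also have "\<dots> = (\<integral>y. indicator (prism z) y * g (foot z y) \<partial>lborel)"
    by (rule integral_lebesgue_on_borel) auto
  finally show ?thesis .
qed

lemma space_surface_measure: "space (surface_measure (facet z)) = facet z"
  by (simp add: surface_measure_def space_restrict_space)

lemma prism_integrable:
  fixes g :: "real ^ 'n \<Rightarrow> real"
  assumes z: "z \<in> C" and g: "continuous_on UNIV g"
  shows "integrable lborel (\<lambda>y. indicator (prism z) y * g (foot z y))"
proof -
  have "compact (facet z)" using fin by (simp add: finite_imp_compact_convex_hull)
  then obtain B where B: "\<And>x. x \<in> facet z \<Longrightarrow> norm (g x) \<le> B"
    using compact_imp_bounded[OF compact_continuous_image[OF continuous_on_subset[OF g subset_UNIV], of "facet z"]]
    by (auto simp: bounded_iff)
  note [measurable] = foot_borel[OF z] prism_borel[OF z] borel_measurable_continuous_onI[OF g]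
  show ?thesis
  proof (rule Bochner_Integration.integrable_bound)
    show "integrable lborel (\<lambda>x. B * indicat_real (prism z) x)"
      using emeasure_bounded_finite[OF bounded_prism[OF z]] by (auto simp: top.not_eq_extremum)
    show "AE y in lborel. norm (indicat_real (prism z) y * g (foot z y)) \<le> norm (B * indicat_real (prism z) y)"
      using B[OF prism_foot[OF z]] by (intro AE_I2) (force simp: indicator_def)
  qed simp
qed

lemma edge_inner_normal:
  assumes "z0 \<in> C" "z1 \<in> C" "z1 \<noteq> z0" "unit_normal (facet z0) = c *\<^sub>R bary_grad z0"
  shows "unit_normal (facet z0) \<bullet> (z1 - z0) = - c"
  using bary_grad_diff[OF assms(1,2,1)] assms by simp

text \<open>The divergence theorem for \<open>bary z1 * k\<close> times the edge vector
  \<open>z1 - z0\<close>: the left integrand is the divergence, because \<open>bary z1\<close> grows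
  at rate 1 along the edge, and the flux crosses only the facet opposite \<open>z0\<close>. There
  the edge has a normal component of modulus \<open>height z0\<close>.\<close>

theorem facet_green:
  assumes z0: "z0 \<in> C" and z1: "z1 \<in> C" and ne: "z1 \<noteq> z0" and k: "C1_with_gradient k k'"
  shows "(LINT x|lebesgue_on T. k x + bary z1 x * (k' x \<bullet> (z1 - z0))) =
    height z0 * (LINT s|surface_measure (facet z0). bary z1 s * k s)"
proof -
  define e where "e = z1 - z0"
  define n where "n = unit_normal (facet z0)"
  obtain c where c: "n = c *\<^sub>R bary_grad z0" "\<bar>c\<bar> = height z0" "c\<^sup>2 = (height z0)\<^sup>2"
    "\<And>y. y = foot z0 y + (c * bary z0 y) *\<^sub>R n"
    "\<And>x t. bary z0 x = 0 \<Longrightarrow> c * bary z0 (x + t *\<^sub>R n) = t"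
    "\<And>x t. bary z0 x = 0 \<Longrightarrow> foot z0 (x + t *\<^sub>R n) = x"
    and pr: "prism z0 = {y. foot z0 y \<in> facet z0 \<and> 0 \<le> c * bary z0 y \<and> c * bary z0 y \<le> 1}"
    unfolding n_def by (rule normal_coeff[OF z0]) blast
  have n1: "norm n = 1" unfolding n_def by (rule unit_normal_facet[OF z0])
  have ne': "n \<bullet> e = - c" unfolding n_def e_def using edge_inner_normal[OF z0 z1 ne c(1)[unfolded n_def]] .
  have c0: "c \<noteq> 0" using c(2) height_pos[OF z0] by auto
  \<comment> \<open>The shear with this \<open>w\<close> fixes the hyperplane of the facet and sends
    \<open>n\<close> to \<open>e\<close>, so it carries the right prism to the oblique one. Its
    determinant is \<open>n \<bullet> e\<close>, of modulus \<open>height z0\<close>.\<close>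
  define w where "w = e - n"
  have nw: "1 + n \<bullet> w = - c" using n1 ne' by (simp add: w_def inner_diff_right norm_eq_1)
  define g where "g x = bary z1 x * k x" for x
  have g_cont: "continuous_on UNIV g"
    unfolding g_def by (intro continuous_intros bary_continuous z1 C1_continuous[OF k])
  have [measurable]: "g \<in> borel_measurable borel" using g_cont by (rule borel_measurable_continuous_onI)
  have [measurable]: "bary z0 \<in> borel_measurable borel" "T \<in> sets borel" using bary_borel z0 T_borel by auto
  have "closed (oblique_prism z0 z1)"
  proof -
    have "oblique_prism z0 z1 = (\<Inter>z\<in>C - {z0, z1}. {x. 0 \<le> bary z x}) \<inter> {x. 0 \<le> bary z0 x + bary z1 x}
        \<inter> {x. - 1 \<le> bary z0 x} \<inter> {x. bary z0 x \<le> 0}"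
      unfolding oblique_prism_def by auto
    also have "closed \<dots>"
      using z0 z1 by (intro closed_Int closed_INT ballI closed_bary_ge closed_Collect_le continuous_intros bary_continuous) auto
    finally show ?thesis .
  qed
  then have [measurable]: "oblique_prism z0 z1 \<in> sets borel" by simp
  define f where "f x = indicator (oblique_prism z0 z1) x * g (x + bary z0 x *\<^sub>R e)" for x
  have fm: "f \<in> borel_measurable borel" unfolding f_def by measurable
  have ny: "n \<bullet> (y - z1) = c * bary z0 y" for y
    using bary_grad_inner_diff[OF z0, of y z1] bary_vertex[OF z0 z1] ne by (simp add: c(1))
  have fA: "f (y + (n \<bullet> (y - z1)) *\<^sub>R w) = indicator (prism z0) y * g (foot z0 y)" for y
  proof -
    define t x where "t = c * bary z0 y" and "x = foot z0 y"
    have Ay: "y + (n \<bullet> (y - z1)) *\<^sub>R w = x + t *\<^sub>R e"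
    proof -
      have "y = x + t *\<^sub>R n" using c(4)[of y] by (simp add: x_def t_def)
      then show ?thesis unfolding ny t_def[symmetric] w_def by (simp add: scaleR_diff_right)
    qed
    have bx: "bary z0 x = 0" unfolding x_def by (rule bary_foot[OF z0])
    have b0: "bary z0 (x + t *\<^sub>R e) = - t" using bary_edge[OF z0 z1 ne z0, of x t] ne bx by (simp add: e_def)
    have b1: "bary z1 (x + t *\<^sub>R e) = bary z1 x + t" using bary_edge[OF z0 z1 ne z1, of x t] ne by (simp add: e_def)
    have bz: "bary z (x + t *\<^sub>R e) = bary z x" if "z \<in> C - {z0, z1}" for z
      using bary_edge[OF z0 z1 ne, of z x t] that by (simp add: e_def)
    have "x \<in> facet z0 \<longleftrightarrow> (\<forall>z\<in>C - {z0, z1}. 0 \<le> bary z x) \<and> 0 \<le> bary z1 x"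
      unfolding facet_bary[OF z0] using bx z1 by auto
    then have "x + t *\<^sub>R e \<in> oblique_prism z0 z1 \<longleftrightarrow> y \<in> prism z0"
      unfolding oblique_prism_def pr using bz b0 b1 by (auto simp: x_def[symmetric] t_def[symmetric])
    moreover have "x + t *\<^sub>R e + bary z0 (x + t *\<^sub>R e) *\<^sub>R e = x" unfolding b0 by simp
    ultimately have "f (x + t *\<^sub>R e) = indicator (prism z0) y * g x"
      unfolding f_def by (simp only: indicator_def)
    then show ?thesis unfolding Ay by (simp only: x_def)
  qed
  have "(LINT x|lebesgue_on T. k x + bary z1 x * (k' x \<bullet> e)) = (\<integral>x. f x \<partial>lborel)"
  proof -
    have [measurable]: "k \<in> borel_measurable borel" "k' \<in> borel_measurable borel" "bary z1 \<in> borel_measurable borel"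
      using C1_continuous[OF k] C1_continuous_gradient[OF k] bary_borel z1
      by (auto intro: borel_measurable_continuous_onI)
    have "(LINT x|lebesgue_on T. k x + bary z1 x * (k' x \<bullet> e)) =
        (\<integral>x. indicator T x * (k x + bary z1 x * (k' x \<bullet> e)) \<partial>lborel)"
      by (rule integral_lebesgue_on_borel) auto
    then show ?thesis using edge_derivative_integral(1)[OF z0 z1 ne k] by (simp add: f_def g_def e_def)
  qed
  also have "\<dots> = \<bar>1 + n \<bullet> w\<bar> * (\<integral>y. f (y + (n \<bullet> (y - z1)) *\<^sub>R w) \<partial>lborel)"
    using c0 nw by (intro integral_shear dim n1 fm) auto
  also have "\<dots> = height z0 * (LINT s|surface_measure (facet z0). g s)"
    unfolding fA nw using surface_integral[OF z0, of g] c(2) by simp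
  finally show ?thesis by (simp add: e_def g_def)
qed

end

text \<open>
  If \<open>M\<close> is the largest coefficient of a facet function, then the function is at least \<open>c0 * M\<close> in
  modulus at a vertex or at the barycentre of the facet, and at least half of that on the homothetic
  copy of the facet of ratio \<open>\<theta>\<close> about that point.
\<close>

definition coefficient_bound :: "nat \<Rightarrow> real" where
  "coefficient_bound m = (let D = real m; c0 = (1 / (2 * D)) ^ m / 2; \<theta> = c0 / (2 * (D + 1))
     in (2 / c0)\<^sup>2 / \<theta> ^ m)"

lemma coefficient_bound_pos: "0 < m \<Longrightarrow> 0 < coefficient_bound m"
  by (simp add: coefficient_bound_def Let_def)

context simplex_element
begin

lemma surface_integral_sum:
  fixes g :: "'i \<Rightarrow> real ^ 'n \<Rightarrow> real"
  assumes z: "z \<in> C" and g: "\<And>i. i \<in> I \<Longrightarrow> continuous_on UNIV (g i)"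
  shows "(LINT s|surface_measure (facet z). (\<Sum>i\<in>I. g i s)) = (\<Sum>i\<in>I. (LINT s|surface_measure (facet z). g i s))"
proof -
  have m: "g i \<in> borel_measurable borel" if "i \<in> I" for i
    using g[OF that] by (rule borel_measurable_continuous_onI)
  have m': "(\<lambda>s. \<Sum>i\<in>I. g i s) \<in> borel_measurable borel" using m by (rule borel_measurable_sum)
  have "(LINT s|surface_measure (facet z). (\<Sum>i\<in>I. g i s)) =
      (\<integral>y. (\<Sum>i\<in>I. indicator (prism z) y * g i (foot z y)) \<partial>lborel)"
    by (simp add: surface_integral[OF z m'] sum_distrib_left)
  also have "\<dots> = (\<Sum>i\<in>I. (\<integral>y. indicator (prism z) y * g i (foot z y) \<partial>lborel))"
    by (rule Bochner_Integration.integral_sum) (rule prism_integrable[OF z g])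
  also have "\<dots> = (\<Sum>i\<in>I. (LINT s|surface_measure (facet z). g i s))"
    by (rule sum.cong) (simp_all add: surface_integral[OF z m])
  finally show ?thesis .
qed

lemma surface_integral_const: "z \<in> C \<Longrightarrow> (LINT s|surface_measure (facet z). c) = c * area z"
proof -
  assume z: "z \<in> C"
  have "(LINT s|surface_measure (facet z). c) = (\<integral>y. indicator (prism z) y * c \<partial>lborel)"
    by (rule surface_integral[OF z]) simp
  also have "\<dots> = measure lborel (prism z) * c" by simp
  also have "measure lborel (prism z) = area z" using prism_borel[OF z] by (simp add: area_def measure_completion)
  finally show ?thesis by (simp add: mult.commute)
qed

lemma surface_integral_mono:
  fixes g h :: "real ^ 'n \<Rightarrow> real"
  assumes z: "z \<in> C" and g: "continuous_on UNIV g" and h: "continuous_on UNIV h"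
    and le: "\<And>x. x \<in> facet z \<Longrightarrow> g x \<le> h x"
  shows "(LINT s|surface_measure (facet z). g s) \<le> (LINT s|surface_measure (facet z). h s)"
proof -
  have "(\<integral>y. indicator (prism z) y * g (foot z y) \<partial>lborel) \<le> (\<integral>y. indicator (prism z) y * h (foot z y) \<partial>lborel)"
    using prism_integrable[OF z g] prism_integrable[OF z h] le[OF prism_foot[OF z]]
    by (intro integral_mono) (auto simp: indicator_def)
  then show ?thesis
    using surface_integral[OF z borel_measurable_continuous_onI[OF g]]
      surface_integral[OF z borel_measurable_continuous_onI[OF h]] by simp
qed

lemma area_nonneg: "0 \<le> area z" by (simp add: area_def)

lemma sum_bary_facet: assumes "z0 \<in> C" "bary z0 x = 0" shows "(\<Sum>z\<in>C - {z0}. bary z x) = 1"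
  using sum.remove[OF fin assms(1), of "\<lambda>z. bary z x"] bary_sum[of x] assms(2) by simp

text \<open>For each vertex \<open>z1\<close> of the facet, \<open>facet_green\<close> with the
  constant 1 gives the volume as \<open>height z0\<close> times the integral of
  \<open>bary z1\<close>. In the sum over these vertices the coordinates add up to 1 on the
  facet.\<close>

lemma volume_height_area:
  assumes z0: "z0 \<in> C"
  shows "real CARD('n) * measure lebesgue T = height z0 * area z0"
proof -
  have 1: "measure lebesgue T = height z0 * (LINT s|surface_measure (facet z0). bary z1 s)" if "z1 \<in> C - {z0}" for z1
    using facet_green[OF z0 _ _ C1_const[of 1], of z1] that T_lmeasurable
    by (simp add: measure_restrict_space fmeasurableD)
  have "real CARD('n) * measure lebesgue T = (\<Sum>z1\<in>C - {z0}. measure lebesgue T)"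
    using card_C z0 fin by simp
  also have "\<dots> = (\<Sum>z1\<in>C - {z0}. height z0 * (LINT s|surface_measure (facet z0). bary z1 s))"
    using 1 by (intro sum.cong) auto
  also have "\<dots> = height z0 * (\<Sum>z1\<in>C - {z0}. (LINT s|surface_measure (facet z0). bary z1 s))"
    by (simp add: sum_distrib_left)
  also have "(\<Sum>z1\<in>C - {z0}. (LINT s|surface_measure (facet z0). bary z1 s)) =
      (LINT s|surface_measure (facet z0). (\<Sum>z1\<in>C - {z0}. bary z1 s))"
    by (rule surface_integral_sum[OF z0, symmetric]) (simp add: bary_continuous)
  also have "\<dots> = (LINT s|surface_measure (facet z0). 1)"
  proof (rule Bochner_Integration.integral_cong[OF refl])
    fix x assume "x \<in> space (surface_measure (facet z0))"
    then have "x \<in> facet z0" by (simp only: space_surface_measure)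
    then have "bary z0 x = 0" unfolding facet_bary[OF z0] by blast
    then show "(\<Sum>z1\<in>C - {z0}. bary z1 x) = 1" by (rule sum_bary_facet[OF z0])
  qed
  also have "\<dots> = area z0" using surface_integral_const[OF z0, of 1] by simp
  finally show ?thesis .
qed

text \<open>The prism over the facet, stretched to height \<open>h\<close>, lies in a cube of side
  \<open>4 * h\<close>. The length \<open>h\<close> only has to bound the facet, so the diameter of
  a neighbouring element can be inserted.\<close>

lemma area_le:
  assumes z0: "z0 \<in> C" and h: "0 < h" "\<And>x y. x \<in> facet z0 \<Longrightarrow> y \<in> facet z0 \<Longrightarrow> norm (x - y) \<le> h"
  shows "area z0 \<le> 4 ^ CARD('n) * h ^ (CARD('n) - 1)"
proof -
  define n where "n = unit_normal (facet z0)"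
  obtain c where c: "n = c *\<^sub>R bary_grad z0" "\<bar>c\<bar> = height z0" "c\<^sup>2 = (height z0)\<^sup>2"
    "\<And>y. y = foot z0 y + (c * bary z0 y) *\<^sub>R n"
    "\<And>x t. bary z0 x = 0 \<Longrightarrow> c * bary z0 (x + t *\<^sub>R n) = t"
    "\<And>x t. bary z0 x = 0 \<Longrightarrow> foot z0 (x + t *\<^sub>R n) = x"
    and pr: "prism z0 = {y. foot z0 y \<in> facet z0 \<and> 0 \<le> c * bary z0 y \<and> c * bary z0 y \<le> 1}"
    unfolding n_def by (rule normal_coeff[OF z0]) blast
  have n1: "norm n = 1" unfolding n_def by (rule unit_normal_facet[OF z0])
  obtain z1 where z1: "z1 \<in> C" "z1 \<noteq> z0" using C_other z0 by blast
  have z1F: "z1 \<in> facet z0" using z1 by (simp add: hull_inc)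
  have ny: "n \<bullet> (y - z1) = c * bary z0 y" for y
    using bary_grad_inner_diff[OF z0, of y z1] bary_vertex[OF z0 z1(1)] z1 by (simp add: c(1))
  define P where "P = {y. foot z0 y \<in> facet z0 \<and> 0 \<le> c * bary z0 y \<and> c * bary z0 y \<le> h}"
  have "P = foot z0 -` facet z0 \<inter> ({y. 0 \<le> c * bary z0 y} \<inter> {y. c * bary z0 y \<le> h})" by (auto simp: P_def)
  moreover have "closed \<dots>"
    using continuous_closed_vimage[OF closed_facet] foot_continuous[OF z0, of UNIV] bary_continuous[OF z0]
    by (intro closed_Int closed_Collect_le continuous_intros)
       (auto simp: continuous_on_eq_continuous_at closed_facet)
  ultimately have Pc: "closed P" by simp
  then have Pb: "P \<in> sets borel" by simp
  have nn: "n \<bullet> n = 1" using n1 by (simp add: norm_eq_1)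
  \<comment> \<open>A shear along \<open>n\<close> itself is a dilation in the normal
    direction.\<close>
  have stretch: "indicator P (y + (n \<bullet> (y - z1)) *\<^sub>R ((h - 1) *\<^sub>R n)) = (indicator (prism z0) y :: real)" for y
  proof -
    define t where "t = c * bary z0 y"
    have "y = foot z0 y + t *\<^sub>R n" using c(4)[of y] by (simp add: t_def)
    then have y': "y + (n \<bullet> (y - z1)) *\<^sub>R ((h - 1) *\<^sub>R n) = foot z0 y + (t * h) *\<^sub>R n"
    proof -
      assume y: "y = foot z0 y + t *\<^sub>R n"
      have "y + t *\<^sub>R ((h - 1) *\<^sub>R n) = foot z0 y + (t *\<^sub>R n + t *\<^sub>R ((h - 1) *\<^sub>R n))"
        by (subst y) (simp only: add.assoc)
      also have "t *\<^sub>R n + t *\<^sub>R ((h - 1) *\<^sub>R n) = (t * h) *\<^sub>R n" by (simp add: algebra_simps)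
      finally show ?thesis unfolding ny t_def[symmetric] .
    qed
    have "foot z0 y + (t * h) *\<^sub>R n \<in> P \<longleftrightarrow> foot z0 y \<in> facet z0 \<and> 0 \<le> t * h \<and> t * h \<le> h"
      unfolding P_def using c(5,6)[OF bary_foot[OF z0]] by simp
    also have "\<dots> \<longleftrightarrow> y \<in> prism z0"
      unfolding pr mem_Collect_eq t_def[symmetric] using h(1)
      by (simp add: zero_le_mult_iff mult_le_cancel_right2 linorder_not_le)
    finally show ?thesis unfolding y' by (simp add: indicator_def)
  qed
  have "measure lborel P = (\<integral>y. indicator P y \<partial>lborel)" using Pb by simp
  also have "\<dots> = \<bar>1 + n \<bullet> ((h - 1) *\<^sub>R n)\<bar> * (\<integral>y. indicator P (y + (n \<bullet> (y - z1)) *\<^sub>R ((h - 1) *\<^sub>R n)) \<partial>lborel)"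
    using h(1) nn Pb by (intro integral_shear dim n1) auto
  also have "\<dots> = h * measure lborel (prism z0)"
    unfolding stretch using nn h(1) prism_borel[OF z0] by simp
  also have "measure lborel (prism z0) = area z0" using prism_borel[OF z0] by (simp add: area_def measure_completion)
  finally have hP: "measure lborel P = h * area z0" .
  define a :: "real ^ 'n" where "a = (\<chi> i. 2 * h)"
  have "P \<subseteq> cbox (z1 - a) (z1 + a)"
  proof
    fix y assume y: "y \<in> P"
    have "norm (y - z1) \<le> norm (foot z0 y - z1) + norm ((c * bary z0 y) *\<^sub>R n)"
      using c(4)[of y] norm_triangle_ineq[of "foot z0 y - z1" "(c * bary z0 y) *\<^sub>R n"]
      by (simp add: algebra_simps)
    also have "\<dots> \<le> h + h" using y h z1F n1 by (intro add_mono) (auto simp: P_def)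
    finally have "norm (y - z1) \<le> 2 * h" by simp
    then have "\<bar>(y - z1) $ i\<bar> \<le> 2 * h" for i using component_le_norm_cart[of "y - z1" i] by linarith
    then show "y \<in> cbox (z1 - a) (z1 + a)" by (simp add: mem_box_cart a_def abs_le_iff algebra_simps)
  qed
  then have "measure lborel P \<le> measure lborel (cbox (z1 - a) (z1 + a))"
    using Pb by (intro measure_mono_fmeasurable) auto
  also have "\<dots> = (4 * h) ^ CARD('n)"
  proof -
    have "cbox (z1 - a) (z1 + a) \<noteq> {}" using h(1) by (auto simp: interval_ne_empty_cart a_def)
    then show ?thesis by (simp add: content_cbox_cart a_def)
  qed
  finally have "h * area z0 \<le> h * (4 ^ CARD('n) * h ^ (CARD('n) - 1))"
    using hP card_ge_2 by (simp add: power_mult_distrib mult.left_commute power_eq_if[of h "CARD('n)"])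
  then show ?thesis using h(1) by simp
qed


text \<open>The homothety about \<open>z0\<close> with ratio \<open>1 - \<theta>\<close> maps
  \<open>T\<close> into the complement of the layer, and Bernoulli's inequality bounds the remaining
  volume.\<close>

lemma layer_measure:
  assumes z0: "z0 \<in> C" and \<theta>: "0 < \<theta>" "\<theta> \<le> 1"
  shows "measure lebesgue {x \<in> T. bary z0 x < \<theta>} \<le> real CARD('n) * \<theta> * measure lebesgue T"
proof (cases "\<theta> = 1")
  \<comment> \<open>For ratio zero the homothety is degenerate and the trivial bound
    suffices.\<close>
  case True
  have "measure lebesgue {x \<in> T. bary z0 x < \<theta>} \<le> measure lebesgue T"
  proof (rule measure_mono_fmeasurable)
    have "open {x. bary z0 x < \<theta>}" by (intro open_Collect_less bary_continuous[OF z0] continuous_intros)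
    then have "open (T \<inter> {x. bary z0 x < \<theta>})" using open_T by blast
    then show "{x \<in> T. bary z0 x < \<theta>} \<in> sets lebesgue" by (simp add: Int_def)
  qed (use T_lmeasurable in auto)
  also have "\<dots> \<le> real CARD('n) * measure lebesgue T" using card_ge_2 by (simp add: mult_le_cancel_right1)
  finally show ?thesis by (simp add: True)
next
  case False
  then have \<theta>1: "\<theta> < 1" using \<theta> by simp
  define h where "h x = z0 + (1 - \<theta>) *\<^sub>R (x - z0)" for x
  let ?L = "{x \<in> T. bary z0 x < \<theta>}"
  have "h ` T = (\<lambda>x. (z0 - (1 - \<theta>) *\<^sub>R z0) + (1 - \<theta>) *\<^sub>R x) ` T" by (simp add: h_def algebra_simps)
  then have op: "open (h ` T)" using open_affinity[OF open_T, of "1 - \<theta>"] \<theta>1 by simp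
  have bh: "bary z (h x) = \<theta> * bary z z0 + (1 - \<theta>) * bary z x" if "z \<in> C" for z x
  proof -
    have "bary z (h x) = bary z z0 + (1 - \<theta>) * (bary z x - bary z z0)"
      unfolding h_def bary_line[OF that] bary_grad_inner_diff[OF that] ..
    then show ?thesis by (simp add: algebra_simps)
  qed
  have sub: "h ` T \<subseteq> T - ?L"
  proof
    fix y assume "y \<in> h ` T"
    then obtain x where x: "x \<in> T" "y = h x" by blast
    have pos: "0 < bary z x" if "z \<in> C" for z using x(1) that by (subst (asm) T_bary) blast
    have "0 < bary z y" if "z \<in> C" for z
      using bh[OF that, of x] pos[OF that] \<theta> \<theta>1 bary_vertex[OF that z0] x(2)
      by (auto intro!: add_pos_pos)
    then have "y \<in> T" by (subst T_bary) blast
    moreover have "\<theta> \<le> bary z0 y"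
      using bh[OF z0, of x] pos[OF z0] \<theta>1 bary_vertex[OF z0 z0] x(2) by simp
    ultimately show "y \<in> T - ?L" by auto
  qed
  have Lop: "open ?L"
  proof -
    have "open {x. bary z0 x < \<theta>}" by (intro open_Collect_less bary_continuous[OF z0] continuous_intros)
    then have "open (T \<inter> {x. bary z0 x < \<theta>})" using open_T by blast
    then show ?thesis by (simp add: Int_def)
  qed
  have Lm: "?L \<in> lmeasurable" using Lop bounded_subset[OF bounded_T] by (intro lmeasurable_open) auto
  have "(1 - \<theta>) ^ CARD('n) * measure lebesgue T = measure lebesgue (h ` T)"
    unfolding h_def using measure_homothety[of "1 - \<theta>" z0 T] \<theta>1 by simp
  also have "\<dots> \<le> measure lebesgue (T - ?L)"
    using sub op T_lmeasurable Lm by (intro measure_mono_fmeasurable) (auto intro: fmeasurable.Diff fmeasurableD)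
  also have "\<dots> = measure lebesgue T - measure lebesgue ?L"
    using T_lmeasurable Lm by (intro measurable_measure_Diff) (auto simp: fmeasurableD)
  finally have "measure lebesgue ?L \<le> (1 - (1 - \<theta>) ^ CARD('n)) * measure lebesgue T"
    by (simp add: algebra_simps)
  also have "\<dots> \<le> (real CARD('n) * \<theta>) * measure lebesgue T"
    using Bernoulli_inequality[of "- \<theta>" "CARD('n)"] \<theta> by (intro mult_right_mono) auto
  finally show ?thesis .
qed

text \<open>The homothety about \<open>x0\<close> is applied to the whole prism and shrinks its
  height as well; hence the exponent is the full dimension and not that of the facet.\<close>

lemma surface_integral_square_lower:
  assumes z: "z \<in> C" and x0: "x0 \<in> facet z" and \<theta>: "0 \<le> \<theta>" "\<theta> \<le> 1"
    and q: "continuous_on UNIV q" and m: "0 \<le> m"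
    and le: "\<And>x. x \<in> facet z \<Longrightarrow> m \<le> \<bar>q (x0 + \<theta> *\<^sub>R (x - x0))\<bar>"
  shows "\<theta> ^ CARD('n) * area z * m\<^sup>2 \<le> (LINT s|surface_measure (facet z). (q s)\<^sup>2)"
proof -
  define h where "h x = x0 + \<theta> *\<^sub>R (x - x0)" for x
  obtain c where c: "unit_normal (facet z) = c *\<^sub>R bary_grad z"
    "\<And>x t. bary z x = 0 \<Longrightarrow> foot z (x + t *\<^sub>R unit_normal (facet z)) = x"
    by (rule normal_coeff[OF z]) blast
  have hS: "h y \<in> prism z \<and> m\<^sup>2 \<le> (q (foot z (h y)))\<^sup>2" if y: "y \<in> prism z" for y
  proof -
    obtain x t where xt: "y = x + t *\<^sub>R unit_normal (facet z)" "x \<in> facet z" "0 \<le> t" "t \<le> 1"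
      using y unfolding prism_def by blast
    have hy: "h y = h x + (\<theta> * t) *\<^sub>R unit_normal (facet z)" by (simp add: h_def xt(1) algebra_simps)
    have "h x = (1 - \<theta>) *\<^sub>R x0 + \<theta> *\<^sub>R x" by (simp add: h_def algebra_simps)
    then have hx: "h x \<in> facet z"
      using convexD_alt[OF convex_convex_hull x0 xt(2) \<theta>] by simp
    have "0 \<le> \<theta> * t" "\<theta> * t \<le> 1" using \<theta> xt by (auto intro: mult_le_one)
    then have "h y \<in> prism z" unfolding prism_def hy using hx by blast
    moreover have "foot z (h y) = h x" unfolding hy using hx c(2) by (simp add: facet_bary[OF z])
    moreover have "m\<^sup>2 \<le> (q (h x))\<^sup>2" using le[OF xt(2)] m 
      using power_mono[OF le[OF xt(2)] m, of 2] by (simp add: h_def)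
    ultimately show ?thesis by simp
  qed
  have "compact (h ` prism z)"
    unfolding h_def using closed_prism[OF z] bounded_prism[OF z]
    by (intro compact_continuous_image continuous_intros) (simp add: compact_eq_bounded_closed)
  then have hb: "h ` prism z \<in> sets borel" by (simp add: compact_imp_closed)
  have "\<theta> ^ CARD('n) * area z = measure lborel (h ` prism z)"
    using measure_homothety[OF \<theta>(1), of x0 "prism z"] hb by (simp add: area_def h_def measure_completion)
  then have "\<theta> ^ CARD('n) * area z * m\<^sup>2 = (\<integral>y. indicator (h ` prism z) y * m\<^sup>2 \<partial>lborel)"
    using hb by simp
  also have "\<dots> \<le> (\<integral>y. indicator (prism z) y * (q (foot z y))\<^sup>2 \<partial>lborel)"
  proof (rule integral_mono)
    show "integrable lborel (\<lambda>y. indicator (prism z) y * (q (foot z y))\<^sup>2)"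
      by (rule prism_integrable[OF z]) (intro continuous_intros q)
    have "emeasure lborel (h ` prism z) < \<infinity>"
      using emeasure_bounded_finite[OF compact_imp_bounded[OF \<open>compact (h ` prism z)\<close>]] by simp
    then show "integrable lborel (\<lambda>y. indicator (h ` prism z) y * m\<^sup>2)"
      using hb by simp
    show "indicator (h ` prism z) y * m\<^sup>2 \<le> indicator (prism z) y * (q (foot z y))\<^sup>2" for y
      using hS by (auto simp: indicator_def)
  qed
  also have "\<dots> = (LINT s|surface_measure (facet z). (q s)\<^sup>2)"
  proof (rule surface_integral[OF z, symmetric])
    show "(\<lambda>s. (q s)\<^sup>2) \<in> borel_measurable borel"
      by (intro borel_measurable_continuous_onI continuous_intros q)
  qed
  finally show ?thesis .
qed


text \<open>On the hyperplane of the facet the coordinates of its vertices add up to 1, so every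
  affine function is given by its vertex values \<open>d\<close> without a constant term. The
  product is the facet bubble.\<close>

definition facet_function :: "real ^ 'n \<Rightarrow> (real ^ 'n \<Rightarrow> real) \<Rightarrow> real \<Rightarrow> real ^ 'n \<Rightarrow> real" where
  "facet_function z0 d \<gamma> x = (\<Sum>z\<in>C - {z0}. d z * bary z x) + \<gamma> * (\<Prod>z\<in>C - {z0}. bary z x)"

lemma facet_function_continuous: "continuous_on S (facet_function z0 d \<gamma>)"
  unfolding facet_function_def by (intro continuous_intros bary_continuous) auto

lemma facet_line:
  assumes z0: "z0 \<in> C" and x0: "x0 \<in> facet z0" and x: "x \<in> facet z0" and z: "z \<in> C"
  shows "bary z (x0 + \<theta> *\<^sub>R (x - x0)) = (1 - \<theta>) * bary z x0 + \<theta> * bary z x"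
  unfolding bary_line[OF z] bary_grad_inner_diff[OF z] by (simp add: algebra_simps)

lemma bary_facet_bounds: assumes "z0 \<in> C" "x \<in> facet z0" "z \<in> C" shows "0 \<le> bary z x" "bary z x \<le> 1"
proof -
  have "x \<in> convex hull C" using assms(2) facet_subset_hull by blast
  then show "0 \<le> bary z x" "bary z x \<le> 1" using bary_le_1 assms(3) by (auto simp: hull_bary)
qed

lemma coefficient_estimate:
  assumes z0: "z0 \<in> C" and \<gamma>: "\<bar>\<gamma>\<bar> \<le> M" and d: "\<And>z. z \<in> C - {z0} \<Longrightarrow> \<bar>d z\<bar> \<le> M"
    and M: "M = \<bar>\<gamma>\<bar> \<or> (\<exists>v\<in>C - {z0}. M = \<bar>d v\<bar>)"
  shows "area z0 * M\<^sup>2 \<le> coefficient_bound CARD('n) *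
           (LINT s|surface_measure (facet z0). (facet_function z0 d \<gamma> s)\<^sup>2)"
proof -
  define D where "D = real CARD('n)"
  \<comment> \<open>A point halfway between the barycentre and any point of the facet has
    coordinates at least \<open>1 / (2 * D)\<close> at all facet vertices, so the bubble there is at
    least \<open>2 * c0\<close>.\<close>
  define c0 where "c0 = (1 / (2 * D)) ^ CARD('n) / 2"
  \<comment> \<open>Near a vertex, \<open>D + 1\<close> terms change by at most
    \<open>M * \<theta>\<close> each, which makes \<open>c0 * M / 2\<close> in total.\<close>
  define \<theta> where "\<theta> = c0 / (2 * (D + 1))"
  define J where "J = (LINT s|surface_measure (facet z0). (facet_function z0 d \<gamma> s)\<^sup>2)"
  let ?q = "facet_function z0 d \<gamma>"
  have D: "D \<ge> 2" using card_ge_2 by (simp add: D_def)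
  have cardC0: "card (C - {z0}) = CARD('n)" using card_C z0 fin by simp
  have c0: "0 < c0" using D by (simp add: c0_def)
  have "(1 / (2 * D)) ^ CARD('n) \<le> 1" using D by (intro power_le_one) auto
  then have c01: "c0 \<le> 1 / 2" by (simp add: c0_def)
  have \<theta>: "0 < \<theta>" "\<theta> \<le> 1 / 2" using c0 c01 D by (auto simp: \<theta>_def field_simps)
  have M0: "0 \<le> M" using \<gamma> by linarith
  have key: "\<theta> ^ CARD('n) * area z0 * (c0 * M / 2)\<^sup>2 \<le> J"
  proof (cases "\<exists>v\<in>C - {z0}. c0 * M \<le> \<bar>d v\<bar>")
    case True
    then obtain v where v: "v \<in> C" "v \<noteq> z0" "c0 * M \<le> \<bar>d v\<bar>" by blast
    have vF: "v \<in> facet z0" using v by (simp add: hull_inc)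
    \<comment> \<open>A second vertex \<open>w\<close> of the facet makes the bubble small near
      \<open>v\<close>, since \<open>bary w\<close> is one of its factors.\<close>
    have "card (C - {z0} - {v}) > 0" using v fin cardC0 D by (simp add: D_def)
    then obtain w where w: "w \<in> C" "w \<noteq> z0" "w \<noteq> v" by (auto simp: card_gt_0_iff)
    have "c0 * M / 2 \<le> \<bar>?q (v + \<theta> *\<^sub>R (x - v))\<bar>" if x: "x \<in> facet z0" for x
    proof -
      define y where "y = v + \<theta> *\<^sub>R (x - v)"
      have bry: "bary z y = (1 - \<theta>) * (if z = v then 1 else 0) + \<theta> * bary z x" if "z \<in> C" for z
        unfolding y_def facet_line[OF z0 vF x that] bary_vertex[OF that v(1)] ..
      note bx = bary_facet_bounds[OF z0 x]
      have "y = (1 - \<theta>) *\<^sub>R v + \<theta> *\<^sub>R x" by (simp add: y_def algebra_simps)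
      then have yF: "y \<in> facet z0"
        using convexD_alt[OF convex_convex_hull vF x, of \<theta>] \<theta> by simp
      have y1: "0 \<le> bary z y" "bary z y \<le> 1" if "z \<in> C" for z
        using bary_facet_bounds[OF z0 _ that] yF by auto
      have yw: "bary z y \<le> \<theta>" if "z \<in> C" "z \<noteq> v" for z
        using bry[OF that(1)] bx[OF that(1)] \<theta> that by (simp add: mult_left_le)
      have yv: "\<bar>bary v y - 1\<bar> \<le> \<theta>"
      proof -
        have "bary v y - 1 = - (\<theta> * (1 - bary v x))" using bry[OF v(1)] by (simp add: algebra_simps)
        moreover have "\<theta> * (1 - bary v x) \<le> \<theta> * 1" using bx[OF v(1)] \<theta> by (intro mult_left_mono) auto
        moreover have "0 \<le> \<theta> * (1 - bary v x)" using bx[OF v(1)] \<theta> by simp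
        ultimately show ?thesis by simp
      qed
      have pr: "\<bar>\<Prod>z\<in>C - {z0}. bary z y\<bar> \<le> \<theta>"
      proof -
        define Q where "Q = (\<Prod>z\<in>C - {z0} - {w}. bary z y)"
        have "(\<Prod>z\<in>C - {z0}. bary z y) = bary w y * Q"
          unfolding Q_def using w fin by (intro prod.remove) auto
        moreover have "0 \<le> Q" "Q \<le> 1" unfolding Q_def
          using y1 by (auto intro!: prod_nonneg prod_le_1)
        then have "bary w y * Q \<le> \<theta> * 1" "0 \<le> bary w y * Q"
          using yw[OF w(1,3)] y1[OF w(1)] \<theta> by (auto intro!: mult_mono mult_nonneg_nonneg simp del: mult_1_right)
        ultimately show ?thesis by simp
      qed
      have "?q y - d v = d v * (bary v y - 1) + (\<Sum>z\<in>C - {z0} - {v}. d z * bary z y) + \<gamma> * (\<Prod>z\<in>C - {z0}. bary z y)"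
        unfolding facet_function_def
        using v fin sum.remove[of "C - {z0}" v "\<lambda>z. d z * bary z y"] by (simp add: algebra_simps)
      also have "\<bar>\<dots>\<bar> \<le> M * \<theta> + (\<Sum>z\<in>C - {z0} - {v}. M * \<theta>) + M * \<theta>"
      proof -
        have "\<bar>\<Sum>z\<in>C - {z0} - {v}. d z * bary z y\<bar> \<le> (\<Sum>z\<in>C - {z0} - {v}. M * \<theta>)"
          using d y1 yw M0 by (intro order_trans[OF sum_abs] sum_mono) (auto simp: abs_mult intro!: mult_mono)
        moreover have "\<bar>d v * (bary v y - 1)\<bar> \<le> M * \<theta>"
          unfolding abs_mult using d v yv M0 by (intro mult_mono) auto
        moreover have "\<bar>\<gamma> * (\<Prod>z\<in>C - {z0}. bary z y)\<bar> \<le> M * \<theta>"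
          unfolding abs_mult using \<gamma> pr M0 by (intro mult_mono) auto
        ultimately show ?thesis by linarith
      qed
      also have "\<dots> = (D + 1) * (M * \<theta>)"
        using v fin cardC0 card_ge_2 by (simp add: D_def algebra_simps of_nat_diff)
      also have "\<dots> = c0 * M / 2" using D by (simp add: \<theta>_def field_simps)
      finally show ?thesis using v(3) unfolding y_def by linarith
    qed
    then show ?thesis unfolding J_def
      using \<theta> c0 M0 by (intro surface_integral_square_lower[OF z0 vF] facet_function_continuous) auto
  next
    case False
    \<comment> \<open>Now the largest coefficient has to be that of the bubble, and the affine part
      is at most \<open>c0 * M\<close> on the facet.\<close>
    then have small: "\<bar>d v\<bar> < c0 * M" if "v \<in> C - {z0}" for v using that by force
    have Mpos: "0 < M"
    proof -
      obtain v where "v \<in> C - {z0}" using C_other z0 by blast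
      then have "0 < c0 * M" using small by (meson abs_ge_zero le_less_trans)
      then show ?thesis using c0 by (simp add: zero_less_mult_iff)
    qed
    have "c0 * M \<le> M" using c01 Mpos by (simp add: mult_le_cancel_right1)
    then have Mg: "M = \<bar>\<gamma>\<bar>" using M small by force
    define x0 where "x0 = (\<Sum>z\<in>C - {z0}. (1 / D) *\<^sub>R z)"
    have s1: "(\<Sum>z\<in>C - {z0}. 1 / D) = 1" using cardC0 D by (simp add: D_def)
    note fx0 = facet_comb[OF z0 s1 x0_def[symmetric]]
    have x0F: "x0 \<in> facet z0" unfolding facet_bary[OF z0] using fx0 D by (auto, metis DiffI divide_nonneg_nonneg fx0(1) of_nat_0_le_iff D_def singletonD zero_le_one order_refl)
    have "c0 * M / 2 \<le> \<bar>?q (x0 + (1/2) *\<^sub>R (x - x0))\<bar>" if x: "x \<in> facet z0" for x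
    proof -
      define y where "y = x0 + (1/2) *\<^sub>R (x - x0)"
      have bry: "bary z y = (1 / 2) * bary z x0 + (1 / 2) * bary z x" if "z \<in> C" for z
        unfolding y_def using facet_line[OF z0 x0F x that, of "1/2"] by simp
      note bx = bary_facet_bounds[OF z0 x]
      have low: "1 / (2 * D) \<le> bary z y" if "z \<in> C - {z0}" for z
        using bry[of z] fx0(2)[OF that] bx[of z] that by auto
      have hi: "0 \<le> bary z y" if "z \<in> C - {z0}" for z
        using order_trans[OF _ low[OF that], of 0] D by simp
      have sum1: "(\<Sum>z\<in>C - {z0}. bary z y) = 1"
      proof (rule sum_bary_facet[OF z0])
        show "bary z0 y = 0" using bry[OF z0] fx0(1) x by (simp add: facet_bary[OF z0])
      qed
      have "(1 / (2 * D)) ^ CARD('n) = (\<Prod>z\<in>C - {z0}. 1 / (2 * D))" by (simp add: cardC0)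
      also have "\<dots> \<le> (\<Prod>z\<in>C - {z0}. bary z y)" using low D by (intro prod_mono) auto
      finally have "2 * c0 \<le> (\<Prod>z\<in>C - {z0}. bary z y)" by (simp add: c0_def)
      then have "M * (2 * c0) \<le> \<bar>\<gamma> * (\<Prod>z\<in>C - {z0}. bary z y)\<bar>"
        unfolding abs_mult Mg[symmetric] using c0 M0 by (intro mult_left_mono) auto
      moreover have "\<bar>\<Sum>z\<in>C - {z0}. d z * bary z y\<bar> \<le> (\<Sum>z\<in>C - {z0}. (c0 * M) * bary z y)"
      proof (intro order_trans[OF sum_abs] sum_mono)
        fix z assume z: "z \<in> C - {z0}"
        show "\<bar>d z * bary z y\<bar> \<le> c0 * M * bary z y"
          using mult_right_mono[OF less_imp_le[OF small[OF z]] hi[OF z]] hi[OF z] by (simp add: abs_mult)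
      qed
      then have "\<bar>\<Sum>z\<in>C - {z0}. d z * bary z y\<bar> \<le> c0 * M"
        by (simp add: sum1 flip: sum_distrib_left)
      ultimately have "c0 * M \<le> \<bar>?q y\<bar>" unfolding facet_function_def by (simp add: algebra_simps)
      moreover have "c0 * M / 2 \<le> c0 * M" using c0 M0 by simp
      ultimately show ?thesis unfolding y_def by linarith
    qed
    \<comment> \<open>The ratio 1/2 that works here is weakened to the smaller
      \<open>\<theta>\<close> of the other case.\<close>
    then have "(1/2) ^ CARD('n) * area z0 * (c0 * M / 2)\<^sup>2 \<le> J" unfolding J_def
      using c0 M0 by (intro surface_integral_square_lower[OF z0 x0F] facet_function_continuous) auto
    moreover have "\<theta> ^ CARD('n) \<le> (1/2) ^ CARD('n)" using \<theta> by (intro power_mono) auto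
    then have "\<theta> ^ CARD('n) * area z0 * (c0 * M / 2)\<^sup>2 \<le> (1/2) ^ CARD('n) * area z0 * (c0 * M / 2)\<^sup>2"
      using area_nonneg by (intro mult_right_mono) auto
    ultimately show ?thesis by linarith
  qed
  have cb: "coefficient_bound CARD('n) = (2 / c0)\<^sup>2 / \<theta> ^ CARD('n)"
    by (simp add: coefficient_bound_def Let_def D_def c0_def \<theta>_def)
  have "area z0 * M\<^sup>2 = (2 / c0)\<^sup>2 / \<theta> ^ CARD('n) * (\<theta> ^ CARD('n) * area z0 * (c0 * M / 2)\<^sup>2)"
    using c0 \<theta> by (simp add: field_simps power2_eq_square)
  also have "\<dots> \<le> coefficient_bound CARD('n) * J"
    unfolding cb using key c0 \<theta> by (intro mult_left_mono) auto
  finally show ?thesis by (simp add: J_def)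
qed

end

subsection \<open>Fluxes through one facet\<close>

text \<open>The square makes the ramp continuously differentiable, as \<open>C1_compose\<close>
  requires. Evaluated at \<open>bary z0\<close>, it confines a field to a layer of relative
  thickness \<open>1 / s\<close> along the facet.\<close>

definition cutoff :: "real \<Rightarrow> real \<Rightarrow> real" where "cutoff s t = (max 0 (1 - s * t))\<^sup>2"

definition cutoff' :: "real \<Rightarrow> real \<Rightarrow> real" where "cutoff' s t = - (2 * s * max 0 (1 - s * t))"

lemma cutoff_deriv: "(cutoff s has_real_derivative cutoff' s t) (at t)"
proof -
  have pos: "((\<lambda>u. (max 0 u)\<^sup>2) has_real_derivative 2 * max 0 u) (at u)" for u :: real
  proof (cases "u = 0")
    case True
    have "((\<lambda>h. ((max 0 h)\<^sup>2 - 0) / h) \<longlongrightarrow> 0) (at (0::real))"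
    proof (rule Lim_null_comparison)
      have "norm (((max 0 h)\<^sup>2 - 0) / h) \<le> \<bar>h\<bar>" for h :: real
        by (cases "h \<le> 0") (auto simp: max_def power2_eq_square)
      then show "\<forall>\<^sub>F h in at (0::real). norm (((max 0 h)\<^sup>2 - 0) / h) \<le> \<bar>h\<bar>" by simp
      show "((\<lambda>h. \<bar>h\<bar>) \<longlongrightarrow> 0) (at (0::real))" by (intro tendsto_eq_intros) auto
    qed
    then show ?thesis using True by (simp add: has_field_derivative_iff)
  next
    case False
    show ?thesis
    proof (cases "u > 0")
      case True
      have "eventually (\<lambda>v::real. 0 < v) (nhds u)" using True eventually_nhds_in_open[OF open_greaterThan, of u 0] by simp
      then have "eventually (\<lambda>v. (max 0 v)\<^sup>2 = v\<^sup>2) (nhds u)" by eventually_elim simp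
      moreover have "((\<lambda>v. v\<^sup>2) has_real_derivative 2 * max 0 u) (at u)" using True by (auto intro!: derivative_eq_intros)
      ultimately show ?thesis by (subst DERIV_cong_ev[OF refl _ refl]) auto
    next
      case nF: False
      then have un: "u < 0" using False by simp
      then have "eventually (\<lambda>v::real. v < 0) (nhds u)" using eventually_nhds_in_open[OF open_lessThan, of u 0] by simp
      then have "eventually (\<lambda>v. (max 0 v)\<^sup>2 = (0::real)) (nhds u)" by eventually_elim simp
      moreover have "((\<lambda>v. 0) has_real_derivative 2 * max 0 u) (at u)" using un by (auto intro!: derivative_eq_intros)
      ultimately show ?thesis by (subst DERIV_cong_ev[OF refl _ refl]) auto
    qed
  qed
  have "((\<lambda>t. 1 - s * t) has_real_derivative (- s)) (at t)" by (auto intro!: derivative_eq_intros)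
  from DERIV_chain2[OF pos this] show ?thesis
    unfolding cutoff_def[abs_def] cutoff'_def by (rule DERIV_cong) (simp add: algebra_simps)
qed

lemma cutoff'_continuous: "continuous_on UNIV (cutoff' s)"
  unfolding cutoff'_def by (intro continuous_intros)

lemma cutoff_bounds: "0 \<le> s \<Longrightarrow> 0 \<le> t \<Longrightarrow> 0 \<le> cutoff s t" "0 \<le> s \<Longrightarrow> 0 \<le> t \<Longrightarrow> cutoff s t \<le> 1"
  and cutoff'_bound: "0 \<le> s \<Longrightarrow> 0 \<le> t \<Longrightarrow> \<bar>cutoff' s t\<bar> \<le> 2 * s"
  and cutoff_0: "cutoff s 0 = 1"
  and cutoff_support: "1 \<le> s * t \<Longrightarrow> cutoff s t = 0" "1 \<le> s * t \<Longrightarrow> cutoff' s t = 0"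
proof -
  assume "0 \<le> s" "0 \<le> t"
  then have st: "0 \<le> s * t" by simp
  then have m: "0 \<le> max 0 (1 - s * t)" "max 0 (1 - s * t) \<le> 1" by auto
  then show "0 \<le> cutoff s t" "cutoff s t \<le> 1" by (auto simp: cutoff_def power_le_one)
  have "s * max 0 (1 - s * t) \<le> s * 1" using m \<open>0 \<le> s\<close> by (intro mult_left_mono) auto
  moreover have "0 \<le> s * max 0 (1 - s * t)" using m \<open>0 \<le> s\<close> by simp
  ultimately show "\<bar>cutoff' s t\<bar> \<le> 2 * s" by (simp add: cutoff'_def)
qed (auto simp: cutoff_def cutoff'_def)

context simplex_element
begin

text \<open>A combination of the edge fields of \<open>facet_green\<close>: the normal component is
  the sum of \<open>bary z * g z\<close> on the facet opposite \<open>z0\<close> and zero on all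
  others. With all coefficients equal to 1 this is the Raviart-Thomas field, \<open>x - z0\<close>
  divided by \<open>height z0\<close>.\<close>

definition flux :: "real ^ 'n \<Rightarrow> (real ^ 'n \<Rightarrow> real ^ 'n \<Rightarrow> real) \<Rightarrow> real ^ 'n \<Rightarrow> real ^ 'n" where
  "flux z0 g x = (1 / height z0) *\<^sub>R (\<Sum>z\<in>C - {z0}. (bary z x * g z x) *\<^sub>R (z - z0))"

text \<open>The classical divergence of \<open>flux\<close>, because
  \<open>bary_grad z \<bullet> (z - z0) = 1\<close>; \<open>g'\<close> supplies the gradients of the
  coefficients.\<close>

definition flux_div :: "real ^ 'n \<Rightarrow> (real ^ 'n \<Rightarrow> real ^ 'n \<Rightarrow> real) \<Rightarrow>
    (real ^ 'n \<Rightarrow> real ^ 'n \<Rightarrow> real ^ 'n) \<Rightarrow> real ^ 'n \<Rightarrow> real" where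
  "flux_div z0 g g' x = (1 / height z0) * (\<Sum>z\<in>C - {z0}. g z x + bary z x * (g' z x \<bullet> (z - z0)))"

lemma integrable_continuous_T:
  fixes f :: "real ^ 'n \<Rightarrow> 'b::euclidean_space"
  assumes "continuous_on UNIV f"
  shows "integrable (lebesgue_on T) f"
proof -
  have "compact (closure T)" using bounded_T by simp
  then obtain B where "\<And>x. x \<in> closure T \<Longrightarrow> norm (f x) \<le> B"
    using compact_imp_bounded[OF compact_continuous_image[OF continuous_on_subset[OF assms subset_UNIV], of "closure T"]]
    by (auto simp: bounded_iff)
  moreover have "f \<in> borel_measurable (lebesgue_on T)"
    using borel_measurable_continuous_onI[OF assms] by (intro measurable_restrict_space1 measurable_completion) simp
  ultimately show ?thesis
    using closure_subset by (intro integrable_bounded_on[OF T_lmeasurable, of f B]) auto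
qed

text \<open>In this form the later arguments express that the normal component lives on one facet:
  the identity holds for every C1 function \<open>k\<close>, with no further boundary term.\<close>

lemma flux_green:
  assumes z0: "z0 \<in> C" and g: "\<And>z. z \<in> C - {z0} \<Longrightarrow> C1_with_gradient (g z) (g' z)"
    and k: "C1_with_gradient k k'"
  shows "(LINT x|lebesgue_on T. flux_div z0 g g' x * k x + flux z0 g x \<bullet> k' x) =
    (LINT s|surface_measure (facet z0). (\<Sum>z\<in>C - {z0}. bary z s * g z s) * k s)"
proof -
  define G where "G z x = g z x * k x + bary z x * ((g z x *\<^sub>R k' x + k x *\<^sub>R g' z x) \<bullet> (z - z0))" for z x
  have G: "(LINT x|lebesgue_on T. G z x) = height z0 * (LINT s|surface_measure (facet z0). bary z s * (g z s * k s))"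
    if z: "z \<in> C - {z0}" for z
    unfolding G_def using z by (intro facet_green[OF z0 _ _ C1_mult[OF g[OF z] k]]) auto
  have Gc: "continuous_on UNIV (G z)" if z: "z \<in> C - {z0}" for z
    unfolding G_def using z C1_continuous[OF g[OF z]] C1_continuous_gradient[OF g[OF z]]
    by (intro continuous_intros bary_continuous C1_continuous[OF k] C1_continuous_gradient[OF k]) auto
  have gc: "continuous_on UNIV (\<lambda>s. bary z s * (g z s * k s))" if z: "z \<in> C - {z0}" for z
    using z C1_continuous[OF g[OF z]] by (intro continuous_intros bary_continuous C1_continuous[OF k]) auto
  have "(LINT x|lebesgue_on T. flux_div z0 g g' x * k x + flux z0 g x \<bullet> k' x) =
      (LINT x|lebesgue_on T. (1 / height z0) * (\<Sum>z\<in>C - {z0}. G z x))"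
  proof (rule Bochner_Integration.integral_cong[OF refl])
    fix x
    have "G z x = (g z x + bary z x * (g' z x \<bullet> (z - z0))) * k x + (bary z x * g z x) *\<^sub>R (z - z0) \<bullet> k' x" for z
      unfolding G_def inner_add_left inner_scaleR_left inner_commute[of "k' x"] by (simp only: algebra_simps)
    then have "(\<Sum>z\<in>C - {z0}. G z x) =
        (\<Sum>z\<in>C - {z0}. g z x + bary z x * (g' z x \<bullet> (z - z0))) * k x +
        (\<Sum>z\<in>C - {z0}. (bary z x * g z x) *\<^sub>R (z - z0)) \<bullet> k' x"
      by (simp only: sum_distrib_right inner_sum_left sum.distrib[symmetric])
    then show "flux_div z0 g g' x * k x + flux z0 g x \<bullet> k' x = (1 / height z0) * (\<Sum>z\<in>C - {z0}. G z x)"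
      by (simp add: flux_def flux_div_def add_divide_distrib)
  qed
  also have "\<dots> = (1 / height z0) * (\<Sum>z\<in>C - {z0}. (LINT x|lebesgue_on T. G z x))"
    using integrable_continuous_T[OF Gc] by (simp add: Bochner_Integration.integral_sum)
  also have "\<dots> = (\<Sum>z\<in>C - {z0}. (LINT s|surface_measure (facet z0). bary z s * (g z s * k s)))"
    using G height_pos[OF z0] by (simp add: sum_distrib_left)
  also have "\<dots> = (LINT s|surface_measure (facet z0). (\<Sum>z\<in>C - {z0}. bary z s * (g z s * k s)))"
    by (rule surface_integral_sum[OF z0 gc, symmetric])
  finally show ?thesis by (simp add: sum_distrib_right mult.assoc)
qed

lemma flux_continuous:
  assumes "z0 \<in> C" "\<And>z. z \<in> C - {z0} \<Longrightarrow> C1_with_gradient (g z) (g' z)"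
  shows "continuous_on S (flux z0 g)"
  unfolding flux_def using assms
  by (intro continuous_intros bary_continuous C1_continuous) auto

lemma flux_div_continuous:
  assumes "z0 \<in> C" "\<And>z. z \<in> C - {z0} \<Longrightarrow> C1_with_gradient (g z) (g' z)"
  shows "continuous_on S (flux_div z0 g g')"
proof -
  have "continuous_on S (g z)" "continuous_on S (g' z)" "continuous_on S (bary z)" if "z \<in> C - {z0}" for z
    using C1_continuous[OF assms(2)[OF that]] C1_continuous_gradient[OF assms(2)[OF that]] bary_continuous that by auto
  then show ?thesis unfolding flux_div_def by (intro continuous_intros) auto
qed

lemma measure_T_pos: "0 < measure lebesgue T"
proof -
  have "\<not> negligible T" using T_nonempty open_T open_not_negligible by blast
  then show ?thesis using T_lmeasurable by (metis negligible_iff_measure zero_less_measure_iff)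
qed

text \<open>With d the dimension and h the diameter, d times the volume is
  \<open>height z0 * area z0\<close>, the area is at most 4^d h^(d-1), and shape regularity bounds
  h^d by the volume. Cancelling powers leaves h against the height.\<close>

lemma diameter_le_height:
  assumes z0: "z0 \<in> C" and \<kappa>: "diameter T ^ CARD('n) / measure lebesgue T \<le> \<kappa>"
  shows "diameter T \<le> \<kappa> * 4 ^ CARD('n) * height z0" "0 < \<kappa>"
proof -
  define h where "h = diameter T"
  have h: "0 < h" using diameter_pos by (simp add: h_def)
  have hk: "h ^ CARD('n) \<le> \<kappa> * measure lebesgue T"
    using \<kappa> measure_T_pos by (simp add: h_def field_simps)
  then show kp: "0 < \<kappa>" using h measure_T_pos by (metis less_le_trans zero_less_power zero_less_mult_pos2)
  have "area z0 \<le> 4 ^ CARD('n) * h ^ (CARD('n) - 1)"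
  proof (rule area_le[OF z0 h])
    fix x y assume "x \<in> facet z0" "y \<in> facet z0"
    then show "norm (x - y) \<le> h"
      unfolding h_def using facet_subset_hull[of z0] by (intro norm_diff_hull_le_diameter) auto
  qed
  then have "height z0 * area z0 \<le> height z0 * (4 ^ CARD('n) * h ^ (CARD('n) - 1))"
    using height_pos[OF z0] by (intro mult_left_mono) auto
  moreover have "measure lebesgue T \<le> real CARD('n) * measure lebesgue T"
    using card_ge_2 measure_T_pos by (simp add: mult_le_cancel_right1)
  ultimately have "measure lebesgue T \<le> height z0 * (4 ^ CARD('n) * h ^ (CARD('n) - 1))"
    using volume_height_area[OF z0] by linarith
  then have "\<kappa> * measure lebesgue T \<le> \<kappa> * (height z0 * (4 ^ CARD('n) * h ^ (CARD('n) - 1)))"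
    using kp by (intro mult_left_mono) auto
  with hk have "h * h ^ (CARD('n) - 1) \<le> (\<kappa> * 4 ^ CARD('n) * height z0) * h ^ (CARD('n) - 1)"
    using card_ge_2 by (simp add: power_eq_if[of h "CARD('n)"] algebra_simps)
  then show "diameter T \<le> \<kappa> * 4 ^ CARD('n) * height z0" using h by (simp add: h_def)
qed

text \<open>Supremum squared times the volume of the layer, which \<open>volume_height_area\<close>
  expresses through the facet.\<close>

lemma square_integral_layer:
  fixes f :: "real ^ 'n \<Rightarrow> 'b::euclidean_space"
  assumes z0: "z0 \<in> C" and f: "continuous_on UNIV f" and t: "0 < t" "t \<le> 1"
    and bnd: "\<And>x. x \<in> T \<Longrightarrow> norm (f x) \<le> B" and B: "0 \<le> B"
    and supp: "\<And>x. x \<in> T \<Longrightarrow> t \<le> bary z0 x \<Longrightarrow> f x = 0"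
  shows "(LINT x|lebesgue_on T. (norm (f x))\<^sup>2) \<le> B\<^sup>2 * (t * (height z0 * area z0))"
proof -
  let ?L = "{x \<in> T. bary z0 x < t}"
  have "open {x. bary z0 x < t}" by (intro open_Collect_less bary_continuous[OF z0] continuous_intros)
  then have "open (T \<inter> {x. bary z0 x < t})" using open_T by blast
  then have Lop: "open ?L" by (simp add: Int_def)
  have Lm: "?L \<in> lmeasurable" using Lop bounded_subset[OF bounded_T] by (intro lmeasurable_open) auto
  have "(LINT x|lebesgue_on T. (norm (f x))\<^sup>2) \<le> (LINT x|lebesgue_on T. B\<^sup>2 * indicat_real ?L x)"
  proof (rule integral_mono)
    show "integrable (lebesgue_on T) (\<lambda>x. (norm (f x))\<^sup>2)"
      by (rule integrable_continuous_T) (intro continuous_intros f)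
    show "integrable (lebesgue_on T) (\<lambda>x. B\<^sup>2 * indicat_real ?L x)"
      using fmeasurableD[OF Lm]
      by (intro integrable_mult_right integrable_bounded_on[OF T_lmeasurable, of _ 1] measurable_restrict_space1
        borel_measurable_indicator) (auto simp: indicator_def)
    show "(norm (f x))\<^sup>2 \<le> B\<^sup>2 * indicat_real ?L x" if "x \<in> space (lebesgue_on T)" for x
    proof (cases "x \<in> ?L")
      case True then show ?thesis using bnd[of x] by (simp add: power_mono)
    next
      case False then show ?thesis using supp[of x] that by (simp add: not_less)
    qed
  qed
  also have "\<dots> = B\<^sup>2 * measure lebesgue ?L"
  proof -
    have "(LINT x|lebesgue_on T. indicat_real ?L x) = measure (lebesgue_on T) (?L \<inter> space (lebesgue_on T))" by simp
    also have "?L \<inter> space (lebesgue_on T) = ?L" by auto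
    also have "measure (lebesgue_on T) ?L = measure lebesgue ?L"
      using T_lmeasurable by (intro measure_restrict_space) (auto simp: fmeasurableD)
    finally show ?thesis by simp
  qed
  also have "\<dots> \<le> B\<^sup>2 * (real CARD('n) * t * measure lebesgue T)"
    by (intro mult_left_mono layer_measure[OF z0 t]) auto
  also have "\<dots> = B\<^sup>2 * (t * (height z0 * area z0))"
    using volume_height_area[OF z0] by (metis mult.assoc mult.commute)
  finally show ?thesis .
qed

lemma norm_vertex_diff: "z \<in> C \<Longrightarrow> y \<in> C \<Longrightarrow> norm (z - y) \<le> diameter T"
  by (intro norm_diff_hull_le_diameter C_hull)

lemma T_bary_bounds: assumes "x \<in> T" "z \<in> C" shows "0 \<le> bary z x" "bary z x \<le> 1"
proof -
  have "x \<in> convex hull C" using assms(1) T_subset_hull by blast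
  then show "0 \<le> bary z x" "bary z x \<le> 1" using bary_le_1 assms(2) by (auto simp: hull_bary)
qed

lemma sum_bary_le_1: assumes "x \<in> T" "z0 \<in> C" shows "(\<Sum>z\<in>C - {z0}. bary z x) \<le> 1"
  using sum.remove[OF fin assms(2), of "\<lambda>z. bary z x"] bary_sum[of x] T_bary_bounds[OF assms] by simp

text \<open>In \<open>T\<close> the coordinates of the facet vertices sum to at most 1, so the
  number of edge fields does not enter the bound.\<close>

lemma flux_bound:
  assumes z0: "z0 \<in> C" and x: "x \<in> T" and B: "\<And>z. z \<in> C - {z0} \<Longrightarrow> \<bar>g z x\<bar> \<le> B" "0 \<le> B"
  shows "norm (flux z0 g x) \<le> B * diameter T / height z0"
proof -
  have "norm (\<Sum>z\<in>C - {z0}. (bary z x * g z x) *\<^sub>R (z - z0)) \<le> (\<Sum>z\<in>C - {z0}. bary z x * (B * diameter T))"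
  proof (intro order_trans[OF norm_sum] sum_mono)
    fix z assume z: "z \<in> C - {z0}"
    have "\<bar>g z x\<bar> * norm (z - z0) \<le> B * diameter T"
      using B(1)[OF z] B(2) norm_vertex_diff z z0 by (intro mult_mono) auto
    then show "norm ((bary z x * g z x) *\<^sub>R (z - z0)) \<le> bary z x * (B * diameter T)"
      using T_bary_bounds[OF x, of z] z by (simp add: abs_mult mult.assoc mult_left_mono)
  qed
  also have "\<dots> = (\<Sum>z\<in>C - {z0}. bary z x) * (B * diameter T)" by (simp add: sum_distrib_right)
  also have "\<dots> \<le> 1 * (B * diameter T)"
    using sum_bary_le_1[OF x z0] B(2) diameter_pos by (intro mult_right_mono) auto
  finally show ?thesis using height_pos[OF z0] by (simp add: flux_def divide_right_mono)
qed

end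

section \<open>Fields with prescribed normal component on one facet\<close>

context simplex_element
begin

text \<open>The facet bubble without the factor \<open>bary z\<close>. It involves neither
  \<open>z0\<close> nor \<open>z\<close>, hence is constant along \<open>z - z0\<close>; as
  coefficient of that edge field it adds only its own value to the divergence.\<close>

definition others_prod :: "real ^ 'n \<Rightarrow> real ^ 'n \<Rightarrow> real ^ 'n \<Rightarrow> real" where
  "others_prod z0 z x = (\<Prod>y\<in>C - {z0, z}. bary y x)"

lemma others_prod_C1:
  assumes z0: "z0 \<in> C"
  obtains p' where "C1_with_gradient (others_prod z0 z) p'" "\<And>x. z \<in> C \<Longrightarrow> p' x \<bullet> (z - z0) = 0"
proof -
  define p' where "p' x = (\<Sum>i\<in>C - {z0, z}. (\<Prod>j\<in>C - {z0, z} - {i}. bary j x) *\<^sub>R bary_grad i)" for x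
  have "C1_with_gradient (others_prod z0 z) p'"
    unfolding others_prod_def p'_def using fin by (intro C1_prod C1_bary) auto
  moreover have "p' x \<bullet> (z - z0) = 0" if "z \<in> C" for x
    unfolding p'_def inner_sum_left using z0 that by (intro sum.neutral) (auto simp: bary_grad_diff)
  ultimately show ?thesis using that by blast
qed

lemma others_prod_mult: "z \<in> C - {z0} \<Longrightarrow> bary z x * others_prod z0 z x = (\<Prod>y\<in>C - {z0}. bary y x)"
  unfolding others_prod_def using fin prod.remove[of "C - {z0}" z "\<lambda>y. bary y x"]
  by (simp add: Diff_insert2[symmetric] insert_commute)

lemma others_prod_bounds:
  assumes "\<And>y. y \<in> C \<Longrightarrow> 0 \<le> bary y x" "\<And>y. y \<in> C \<Longrightarrow> bary y x \<le> 1"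
  shows "0 \<le> others_prod z0 z x" "others_prod z0 z x \<le> 1"
  unfolding others_prod_def using assms by (auto intro!: prod_nonneg prod_le_1)

lemma edge_gradient:
  assumes "z0 \<in> C" "z \<in> C - {z0}"
  shows "bary_grad z0 \<bullet> (z - z0) = - 1" "bary_grad z \<bullet> (z - z0) = 1"
  using assms by (auto simp: bary_grad_diff)

lemma card_C0: "z0 \<in> C \<Longrightarrow> card (C - {z0}) = CARD('n)" using card_C fin by simp

text \<open>
  The coefficients come from solving for constant divergence. In three dimensions, with
  \<open>s = 1 - bary z0\<close> and \<open>e\<close> the second elementary symmetric polynomial of the other coordinates, the
  products contribute \<open>e\<close>, and subtracting half of the fields \<open>bary z0 * bary z\<close> trades it for
  a polynomial in \<open>s\<close> alone.
\<close>

definition bubble_divergence :: real where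
  "bubble_divergence = (if card C = 3 then 1/3 else 1/20)"

lemma facet_bubble_field:
  assumes z0: "z0 \<in> C"
  obtains ge ge' where
    "\<And>z. z \<in> C - {z0} \<Longrightarrow> C1_with_gradient (ge z) (ge' z)"
    "\<And>z x. z \<in> C - {z0} \<Longrightarrow> x \<in> T \<Longrightarrow> \<bar>ge z x\<bar> \<le> 2"
    "\<And>x. (\<Sum>z\<in>C - {z0}. ge z x + bary z x * (ge' z x \<bullet> (z - z0))) = bubble_divergence"
    "\<And>x. bary z0 x = 0 \<Longrightarrow> (\<Sum>z\<in>C - {z0}. bary z x * ge z x) = (\<Prod>z\<in>C - {z0}. bary z x)"
proof -
  have "\<forall>z. \<exists>p'. C1_with_gradient (others_prod z0 z) p' \<and> (\<forall>x. z \<in> C \<longrightarrow> p' x \<bullet> (z - z0) = 0)"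
    using others_prod_C1[OF z0] by metis
  then obtain p' where p': "\<And>z. C1_with_gradient (others_prod z0 z) (p' z)"
    "\<And>z x. z \<in> C \<Longrightarrow> p' z x \<bullet> (z - z0) = 0" by metis
  define D where "D = real CARD('n)"
  have D: "D = 2 \<or> D = 3" using dim by (auto simp: D_def)
  define a b c :: real where "a = (if D = 2 then 1/3 else 7/20)"
    and "b = (if D = 2 then 0 else - 3/10)" and "c = (if D = 2 then 0 else - 1/2)"
  define r where "r z x = a + b * bary z0 x + c * bary z x" for z x
  \<comment> \<open>Equal shares of the products already yield the bubble on the facet. The
    correction has the factor \<open>bary z0\<close>, so it alters the divergence but not the
    trace.\<close>
  define ge where "ge z x = (1 / D) * (others_prod z0 z x + bary z0 x * r z x)" for z x
  define ge' where "ge' z x = (1 / D) *\<^sub>R (p' z x + (bary z0 x *\<^sub>R (b *\<^sub>R bary_grad z0 + c *\<^sub>R bary_grad z)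
      + r z x *\<^sub>R bary_grad z0))" for z x
  have 1: "C1_with_gradient (ge z) (ge' z)" if "z \<in> C - {z0}" for z
  proof -
    have "C1_with_gradient (r z) (\<lambda>x. 0 + b *\<^sub>R bary_grad z0 + c *\<^sub>R bary_grad z)"
      unfolding r_def using z0 that by (intro C1_add C1_const C1_cmult C1_bary) auto
    then show ?thesis unfolding ge_def ge'_def using p'(1)[of z] z0
      by (intro C1_cmult C1_add C1_mult[OF C1_bary[OF z0], where g' = "\<lambda>x. b *\<^sub>R bary_grad z0 + c *\<^sub>R bary_grad z"]) auto
  qed
  have 2: "\<bar>ge z x\<bar> \<le> 2" if z: "z \<in> C - {z0}" and x: "x \<in> T" for z x
  proof -
    note bz = T_bary_bounds[OF x]
    have o: "0 \<le> others_prod z0 z x" "others_prod z0 z x \<le> 1" using others_prod_bounds bz by auto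
    have "\<bar>r z x\<bar> \<le> 2" using bz[OF z0] bz[of z] z D by (auto simp: r_def a_def b_def c_def abs_le_iff)
    then have "\<bar>bary z0 x * r z x\<bar> \<le> 1 * 2" unfolding abs_mult using bz[OF z0] by (intro mult_mono) auto
    then have "\<bar>others_prod z0 z x + bary z0 x * r z x\<bar> \<le> 3" using o by linarith
    moreover have "\<bar>ge z x\<bar> = \<bar>others_prod z0 z x + bary z0 x * r z x\<bar> / D" using D by (auto simp: ge_def)
    ultimately show ?thesis using D by auto
  qed
  have k0: "bubble_divergence = (if D = 2 then 1/3 else 1/20 :: real)"
    using D card_C by (auto simp: bubble_divergence_def D_def)
  have 4: "(\<Sum>z\<in>C - {z0}. ge z x + bary z x * (ge' z x \<bullet> (z - z0))) = bubble_divergence" for x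
  proof -
    define t where "t z = others_prod z0 z x + bary z0 x * r z x + bary z x * (bary z0 x * (c - b) - r z x)" for z
    have "ge z x + bary z x * (ge' z x \<bullet> (z - z0)) = (1 / D) * t z" if z: "z \<in> C - {z0}" for z
    proof -
      have "ge' z x \<bullet> (z - z0) = (1 / D) * (bary z0 x * (c - b) - r z x)"
        using p'(2)[of z x] edge_gradient[OF z0 z] z
        by (simp add: ge'_def inner_add_left algebra_simps del: inner_diff_right)
      then show ?thesis unfolding ge_def t_def by (simp only:) (simp add: algebra_simps)
    qed
    then have S: "(\<Sum>z\<in>C - {z0}. ge z x + bary z x * (ge' z x \<bullet> (z - z0))) = (1 / D) * (\<Sum>z\<in>C - {z0}. t z)"
      by (simp add: sum_distrib_left)
    have b0: "bary z0 x = 1 - (\<Sum>z\<in>C - {z0}. bary z x)"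
      using sum.remove[OF fin z0, of "\<lambda>z. bary z x"] bary_sum[of x] by simp
    show ?thesis
    proof (cases "D = 2")
      case True
      then have "card (C - {z0}) = 2" using card_C0[OF z0] by (simp add: D_def)
      then obtain u v where uv: "C - {z0} = {u, v}" "u \<noteq> v" by (meson card_2_iff)
      have "C - {z0, u} = {v}" "C - {z0, v} = {u}" using uv by auto
      then have "t u + t v = 2 / 3" using b0 uv True
        by (simp add: t_def others_prod_def r_def a_def b_def c_def algebra_simps)
      then show ?thesis unfolding S using uv True by (simp add: k0)
    next
      case False
      then have "card (C - {z0}) = 3" using card_C0[OF z0] D by (simp add: D_def)
      then obtain u v w where uv: "C - {z0} = {u, v, w}" "u \<noteq> v" "v \<noteq> w" "u \<noteq> w" by (meson card_3_iff)
      have "C - {z0, u} = {v, w}" "C - {z0, v} = {u, w}" "C - {z0, w} = {u, v}" using uv by auto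
      moreover have "bary z0 x = 1 - (bary u x + bary v x + bary w x)" using b0 uv by simp
      ultimately have "t u + t v + t w = 3 / 20" using uv(2-) False
        by (simp add: t_def others_prod_def r_def a_def b_def c_def) (simp add: field_simps)
      then show ?thesis unfolding S using uv False D by (simp add: k0)
    qed
  qed
  have 5: "(\<Sum>z\<in>C - {z0}. bary z x * ge z x) = (\<Prod>z\<in>C - {z0}. bary z x)" if "bary z0 x = 0" for x
  proof -
    have "bary z x * ge z x = (1 / D) * (\<Prod>z\<in>C - {z0}. bary z x)" if "z \<in> C - {z0}" for z
      using others_prod_mult[OF that, of x] \<open>bary z0 x = 0\<close> by (simp add: ge_def)
    then have "(\<Sum>z\<in>C - {z0}. bary z x * ge z x) = D * ((1 / D) * (\<Prod>z\<in>C - {z0}. bary z x))"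
      using card_C0[OF z0] by (simp add: D_def)
    then show ?thesis using D by auto
  qed
  show ?thesis using that[OF 1 2 4 5] by blast
qed

text \<open>Of the two factors \<open>diameter T / height z0\<close> from \<open>flux_bound\<close>,
  shape regularity absorbs one; the height in the other cancels against the volume of the
  layer.\<close>

lemma square_integral_flux:
  assumes z0: "z0 \<in> C" and g: "\<And>z. z \<in> C - {z0} \<Longrightarrow> C1_with_gradient (g z) (g' z)"
    and \<kappa>: "diameter T ^ CARD('n) / measure lebesgue T \<le> \<kappa>" and t: "0 < t" "t \<le> 1"
    and B: "\<And>z x. z \<in> C - {z0} \<Longrightarrow> x \<in> T \<Longrightarrow> \<bar>g z x\<bar> \<le> B" "0 \<le> B"
    and supp: "\<And>z x. z \<in> C - {z0} \<Longrightarrow> x \<in> T \<Longrightarrow> t \<le> bary z0 x \<Longrightarrow> g z x = 0"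
  shows "(LINT x|lebesgue_on T. (norm (flux z0 g x))\<^sup>2)
           \<le> (\<kappa> * 4 ^ CARD('n)) * B\<^sup>2 * (t * diameter T) * area z0"
proof -
  have hH: "diameter T / height z0 \<le> \<kappa> * 4 ^ CARD('n)"
    using diameter_le_height[OF z0 \<kappa>] height_pos[OF z0] by (simp add: field_simps)
  have "(LINT x|lebesgue_on T. (norm (flux z0 g x))\<^sup>2) \<le> (B * diameter T / height z0)\<^sup>2 * (t * (height z0 * area z0))"
  proof (rule square_integral_layer[OF z0 flux_continuous[OF z0 g] t])
    show "norm (flux z0 g x) \<le> B * diameter T / height z0" if "x \<in> T" for x
      by (rule flux_bound[OF z0 that]) (use B that in auto)
    show "0 \<le> B * diameter T / height z0" using B diameter_pos height_pos[OF z0] by simp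
    show "flux z0 g x = 0" if "x \<in> T" "t \<le> bary z0 x" for x
      using supp[OF _ that] by (simp add: flux_def)
  qed
  also have "\<dots> = (diameter T / height z0) * (B\<^sup>2 * (t * diameter T) * area z0)"
    using height_pos[OF z0] by (simp add: power2_eq_square field_simps)
  also have "\<dots> \<le> (\<kappa> * 4 ^ CARD('n)) * (B\<^sup>2 * (t * diameter T) * area z0)"
    using hH t diameter_pos area_nonneg by (intro mult_right_mono) auto
  finally show ?thesis by (simp add: mult.assoc)
qed

text \<open>Constant coefficients and the bubble field both have constant divergence. Subtracting
  the same constant \<open>c\<close> from all coefficients cancels it, at the price of subtracting
  \<open>c\<close> from the trace, because the facet coordinates add up to 1 there.\<close>

lemma divergence_free_field:
  assumes z0: "z0 \<in> C" and \<gamma>: "\<bar>\<gamma>\<bar> \<le> M" and d: "\<And>z. z \<in> C - {z0} \<Longrightarrow> \<bar>d z\<bar> \<le> M"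
    and \<kappa>: "diameter T ^ CARD('n) / measure lebesgue T \<le> \<kappa>"
  obtains g g' where "\<And>z. z \<in> C - {z0} \<Longrightarrow> C1_with_gradient (g z) (g' z)"
    "\<And>x. bary z0 x = 0 \<Longrightarrow> (\<Sum>z\<in>C - {z0}. bary z x * g z x) =
       facet_function z0 d \<gamma> x - ((\<Sum>z\<in>C - {z0}. d z) + \<gamma> * bubble_divergence) / real CARD('n)"
    "\<And>x. flux_div z0 g g' x = 0"
    "(LINT x|lebesgue_on T. (norm (flux z0 g x))\<^sup>2)
        \<le> (\<kappa> * 4 ^ CARD('n)) * (5 * M)\<^sup>2 * diameter T * area z0"
proof -
  obtain ge ge' where ge: "\<And>z. z \<in> C - {z0} \<Longrightarrow> C1_with_gradient (ge z) (ge' z)"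
    "\<And>z x. z \<in> C - {z0} \<Longrightarrow> x \<in> T \<Longrightarrow> \<bar>ge z x\<bar> \<le> 2"
    "\<And>x. (\<Sum>z\<in>C - {z0}. ge z x + bary z x * (ge' z x \<bullet> (z - z0))) = bubble_divergence"
    "\<And>x. bary z0 x = 0 \<Longrightarrow> (\<Sum>z\<in>C - {z0}. bary z x * ge z x) = (\<Prod>z\<in>C - {z0}. bary z x)"
    using facet_bubble_field[OF z0] by blast
  define D where "D = real CARD('n)"
  have D: "2 \<le> D" "D > 0" using card_ge_2 by (auto simp: D_def)
  define c where "c = ((\<Sum>z\<in>C - {z0}. d z) + \<gamma> * bubble_divergence) / D"
  have M0: "0 \<le> M" using \<gamma> by linarith
  have "\<bar>\<Sum>z\<in>C - {z0}. d z\<bar> \<le> (\<Sum>z\<in>C - {z0}. M)"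
    using d by (intro order_trans[OF sum_abs] sum_mono) auto
  also have "\<dots> = D * M" using card_C0[OF z0] by (simp add: D_def)
  finally have sd: "\<bar>\<Sum>z\<in>C - {z0}. d z\<bar> \<le> D * M" .
  have "\<bar>\<gamma> * bubble_divergence\<bar> \<le> M * 1"
    unfolding abs_mult using \<gamma> M0 by (intro mult_mono) (auto simp: bubble_divergence_def)
  then have "\<bar>(\<Sum>z\<in>C - {z0}. d z) + \<gamma> * bubble_divergence\<bar> \<le> D * M + M" using sd by linarith
  also have "\<dots> \<le> 2 * M * D" using D mult_right_mono[OF D(1) M0] M0 by (simp add: algebra_simps)
  finally have c: "\<bar>c\<bar> \<le> 2 * M" using D by (simp add: c_def field_simps)
  define g where "g z x = (d z - c) + \<gamma> * ge z x" for z x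
  define g' where "g' z x = 0 + \<gamma> *\<^sub>R ge' z x" for z x
  have g: "C1_with_gradient (g z) (g' z)" if "z \<in> C - {z0}" for z
    unfolding g_def g'_def using ge(1)[OF that] by (intro C1_add C1_const C1_cmult)
  have tr: "(\<Sum>z\<in>C - {z0}. bary z x * g z x) = facet_function z0 d \<gamma> x - c" if b: "bary z0 x = 0" for x
  proof -
    have "(\<Sum>z\<in>C - {z0}. bary z x * g z x) = (\<Sum>z\<in>C - {z0}. d z * bary z x) - c * (\<Sum>z\<in>C - {z0}. bary z x)
       + \<gamma> * (\<Sum>z\<in>C - {z0}. bary z x * ge z x)"
      by (simp add: g_def sum.distrib sum_subtractf sum_distrib_left algebra_simps)
    then show ?thesis using ge(4)[OF b] sum_bary_facet[OF z0 b] by (simp add: facet_function_def)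
  qed
  have dv: "flux_div z0 g g' x = 0" for x
  proof -
    have "(\<Sum>z\<in>C - {z0}. g z x + bary z x * (g' z x \<bullet> (z - z0))) =
       (\<Sum>z\<in>C - {z0}. d z) - c * real (card (C - {z0}))
        + \<gamma> * (\<Sum>z\<in>C - {z0}. ge z x + bary z x * (ge' z x \<bullet> (z - z0)))"
      by (simp add: g_def g'_def sum.distrib sum_subtractf sum_distrib_left algebra_simps del: inner_diff_right)
    also have "\<dots> = 0" unfolding ge(3) card_C0[OF z0] using D by (simp add: c_def D_def)
    finally show ?thesis by (simp add: flux_div_def)
  qed
  have gB: "\<bar>g z x\<bar> \<le> 5 * M" if "z \<in> C - {z0}" "x \<in> T" for z x
  proof -
    have "\<bar>\<gamma> * ge z x\<bar> \<le> M * 2" unfolding abs_mult using \<gamma> ge(2)[OF that] M0 by (intro mult_mono) auto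
    then show ?thesis using d[OF that(1)] c by (simp add: g_def)
  qed
  have "(LINT x|lebesgue_on T. (norm (flux z0 g x))\<^sup>2)
        \<le> (\<kappa> * 4 ^ CARD('n)) * (5 * M)\<^sup>2 * (1 * diameter T) * area z0"
  proof (rule square_integral_flux[OF z0 g \<kappa> _ _ gB])
    \<comment> \<open>For \<open>t = 1\<close> the layer is the whole element: in the open simplex
      \<open>bary z0\<close> stays below 1, so this condition is vacuous.\<close>
    show "g z x = 0" if "x \<in> T" "1 \<le> bary z0 x" for z x
    proof -
      obtain a where a: "a \<in> C" "a \<noteq> z0" using C_other z0 by blast
      have "0 < bary z x" if "z \<in> C" for z using \<open>x \<in> T\<close> that by (subst (asm) T_bary) blast
      then have "0 < (\<Sum>z\<in>C - {z0}. bary z x)" using a fin by (intro sum_pos) auto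
      then show ?thesis using sum.remove[OF fin z0, of "\<lambda>z. bary z x"] bary_sum[of x] that(2) by simp
    qed
  qed (use M0 in auto)
  then show ?thesis using that[OF g tr[unfolded c_def D_def] dv] by simp
qed

text \<open>The trace is continued into the element by polynomials and multiplied by the cutoff. The
  relative thickness \<open>1 / s\<close> makes the squared norm of the field of order
  \<open>diameter T / s\<close>; differentiating the cutoff costs a factor \<open>s\<close>, so that
  of the divergence is of order \<open>s / diameter T\<close>.\<close>

lemma boundary_layer_field:
  assumes z0: "z0 \<in> C" and \<gamma>: "\<bar>\<gamma>\<bar> \<le> M" and d: "\<And>z. z \<in> C - {z0} \<Longrightarrow> \<bar>d z\<bar> \<le> M"
    and \<kappa>: "diameter T ^ CARD('n) / measure lebesgue T \<le> \<kappa>" and s: "1 \<le> s"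
  obtains g g' where "\<And>z. z \<in> C - {z0} \<Longrightarrow> C1_with_gradient (g z) (g' z)"
    "\<And>x. bary z0 x = 0 \<Longrightarrow> (\<Sum>z\<in>C - {z0}. bary z x * g z x) = facet_function z0 d \<gamma> x"
    "(LINT x|lebesgue_on T. (norm (flux z0 g x))\<^sup>2)
        \<le> (\<kappa> * 4 ^ CARD('n)) * (2 * M)\<^sup>2 * (diameter T / s) * area z0"
    "(LINT x|lebesgue_on T. (norm (flux_div z0 g g' x))\<^sup>2)
        \<le> (\<kappa> * 4 ^ CARD('n)) * (14 * M)\<^sup>2 * (s / diameter T) * area z0"
proof -
  have "\<forall>z. \<exists>p'. C1_with_gradient (others_prod z0 z) p' \<and> (\<forall>x. z \<in> C \<longrightarrow> p' x \<bullet> (z - z0) = 0)"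
    using others_prod_C1[OF z0] by metis
  then obtain p' where p': "\<And>z. C1_with_gradient (others_prod z0 z) (p' z)"
    "\<And>z x. z \<in> C \<Longrightarrow> p' z x \<bullet> (z - z0) = 0" by metis
  define D where "D = real CARD('n)"
  have D: "2 \<le> D" "D \<le> 3" "D > 0" using card_ge_2 card_le_3 by (auto simp: D_def)
  have M0: "0 \<le> M" using \<gamma> by linarith
  \<comment> \<open>Each of the \<open>D\<close> edge fields reproduces the full bubble, hence the
    share \<open>\<gamma> / D\<close>.\<close>
  define p where "p z x = d z + (\<gamma> / D) * others_prod z0 z x" for z x
  define pg where "pg z x = 0 + (\<gamma> / D) *\<^sub>R p' z x" for z x
  have p: "C1_with_gradient (p z) (pg z)" for z
    unfolding p_def pg_def by (intro C1_add C1_const C1_cmult p')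
  define \<psi> where "\<psi> x = cutoff s (bary z0 x)" for x
  define \<psi>' where "\<psi>' x = cutoff' s (bary z0 x) *\<^sub>R bary_grad z0" for x
  have \<psi>: "C1_with_gradient \<psi> \<psi>'"
    unfolding \<psi>_def \<psi>'_def by (rule C1_compose[OF C1_bary[OF z0] cutoff_deriv cutoff'_continuous])
  define g where "g z x = \<psi> x * p z x" for z x
  define g' where "g' z x = \<psi> x *\<^sub>R pg z x + p z x *\<^sub>R \<psi>' x" for z x
  have g: "C1_with_gradient (g z) (g' z)" for z unfolding g_def g'_def by (rule C1_mult[OF \<psi> p])
  have tr: "(\<Sum>z\<in>C - {z0}. bary z x * g z x) = facet_function z0 d \<gamma> x" if b: "bary z0 x = 0" for x
  proof -
    have "bary z x * g z x = d z * bary z x + (\<gamma> / D) * (\<Prod>z\<in>C - {z0}. bary z x)" if "z \<in> C - {z0}" for z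
      using others_prod_mult[OF that, of x] b by (simp add: g_def \<psi>_def cutoff_0 p_def algebra_simps)
    then have "(\<Sum>z\<in>C - {z0}. bary z x * g z x) =
      (\<Sum>z\<in>C - {z0}. d z * bary z x) + D * ((\<gamma> / D) * (\<Prod>z\<in>C - {z0}. bary z x))"
      using card_C0[OF z0] by (simp add: sum.distrib D_def)
    then show ?thesis using D by (simp add: facet_function_def)
  qed
  have pB: "\<bar>p z x\<bar> \<le> 3 / 2 * M" if "z \<in> C - {z0}" "x \<in> T" for z x
  proof -
    have "\<bar>\<gamma> / D\<bar> \<le> M / 2" 
      using frac_le[OF M0 \<gamma> _ D(1)] D by simp
    moreover have "\<bar>others_prod z0 z x\<bar> \<le> 1" using others_prod_bounds T_bary_bounds[OF that(2)] by force
    ultimately have "\<bar>(\<gamma> / D) * others_prod z0 z x\<bar> \<le> M / 2 * 1"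
      unfolding abs_mult using M0 by (intro mult_mono) auto
    then show ?thesis
      using d[OF that(1)] abs_triangle_ineq[of "d z" "(\<gamma> / D) * others_prod z0 z x"]
      unfolding p_def by linarith
  qed
  have \<psi>B: "\<bar>\<psi> x\<bar> \<le> 1" if "x \<in> T" for x
    using cutoff_bounds[of s "bary z0 x"] T_bary_bounds[OF that z0] s by (simp add: \<psi>_def)
  have gB: "\<bar>g z x\<bar> \<le> 2 * M" if "z \<in> C - {z0}" "x \<in> T" for z x
  proof -
    have "\<bar>\<psi> x * p z x\<bar> \<le> 1 * (3 / 2 * M)" unfolding abs_mult using pB[OF that] \<psi>B[OF that(2)] by (intro mult_mono) auto
    then show ?thesis using M0 by (simp add: g_def)
  qed
  have supp: "\<psi> x = 0" "cutoff' s (bary z0 x) = 0" if "1 / s \<le> bary z0 x" for x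
    using cutoff_support[of s "bary z0 x"] that s by (auto simp: \<psi>_def field_simps)
  have "(LINT x|lebesgue_on T. (norm (flux z0 g x))\<^sup>2)
        \<le> (\<kappa> * 4 ^ CARD('n)) * (2 * M)\<^sup>2 * (1 / s * diameter T) * area z0"
    using s M0 supp by (intro square_integral_flux[OF z0 g \<kappa> _ _ gB]) (auto simp: g_def)
  then have 3: "(LINT x|lebesgue_on T. (norm (flux z0 g x))\<^sup>2)
        \<le> (\<kappa> * 4 ^ CARD('n)) * (2 * M)\<^sup>2 * (diameter T / s) * area z0" by simp
  have dv: "flux_div z0 g g' x = (1 / height z0) * (\<Sum>z\<in>C - {z0}. p z x * (\<psi> x - bary z x * cutoff' s (bary z0 x)))" for x
  proof -
    have "g z x + bary z x * (g' z x \<bullet> (z - z0)) = p z x * (\<psi> x - bary z x * cutoff' s (bary z0 x))"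
      if z: "z \<in> C - {z0}" for z
    proof -
      have "g' z x \<bullet> (z - z0) = - (p z x * cutoff' s (bary z0 x))"
        using p'(2)[of z x] edge_gradient[OF z0 z] z
        by (simp add: g'_def pg_def \<psi>'_def inner_add_left del: inner_diff_right)
      then show ?thesis unfolding g_def by (simp only:) (simp add: algebra_simps)
    qed
    then show ?thesis by (simp add: flux_div_def)
  qed
  have "(LINT x|lebesgue_on T. (norm (flux_div z0 g g' x))\<^sup>2) \<le> (14 * M * s / height z0)\<^sup>2 * (1 / s * (height z0 * area z0))"
  proof (rule square_integral_layer[OF z0 flux_div_continuous[OF z0 g]])
    show "norm (flux_div z0 g g' x) \<le> 14 * M * s / height z0" if x: "x \<in> T" for x
    proof -
      have "\<bar>\<Sum>z\<in>C - {z0}. p z x * (\<psi> x - bary z x * cutoff' s (bary z0 x))\<bar> \<le> (\<Sum>z\<in>C - {z0}. 3 / 2 * M * (3 * s))"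
      proof (intro order_trans[OF sum_abs] sum_mono)
        fix z assume z: "z \<in> C - {z0}"
        have "\<bar>bary z x * cutoff' s (bary z0 x)\<bar> \<le> 1 * (2 * s)"
          unfolding abs_mult using T_bary_bounds[OF x, of z] T_bary_bounds[OF x z0] z s cutoff'_bound[of s "bary z0 x"]
          by (intro mult_mono) auto
        then have "\<bar>\<psi> x - bary z x * cutoff' s (bary z0 x)\<bar> \<le> 3 * s" using \<psi>B[OF x] s by linarith
        then show "\<bar>p z x * (\<psi> x - bary z x * cutoff' s (bary z0 x))\<bar> \<le> 3 / 2 * M * (3 * s)"
          unfolding abs_mult using pB[OF z x] M0 by (intro mult_mono) auto
      qed
      also have "\<dots> = D * (9 / 2 * (M * s))" using card_C0[OF z0] by (simp add: D_def)
      \<comment> \<open>At most three edges contribute 9/2 each; the total 27/2 is rounded up to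
        14.\<close>
      also have "\<dots> \<le> 3 * (9 / 2 * (M * s))" using D M0 s by (intro mult_right_mono) auto
      also have "\<dots> \<le> 14 * M * s" using mult_nonneg_nonneg[of M s] M0 s by simp
      finally show ?thesis unfolding dv using height_pos[OF z0] by (simp add: divide_right_mono)
    qed
    show "0 \<le> 14 * M * s / height z0" using M0 s height_pos[OF z0] by simp
    show "flux_div z0 g g' x = 0" if "1 / s \<le> bary z0 x" for x
      unfolding dv using supp[OF that] by simp
  qed (use s in auto)
  also have "\<dots> = (diameter T / height z0) * ((14 * M)\<^sup>2 * (s / diameter T) * area z0)"
    using height_pos[OF z0] diameter_pos s by (simp add: power2_eq_square field_simps)
  also have "\<dots> \<le> (\<kappa> * 4 ^ CARD('n)) * ((14 * M)\<^sup>2 * (s / diameter T) * area z0)"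
  proof (rule mult_right_mono)
    show "diameter T / height z0 \<le> \<kappa> * 4 ^ CARD('n)"
      using diameter_le_height[OF z0 \<kappa>] height_pos[OF z0] by (simp add: field_simps)
  qed (use s diameter_pos area_nonneg in auto)
  finally have 4: "(LINT x|lebesgue_on T. (norm (flux_div z0 g g' x))\<^sup>2)
        \<le> (\<kappa> * 4 ^ CARD('n)) * (14 * M)\<^sup>2 * (s / diameter T) * area z0" by (simp add: mult.assoc)
  show ?thesis using that[OF g tr 3 4] .
qed

end

subsection \<open>Test functions and weak derivatives\<close>

text \<open>Smoothness is given through iterated partial derivatives: the list \<open>[]\<close>
  yields differentiability, the lists \<open>[i]\<close> continuity of the gradient.\<close>

lemma test_function_C1:
  assumes "\<phi> \<in> test_functions S"
  shows "C1_with_gradient \<phi> (gradient \<phi>)"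
proof (rule C1_withI)
  have sm: "smooth \<phi>" using assms by (simp add: test_functions_def)
  have d: "\<phi> differentiable (at x)" for x using sm[unfolded smooth_def, rule_format, of "[]" x] by simp
  have dp: "partial_deriv i \<phi> differentiable (at x)" for i x
    using sm[unfolded smooth_def, rule_format, of "[i]" x] by simp
  show "(\<phi> has_derivative frechet_derivative \<phi> (at x)) (at x)" for x
    using d frechet_derivative_works by blast
  show "frechet_derivative \<phi> (at x) h = gradient \<phi> x \<bullet> h" for x h
  proof -
    have l: "linear (frechet_derivative \<phi> (at x))" using d linear_frechet_derivative by blast
    have "frechet_derivative \<phi> (at x) h = frechet_derivative \<phi> (at x) (\<Sum>i\<in>UNIV. h $ i *\<^sub>R axis i 1)"
      using basis_expansion[of h] by (simp add: scalar_mult_eq_scaleR)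
    also have "\<dots> = (\<Sum>i\<in>UNIV. h $ i * frechet_derivative \<phi> (at x) (axis i 1))"
      by (simp add: linear_sum[OF l] linear_cmul[OF l])
    also have "\<dots> = gradient \<phi> x \<bullet> h"
      by (simp add: gradient_def partial_deriv_def inner_vec_def mult.commute)
    finally show ?thesis .
  qed
  have "continuous_on UNIV (partial_deriv i \<phi>)" for i
    using dp by (simp add: continuous_at_imp_continuous_on differentiable_imp_continuous_within)
  then show "continuous_on UNIV (gradient \<phi>)"
    unfolding gradient_def by (intro continuous_on_vec_lambda)
qed

lemma test_function_support:
  assumes "\<phi> \<in> test_functions S"
  obtains K where "compact K" "K \<subseteq> S" "\<And>x. x \<notin> K \<Longrightarrow> \<phi> x = 0" "\<And>x. x \<notin> K \<Longrightarrow> gradient \<phi> x = 0"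
proof -
  obtain K where K: "compact K" "K \<subseteq> S" "\<And>x. x \<notin> K \<Longrightarrow> \<phi> x = 0"
    using assms by (auto simp: test_functions_def)
  have "gradient \<phi> x = 0" if "x \<notin> K" for x
  proof (rule gradient_eqI)
    have "open (- K)" using K(1) by (simp add: compact_imp_closed open_Compl)
    then show "(\<phi> has_derivative (\<lambda>h. 0 \<bullet> h)) (at x)"
      using has_derivative_transform_within_open[of "\<lambda>x. 0" "\<lambda>h. 0" x UNIV "- K" \<phi>] K(3) that by auto
  qed
  then show ?thesis using that K by blast
qed

lemma C1_compact_support_integral:
  fixes G :: "real ^ 'n \<Rightarrow> real"
  assumes G: "C1_with_gradient G G'" and supp: "\<And>x. R < norm x \<Longrightarrow> G x = 0"
  shows "integrable lborel (\<lambda>x. G' x \<bullet> e)" "(\<integral>x. G' x \<bullet> e \<partial>lborel) = 0"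
proof -
  define r where "r = \<bar>R\<bar> + norm e + 1"
  obtain L where L: "L \<ge> 0" "\<And>x y. x \<in> cball 0 r \<Longrightarrow> y \<in> cball 0 r \<Longrightarrow> \<bar>G x - G y\<bar> \<le> L * norm (x - y)"
    using C1_lipschitz_on_compact_convex[OF G, of "cball 0 r"] by auto
  obtain B where "\<forall>y \<in> G ` cball 0 r. norm y \<le> B"
    using compact_imp_bounded[OF compact_continuous_image[OF C1_continuous[OF G] compact_cball[of 0 r]]] unfolding bounded_iff by blast
  then have B: "norm (G x) \<le> B" if "x \<in> cball 0 r" for x using that by blast
  have B0: "0 \<le> B" using B[of 0] norm_ge_zero[of "G 0"] by (force simp: r_def)
  have bnd: "\<bar>G x\<bar> \<le> B" for x
  proof (cases "norm x \<le> r")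
    case True then show ?thesis using B[of x] by simp
  next
    case False
    then have "R < norm x" unfolding r_def using norm_ge_zero[of e] by linarith
    then show ?thesis using supp B0 by simp
  qed
  have lip: "\<bar>G (x + t *\<^sub>R e) - G x\<bar> \<le> (L * norm e) * t" if t: "0 \<le> t" "t \<le> 1" for x t
  proof -
    have te: "norm (t *\<^sub>R e) \<le> norm e" using t by (simp add: mult_left_le_one_le)
    show ?thesis
    proof (cases "norm x \<le> r \<and> norm (x + t *\<^sub>R e) \<le> r")
      case True then show ?thesis using L(2)[of "x + t *\<^sub>R e" x] t by (simp add: mult_ac)
    next
      case False
      have "norm (x + t *\<^sub>R e) \<le> norm x + norm e" "norm x \<le> norm (x + t *\<^sub>R e) + norm e"
        using norm_triangle_ineq[of x "t *\<^sub>R e"] norm_triangle_ineq4[of "x + t *\<^sub>R e" "t *\<^sub>R e"] te by simp_all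
      then have "R < norm x" "R < norm (x + t *\<^sub>R e)" using False by (auto simp: r_def)
      then show ?thesis using supp L(1) t by simp
    qed
  qed
  have dv: "((\<lambda>t. G (x + t *\<^sub>R e)) has_real_derivative G' x \<bullet> e) (at 0)" for x
    using C1_along_line[OF G, of x e 0] by simp
  have m: "G \<in> borel_measurable borel" "(\<lambda>x. G' x \<bullet> e) \<in> borel_measurable borel"
    using C1_continuous[OF G] C1_continuous_gradient[OF G]
    by (auto intro!: borel_measurable_continuous_onI continuous_intros)
  show "integrable lborel (\<lambda>x. G' x \<bullet> e)" "(\<integral>x. G' x \<bullet> e \<partial>lborel) = 0"
    using integral_directional_derivative_eq_0[OF m bnd supp lip] dv by auto
qed

lemma L2_bounded_continuous:
  fixes f :: "real ^ 'n \<Rightarrow> 'b::euclidean_space"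
  assumes S: "open S" "bounded S" and f: "continuous_on UNIV f" and g: "\<And>x. x \<in> S \<Longrightarrow> g x = f x"
  shows "g \<in> L2 S"
proof -
  have Sm: "S \<in> lmeasurable" using S by (simp add: lmeasurable_open)
  have "compact (closure S)" using S by simp
  then obtain B where B: "\<And>x. x \<in> closure S \<Longrightarrow> norm (f x) \<le> B"
    using compact_imp_bounded[OF compact_continuous_image[OF continuous_on_subset[OF f subset_UNIV], of "closure S"]]
    by (auto simp: bounded_iff)
  have fm: "f \<in> borel_measurable (lebesgue_on S)"
    using borel_measurable_continuous_onI[OF f] by (intro measurable_restrict_space1 measurable_completion) simp
  have gm: "g \<in> borel_measurable (lebesgue_on S)"
    using fm by (subst measurable_cong[of _ _ f]) (auto simp: g)
  have "integrable (lebesgue_on S) (\<lambda>x. (norm (g x))\<^sup>2)"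
  proof (rule integrable_bounded_on[OF Sm, of _ "B\<^sup>2"])
    show "(\<lambda>x. (norm (g x))\<^sup>2) \<in> borel_measurable (lebesgue_on S)" using gm by measurable
    show "norm ((norm (g x))\<^sup>2) \<le> B\<^sup>2" if "x \<in> S" for x
      using B[of x] that closure_subset[of S] g by (auto intro!: power_mono)
  qed
  then show ?thesis using gm by (simp add: L2_def)
qed

lemma L2_integrable_inner:
  fixes f g :: "real ^ 'n \<Rightarrow> 'b::euclidean_space"
  assumes "f \<in> L2 S" "g \<in> L2 S"
  shows "integrable (lebesgue_on S) (\<lambda>x. f x \<bullet> g x)"
proof (rule Bochner_Integration.integrable_bound)
  show "integrable (lebesgue_on S) (\<lambda>x. (norm (f x))\<^sup>2 + (norm (g x))\<^sup>2)"
    using assms by (simp add: L2_def)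
  show "(\<lambda>x. f x \<bullet> g x) \<in> borel_measurable (lebesgue_on S)"
    using assms by (auto simp: L2_def)
  show "AE x in lebesgue_on S. norm (f x \<bullet> g x) \<le> norm ((norm (f x))\<^sup>2 + (norm (g x))\<^sup>2)"
  proof (rule AE_I2)
    fix x
    have "norm (f x \<bullet> g x) \<le> norm (f x) * norm (g x)" by (simp add: Cauchy_Schwarz_ineq2)
    also have "\<dots> \<le> (norm (f x))\<^sup>2 + (norm (g x))\<^sup>2"
      using sum_squares_bound[of "norm (f x)" "norm (g x)"]
        mult_nonneg_nonneg[OF norm_ge_zero[of "f x"] norm_ge_zero[of "g x"]] by linarith
    finally show "norm (f x \<bullet> g x) \<le> norm ((norm (f x))\<^sup>2 + (norm (g x))\<^sup>2)" by simp
  qed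
qed

lemma L2_add: "f \<in> L2 S \<Longrightarrow> g \<in> L2 S \<Longrightarrow> (\<lambda>x. f x + g x) \<in> L2 S"
proof -
  assume fg: "f \<in> L2 S" "g \<in> L2 S"
  have "integrable (lebesgue_on S) (\<lambda>x. (norm (f x))\<^sup>2 + 2 * (f x \<bullet> g x) + (norm (g x))\<^sup>2)"
    using fg L2_integrable_inner[OF fg] by (simp add: L2_def)
  moreover have "(norm (f x + g x))\<^sup>2 = (norm (f x))\<^sup>2 + 2 * (f x \<bullet> g x) + (norm (g x))\<^sup>2" for x
    by (simp add: power2_norm_eq_inner inner_add_left inner_add_right inner_commute)
  ultimately show ?thesis using fg by (auto simp: L2_def)
qed

lemma L2_scale: "f \<in> L2 S \<Longrightarrow> (\<lambda>x. c *\<^sub>R f x) \<in> L2 S"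
  by (auto simp: L2_def power_mult_distrib)

lemma L2_diff: "f \<in> L2 S \<Longrightarrow> g \<in> L2 S \<Longrightarrow> (\<lambda>x. f x - g x) \<in> L2 S"
  using L2_add[OF _ L2_scale[of g S "-1"]] by simp

lemma L2_component: fixes f :: "real ^ 'n \<Rightarrow> real ^ 'm"
  assumes "f \<in> L2 S" shows "(\<lambda>x. f x $ i) \<in> L2 S"
proof -
  have "(\<lambda>x. f x \<bullet> axis i 1) \<in> borel_measurable (lebesgue_on S)" using assms by (auto simp: L2_def)
  then have m: "(\<lambda>x. f x $ i) \<in> borel_measurable (lebesgue_on S)" by (simp add: inner_axis)
  have "integrable (lebesgue_on S) (\<lambda>x. (norm (f x $ i))\<^sup>2)"
  proof (rule Bochner_Integration.integrable_bound)
    show "integrable (lebesgue_on S) (\<lambda>x. (norm (f x))\<^sup>2)" using assms by (simp add: L2_def)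
    show "(\<lambda>x. (norm (f x $ i))\<^sup>2) \<in> borel_measurable (lebesgue_on S)" using m by measurable
    show "AE x in lebesgue_on S. norm ((norm (f x $ i))\<^sup>2) \<le> norm ((norm (f x))\<^sup>2)"
    proof (rule AE_I2)
      fix x show "norm ((norm (f x $ i))\<^sup>2) \<le> norm ((norm (f x))\<^sup>2)"
        using power_mono[OF component_le_norm_cart[of "f x" i] abs_ge_zero, of 2] by simp
    qed
  qed
  then show ?thesis using m by (simp add: L2_def)
qed

lemma L2_restrict:
  assumes "f \<in> L2 S" "T \<subseteq> S" "T \<in> sets lebesgue" "S \<in> sets lebesgue"
  shows "f \<in> L2 T"
proof -
  have "f \<in> borel_measurable (lebesgue_on T)"
    using assms by (auto simp: L2_def intro: measurable_restrict_mono)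
  moreover have "integrable (lebesgue_on T) (\<lambda>x. (norm (f x))\<^sup>2)"
  proof -
    have "set_integrable lebesgue S (\<lambda>x. (norm (f x))\<^sup>2)"
      using assms integrable_restrict_space[of S lebesgue "\<lambda>x. (norm (f x))\<^sup>2"] by (simp add: L2_def set_integrable_def)
    then have "set_integrable lebesgue T (\<lambda>x. (norm (f x))\<^sup>2)"
      by (rule set_integrable_subset) (use assms in auto)
    then show ?thesis
      using assms integrable_restrict_space[of T lebesgue "\<lambda>x. (norm (f x))\<^sup>2"] by (simp add: set_integrable_def)
  qed
  ultimately show ?thesis by (simp add: L2_def)
qed

lemma test_function_L2:
  assumes "open S" "bounded S" "\<phi> \<in> test_functions S"
  shows "\<phi> \<in> L2 S" "gradient \<phi> \<in> L2 S"
  using L2_bounded_continuous[OF assms(1,2) C1_continuous[OF test_function_C1[OF assms(3)]]]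
    L2_bounded_continuous[OF assms(1,2) C1_continuous_gradient[OF test_function_C1[OF assms(3)]]] by auto

text \<open>The product with a test function is C1 on the whole space with compact support, so its
  partial derivatives integrate to zero and the boundary of \<open>S\<close> plays no part.\<close>

lemma C1_weak_gradient:
  assumes S: "open S" "bounded S" and w: "C1_with_gradient w w'" and v: "\<And>x. x \<in> S \<Longrightarrow> v x = w x"
    and g: "\<And>x. x \<in> S \<Longrightarrow> g x = w' x"
  shows "is_weak_gradient S v g"
  unfolding is_weak_gradient_def
proof (intro conjI ballI allI)
  show "g \<in> L2 S" using L2_bounded_continuous[OF S C1_continuous_gradient[OF w] g] .
  fix \<phi> i assume \<phi>: "\<phi> \<in> test_functions S"
  obtain K where K: "compact K" "K \<subseteq> S" "\<And>x. x \<notin> K \<Longrightarrow> \<phi> x = 0" "\<And>x. x \<notin> K \<Longrightarrow> gradient \<phi> x = 0"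
    using test_function_support[OF \<phi>] by blast
  obtain R where R: "\<And>x. x \<in> K \<Longrightarrow> norm x \<le> R" using compact_imp_bounded[OF K(1)] by (auto simp: bounded_iff)
  note C1\<phi> = test_function_C1[OF \<phi>]
  let ?G = "\<lambda>x. w x * \<phi> x" and ?G' = "\<lambda>x. w x *\<^sub>R gradient \<phi> x + \<phi> x *\<^sub>R w' x"
  have G: "C1_with_gradient ?G ?G'" by (rule C1_mult[OF w C1\<phi>])
  have supp: "?G x = 0" if "R < norm x" for x using R[of x] K(3)[of x] that by force
  have Sb: "S \<in> sets borel" using S by simp
  have Gm: "(\<lambda>x. ?G' x \<bullet> axis i 1) \<in> borel_measurable borel"
    by (rule borel_measurable_continuous_onI[OF continuous_on_inner[OF C1_continuous_gradient[OF G] continuous_on_const]])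
  have "(LINT x|lebesgue_on S. ?G' x \<bullet> axis i 1) = (\<integral>x. indicator S x * (?G' x \<bullet> axis i 1) \<partial>lborel)"
    by (rule integral_lebesgue_on_borel[OF Gm Sb])
  also have "(\<lambda>x. indicator S x * (?G' x \<bullet> axis i 1)) = (\<lambda>x. ?G' x \<bullet> axis i 1)"
    using K by (force simp: indicator_def)
  also have "(\<integral>x. ?G' x \<bullet> axis i 1 \<partial>lborel) = 0"
    by (rule C1_compact_support_integral(2)[OF G supp])
  finally have 0: "(LINT x|lebesgue_on S. ?G' x \<bullet> axis i 1) = 0" .
  have vL: "v \<in> L2 S" by (rule L2_bounded_continuous[OF S C1_continuous[OF w] v])
  have gL: "g \<in> L2 S" by (rule L2_bounded_continuous[OF S C1_continuous_gradient[OF w] g])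
  note tL = test_function_L2[OF S \<phi>]
  have pd: "partial_deriv i \<phi> = (\<lambda>x. gradient \<phi> x $ i)" by (simp add: gradient_def fun_eq_iff)
  have "(LINT x|lebesgue_on S. ?G' x \<bullet> axis i 1) =
      (LINT x|lebesgue_on S. v x \<bullet> gradient \<phi> x $ i + g x $ i \<bullet> \<phi> x)"
    by (rule Bochner_Integration.integral_cong) (auto simp: v g inner_add_left inner_axis)
  also have "\<dots> = l2_inner S v (partial_deriv i \<phi>) + l2_inner S (\<lambda>x. g x $ i) \<phi>"
    unfolding l2_inner_def pd
    by (intro Bochner_Integration.integral_add L2_integrable_inner vL tL(1) L2_component gL tL(2))
  finally show "l2_inner S v (partial_deriv i \<phi>) = - l2_inner S (\<lambda>x. g x $ i) \<phi>" using 0 by simp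
qed


section \<open>Bump functions and the fundamental lemma\<close>

definition flat :: "nat \<Rightarrow> real \<Rightarrow> real" where
  "flat m t = (if 0 < t then (1 / t) ^ m * exp (- (1 / t)) else 0)"

lemma flat_tendsto_0: "(flat m \<longlongrightarrow> 0) (at 0)"
proof -
  have "((\<lambda>t. (1 / t) ^ m / exp (1 / t)) \<longlongrightarrow> 0) (at_right (0::real))"
    using filterlim_compose[OF tendsto_power_div_exp_0[of m] filterlim_inverse_at_top_right]
    by (simp add: inverse_eq_divide)
  then have "(flat m \<longlongrightarrow> 0) (at_right 0)"
  proof (rule Lim_transform_eventually)
    show "\<forall>\<^sub>F t in at_right 0. (1 / t) ^ m / exp (1 / t) = flat m t"
      by (rule eventually_at_right_less[THEN eventually_mono]) (simp add: flat_def exp_minus divide_inverse)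
  qed
  moreover have "(flat m \<longlongrightarrow> 0) (at_left 0)"
  proof (rule Lim_transform_eventually[OF tendsto_const])
    have "eventually (\<lambda>t::real. t < 0) (at_left 0)" by (simp add: eventually_at_filter)
    then show "\<forall>\<^sub>F t in at_left 0. 0 = flat m t" by eventually_elim (simp add: flat_def)
  qed
  ultimately show ?thesis by (simp add: filterlim_split_at)
qed

text \<open>The exponent \<open>m\<close> is carried along so that the family is closed under
  differentiation up to linear combinations. At 0 the difference quotient of \<open>flat m\<close>
  is \<open>flat (m + 1)\<close>, which tends to 0.\<close>

lemma flat_deriv: "(flat m has_real_derivative (- real m * flat (m + 1) t + flat (m + 2) t)) (at t)"
proof -
  consider "t > 0" | "t < 0" | "t = 0" by linarith
  then show ?thesis
  proof cases
    case 1
    have "eventually (\<lambda>u::real. 0 < u) (nhds t)" using 1 eventually_nhds_in_open[OF open_greaterThan, of t 0] by simp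
    then have ev: "eventually (\<lambda>u. flat m u = (inverse u) ^ m * exp (- inverse u)) (nhds t)"
      by eventually_elim (simp add: flat_def inverse_eq_divide)
    have "((\<lambda>u. (inverse u) ^ m * exp (- inverse u)) has_real_derivative
        (- real m * flat (m + 1) t + flat (m + 2) t)) (at t)"
    proof -
      have i: "(inverse has_real_derivative - (inverse t)\<^sup>2) (at t)"
        using DERIV_inverse[of t] 1 by (simp add: numeral_2_eq_2)
      have D: "((\<lambda>u. (inverse u) ^ m * exp (- inverse u)) has_real_derivative
         (real m * (inverse t ^ (m - 1)) * - (inverse t)\<^sup>2) * exp (- inverse t) + (exp (- inverse t) * (inverse t)\<^sup>2) * inverse t ^ m) (at t)"
        by (rule derivative_eq_intros DERIV_power[OF i] DERIV_minus[OF i] refl | simp)+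
      have E: "real m * (inverse t ^ (m - 1)) * - (inverse t)\<^sup>2 = - real m * inverse t ^ (m + 1)"
        by (cases m) (auto simp: power2_eq_square algebra_simps)
      show ?thesis
        by (rule DERIV_cong[OF D], unfold E) (use 1 in \<open>simp add: flat_def inverse_eq_divide power2_eq_square mult_ac\<close>)
    qed
    then show ?thesis by (subst DERIV_cong_ev[OF refl ev refl])
  next
    case 2
    have "eventually (\<lambda>u::real. u < 0) (nhds t)" using 2 eventually_nhds_in_open[OF open_lessThan, of t 0] by simp
    then have ev: "eventually (\<lambda>u. flat m u = 0) (nhds t)" by eventually_elim (simp add: flat_def)
    show ?thesis using 2 by (subst DERIV_cong_ev[OF refl ev refl]) (simp add: flat_def)
  next
    case 3
    have "((\<lambda>u. (flat m u - flat m 0) / (u - 0)) \<longlongrightarrow> 0) (at 0)"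
    proof (rule Lim_transform_eventually[OF flat_tendsto_0[of "m + 1"]])
      show "\<forall>\<^sub>F u in at 0. flat (m + 1) u = (flat m u - flat m 0) / (u - 0)"
        by (simp add: flat_def eventually_at_filter)
    qed
    then show ?thesis using 3 by (simp add: has_field_derivative_iff flat_def)
  qed
qed

text \<open>A family closed under partial derivatives: all iterated derivatives of a member are
  members, by induction on the list, and this gives smoothness.\<close>

inductive_set bump_algebra :: "(real ^ 'n \<Rightarrow> real) set" where
  bump_const: "(\<lambda>x. c) \<in> bump_algebra"
| bump_flat: "(\<lambda>x. flat m (a * x $ i + b)) \<in> bump_algebra"
| bump_add: "f \<in> bump_algebra \<Longrightarrow> g \<in> bump_algebra \<Longrightarrow> (\<lambda>x. f x + g x) \<in> bump_algebra"
| bump_mult: "f \<in> bump_algebra \<Longrightarrow> g \<in> bump_algebra \<Longrightarrow> (\<lambda>x. f x * g x) \<in> bump_algebra"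

lemma bump_derivative:
  fixes f :: "real ^ 'n \<Rightarrow> real"
  assumes "f \<in> bump_algebra"
  shows "\<exists>f'. (\<forall>x. (f has_derivative (\<lambda>h. \<Sum>i\<in>UNIV. h $ i * f' i x)) (at x)) \<and> (\<forall>i. f' i \<in> bump_algebra)"
  using assms
proof induction
  case (bump_const c)
  show ?case by (rule exI[of _ "\<lambda>i x. 0"]) (auto intro: bump_algebra.intros)
next
  case (bump_flat m a j b)
  let ?f' = "\<lambda>i (x :: real ^ 'n). (if i = j then a else 0) * ((- real m) * flat (m + 1) (a * x $ j + b) + flat (m + 2) (a * x $ j + b))"
  have "((\<lambda>x. flat m (a * x $ j + b)) has_derivative (\<lambda>h. \<Sum>i\<in>UNIV. h $ i * ?f' i x)) (at x)" for x :: "real ^ 'n"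
  proof -
    have "((\<lambda>x. a * x $ j + b) has_derivative (\<lambda>h. a * h $ j)) (at x)"
      by (auto intro!: derivative_eq_intros bounded_linear_imp_has_derivative bounded_linear_vec_nth)
    from has_derivative_compose[OF this flat_deriv[of m "a * x $ j + b", unfolded has_field_derivative_def]]
    have "((\<lambda>x. flat m (a * x $ j + b)) has_derivative
      (\<lambda>h. (- real m * flat (m + 1) (a * x $ j + b) + flat (m + 2) (a * x $ j + b)) * (a * h $ j))) (at x)" .
    moreover have "(\<lambda>h. \<Sum>i\<in>UNIV. h $ i * ?f' i x) =
      (\<lambda>h. (- real m * flat (m + 1) (a * x $ j + b) + flat (m + 2) (a * x $ j + b)) * (a * h $ j))"
    proof
      fix h :: "real ^ 'n"
      have "(\<Sum>i\<in>UNIV. h $ i * ?f' i x) = (\<Sum>i\<in>UNIV. if i = j then h $ j * ?f' j x else 0)"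
        by (rule sum.cong) auto
      then show "(\<Sum>i\<in>UNIV. h $ i * ?f' i x) =
        (- real m * flat (m + 1) (a * x $ j + b) + flat (m + 2) (a * x $ j + b)) * (a * h $ j)" by simp
    qed
    ultimately show ?thesis by simp
  qed
  moreover have "?f' i \<in> bump_algebra" for i by (intro bump_algebra.intros)
  ultimately show ?case by (intro exI[of _ ?f']) blast
next
  case (bump_add f g)
  then obtain f' g' where "\<And>x. (f has_derivative (\<lambda>h. \<Sum>i\<in>UNIV. h $ i * f' i x)) (at x)" "\<And>i. f' i \<in> bump_algebra"
    "\<And>x. (g has_derivative (\<lambda>h. \<Sum>i\<in>UNIV. h $ i * g' i x)) (at x)" "\<And>i. g' i \<in> bump_algebra" by blast
  then show ?case
    by (intro exI[of _ "\<lambda>i x. f' i x + g' i x"] conjI allI bump_algebra.bump_add)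
       (auto simp: distrib_left sum.distrib intro!: has_derivative_add)
next
  case (bump_mult f g)
  then obtain f' g' where fg: "\<And>x. (f has_derivative (\<lambda>h. \<Sum>i\<in>UNIV. h $ i * f' i x)) (at x)" "\<And>i. f' i \<in> bump_algebra"
    "\<And>x. (g has_derivative (\<lambda>h. \<Sum>i\<in>UNIV. h $ i * g' i x)) (at x)" "\<And>i. g' i \<in> bump_algebra" by blast
  have "((\<lambda>x. f x * g x) has_derivative (\<lambda>h. \<Sum>i\<in>UNIV. h $ i * (f x * g' i x + f' i x * g x))) (at x)" for x
    using has_derivative_mult[OF fg(1)[of x] fg(3)[of x]]
    by (simp add: distrib_left sum.distrib sum_distrib_left sum_distrib_right mult_ac)
  then show ?case using fg bump_mult.hyps
    by (intro exI[of _ "\<lambda>i x. f x * g' i x + f' i x * g x"] conjI allI bump_algebra.intros) auto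
qed

lemma bump_smooth: assumes "f \<in> bump_algebra" shows "smooth f"
proof -
  have step: "partial_deriv i f \<in> bump_algebra" "f differentiable (at x)" if f: "f \<in> bump_algebra" for f :: "real ^ 'n \<Rightarrow> real" and i x
  proof -
    obtain f' where f': "\<And>x. (f has_derivative (\<lambda>h. \<Sum>i\<in>UNIV. h $ i * f' i x)) (at x)" "\<And>i. f' i \<in> bump_algebra"
      using bump_derivative[OF f] by blast
    have "partial_deriv i f x = f' i x" for x
    proof -
      have "partial_deriv i f x = (\<Sum>k\<in>UNIV. axis i 1 $ k * f' k x)"
        unfolding partial_deriv_def frechet_derivative_at[OF f'(1), symmetric] ..
      also have "\<dots> = (\<Sum>k\<in>UNIV. if k = i then f' i x else 0)" by (rule sum.cong) (auto simp: axis_def)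
      finally show ?thesis by simp
    qed
    then have "partial_deriv i f = f' i" by blast
    then show "partial_deriv i f \<in> bump_algebra" using f'(2) by simp
    show "f differentiable (at x)" using f'(1) differentiableI by blast
  qed
  have "foldr partial_deriv is f \<in> bump_algebra" for "is" using assms step by (induction "is") auto
  then show ?thesis unfolding smooth_def using step by blast
qed

lemma bump_prod: "finite I \<Longrightarrow> (\<And>i. i \<in> I \<Longrightarrow> f i \<in> bump_algebra) \<Longrightarrow> (\<lambda>x. \<Prod>i\<in>I. f i x) \<in> bump_algebra"
  by (induction I rule: finite_induct) (auto intro: bump_algebra.intros)

text \<open>As \<open>k\<close> grows this tends to the indicator of the open box, while the support
  stays in the closed box. The arguments are spelled in the affine form of
  \<open>bump_flat\<close>.\<close>

definition box_bump :: "real ^ 'n \<Rightarrow> real ^ 'n \<Rightarrow> nat \<Rightarrow> real ^ 'n \<Rightarrow> real" where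
  "box_bump a b k x = (\<Prod>i\<in>UNIV. flat 0 (real k * x $ i + (- (real k * a $ i))) * flat 0 ((- real k) * x $ i + real k * b $ i))"

lemma box_bump_test_function:
  assumes "cbox a b \<subseteq> S" shows "box_bump a b k \<in> test_functions S"
proof -
  have "box_bump a b k \<in> bump_algebra"
    unfolding box_bump_def by (intro bump_prod bump_algebra.intros) auto
  then have "smooth (box_bump a b k)" by (rule bump_smooth)
  moreover have "box_bump a b k x = 0" if x: "x \<notin> cbox a b" for x
  proof -
    obtain i where i: "x $ i < a $ i \<or> b $ i < x $ i" using x by (force simp: mem_box_cart not_le)
    then have "real k * x $ i + (- (real k * a $ i)) \<le> 0 \<or> (- real k) * x $ i + real k * b $ i \<le> 0"
      by (auto simp: mult_left_mono)
    then have "flat 0 (real k * x $ i + (- (real k * a $ i))) * flat 0 ((- real k) * x $ i + real k * b $ i) = 0"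
      by (auto simp: flat_def)
    then show ?thesis unfolding box_bump_def by (intro prod_zero) auto
  qed
  ultimately show ?thesis using assms by (auto simp: test_functions_def intro: exI[of _ "cbox a b"])
qed

lemma flat0_bounds: "0 \<le> flat 0 t" "flat 0 t \<le> 1" by (auto simp: flat_def)

lemma box_bump_bounds: "0 \<le> box_bump a b k x" "box_bump a b k x \<le> 1"
  unfolding box_bump_def using flat0_bounds by (auto intro!: prod_nonneg prod_le_1 mult_le_one)

lemma box_bump_tendsto: "(\<lambda>k. box_bump a b k x) \<longlonglongrightarrow> indicator (box a b) x"
proof -
  have f: "(\<lambda>k. flat 0 (real k * t)) \<longlonglongrightarrow> (if 0 < t then 1 else 0)" for t
  proof (cases "0 < t")
    case True
    have "(\<lambda>k. 1 / real k * (1 / t)) \<longlonglongrightarrow> 0 * (1 / t)" by (intro tendsto_mult lim_1_over_n tendsto_const)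
    then have "(\<lambda>k. exp (- (1 / (real k * t)))) \<longlonglongrightarrow> exp (- 0)"
      by (intro tendsto_exp tendsto_minus) (simp add: field_simps)
    then have "(\<lambda>k. flat 0 (real k * t)) \<longlonglongrightarrow> exp (- 0)"
    proof (rule Lim_transform_eventually)
      show "\<forall>\<^sub>F k in sequentially. exp (- (1 / (real k * t))) = flat 0 (real k * t)"
        using eventually_gt_at_top[of 0] by eventually_elim (simp add: flat_def True)
    qed
    then show ?thesis using True by simp
  next
    case False
    then have "flat 0 (real k * t) = 0" for k by (simp add: flat_def not_less mult_nonneg_nonpos zero_less_mult_iff)
    then show ?thesis using False by simp
  qed
  have "(\<lambda>k. \<Prod>i\<in>UNIV. flat 0 (real k * (x $ i - a $ i)) * flat 0 (real k * (b $ i - x $ i))) \<longlonglongrightarrow>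
     (\<Prod>i\<in>UNIV. (if 0 < x $ i - a $ i then 1 else 0) * (if 0 < b $ i - x $ i then 1 else 0))"
    by (intro tendsto_prod tendsto_mult f)
  moreover have "(\<Prod>i\<in>UNIV. (if 0 < x $ i - a $ i then 1 else 0) * (if 0 < b $ i - x $ i then 1 else 0)) = indicat_real (box a b) x"
  proof (cases "x \<in> box a b")
    case True then show ?thesis by (simp add: mem_box_cart)
  next
    case False
    then obtain i where "\<not> (a $ i < x $ i \<and> x $ i < b $ i)" by (auto simp: mem_box_cart)
    then have "(\<Prod>i\<in>UNIV. (if 0 < x $ i - a $ i then 1 else 0) * (if 0 < b $ i - x $ i then 1 else 0 :: real)) = 0"
      by (intro prod_zero) auto
    then show ?thesis using False by simp
  qed
  ultimately show ?thesis by (simp add: box_bump_def algebra_simps)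
qed

text \<open>The bumps are bounded by 1, so the modulus of \<open>g\<close> dominates their limit to
  the indicator.\<close>

lemma integral_box_eq_0:
  fixes g :: "real ^ 'n \<Rightarrow> real"
  assumes S: "S \<in> sets lebesgue" and g: "integrable (lebesgue_on S) g"
    and test: "\<And>\<phi>. \<phi> \<in> test_functions S \<Longrightarrow> (LINT x|lebesgue_on S. g x * \<phi> x) = 0"
    and ab: "cbox a b \<subseteq> S"
  shows "(LINT x|lebesgue_on S. g x * indicator (box a b) x) = 0"
proof -
  have bm: "box_bump a b k \<in> borel_measurable (lebesgue_on S)" for k
  proof -
    have "box_bump a b k \<in> borel_measurable borel"
      by (rule borel_measurable_continuous_onI[OF C1_continuous[OF test_function_C1[OF box_bump_test_function[OF ab]]]])
    then show ?thesis by (intro measurable_restrict_space1 measurable_completion) simp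
  qed
  have im: "indicat_real (box a b) \<in> borel_measurable (lebesgue_on S)"
    by (intro measurable_restrict_space1 borel_measurable_indicator) simp
  have gm: "g \<in> borel_measurable (lebesgue_on S)" using g by simp
  have "(\<lambda>k. LINT x|lebesgue_on S. g x * box_bump a b k x) \<longlonglongrightarrow> (LINT x|lebesgue_on S. g x * indicator (box a b) x)"
  proof (rule integral_dominated_convergence[where w = "\<lambda>x. norm (g x)"])
    show "integrable (lebesgue_on S) (\<lambda>x. norm (g x))" using g by simp
    show "AE x in lebesgue_on S. (\<lambda>k. g x * box_bump a b k x) \<longlonglongrightarrow> g x * indicator (box a b) x"
      by (intro AE_I2 tendsto_mult tendsto_const box_bump_tendsto)
    show "AE x in lebesgue_on S. norm (g x * box_bump a b k x) \<le> norm (g x)" for k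
    proof (rule AE_I2)
      fix x show "norm (g x * box_bump a b k x) \<le> norm (g x)"
        using mult_left_le[of "box_bump a b k x" "\<bar>g x\<bar>"] box_bump_bounds[of a b k x] by (simp add: abs_mult)
    qed
  qed (use gm bm im in measurable)
  then show ?thesis using test[OF box_bump_test_function[OF ab]] by (simp add: LIMSEQ_const_iff)
qed

text \<open>The signed measure with density \<open>g\<close> vanishes on the boxes, an
  intersection-stable generator, and on the whole space. So it vanishes on all Borel sets, in
  particular where a Borel version of \<open>g\<close> is positive or negative.\<close>

lemma AE_eq_0_if_box_integrals_eq_0:
  fixes g :: "real ^ 'n \<Rightarrow> real"
  assumes g: "integrable lebesgue g"
    and box: "\<And>l u. (LINT x|lebesgue. indicator (box l u) x * g x) = 0"
  shows "AE x in lebesgue. g x = 0"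
proof -
  have int: "integrable lebesgue (\<lambda>x. indicat_real A x * g x)" if "A \<in> sets borel" for A
    using integrable_mult_indicator[of A lebesgue g] g that by simp
  have whole: "(LINT x|lebesgue. g x) = 0"
  proof -
    let ?a = "\<lambda>k. (\<chi> i. - real k) :: real ^ 'n" and ?b = "\<lambda>k. (\<chi> i. real k) :: real ^ 'n"
    have "(\<lambda>k. LINT x|lebesgue. indicator (box (?a k) (?b k)) x * g x) \<longlonglongrightarrow> (LINT x|lebesgue. g x)"
    proof (rule integral_dominated_convergence[where w = "\<lambda>x. norm (g x)"])
      show "integrable lebesgue (\<lambda>x. norm (g x))" using g by simp
      show "AE x in lebesgue. (\<lambda>k. indicator (box (?a k) (?b k)) x * g x) \<longlonglongrightarrow> g x"
      proof (rule AE_I2)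
        fix x :: "real ^ 'n"
        obtain N where N: "norm x < real N" using reals_Archimedean2 by blast
        show "(\<lambda>k. indicator (box (?a k) (?b k)) x * g x) \<longlonglongrightarrow> g x"
        proof (rule tendsto_eventually)
          show "\<forall>\<^sub>F k in sequentially. indicator (box (?a k) (?b k)) x * g x = g x"
            using eventually_ge_at_top[of N]
          proof eventually_elim
            case (elim k)
            have "\<bar>x $ i\<bar> < real k" for i
              using component_le_norm_cart[of x i] N elim by linarith
            then have "x \<in> box (?a k) (?b k)" by (auto simp: mem_box_cart abs_less_iff minus_less_iff)
            then show ?case by simp
          qed
        qed
      qed
      show "AE x in lebesgue. norm (indicator (box (?a k) (?b k)) x * g x) \<le> norm (g x)" for k
        by (intro AE_I2) (simp add: indicator_def)
      show "(\<lambda>x. indicator (box (?a k) (?b k)) x * g x) \<in> borel_measurable lebesgue" for k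
        using int[of "box (?a k) (?b k)"] by simp
    qed (use g in simp)
    then show ?thesis using box by (simp add: LIMSEQ_const_iff)
  qed
  have all: "(LINT x|lebesgue. indicat_real A x * g x) = 0" if A: "A \<in> sets borel" for A
  proof -
    let ?E = "range (\<lambda>(a, b). box a b :: (real ^ 'n) set)"
    have st: "Int_stable ?E" by (auto simp: Int_stable_def box_Int_box)
    have "?E \<subseteq> Pow UNIV" "A \<in> sigma_sets UNIV ?E" using A by (simp_all add: borel_eq_box)
    from st this show ?thesis
    proof (induction rule: sigma_sets_induct_disjoint)
      case (compl A)
      have Ab: "A \<in> sets borel" using compl(1) by (simp add: borel_eq_box)
      have "(LINT x|lebesgue. indicat_real (UNIV - A) x * g x) = (LINT x|lebesgue. g x - indicat_real A x * g x)"
        by (rule Bochner_Integration.integral_cong) (auto simp: indicator_def)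
      also have "\<dots> = 0" using whole compl(2) g int[OF Ab] by (subst Bochner_Integration.integral_diff) auto
      finally show ?case .
    next
      case (union A)
      have Ab: "A i \<in> sets borel" for i using union(2) by (auto simp: borel_eq_box image_subset_iff)
      have si: "set_integrable lebesgue (\<Union>i. A i) g"
      proof -
        have "(\<Union>i. A i) \<in> sets borel" using Ab by (intro sets.countable_nat_UN) auto
        then show ?thesis using int by (simp add: set_integrable_def)
      qed
      have "(LINT x:(\<Union>i. A i)|lebesgue. g x) = (\<Sum>i. (LINT x:(A i)|lebesgue. g x))"
        using union(1) Ab si by (intro lebesgue_integral_countable_add) (auto simp: disjoint_family_on_def)
      then show ?case using union(3) by (simp add: set_lebesgue_integral_def)
    qed (use box in auto)
  qed
  obtain g' where g': "g' \<in> borel_measurable borel" "AE x in lborel. g x = g' x"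
    using completion_ex_borel_measurable_real[of g lborel] g by (auto dest: borel_measurable_integrable)
  have eq: "AE x in lebesgue. g x = g' x" using g'(2) by (rule AE_completion)
  \<comment> \<open>\<open>h\<close> stands for the Borel version or its negative, so that both
    signs are treated at once.\<close>
  have pos: "AE x in lebesgue. h x \<le> 0"
    if h: "h = g' \<or> h = (\<lambda>x. - g' x)" for h
  proof -
    define A where "A = {x. 0 < h x}"
    have [measurable]: "h \<in> borel_measurable borel" using h g'(1) by auto
    have A: "A \<in> sets borel" unfolding A_def by measurable
    have "(LINT x|lebesgue. indicat_real A x * (if h = g' then g x else - g x)) = 0"
      using all[OF A] by (cases "h = g'") simp_all
    moreover have "AE x in lebesgue. 0 \<le> indicat_real A x * (if h = g' then g x else - g x)"
      using eq by eventually_elim (use h in \<open>auto simp: A_def indicator_def\<close>)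
    moreover have "integrable lebesgue (\<lambda>x. indicat_real A x * (if h = g' then g x else - g x))"
      using int[OF A] by (cases "h = g'") simp_all
    ultimately have "AE x in lebesgue. indicat_real A x * (if h = g' then g x else - g x) = 0"
      by (subst (asm) integral_nonneg_eq_0_iff_AE) auto
    with eq show ?thesis by eventually_elim (use h in \<open>auto simp: A_def indicator_def split: if_splits\<close>)
  qed
  from pos[of g'] pos[of "\<lambda>x. - g' x"] eq
  have "AE x in lebesgue. g' x \<le> 0" "AE x in lebesgue. - g' x \<le> 0" "AE x in lebesgue. g x = g' x"
    by simp_all
  then show ?thesis by eventually_elim simp
qed

text \<open>The claim is localised to closed boxes inside \<open>S\<close>, where bumps on sub-boxes
  are admissible test functions; countably many such boxes cover the open set.\<close>

lemma fundamental_lemma: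
  fixes g :: "real ^ 'n \<Rightarrow> real"
  assumes S: "open S" and g: "integrable (lebesgue_on S) g"
    and test: "\<And>\<phi>. \<phi> \<in> test_functions S \<Longrightarrow> (LINT x|lebesgue_on S. g x * \<phi> x) = 0"
  shows "AE x in lebesgue_on S. g x = 0"
proof -
  have Sm: "S \<in> sets lebesgue" using S by simp
  have loc: "AE x in lebesgue. x \<in> cbox a b \<longrightarrow> g x = 0" if ab: "cbox a b \<subseteq> S" for a b
  proof -
    let ?g = "\<lambda>x. indicat_real (box a b) x * g x"
    have bS: "box a b \<subseteq> S" using ab box_subset_cbox by blast
    have "set_integrable lebesgue S g"
      using g integrable_restrict_space[of S lebesgue g] Sm by (simp add: set_integrable_def)
    then have "set_integrable lebesgue (box a b) g"
      by (rule set_integrable_subset) (use bS in auto)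
    then have gi: "integrable lebesgue ?g" by (simp add: set_integrable_def)
    have "AE x in lebesgue. ?g x = 0"
    proof (rule AE_eq_0_if_box_integrals_eq_0[OF gi])
      fix l u :: "real ^ 'n"
      obtain l' u' where lu: "box a b \<inter> box l u = box l' u'" "cbox a b \<inter> cbox l u = cbox l' u'"
        by (rule that[OF box_Int_box Int_interval])
      have "(LINT x|lebesgue. indicator (box l u) x * ?g x) = (LINT x|lebesgue. indicator S x *\<^sub>R (g x * indicator (box l' u') x))"
        unfolding lu(1)[symmetric] using bS by (intro Bochner_Integration.integral_cong) (auto simp: indicator_def)
      also have "\<dots> = (LINT x|lebesgue_on S. g x * indicator (box l' u') x)"
        using Sm by (simp add: integral_restrict_space set_lebesgue_integral_def)
      also have "\<dots> = 0" using lu(2) ab by (intro integral_box_eq_0[OF Sm g test]) auto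
      finally show "(LINT x|lebesgue. indicator (box l u) x * ?g x) = 0" .
    qed
    moreover have "AE x in lebesgue. x \<notin> cbox a b - box a b"
      using negligible_frontier_interval[of a b] by (intro AE_not_in) (simp add: negligible_iff_null_sets)
    ultimately show ?thesis by eventually_elim (auto simp: indicator_def split: if_splits)
  qed
  obtain \<D> where \<D>: "countable \<D>" "\<D> \<subseteq> Pow S" "\<And>X. X \<in> \<D> \<Longrightarrow> \<exists>a b. X = cbox a b" "\<Union>\<D> = S"
    using open_countable_Union_open_cbox[OF S] by metis
  have "AE x in lebesgue. \<forall>X\<in>\<D>. x \<in> X \<longrightarrow> g x = 0"
  proof (subst AE_ball_countable[OF \<D>(1)], intro ballI)
    fix X assume X: "X \<in> \<D>"
    then obtain a b where ab: "X = cbox a b" using \<D>(3) by blast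
    then have "cbox a b \<subseteq> S" using X \<D>(2) by auto
    then show "AE x in lebesgue. x \<in> X \<longrightarrow> g x = 0" unfolding ab by (rule loc)
  qed
  then have "AE x in lebesgue. x \<in> S \<longrightarrow> g x = 0"
  proof eventually_elim
    case (elim x) then show ?case unfolding \<D>(4)[symmetric] by blast
  qed
  then show ?thesis using Sm by (subst AE_restrict_space_iff) auto
qed

lemma L2_inner_eq_imp_AE_eq:
  fixes f g :: "real ^ 'n \<Rightarrow> real"
  assumes S: "open S" "bounded S" and f: "f \<in> L2 S" and g: "g \<in> L2 S"
    and eq: "\<And>\<phi>. \<phi> \<in> test_functions S \<Longrightarrow> l2_inner S f \<phi> = l2_inner S g \<phi>"
  shows "AE x in lebesgue_on S. f x = g x"
proof -
  have one: "(\<lambda>x. 1::real) \<in> L2 S"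
    by (rule L2_bounded_continuous[OF S, of "\<lambda>x. 1"]) auto
  have d: "(\<lambda>x. f x - g x) \<in> L2 S" by (rule L2_diff[OF f g])
  have "AE x in lebesgue_on S. f x - g x = 0"
  proof (rule fundamental_lemma[OF S(1)])
    show "integrable (lebesgue_on S) (\<lambda>x. f x - g x)" using L2_integrable_inner[OF d one] by simp
    fix \<phi> assume \<phi>: "\<phi> \<in> test_functions S"
    have "(LINT x|lebesgue_on S. (f x - g x) * \<phi> x) = l2_inner S f \<phi> - l2_inner S g \<phi>"
      unfolding l2_inner_def
      using L2_integrable_inner[OF f test_function_L2(1)[OF S \<phi>]] L2_integrable_inner[OF g test_function_L2(1)[OF S \<phi>]]
      by (simp add: left_diff_distrib)
    then show "(LINT x|lebesgue_on S. (f x - g x) * \<phi> x) = 0" using eq[OF \<phi>] by simp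
  qed
  then show ?thesis by eventually_elim simp
qed

text \<open>\<open>weak_gradient\<close> is an arbitrary choice; this lemma is what allows an
  explicit gradient to replace it under integrals.\<close>

lemma weak_gradient_unique:
  assumes S: "open S" "bounded S" and g: "is_weak_gradient S v g" and h: "is_weak_gradient S v h"
  shows "AE x in lebesgue_on S. g x = h x"
proof -
  have gh: "g \<in> L2 S" "h \<in> L2 S" using g h by (simp_all add: is_weak_gradient_def)
  have "AE x in lebesgue_on S. g x $ i = h x $ i" for i
  proof (rule L2_inner_eq_imp_AE_eq[OF S L2_component[OF gh(1)] L2_component[OF gh(2)]])
    fix \<phi> assume "\<phi> \<in> test_functions S"
    then have "l2_inner S v (partial_deriv i \<phi>) = - l2_inner S (\<lambda>x. g x $ i) \<phi>"
      "l2_inner S v (partial_deriv i \<phi>) = - l2_inner S (\<lambda>x. h x $ i) \<phi>"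
      using g h unfolding is_weak_gradient_def by blast+
    then show "l2_inner S (\<lambda>x. g x $ i) \<phi> = l2_inner S (\<lambda>x. h x $ i) \<phi>" by simp
  qed
  then have "AE x in lebesgue_on S. \<forall>i\<in>UNIV. g x $ i = h x $ i" by (intro AE_finite_allI) auto
  then show ?thesis by eventually_elim (simp add: vec_eq_iff)
qed

lemma weak_divergence_unique:
  assumes S: "open S" "bounded S" and g: "is_weak_divergence S \<tau> g" and h: "is_weak_divergence S \<tau> h"
  shows "AE x in lebesgue_on S. g x = h x"
proof (rule L2_inner_eq_imp_AE_eq[OF S, where f = g and g = h])
  show "g \<in> L2 S" "h \<in> L2 S" using g h by (simp_all add: is_weak_divergence_def)
  fix \<phi> assume "\<phi> \<in> test_functions S"
  note \<phi> = this
  have "l2_inner S \<tau> (gradient \<phi>) = - l2_inner S g \<phi>" using g \<phi> by (simp add: is_weak_divergence_def)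
  moreover have "l2_inner S \<tau> (gradient \<phi>) = - l2_inner S h \<phi>" using h \<phi> by (simp add: is_weak_divergence_def)
  ultimately show "l2_inner S g \<phi> = l2_inner S h \<phi>" by linarith
qed

lemma weak_gradient_is_weak_gradient: "is_weak_gradient S v g \<Longrightarrow> is_weak_gradient S v (weak_gradient S v)"
  unfolding weak_gradient_def by (rule someI[of "is_weak_gradient S v"])

lemma weak_divergence_is_weak_divergence: "is_weak_divergence S \<tau> w \<Longrightarrow> is_weak_divergence S \<tau> (weak_divergence S \<tau>)"
  unfolding weak_divergence_def by (rule someI[of "is_weak_divergence S \<tau>"])

lemma l2_inner_diff_left:
  assumes "f \<in> L2 S" "g \<in> L2 S" "h \<in> L2 S"
  shows "l2_inner S (\<lambda>x. f x - g x) h = l2_inner S f h - l2_inner S g h"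
  unfolding l2_inner_def inner_diff_left
  by (rule Bochner_Integration.integral_diff[OF L2_integrable_inner[OF assms(1,3)] L2_integrable_inner[OF assms(2,3)]])

lemma is_weak_gradient_diff:
  assumes S: "open S" "bounded S" and v: "v \<in> L2 S" "is_weak_gradient S v g"
    and w: "w \<in> L2 S" "is_weak_gradient S w h"
  shows "is_weak_gradient S (\<lambda>x. v x - w x) (\<lambda>x. g x - h x)"
  unfolding is_weak_gradient_def
proof (intro conjI ballI allI)
  have gL: "g \<in> L2 S" and hL: "h \<in> L2 S" using v w by (auto simp: is_weak_gradient_def)
  then show "(\<lambda>x. g x - h x) \<in> L2 S" by (rule L2_diff)
  fix \<phi> i assume \<phi>: "\<phi> \<in> test_functions S"
  have pd: "partial_deriv i \<phi> = (\<lambda>x. gradient \<phi> x $ i)" by (simp add: gradient_def fun_eq_iff)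
  have pL: "partial_deriv i \<phi> \<in> L2 S" unfolding pd by (rule L2_component[OF test_function_L2(2)[OF S \<phi>]])
  show "l2_inner S (\<lambda>x. v x - w x) (partial_deriv i \<phi>) = - l2_inner S (\<lambda>x. (g x - h x) $ i) \<phi>"
    using v(2) w(2) \<phi> l2_inner_diff_left[OF v(1) w(1) pL]
      l2_inner_diff_left[OF L2_component[OF gL, of i] L2_component[OF hL, of i] test_function_L2(1)[OF S \<phi>]]
    by (simp add: is_weak_gradient_def)
qed

subsection \<open>Discrete functions on elements and the mesh\<close>

context simplex_element
begin

lemma facet_bubble_eq: "z \<in> C \<Longrightarrow> facet_bubble T (facet z) x = (\<Prod>y\<in>C - {z}. bary y x)"
  unfolding facet_bubble_def by (simp add: opposite_vertex_eq vertices_eq)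

text \<open>On the hyperplane opposite \<open>z0\<close> the bubbles of the other facets and the
  element bubble contain the factor \<open>bary z0\<close> and vanish, the exponential equals 1, and
  the affine part is recovered from its vertex values. So both versions of the local space have
  facet traces of the same form.\<close>

lemma local_space_representation:
  assumes w: "w \<in> local_space \<epsilon> T"
  obtains w' where "C1_with_gradient w w'"
    "\<And>z0. z0 \<in> C \<Longrightarrow> \<exists>d \<gamma>. \<forall>x. bary z0 x = 0 \<longrightarrow> w x = facet_function z0 d \<gamma> x"
proof -
  obtain p \<alpha> \<beta> where pP: "p \<in> P1" and w_eq: "w = (\<lambda>x. p x + (\<Sum>F \<in> facets T. \<alpha> F *
      (if \<epsilon> < diameter T then facet_bubble_eps \<epsilon> T F x else facet_bubble T F x)) + \<beta> * element_bubble T x)"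
    using w unfolding local_space_def by blast
  obtain c a where p: "p = (\<lambda>x. c + a \<bullet> x)" using pP unfolding P1_def by blast
  define E where "E z x = (if \<epsilon> < diameter T then exp (- (diameter T / \<epsilon>) * bary z x) else 1)" for z x
  define b where "b z x = E z x * (\<Prod>y\<in>C - {z}. bary y x)" for z x
  have inj: "inj_on facet C" using facet_inj by (auto simp: inj_on_def)
  have fs: "facets T = facet ` C" using facets_eq by auto
  have w_eq': "w x = p x + (\<Sum>z\<in>C. \<alpha> (facet z) * b z x) + \<beta> * (\<Prod>z\<in>C. bary z x)" for x
    unfolding w_eq fs sum.reindex[OF inj] o_def
    by (cases "\<epsilon> < diameter T")
      (simp_all add: facet_bubble_eq facet_bubble_eps_def opposite_vertex_eq b_def E_def element_bubble_def vertices_eq)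
  have "\<exists>b'. C1_with_gradient (b z) b'" if z: "z \<in> C" for z
  proof -
    have "\<exists>E'. C1_with_gradient (E z) E'"
    proof (cases "\<epsilon> < diameter T")
      case True
      have D: "((\<lambda>t. exp (q * t)) has_real_derivative exp (q * t) * q) (at t)" for q t :: real
        by (auto intro!: derivative_eq_intros)
      have "continuous_on UNIV (\<lambda>t. exp (q * t) * q)" for q :: real by (intro continuous_intros)
      from C1_compose[OF C1_bary[OF z] D this]
      have c1: "C1_with_gradient (\<lambda>x. exp (q * bary z x)) (\<lambda>x. (exp (q * bary z x) * q) *\<^sub>R bary_grad z)" for q .
      have Ez: "E z = (\<lambda>x. exp (- (diameter T / \<epsilon>) * bary z x))" by (rule ext) (simp only: E_def True if_True)
      show ?thesis unfolding Ez by (rule exI, rule c1)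
    next
      case False then show ?thesis using C1_const[of 1] by (auto simp: E_def[abs_def])
    qed
    moreover have "\<exists>q'. C1_with_gradient (\<lambda>x. \<Prod>y\<in>C - {z}. bary y x) q'"
    proof (rule exI, rule C1_prod)
      show "finite (C - {z})" using fin by simp
      show "C1_with_gradient (bary y) (\<lambda>x. bary_grad y)" if "y \<in> C - {z}" for y using that by (intro C1_bary) simp
    qed
    ultimately obtain E' q' where "C1_with_gradient (E z) E'" "C1_with_gradient (\<lambda>x. \<Prod>y\<in>C - {z}. bary y x) q'" by blast
    from C1_mult[OF this] show ?thesis unfolding b_def[abs_def] by (intro exI; assumption)
  qed
  then obtain b' where b': "\<And>z. z \<in> C \<Longrightarrow> C1_with_gradient (b z) (b' z)" by metis
  obtain e' where e': "C1_with_gradient (\<lambda>x. \<Prod>y\<in>C. bary y x) e'"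
    by (rule that, rule C1_prod[OF fin], rule C1_bary)
  have "C1_with_gradient (\<lambda>x. p x + (\<Sum>z\<in>C. \<alpha> (facet z) * b z x) + \<beta> * (\<Prod>z\<in>C. bary z x))
      (\<lambda>x. a + (\<Sum>z\<in>C. \<alpha> (facet z) *\<^sub>R b' z x) + \<beta> *\<^sub>R e' x)"
    unfolding p by (intro C1_add C1_affine C1_sum C1_cmult b' e')
  then have C1w: "C1_with_gradient w (\<lambda>x. a + (\<Sum>z\<in>C. \<alpha> (facet z) *\<^sub>R b' z x) + \<beta> *\<^sub>R e' x)"
    unfolding w_eq'[symmetric] .
  have "\<exists>d \<gamma>. \<forall>x. bary z0 x = 0 \<longrightarrow> w x = facet_function z0 d \<gamma> x" if z0: "z0 \<in> C" for z0
  proof (intro exI allI impI)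
    fix x assume x: "bary z0 x = 0"
    have "p x = c * (\<Sum>z\<in>C. bary z x) + a \<bullet> (\<Sum>z\<in>C. bary z x *\<^sub>R z)" by (simp add: bary_sum bary_comb p)
    also have "\<dots> = (\<Sum>z\<in>C. (c + a \<bullet> z) * bary z x)"
      by (simp add: inner_sum_right sum_distrib_left sum.distrib algebra_simps)
    also have "\<dots> = (\<Sum>z\<in>C - {z0}. (c + a \<bullet> z) * bary z x)"
      using sum.remove[OF fin z0, of "\<lambda>z. (c + a \<bullet> z) * bary z x"] x by simp
    finally have px: "p x = (\<Sum>z\<in>C - {z0}. (c + a \<bullet> z) * bary z x)" .
    have "b z x = 0" if "z \<in> C - {z0}" for z
      unfolding b_def using that z0 x fin by (simp add: prod_zero_iff) blast
    then have "(\<Sum>z\<in>C. \<alpha> (facet z) * b z x) = \<alpha> (facet z0) * b z0 x"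
      using sum.remove[OF fin z0, of "\<lambda>z. \<alpha> (facet z) * b z x"] by simp
    moreover have "b z0 x = (\<Prod>y\<in>C - {z0}. bary y x)" by (simp add: b_def E_def x)
    moreover have "(\<Prod>z\<in>C. bary z x) = 0" using fin z0 x by auto
    ultimately show "w x = facet_function z0 (\<lambda>z. c + a \<bullet> z) (\<alpha> (facet z0)) x"
      unfolding w_eq' px facet_function_def by simp
  qed
  with C1w show ?thesis using that by blast
qed

text \<open>Only derivatives along the facet can be compared with those of the facet function.
  Testing with the tangential part \<open>t\<close> itself gives
  \<open>t \<bullet> t = f' \<bullet> t\<close>; the gradients of the coordinates have reciprocal
  heights as norms, bounded by shape regularity. The 6 collects at most three affine and three
  bubble terms.\<close>

lemma tangential_bound:
  assumes z0: "z0 \<in> C" and v: "C1_with_gradient v v'"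
    and eq: "\<And>x. bary z0 x = 0 \<Longrightarrow> v x = facet_function z0 d \<gamma> x"
    and \<gamma>: "\<bar>\<gamma>\<bar> \<le> M" and d: "\<And>z. z \<in> C - {z0} \<Longrightarrow> \<bar>d z\<bar> \<le> M"
    and \<kappa>: "diameter T ^ CARD('n) / measure lebesgue T \<le> \<kappa>" and x: "x \<in> facet z0"
  shows "norm (tangential (facet z0) (v' x)) \<le> 6 * M * (\<kappa> * 4 ^ CARD('n)) / diameter T"
proof -
  define n where "n = unit_normal (facet z0)"
  define t where "t = tangential (facet z0) (v' x)"
  obtain c where c: "n = c *\<^sub>R bary_grad z0" "\<bar>c\<bar> = height z0"
    unfolding n_def using unit_normal_facet(2)[OF z0] by blast
  have n1: "n \<bullet> n = 1" using unit_normal_facet(1)[OF z0] by (simp add: n_def norm_eq_1)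
  have t_eq: "t = v' x - (v' x \<bullet> n) *\<^sub>R n" by (simp add: t_def tangential_def n_def)
  have tn: "t \<bullet> n = 0" by (simp add: t_eq inner_diff_left n1)
  have "c \<noteq> 0" using c(2) height_pos[OF z0] by auto
  then have tG: "bary_grad z0 \<bullet> t = 0" using tn by (simp add: c(1) inner_commute)
  have bx: "bary z0 x = 0" using x by (simp add: facet_bary[OF z0])
  define f' where "f' = (\<Sum>z\<in>C - {z0}. d z *\<^sub>R bary_grad z) +
     \<gamma> *\<^sub>R (\<Sum>z\<in>C - {z0}. (\<Prod>y\<in>C - {z0} - {z}. bary y x) *\<^sub>R bary_grad z)"
  have ff: "C1_with_gradient (facet_function z0 d \<gamma>) (\<lambda>x. (\<Sum>z\<in>C - {z0}. d z *\<^sub>R bary_grad z) +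
     \<gamma> *\<^sub>R (\<Sum>z\<in>C - {z0}. (\<Prod>y\<in>C - {z0} - {z}. bary y x) *\<^sub>R bary_grad z))"
    unfolding facet_function_def using fin by (intro C1_add C1_sum C1_cmult C1_prod C1_bary) auto
  have "v (x + s *\<^sub>R t) = facet_function z0 d \<gamma> (x + s *\<^sub>R t)" for s
    by (rule eq) (simp add: bary_line[OF z0] bx tG)
  then have "((\<lambda>s. facet_function z0 d \<gamma> (x + s *\<^sub>R t)) has_real_derivative v' x \<bullet> t) (at 0)"
    using C1_along_line[OF v, of x t 0] by simp
  moreover have "((\<lambda>s. facet_function z0 d \<gamma> (x + s *\<^sub>R t)) has_real_derivative f' \<bullet> t) (at 0)"
    using C1_along_line[OF ff, of x t 0] by (simp add: f'_def)
  ultimately have vt: "v' x \<bullet> t = f' \<bullet> t" by (rule DERIV_unique)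
  have "t \<bullet> t = (v' x - (v' x \<bullet> n) *\<^sub>R n) \<bullet> t" by (simp only: t_eq[symmetric])
  also have "\<dots> = v' x \<bullet> t" using tn by (simp add: inner_diff_left inner_commute[of n t])
  finally have "t \<bullet> t = v' x \<bullet> t" .
  then have tt: "(norm t)\<^sup>2 = f' \<bullet> t" using vt by (simp add: power2_norm_eq_inner)
  define K where "K = \<kappa> * 4 ^ CARD('n)"
  have M0: "0 \<le> M" using \<gamma> by linarith
  have Gb: "norm (bary_grad z) \<le> K / diameter T" if "z \<in> C" for z
  proof -
    have "diameter T \<le> K * height z" using diameter_le_height(1)[OF that \<kappa>] by (simp add: K_def)
    then show ?thesis using diameter_pos bary_grad_nz[OF that] by (simp add: height_def field_simps)
  qed
  have K0: "0 \<le> K / diameter T" using Gb[OF z0] norm_ge_zero order_trans by blast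
  have p1: "\<bar>\<Prod>y\<in>C - {z0} - {z}. bary y x\<bar> \<le> 1" for z
  proof -
    have "0 \<le> (\<Prod>y\<in>C - {z0} - {z}. bary y x)" "(\<Prod>y\<in>C - {z0} - {z}. bary y x) \<le> 1"
      using bary_facet_bounds[OF z0 x] by (auto intro!: prod_nonneg prod_le_1)
    then show ?thesis by simp
  qed
  have cb: "(\<Sum>z\<in>C - {z0}. r) \<le> 3 * r" if "0 \<le> r" for r :: real
    using card_C0[OF z0] card_le_3 that by (simp add: mult_right_mono)
  have "norm (\<Sum>z\<in>C - {z0}. d z *\<^sub>R bary_grad z) \<le> (\<Sum>z\<in>C - {z0}. M * (K / diameter T))"
    using d Gb M0 by (intro order_trans[OF norm_sum] sum_mono) (auto intro!: mult_mono simp del: times_divide_eq_right)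
  also have "\<dots> \<le> 3 * (M * (K / diameter T))" using M0 K0 by (intro cb mult_nonneg_nonneg)
  finally have 1: "norm (\<Sum>z\<in>C - {z0}. d z *\<^sub>R bary_grad z) \<le> 3 * (M * (K / diameter T))" .
  have "norm (\<Sum>z\<in>C - {z0}. (\<Prod>y\<in>C - {z0} - {z}. bary y x) *\<^sub>R bary_grad z) \<le> (\<Sum>z\<in>C - {z0}. 1 * (K / diameter T))"
  proof (intro order_trans[OF norm_sum] sum_mono)
    fix z assume z: "z \<in> C - {z0}"
    then show "norm ((\<Prod>y\<in>C - {z0} - {z}. bary y x) *\<^sub>R bary_grad z) \<le> 1 * (K / diameter T)"
      unfolding norm_scaleR using p1[of z] Gb[of z] by (intro mult_mono) auto
  qed
  also have "\<dots> \<le> 3 * (1 * (K / diameter T))" using K0 by (intro cb) simp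
  finally have 2: "norm (\<Sum>z\<in>C - {z0}. (\<Prod>y\<in>C - {z0} - {z}. bary y x) *\<^sub>R bary_grad z) \<le> 3 * (K / diameter T)" by simp
  have "norm f' \<le> 3 * (M * (K / diameter T)) + M * (3 * (K / diameter T))"
    unfolding f'_def
  proof (intro order_trans[OF norm_triangle_ineq] add_mono 1)
    show "norm (\<gamma> *\<^sub>R (\<Sum>z\<in>C - {z0}. (\<Prod>y\<in>C - {z0} - {z}. bary y x) *\<^sub>R bary_grad z)) \<le> M * (3 * (K / diameter T))"
      unfolding norm_scaleR using 2 \<gamma> M0 by (intro mult_mono) auto
  qed
  then have fb: "norm f' \<le> 6 * M * K / diameter T" by (simp add: mult_ac)
  have "norm t * norm t \<le> (6 * M * K / diameter T) * norm t"
  proof -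
    have "norm t * norm t = f' \<bullet> t" using tt by (simp add: power2_eq_square)
    also have "\<dots> \<le> norm f' * norm t" by (rule norm_cauchy_schwarz)
    also have "\<dots> \<le> (6 * M * K / diameter T) * norm t" using fb by (intro mult_right_mono) auto
    finally show ?thesis .
  qed
  moreover have "0 \<le> 6 * M * K / diameter T" using fb norm_ge_zero order_trans by blast
  ultimately have "norm t \<le> 6 * M * K / diameter T" 
  proof (cases "t = 0")
    case False
    assume le: "norm t * norm t \<le> 6 * M * K / diameter T * norm t"
    show ?thesis by (rule mult_right_le_imp_le[OF le]) (simp add: False)
  qed simp
  then show ?thesis by (simp add: t_def K_def)
qed

lemma bary_affine_comb:
  assumes z: "z \<in> C" and "sum c A = 1"
  shows "bary z (\<Sum>y\<in>A. c y *\<^sub>R y) = (\<Sum>y\<in>A. c y * bary z y)"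
proof -
  have "(\<Sum>y\<in>A. c y * bary z y) = (\<Sum>y\<in>A. c y * (bary z 0 + bary_grad z \<bullet> y))"
    by (rule sum.cong[OF refl]) (simp only: bary_affine0[OF z, symmetric])
  also have "\<dots> = sum c A * bary z 0 + bary_grad z \<bullet> (\<Sum>y\<in>A. c y *\<^sub>R y)"
    by (simp add: distrib_left sum.distrib inner_sum_right sum_distrib_right)
  also have "\<dots> = bary z (\<Sum>y\<in>A. c y *\<^sub>R y)" using bary_affine0[OF z, of "\<Sum>y\<in>A. c y *\<^sub>R y"] assms(2) by simp
  finally show ?thesis by simp
qed

lemma extreme_points_facet: "z \<in> C \<Longrightarrow> {x. x extreme_point_of (facet z)} = C - {z}"
  using extreme_point_of_convex_hull_affine_independent[OF affine_independent_Diff[OF aff_ind]]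
  by (simp, simp add: set_diff_eq)

end

section \<open>Two simplices with a common facet\<close>

locale facet_pair = T: simplex_element T C + T': simplex_element T' C'
  for T C T' C' :: "(real ^ 'n) set" +
  fixes z0 z0' :: "real ^ 'n"
  assumes z0: "z0 \<in> C" and z0': "z0' \<in> C'" and facet_eq: "T.facet z0 = T'.facet z0'"
begin

lemma C0_eq: "C - {z0} = C' - {z0'}"
proof -
  have "C - {z0} = {x. x extreme_point_of T.facet z0}" by (rule T.extreme_points_facet[OF z0, symmetric])
  also have "\<dots> = {x. x extreme_point_of T'.facet z0'}" unfolding facet_eq ..
  also have "\<dots> = C' - {z0'}" by (rule T'.extreme_points_facet[OF z0'])
  finally show ?thesis .
qed

lemma hyperplane_eq: "T.bary z0 x = 0 \<longleftrightarrow> T'.bary z0' x = 0"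
proof -
  have "{x. T.bary z0 x = 0} = {x. T'.bary z0' x = 0}"
    by (simp only: T.affine_hull_facet[OF z0, symmetric] T'.affine_hull_facet[OF z0', symmetric] facet_eq)
  then show ?thesis by auto
qed

lemma bary_eq: assumes "T.bary z0 x = 0" "z \<in> C - {z0}" shows "T'.bary z x = T.bary z x"
proof -
  have "(\<Sum>z\<in>C' - {z0'}. T.bary z x) = 1" "(\<Sum>z\<in>C' - {z0'}. T.bary z x *\<^sub>R z) = x"
    using T.sum_bary_facet[OF z0 assms(1)] T.bary_comb[of x]
      sum.remove[OF T.fin z0, of "\<lambda>z. T.bary z x *\<^sub>R z"] assms(1) by (simp_all add: C0_eq[symmetric])
  from T'.facet_comb(2)[OF z0' this] assms(2) show ?thesis by (simp add: C0_eq)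
qed

lemma facet_function_eq: assumes x: "T.bary z0 x = 0"
  shows "T'.facet_function z0' d \<gamma> x = T.facet_function z0 d \<gamma> x"
proof -
  have "(\<Sum>z\<in>C' - {z0'}. d z * T'.bary z x) = (\<Sum>z\<in>C - {z0}. d z * T.bary z x)"
  proof (rule sum.cong[OF C0_eq[symmetric]])
    fix z assume "z \<in> C - {z0}"
    from bary_eq[OF x this] show "d z * T'.bary z x = d z * T.bary z x" by (rule arg_cong)
  qed
  moreover have "(\<Prod>z\<in>C' - {z0'}. T'.bary z x) = (\<Prod>z\<in>C - {z0}. T.bary z x)"
    by (rule prod.cong[OF C0_eq[symmetric]]) (rule bary_eq[OF x])
  ultimately show ?thesis unfolding T.facet_function_def T'.facet_function_def by (simp only:)
qed

lemma prism_eq: "T.prism z0 = T'.prism z0'"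
  unfolding T.prism_def T'.prism_def facet_eq ..

lemma area_eq: "T.area z0 = T'.area z0'"
  unfolding T.area_def T'.area_def prism_eq ..

lemma bubble_divergence_eq: "T.bubble_divergence = T'.bubble_divergence"
  unfolding T.bubble_divergence_def T'.bubble_divergence_def T.card_C T'.card_C ..

text \<open>\<open>T.bary z0\<close> is affine and vanishes at the common vertices, so only
  \<open>z0'\<close> survives in the barycentric expansion with respect to
  \<open>T'\<close>.\<close>

lemma bary_transfer: "T.bary z0 x = T'.bary z0' x * T.bary z0 z0'"
proof -
  have "T.bary z0 x = T.bary z0 (\<Sum>z\<in>C'. T'.bary z x *\<^sub>R z)" by (simp add: T'.bary_comb)
  also have "\<dots> = (\<Sum>z\<in>C'. T'.bary z x * T.bary z0 z)" by (rule T.bary_affine_comb[OF z0 T'.bary_sum])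
  also have "\<dots> = T'.bary z0' x * T.bary z0 z0' + (\<Sum>z\<in>C' - {z0'}. T'.bary z x * T.bary z0 z)"
    by (rule sum.remove[OF T'.fin z0'])
  also have "(\<Sum>z\<in>C' - {z0'}. T'.bary z x * T.bary z0 z) = 0"
    unfolding C0_eq[symmetric] using z0 by (intro sum.neutral) (auto simp: T.bary_vertex)
  finally show ?thesis by simp
qed

text \<open>If both opposite vertices were on the same side, a short step from the barycentre of the
  facet towards \<open>z0'\<close> would enter both open simplices.\<close>

lemma opposite_side: assumes disj: "T \<inter> T' = {}" shows "T.bary z0 z0' < 0"
proof (rule ccontr)
  assume "\<not> T.bary z0 z0' < 0"
  \<comment> \<open>By \<open>bary_transfer\<close> the value zero would make
    \<open>T.bary z0\<close> vanish everywhere, even at \<open>z0\<close>.\<close>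
  moreover have "T.bary z0 z0' \<noteq> 0"
  proof
    assume "T.bary z0 z0' = 0"
    then have "T.bary z0 z0 = 0" using bary_transfer[of z0] by (simp only: mult_zero_right)
    moreover have "T.bary z0 z0 = 1" using T.bary_vertex[OF z0 z0] by (simp only: refl if_True)
    ultimately show False by (simp only: zero_neq_one)
  qed
  ultimately have pos: "0 < T.bary z0 z0'" by simp
  define D where "D = real (card (C - {z0}))"
  have D: "D > 0" using T.card_C0[OF z0] T.card_ge_2 by (simp add: D_def)
  define xF where "xF = (\<Sum>z\<in>C - {z0}. (1 / D) *\<^sub>R z)"
  have s1: "(\<Sum>z\<in>C - {z0}. 1 / D) = 1" using D by (simp add: D_def)
  note fc = T.facet_comb[OF z0 s1 xF_def[symmetric]]
  note fc' = T'.facet_comb[OF z0' s1[unfolded C0_eq] xF_def[unfolded C0_eq, symmetric]]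
  define e where "e = z0' - xF"
  have line: "T.bary z (xF + t *\<^sub>R e) = T.bary z xF + t * (T.bary z z0' - T.bary z xF)" if "z \<in> C" for z t
    unfolding T.bary_line[OF that] e_def T.bary_grad_inner_diff[OF that] ..
  have line': "T'.bary z (xF + t *\<^sub>R e) = T'.bary z xF + t * (T'.bary z z0' - T'.bary z xF)" if "z \<in> C'" for z t
    unfolding T'.bary_line[OF that] e_def T'.bary_grad_inner_diff[OF that] ..
  have inT': "xF + t *\<^sub>R e \<in> T'" if t: "0 < t" "t < 1" for t
  proof -
    have "0 < T'.bary z (xF + t *\<^sub>R e)" if z: "z \<in> C'" for z
    proof (cases "z = z0'")
      case True then show ?thesis using line'[OF z, of t] fc'(1) T'.bary_vertex[OF z0' z0'] t by simp
    next
      case False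
      then have "T'.bary z (xF + t *\<^sub>R e) = (1 - t) * (1 / D)"
        using line'[OF z, of t] fc'(2)[of z] T'.bary_vertex[OF z z0'] z D by (simp add: field_simps)
      then show ?thesis using t D by simp
    qed
    then show ?thesis by (subst T'.T_bary) blast
  qed
  have "\<forall>\<^sub>F t in at_right 0. \<forall>z\<in>C. 0 < T.bary z (xF + t *\<^sub>R e)"
  proof (intro eventually_ball_finite[OF T.fin] ballI)
    fix z assume z: "z \<in> C"
    show "\<forall>\<^sub>F t in at_right 0. 0 < T.bary z (xF + t *\<^sub>R e)"
    proof (cases "z = z0")
      case True
      have "\<forall>\<^sub>F t in at_right (0::real). 0 < t" by (rule eventually_at_right_less)
      then show ?thesis
        by eventually_elim (simp add: True line[OF z0] fc(1) pos)
    next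
      case False
      then have p: "0 < T.bary z xF" using fc(2)[of z] z D by simp
      have "((\<lambda>t. T.bary z xF + t * (T.bary z z0' - T.bary z xF)) \<longlongrightarrow> T.bary z xF + 0 * (T.bary z z0' - T.bary z xF)) (at_right 0)"
        by (intro tendsto_intros)
      then have "\<forall>\<^sub>F t in at_right 0. 0 < T.bary z xF + t * (T.bary z z0' - T.bary z xF)"
        using p by (intro order_tendstoD(1)) auto
      then show ?thesis unfolding line[OF z] .
    qed
  qed
  moreover have "\<forall>\<^sub>F t in at_right (0::real). t < 1" "\<forall>\<^sub>F t in at_right (0::real). 0 < t"
    by (auto simp: eventually_at_right[of 0 1] intro: exI[of _ 1] eventually_at_right_less)
  ultimately have "\<forall>\<^sub>F t in at_right 0. xF + t *\<^sub>R e \<in> T \<inter> T'"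
  proof eventually_elim
    case (elim t)
    then have "xF + t *\<^sub>R e \<in> T" by (subst T.T_bary) blast
    then show ?case using inT' elim by blast
  qed
  then have "\<exists>t. xF + t *\<^sub>R e \<in> T \<inter> T'" using eventually_happens'[OF trivial_limit_at_right_real] by blast
  then show False using disj by blast
qed

end

section \<open>Facets of a conforming mesh\<close>

lemma mesh_simplex_element:
  fixes K :: "(real ^ 'n) set"
  assumes dim: "CARD('n) = 2 \<or> CARD('n) = 3" and mesh: "conforming_mesh \<Omega> \<T>" and K: "K \<in> \<T>"
  shows "simplex_element K (vertices K)"
proof -
  have "\<exists>S. int CARD('n) simplex S \<and> K = interior S"
    using mesh K unfolding conforming_mesh_def by simp
  then obtain S where S: "int CARD('n) simplex S" "K = interior S" by (elim exE conjE)
  obtain C where C: "\<not> affine_dependent C" "int (card C) = int CARD('n) + 1" "S = convex hull C"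
    using S(1) unfolding simplex_def by (elim exE conjE)
  have el: "simplex_element K C"
    by (rule simplex_element.intro) (use C S(2) dim in simp_all)
  show ?thesis unfolding simplex_element.vertices_eq[OF el] by (rule el)
qed

lemma mesh_disjoint:
  assumes "conforming_mesh \<Omega> \<T>" "A \<in> \<T>" "B \<in> \<T>" "A \<noteq> B"
  shows "A \<inter> B = {}"
proof -
  have "disjoint \<T>" using assms(1) unfolding conforming_mesh_def by simp
  then show ?thesis using assms(2-4) by (rule disjointD)
qed

text \<open>A relative interior point of \<open>F\<close> in \<open>\<Omega>\<close> is a limit of
  points beyond \<open>F\<close>. Finitely many closed elements other than \<open>T\<close> cover
  these, so the closure of one of them, \<open>K\<close>, contains the limit. The two closures then
  intersect in a face that meets the relative interior of \<open>F\<close>; it contains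
  \<open>F\<close>, and by dimension it equals \<open>F\<close>.\<close>

lemma facet_has_neighbour:
  fixes T :: "(real ^ 'n) set"
  assumes dim: "CARD('n) = 2 \<or> CARD('n) = 3" and mesh: "conforming_mesh \<Omega> \<T>" and \<Omega>: "open \<Omega>"
    and T: "T \<in> \<T>" and F: "F \<in> facets T" and ne: "F \<inter> \<Omega> \<noteq> {}"
  shows "\<exists>K\<in>\<T>. K \<noteq> T \<and> F \<in> facets K"
proof -
  interpret T: simplex_element T "vertices T" by (rule mesh_simplex_element[OF dim mesh T])
  obtain z0 where z0: "z0 \<in> vertices T" "F = T.facet z0" using F T.facets_eq by auto
  have fin: "finite \<T>" and cov: "closure \<Omega> = (\<Union>K\<in>\<T>. closure K)" and disj: "disjoint \<T>"
    and faces: "\<And>K. K \<in> \<T> \<Longrightarrow> (closure T \<inter> closure K) face_of closure T \<and> (closure T \<inter> closure K) face_of closure K"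
    using mesh T by (auto simp: conforming_mesh_def)
  have Fface: "F face_of closure T" "aff_dim F = aff_dim (closure T) - 1" "F \<noteq> {}"
    using F by (auto simp: facets_def facet_of_def)
  have "closure (rel_interior F) = F"
    using convex_closure_rel_interior[of F] T.closed_facet by (simp add: z0(2))
  then have "\<Omega> \<inter> rel_interior F \<noteq> {}" using ne open_Int_closure_eq_empty[OF \<Omega>, of "rel_interior F"] by auto
  then obtain x where x: "x \<in> \<Omega>" "x \<in> rel_interior F" by blast
  have xF: "x \<in> F" using x(2) rel_interior_subset by blast
  have bx: "T.bary z0 x = 0" using xF T.facet_bary[OF z0(1)] unfolding z0(2) by auto
  \<comment> \<open>These points approach \<open>x\<close> from the side of \<open>F\<close> away
    from \<open>z0\<close>.\<close>
  define y where "y k = x + (- inverse (real (Suc k))) *\<^sub>R (z0 - x)" for k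
  let ?U = "\<Union>K\<in>\<T> - {T}. closure K"
  have "(\<lambda>k. x + (- inverse (real (Suc k))) *\<^sub>R (z0 - x)) \<longlonglongrightarrow> x + (- 0) *\<^sub>R (z0 - x)"
    by (intro tendsto_intros LIMSEQ_inverse_real_of_nat)
  then have lim: "y \<longlonglongrightarrow> x" by (simp add: y_def[abs_def])
  have notT: "y k \<notin> closure T" for k
  proof -
    have "T.bary z0 (y k) = - inverse (real (Suc k))"
      unfolding y_def T.bary_line[OF z0(1)] T.bary_grad_inner_diff[OF z0(1)]
      using T.bary_vertex[OF z0(1) z0(1)] bx by simp
    then have "T.bary z0 (y k) < 0" by simp
    then show ?thesis unfolding T.closure_T T.hull_bary using z0(1) by (auto simp: not_le)
  qed
  have evU: "\<forall>\<^sub>F k in sequentially. y k \<in> ?U"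
    using topological_tendstoD[OF lim \<Omega> x(1)]
  proof (rule eventually_mono)
    fix k assume "y k \<in> \<Omega>"
    then have "y k \<in> closure \<Omega>" using closure_subset[of \<Omega>] by (rule subsetD[rotated])
    then obtain K where K: "K \<in> \<T>" "y k \<in> closure K" unfolding cov by (rule UN_E)
    have "K \<noteq> T" using notT[of k] K(2) by auto
    then show "y k \<in> ?U" using K by (intro UN_I[of K]) auto
  qed
  have "closed ?U" using fin by (intro closed_UN) auto
  then have "x \<in> ?U" by (rule Lim_in_closed_set[OF _ evU trivial_limit_sequentially lim])
  then obtain K where K': "K \<in> \<T> - {T}" "x \<in> closure K" by (rule UN_E)
  have K: "K \<in> \<T>" "K \<noteq> T" "x \<in> closure K" using K'(1) K'(2) by simp_all
  interpret K: simplex_element K "vertices K" by (rule mesh_simplex_element[OF dim mesh K(1)])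
  let ?G = "closure T \<inter> closure K"
  note G = faces[OF K(1)]
  have FT: "F \<subseteq> closure T" using Fface(1) by (rule face_of_imp_subset)
  have FG: "F \<subseteq> ?G"
  proof (rule subset_of_face_of[OF conjunct1[OF G] FT])
    have "x \<in> ?G \<inter> rel_interior F" by (intro IntI K(3) x(2) subsetD[OF FT xF])
    then show "?G \<inter> rel_interior F \<noteq> {}" by (metis empty_iff)
  qed
  have cT: "convex (closure T)" unfolding T.closure_T by (rule convex_convex_hull)
  have cK: "convex (closure K)" unfolding K.closure_T by (rule convex_convex_hull)
  \<comment> \<open>Otherwise two disjoint open elements would meet; so the common face has smaller
    dimension than \<open>T\<close>.\<close>
  have "?G \<noteq> closure T"
  proof
    assume "?G = closure T"
    then have "T \<inter> closure K = T" using closure_subset[of T] by blast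
    then have "T \<inter> closure K \<noteq> {}" using T.T_nonempty by simp
    then have "T \<inter> K \<noteq> {}" using open_Int_closure_eq_empty[OF T.open_T, of K] by simp
    then show False using disj[THEN disjointD, OF T K(1)] K(2) by simp
  qed
  then have GT: "aff_dim ?G < aff_dim (closure T)"
    by (rule face_of_aff_dim_lt[OF cT conjunct1[OF G]])
  have FfG: "F face_of ?G" by (rule face_of_subset[OF Fface(1) FG Int_lower1])
  have "F = ?G"
  proof (rule ccontr)
    assume "F \<noteq> ?G"
    then have "aff_dim F < aff_dim ?G" by (rule face_of_aff_dim_lt[OF convex_Int[OF cT cK] FfG])
    then show False using GT Fface(2) by linarith
  qed
  moreover have "aff_dim (closure K) = aff_dim (closure T)"
    by (simp only: closure_aff_dim aff_dim_open[OF T.open_T T.T_nonempty] aff_dim_open[OF K.open_T K.T_nonempty])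
  ultimately have "F facet_of closure K"
    unfolding facet_of_def using conjunct2[OF G] Fface(2,3) by metis
  then have "F \<in> facets K" by (simp add: facets_def)
  then show ?thesis using K(1,2) by (intro bexI[of _ K] conjI)
qed

lemma mesh_facet_pair:
  fixes T K :: "(real ^ 'n) set"
  assumes dim: "CARD('n) = 2 \<or> CARD('n) = 3" and mesh: "conforming_mesh \<Omega> \<T>"
    and T: "T \<in> \<T>" "F \<in> facets T" and K: "K \<in> \<T>" "F \<in> facets K"
  shows "facet_pair T (vertices T) K (vertices K) (opposite_vertex T F) (opposite_vertex K F)"
proof -
  interpret T: simplex_element T "vertices T" by (rule mesh_simplex_element[OF dim mesh T(1)])
  interpret K: simplex_element K "vertices K" by (rule mesh_simplex_element[OF dim mesh K(1)])
  obtain z where z: "z \<in> vertices T" "F = T.facet z" using T(2) T.facets_eq by auto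
  obtain w where w: "w \<in> vertices K" "F = K.facet w" using K(2) K.facets_eq by auto
  have "opposite_vertex T F = z" "opposite_vertex K F = w"
    using T.opposite_vertex_eq[OF z(1)] K.opposite_vertex_eq[OF w(1)] z(2) w(2) by auto
  then show ?thesis using z w by unfold_locales auto
qed

text \<open>Any two of three elements at \<open>F\<close> would lie on opposite sides, making three
  coordinates negative, although by \<open>bary_transfer\<close> one of them is the product of the
  other two.\<close>

lemma facet_neighbour_unique:
  fixes T :: "(real ^ 'n) set"
  assumes dim: "CARD('n) = 2 \<or> CARD('n) = 3" and mesh: "conforming_mesh \<Omega> \<T>"
    and T: "T \<in> \<T>" "F \<in> facets T" and K: "K \<in> \<T>" "F \<in> facets K" "K \<noteq> T"
    and L: "L \<in> \<T>" "F \<in> facets L" "L \<noteq> T"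
  shows "K = L"
proof (rule ccontr)
  assume KL: "K \<noteq> L"
  note disj = mesh_disjoint[OF mesh]
  note TK = mesh_facet_pair[OF dim mesh T K(1,2)]
  note TL = mesh_facet_pair[OF dim mesh T L(1,2)]
  note KL' = mesh_facet_pair[OF dim mesh K(1,2) L(1,2)]
  let ?zT = "opposite_vertex T F" and ?zK = "opposite_vertex K F" and ?zL = "opposite_vertex L F"
  have "barycentric T ?zT ?zK < 0"
    by (rule facet_pair.opposite_side[OF TK disj[OF T(1) K(1) K(3)[symmetric]]])
  moreover have "barycentric T ?zT ?zL < 0"
    by (rule facet_pair.opposite_side[OF TL disj[OF T(1) L(1) L(3)[symmetric]]])
  moreover have "barycentric K ?zK ?zL < 0"
    by (rule facet_pair.opposite_side[OF KL' disj[OF K(1) L(1) KL]])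
  moreover have "barycentric T ?zT ?zL = barycentric K ?zK ?zL * barycentric T ?zT ?zK"
    by (rule facet_pair.bary_transfer[OF TK])
  ultimately show False using mult_neg_neg[of "barycentric K ?zK ?zL" "barycentric T ?zT ?zK"] by linarith
qed

lemma integral_indicator_subset:
  fixes f :: "'a::euclidean_space \<Rightarrow> real"
  assumes "K \<subseteq> S" "K \<in> sets lebesgue" "S \<in> sets lebesgue"
  shows "(LINT x|lebesgue_on S. indicator K x * f x) = (LINT x|lebesgue_on K. f x)"
proof -
  have "(LINT x|lebesgue_on S. indicator K x * f x) = (LINT x|lebesgue. indicator S x *\<^sub>R (indicator K x * f x))"
    using assms by (subst integral_restrict_space) (auto simp: set_lebesgue_integral_def)
  also have "(\<lambda>x. indicator S x *\<^sub>R (indicator K x * f x)) = (\<lambda>x. indicator K x *\<^sub>R f x)"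
    using assms(1) by (auto simp: indicator_def fun_eq_iff)
  also have "(LINT x|lebesgue. indicator K x *\<^sub>R f x) = (LINT x|lebesgue_on K. f x)"
    using assms by (subst integral_restrict_space) (auto simp: set_lebesgue_integral_def)
  finally show ?thesis .
qed

lemma integrable_indicator_subset:
  fixes f :: "'a::euclidean_space \<Rightarrow> real"
  assumes "K \<subseteq> S" "K \<in> sets lebesgue" "S \<in> sets lebesgue" "integrable (lebesgue_on K) f"
  shows "integrable (lebesgue_on S) (\<lambda>x. indicator K x * f x)"
proof -
  have "(\<lambda>x. indicator S x *\<^sub>R (indicator K x * f x)) = (\<lambda>x. indicator K x *\<^sub>R f x)"
    using assms(1) by (auto simp: indicator_def fun_eq_iff)
  moreover have "integrable lebesgue (\<lambda>x. indicator K x *\<^sub>R f x)"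
    using assms integrable_restrict_space[of K lebesgue f] by (simp add: set_integrable_def)
  ultimately show ?thesis
    using assms integrable_restrict_space[of S lebesgue "\<lambda>x. indicator K x * f x"] by (simp add: set_integrable_def)
qed

locale mesh_facet =
  fixes \<Omega> :: "(real ^ 'n) set" and \<T> T F
  assumes dim: "CARD('n) = 2 \<or> CARD('n) = 3"
    and open_\<Omega>: "open \<Omega>" and bounded_\<Omega>: "bounded \<Omega>"
    and mesh: "conforming_mesh \<Omega> \<T>"
    and T: "T \<in> \<T>" and F: "F \<in> facets T"
begin

definition adjacent :: "(real ^ 'n) set set" where "adjacent = {K \<in> \<T>. F \<in> facets K}"

text \<open>The sign of the jump across \<open>F\<close> as seen from \<open>T\<close>.\<close>

definition side :: "(real ^ 'n) set \<Rightarrow> real" where "side K = (if K = T then 1 else - 1)"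

abbreviation opp :: "(real ^ 'n) set \<Rightarrow> real ^ 'n" where "opp K \<equiv> opposite_vertex K F"

lemma finite_\<T>: "finite \<T>" using mesh by (simp add: conforming_mesh_def)

lemma elem: "K \<in> \<T> \<Longrightarrow> simplex_element K (vertices K)"
  by (rule mesh_simplex_element[OF dim mesh])

lemma elem_props: assumes "K \<in> \<T>"
  shows "open K" "bounded K" "K \<subseteq> \<Omega>" "K \<in> sets lebesgue" "K \<in> lmeasurable"
proof -
  interpret K: simplex_element K "vertices K" by (rule elem[OF assms])
  show "open K" "bounded K" "K \<in> lmeasurable" by (rule K.open_T K.bounded_T K.T_lmeasurable)+
  then show "K \<in> sets lebesgue" by (simp add: fmeasurableD)
  show "K \<subseteq> \<Omega>" using mesh assms by (auto simp: conforming_mesh_def)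
qed

lemma elem_disjoint: "K \<in> \<T> \<Longrightarrow> L \<in> \<T> \<Longrightarrow> x \<in> K \<Longrightarrow> x \<in> L \<Longrightarrow> K = L"
  using mesh_disjoint[OF mesh, of K L] by auto

lemma adjacent_T: "T \<in> adjacent" using T F by (simp add: adjacent_def)

lemma adjacentD: "K \<in> adjacent \<Longrightarrow> K \<in> \<T>" "K \<in> adjacent \<Longrightarrow> F \<in> facets K"
  by (simp_all add: adjacent_def)

lemma adjacent_cases: "(adjacent = {T} \<and> F \<inter> \<Omega> = {}) \<or> (\<exists>K. K \<noteq> T \<and> adjacent = {T, K})"
proof (cases "\<exists>K\<in>\<T>. K \<noteq> T \<and> F \<in> facets K")
  case True
  then obtain K where K: "K \<in> \<T>" "F \<in> facets K" "K \<noteq> T" by blast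
  have "adjacent = {T, K}"
  proof (rule set_eqI)
    fix L show "L \<in> adjacent \<longleftrightarrow> L \<in> {T, K}"
      unfolding adjacent_def using K T F facet_neighbour_unique[OF dim mesh T F K, of L] by (cases "L = T") auto
  qed
  then show ?thesis using K by blast
next
  case False
  then have "adjacent = {T}" using T F by (auto simp: adjacent_def)
  moreover have "F \<inter> \<Omega> = {}" using facet_has_neighbour[OF dim mesh open_\<Omega> T F] False by blast
  ultimately show ?thesis by blast
qed

lemma finite_adjacent: "finite adjacent" using finite_\<T> by (simp add: adjacent_def)

lemma sum_adjacent_le:
  assumes "\<And>K. K \<in> adjacent \<Longrightarrow> f K \<le> (c :: real)" "0 \<le> c"
  shows "(\<Sum>K\<in>adjacent. f K) \<le> 2 * c"
  using adjacent_cases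
proof
  assume "adjacent = {T} \<and> F \<inter> \<Omega> = {}"
  then have a: "adjacent = {T}" by (rule conjunct1)
  then have "f T \<le> c" using assms(1)[OF adjacent_T] by simp
  then show ?thesis unfolding a using assms(2) by simp
next
  assume "\<exists>K. K \<noteq> T \<and> adjacent = {T, K}"
  then obtain K where K: "K \<noteq> T" "adjacent = {T, K}" by (elim exE conjE)
  have "K \<in> adjacent" unfolding K(2) by simp
  then have "f T \<le> c" "f K \<le> c" using assms(1) adjacent_T by simp_all
  then show ?thesis unfolding K(2) using K(1) by simp
qed

lemma pair: "K \<in> adjacent \<Longrightarrow> facet_pair T (vertices T) K (vertices K) (opp T) (opp K)"
  by (rule mesh_facet_pair[OF dim mesh T F]) (simp_all add: adjacent_def)

lemma opp_vertex: assumes "K \<in> adjacent"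
  shows "opp K \<in> vertices K" "convex hull (vertices K - {opp K}) = F"
proof -
  interpret K: simplex_element K "vertices K" by (rule elem[OF adjacentD(1)[OF assms]])
  obtain z where z: "z \<in> vertices K" "F = K.facet z" using adjacentD(2)[OF assms] K.facets_eq by auto
  then have "opp K = z" using K.opposite_vertex_eq by simp
  then show "opp K \<in> vertices K" "convex hull (vertices K - {opp K}) = F" using z by auto
qed

text \<open>This is what makes the normal component of the glued field continuous: two neighbours
  carry opposite signs, and a single element means that \<open>F\<close> does not meet
  \<open>\<Omega>\<close>, so that test functions vanish on it.\<close>

lemma side_test_function:
  assumes \<phi>: "\<phi> \<in> test_functions \<Omega>"
  shows "(\<Sum>K\<in>adjacent. side K * (LINT s|surface_measure F. r s * \<phi> s)) = 0"
  using adjacent_cases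
proof
  assume a: "adjacent = {T} \<and> F \<inter> \<Omega> = {}"
  obtain S where S: "S \<subseteq> \<Omega>" "\<And>x. x \<notin> S \<Longrightarrow> \<phi> x = 0" using test_function_support[OF \<phi>] by metis
  have sp: "space (surface_measure F) = F" by (simp add: surface_measure_def space_restrict_space)
  have "(LINT s|surface_measure F. r s * \<phi> s) = (LINT s|surface_measure F. 0)"
  proof (rule Bochner_Integration.integral_cong[OF refl])
    fix s assume "s \<in> space (surface_measure F)"
    then have "s \<notin> S" using S(1) conjunct2[OF a] unfolding sp by (metis disjoint_iff subsetD)
    then show "r s * \<phi> s = 0" using S(2) by simp
  qed
  then show ?thesis unfolding conjunct1[OF a] by simp
next
  assume "\<exists>K. K \<noteq> T \<and> adjacent = {T, K}"
  then obtain K where K: "K \<noteq> T" "adjacent = {T, K}" by (elim exE conjE)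
  show ?thesis unfolding K(2) using K(1) by (simp add: side_def)
qed

end

subsection \<open>Fields on the elements adjacent to a facet\<close>

lemma l2_norm_sq: "(l2_norm S v)\<^sup>2 = l2_inner S v v"
  by (simp add: l2_norm_def l2_inner_def integral_nonneg_AE)

lemma AE_lebesgue_on_subset:
  assumes "AE x in lebesgue_on S. P x" "K \<subseteq> S" "K \<in> sets lebesgue" "S \<in> sets lebesgue"
  shows "AE x in lebesgue_on K. P x"
proof -
  have "AE x in lebesgue. x \<in> S \<longrightarrow> P x" using assms by (simp add: AE_restrict_space_iff)
  then have "AE x in lebesgue. x \<in> K \<longrightarrow> P x"
    by (rule AE_mp) (use assms(2) in \<open>auto intro!: AE_I2\<close>)
  then show ?thesis using assms by (simp add: AE_restrict_space_iff)
qed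

lemma L2_AE_cong:
  fixes f g :: "real ^ 'n \<Rightarrow> 'b::euclidean_space"
  assumes f: "f \<in> L2 S" and ae: "AE x in lebesgue_on S. f x = g x" and S: "S \<in> sets lebesgue"
  shows "g \<in> L2 S"
proof -
  have fm: "(\<lambda>x. indicator S x *\<^sub>R f x) \<in> borel_measurable lebesgue"
    using f S by (simp add: L2_def borel_measurable_restrict_space_iff)
  have "AE x in lebesgue. x \<in> S \<longrightarrow> f x = g x" using ae S by (simp add: AE_restrict_space_iff)
  then have "AE x in lebesgue. indicator S x *\<^sub>R f x = indicator S x *\<^sub>R g x"
    by (rule AE_mp) (auto simp: indicator_def intro!: AE_I2)
  then have "(\<lambda>x. indicator S x *\<^sub>R g x) \<in> borel_measurable lebesgue"
    by (rule borel_measurable_AE[OF fm])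
  then have gm: "g \<in> borel_measurable (lebesgue_on S)"
    using S by (simp add: borel_measurable_restrict_space_iff)
  have "integrable (lebesgue_on S) (\<lambda>x. (norm (f x))\<^sup>2)" using f by (simp add: L2_def)
  then have "integrable (lebesgue_on S) (\<lambda>x. (norm (g x))\<^sup>2)"
  proof (rule Bochner_Integration.integrable_cong_AE_imp)
    show "(\<lambda>x. (norm (g x))\<^sup>2) \<in> borel_measurable (lebesgue_on S)" using gm by measurable
    show "AE x in lebesgue_on S. (norm (f x))\<^sup>2 = (norm (g x))\<^sup>2" using ae by (rule AE_mp) (auto intro!: AE_I2)
  qed
  then show ?thesis using gm by (simp add: L2_def)
qed

lemma l2_inner_AE_cong:
  fixes f g h k :: "real ^ 'n \<Rightarrow> 'b::euclidean_space"
  assumes "f \<in> L2 S" "g \<in> L2 S" "h \<in> L2 S" "k \<in> L2 S"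
    and "AE x in lebesgue_on S. f x = g x" "AE x in lebesgue_on S. h x = k x"
  shows "l2_inner S f h = l2_inner S g k"
  unfolding l2_inner_def
proof (rule integral_cong_AE)
  show "AE x in lebesgue_on S. f x \<bullet> h x = g x \<bullet> k x"
    using assms(5,6) by eventually_elim simp
qed (use assms(1-4) in \<open>auto simp: L2_def\<close>)

lemma l2_inner_cong:
  assumes "\<And>x. x \<in> S \<Longrightarrow> f x \<bullet> h x = g x \<bullet> k x"
  shows "l2_inner S f h = l2_inner S g k"
  unfolding l2_inner_def by (rule Bochner_Integration.integral_cong) (auto simp: assms)

lemma l2_inner_diff_right:
  assumes "f \<in> L2 S" "g \<in> L2 S" "h \<in> L2 S"
  shows "l2_inner S h (\<lambda>x. f x - g x) = l2_inner S h f - l2_inner S h g"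
  using L2_integrable_inner[OF assms(3,1)] L2_integrable_inner[OF assms(3,2)]
  by (simp add: l2_inner_def inner_diff_right)

lemma l2_inner_scale_left: "l2_inner S (\<lambda>x. c *\<^sub>R f x) g = c * l2_inner S f g"
  by (simp add: l2_inner_def)

lemma l2_inner_self_nonneg: "0 \<le> l2_inner S v v"
  by (simp add: l2_inner_def integral_nonneg_AE)

lemma l2_inner_self_integrable: "v \<in> L2 S \<Longrightarrow> integrable (lebesgue_on S) (\<lambda>x. v x \<bullet> v x)"
  by (rule L2_integrable_inner)

text \<open>A weighted Young inequality; \<open>duality\<close> picks the weight
  \<open>\<delta>\<close> such that the field terms can be absorbed.\<close>

lemma l2_inner_young:
  assumes f: "f \<in> L2 S" and g: "g \<in> L2 S" and \<delta>: "0 < \<delta>"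
  shows "\<bar>l2_inner S f g\<bar> \<le> \<delta> * l2_inner S f f + l2_inner S g g / \<delta>"
proof -
  have i: "integrable (lebesgue_on S) (\<lambda>x. \<delta> * (f x \<bullet> f x) + (g x \<bullet> g x) / \<delta>)"
    using L2_integrable_inner[OF f f] L2_integrable_inner[OF g g] by simp
  have pt: "\<bar>f x \<bullet> g x\<bar> \<le> \<delta> * (f x \<bullet> f x) + (g x \<bullet> g x) / \<delta>" for x
  proof -
    have "\<bar>f x \<bullet> g x\<bar> \<le> norm (f x) * norm (g x)" by (rule Cauchy_Schwarz_ineq2)
    also have "\<dots> \<le> \<delta> * (norm (f x))\<^sup>2 + (norm (g x))\<^sup>2 / \<delta>"
    proof -
      have "0 \<le> (\<delta> * norm (f x) - norm (g x))\<^sup>2" by simp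
      then have "2 * (norm (f x) * norm (g x)) \<le> \<delta> * (norm (f x))\<^sup>2 + (norm (g x))\<^sup>2 / \<delta>"
        using \<delta> by (simp add: power2_eq_square field_simps)
      moreover have "0 \<le> norm (f x) * norm (g x)" by simp
      ultimately show ?thesis by linarith
    qed
    finally show ?thesis by (simp add: power2_norm_eq_inner)
  qed
  have "\<bar>l2_inner S f g\<bar> \<le> (LINT x|lebesgue_on S. \<bar>f x \<bullet> g x\<bar>)"
    unfolding l2_inner_def by (rule integral_abs_bound)
  also have "\<dots> \<le> (LINT x|lebesgue_on S. \<delta> * (f x \<bullet> f x) + (g x \<bullet> g x) / \<delta>)"
    by (rule integral_mono) (use i pt L2_integrable_inner[OF f g] in auto)
  also have "\<dots> = \<delta> * l2_inner S f f + l2_inner S g g / \<delta>"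
    using L2_integrable_inner[OF f f] L2_integrable_inner[OF g g] by (simp add: l2_inner_def)
  finally show ?thesis .
qed

lemma l2_inner_self_mono:
  assumes "v \<in> L2 S" "K \<subseteq> S" "K \<in> sets lebesgue" "S \<in> sets lebesgue"
  shows "l2_inner K v v \<le> l2_inner S v v"
proof -
  have i: "integrable (lebesgue_on S) (\<lambda>x. v x \<bullet> v x)" using assms(1) by (rule l2_inner_self_integrable)
  have iK: "integrable (lebesgue_on K) (\<lambda>x. v x \<bullet> v x)"
    by (rule l2_inner_self_integrable[OF L2_restrict[OF assms]])
  have "l2_inner K v v = (LINT x|lebesgue_on S. indicator K x * (v x \<bullet> v x))"
    unfolding l2_inner_def by (rule integral_indicator_subset[OF assms(2-4), symmetric])
  also have "\<dots> \<le> (LINT x|lebesgue_on S. v x \<bullet> v x)"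
    by (rule integral_mono[OF integrable_indicator_subset[OF assms(2-4) iK] i]) (auto simp: indicator_def)
  finally show ?thesis by (simp add: l2_inner_def)
qed

lemma L2_indicator:
  fixes f :: "real ^ 'n \<Rightarrow> 'b::euclidean_space"
  assumes K: "K \<subseteq> S" "K \<in> sets lebesgue" "S \<in> sets lebesgue" and f: "f \<in> L2 K"
  shows "(\<lambda>x. indicator K x *\<^sub>R f x) \<in> L2 S"
proof -
  have "(\<lambda>x. indicator K x *\<^sub>R f x) \<in> borel_measurable lebesgue"
    using f K by (simp add: L2_def borel_measurable_restrict_space_iff)
  then have "(\<lambda>x. indicator K x *\<^sub>R f x) \<in> borel_measurable (lebesgue_on S)" by (rule measurable_restrict_space1)
  moreover have "integrable (lebesgue_on S) (\<lambda>x. indicator K x * (norm (f x))\<^sup>2)"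
    by (rule integrable_indicator_subset[OF K]) (use f in \<open>simp add: L2_def\<close>)
  moreover have "(\<lambda>x. (norm (indicator K x *\<^sub>R f x))\<^sup>2) = (\<lambda>x. indicator K x * (norm (f x))\<^sup>2)"
    by (auto simp: indicator_def fun_eq_iff)
  ultimately show ?thesis by (simp add: L2_def)
qed

lemma L2_zero: "(\<lambda>x. 0) \<in> L2 S" by (simp add: L2_def)

lemma L2_sum: "finite I \<Longrightarrow> (\<And>i. i \<in> I \<Longrightarrow> f i \<in> L2 S) \<Longrightarrow> (\<lambda>x. \<Sum>i\<in>I. f i x) \<in> L2 S"
proof (induction I rule: finite_induct)
  case empty then show ?case by (simp add: L2_zero)
next
  case (insert i I)
  then have "(\<lambda>x. f i x + (\<Sum>i\<in>I. f i x)) \<in> L2 S" by (intro L2_add) auto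
  then show ?case using insert by simp
qed

lemma l2_inner_piecewise:
  fixes f :: "(real ^ 'n) set \<Rightarrow> real ^ 'n \<Rightarrow> 'b::euclidean_space"
  assumes fin: "finite I" and K: "\<And>K. K \<in> I \<Longrightarrow> K \<subseteq> S \<and> K \<in> sets lebesgue" "S \<in> sets lebesgue"
    and f: "\<And>K. K \<in> I \<Longrightarrow> f K \<in> L2 K" and w: "w \<in> L2 S"
  shows "l2_inner S (\<lambda>x. \<Sum>K\<in>I. indicator K x *\<^sub>R f K x) w = (\<Sum>K\<in>I. l2_inner K (f K) w)"
proof -
  have wK: "w \<in> L2 K" if "K \<in> I" for K using L2_restrict[OF w _ _ K(2)] K(1)[OF that] by simp
  have "l2_inner S (\<lambda>x. \<Sum>K\<in>I. indicator K x *\<^sub>R f K x) w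
      = (LINT x|lebesgue_on S. (\<Sum>K\<in>I. indicator K x * (f K x \<bullet> w x)))"
    unfolding l2_inner_def by (simp add: inner_sum_left)
  also have "\<dots> = (\<Sum>K\<in>I. (LINT x|lebesgue_on S. indicator K x * (f K x \<bullet> w x)))"
    by (intro Bochner_Integration.integral_sum integrable_indicator_subset L2_integrable_inner f wK)
      (use K in auto)
  also have "\<dots> = (\<Sum>K\<in>I. l2_inner K (f K) w)"
    by (intro sum.cong refl) (use K in \<open>simp add: l2_inner_def integral_indicator_subset\<close>)
  finally show ?thesis .
qed

text \<open>The open elements leave out only their frontiers, which are null sets because the
  elements are convex.\<close>

lemma AE_in_elements:
  fixes S :: "(real ^ 'n) set"
  assumes fin: "finite N" and K: "\<And>K. K \<in> N \<Longrightarrow> convex K \<and> open K" and S: "S \<in> sets lebesgue"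
    and cover: "S \<subseteq> (\<Union>K\<in>N. closure K)"
  shows "AE x in lebesgue_on S. x \<in> \<Union> N"
proof -
  have "negligible (\<Union>K\<in>N. frontier K)"
    using fin K by (intro negligible_Union) (auto intro: negligible_convex_frontier)
  then have "AE x in lebesgue. x \<notin> (\<Union>K\<in>N. frontier K)"
    by (intro AE_not_in) (simp add: negligible_iff_null_sets)
  then have "AE x in lebesgue. x \<in> S \<longrightarrow> x \<in> \<Union> N"
  proof (rule AE_mp, intro AE_I2 impI)
    fix x assume "x \<notin> (\<Union>K\<in>N. frontier K)" "x \<in> S"
    moreover from \<open>x \<in> S\<close> cover obtain L where L: "L \<in> N" "x \<in> closure L" by auto
    ultimately have "x \<in> interior L" by (auto simp: frontier_def)
    then show "x \<in> \<Union> N" using L interior_subset by blast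
  qed
  then show ?thesis using S by (simp add: AE_restrict_space_iff)
qed

lemma L2_union:
  fixes v :: "real ^ 'n \<Rightarrow> 'b::euclidean_space"
  assumes fin: "finite N" and K: "\<And>K. K \<in> N \<Longrightarrow> convex K \<and> open K \<and> K \<subseteq> S" and S: "S \<in> sets lebesgue"
    and cover: "S \<subseteq> (\<Union>K\<in>N. closure K)" and v: "\<And>K. K \<in> N \<Longrightarrow> v \<in> L2 K"
    and disj: "\<And>K L x. K \<in> N \<Longrightarrow> L \<in> N \<Longrightarrow> x \<in> K \<Longrightarrow> x \<in> L \<Longrightarrow> K = L"
  shows "v \<in> L2 S"
proof (rule L2_AE_cong[OF _ _ S])
  show "(\<lambda>x. \<Sum>K\<in>N. indicator K x *\<^sub>R v x) \<in> L2 S"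
    by (intro L2_sum fin L2_indicator S v) (use K in auto)
  show "AE x in lebesgue_on S. (\<Sum>K\<in>N. indicator K x *\<^sub>R v x) = v x"
  proof (rule AE_mp[OF AE_in_elements[OF fin _ S cover]])
    show "AE x in lebesgue_on S. x \<in> \<Union> N \<longrightarrow> (\<Sum>K\<in>N. indicator K x *\<^sub>R v x) = v x"
    proof (intro AE_I2 impI)
      fix x assume "x \<in> \<Union> N"
      then obtain L where L: "L \<in> N" "x \<in> L" by auto
      have "(\<Sum>K\<in>N. indicator K x *\<^sub>R v x) = (\<Sum>K\<in>{L}. indicator K x *\<^sub>R v x)"
      proof (rule sum.mono_neutral_right[OF fin])
        show "\<forall>K\<in>N - {L}. indicator K x *\<^sub>R v x = 0" using disj[OF L(1) _ L(2)] by (auto simp: indicator_def)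
      qed (use L in auto)
      then show "(\<Sum>K\<in>N. indicator K x *\<^sub>R v x) = v x" using L by simp
    qed
  qed (use K in auto)
qed

lemma (in simplex_element) convex_T: "convex T"
  unfolding T_eq by (intro convex_interior convex_convex_hull)

context mesh_facet
begin

lemma \<Omega>_lebesgue: "\<Omega> \<in> sets lebesgue" using open_\<Omega> by auto

lemma piecewise_eq:
  fixes f :: "(real ^ 'n) set \<Rightarrow> 'b::real_vector"
  assumes "x \<in> K" "K \<in> \<T>"
  shows "(\<Sum>L\<in>adjacent. indicat_real L x *\<^sub>R f L) = (if K \<in> adjacent then f K else 0)"
proof -
  have "(\<Sum>L\<in>adjacent. indicat_real L x *\<^sub>R f L) = (\<Sum>L\<in>adjacent. if L = K then f L else 0)"
  proof (rule sum.cong[OF refl])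
    fix L assume L: "L \<in> adjacent"
    have "x \<in> L \<longleftrightarrow> L = K" using elem_disjoint[OF assms(2) adjacentD(1)[OF L] assms(1)] assms(1) by blast
    then show "indicat_real L x *\<^sub>R f L = (if L = K then f L else 0)" by (simp add: indicator_def)
  qed
  then show ?thesis by (simp add: sum.delta'[OF finite_adjacent] sum.delta[OF finite_adjacent])
qed

lemma H1_element:
  assumes "v \<in> H1_broken \<Omega> \<T>" "K \<in> \<T>"
  shows "v \<in> L2 K" "is_weak_gradient K v (weak_gradient K v)" "weak_gradient K v \<in> L2 K"
proof -
  have *: "v \<in> H1 K" using assms by (auto simp: H1_broken_def)
  then show "v \<in> L2 K" by (simp add: H1_def)
  show "is_weak_gradient K v (weak_gradient K v)"
    using * weak_gradient_is_weak_gradient[of K v] by (auto simp: H1_def)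
  then show "weak_gradient K v \<in> L2 K" by (simp add: is_weak_gradient_def)
qed

lemma continuous_L2:
  fixes f :: "real ^ 'n \<Rightarrow> 'b::euclidean_space"
  shows "K \<in> \<T> \<Longrightarrow> continuous_on UNIV f \<Longrightarrow> f \<in> L2 K"
  by (rule L2_bounded_continuous[OF elem_props(1,2)]) auto

section \<open>Gluing element fields across a facet\<close>

context
  fixes P :: "(real ^ 'n) set \<Rightarrow> real ^ 'n \<Rightarrow> real ^ 'n" and D :: "(real ^ 'n) set \<Rightarrow> real ^ 'n \<Rightarrow> real"
    and r :: "real ^ 'n \<Rightarrow> real"
  assumes P: "\<And>K. K \<in> adjacent \<Longrightarrow> continuous_on UNIV (P K)"
    and D: "\<And>K. K \<in> adjacent \<Longrightarrow> continuous_on UNIV (D K)"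
    and green: "\<And>K k k'. K \<in> adjacent \<Longrightarrow> C1_with_gradient k k' \<Longrightarrow>
      (LINT x|lebesgue_on K. D K x * k x + P K x \<bullet> k' x) = (LINT s|surface_measure F. r s * k s)"
begin

text \<open>The assumption \<open>green\<close> says weakly that \<open>P K\<close> has divergence
  \<open>D K\<close>, outward normal component \<open>r\<close> on \<open>F\<close> and none on the
  other facets. The sign \<open>side K\<close> turns equal outward components on the two sides into
  a continuous normal component.\<close>

definition field :: "real ^ 'n \<Rightarrow> real ^ 'n" where
  "field x = (\<Sum>K\<in>adjacent. indicat_real K x *\<^sub>R (side K *\<^sub>R P K x))"

definition field_div :: "real ^ 'n \<Rightarrow> real" where
  "field_div x = (\<Sum>K\<in>adjacent. indicat_real K x *\<^sub>R (side K *\<^sub>R D K x))"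

lemma P_L2: "K \<in> adjacent \<Longrightarrow> P K \<in> L2 K" by (rule continuous_L2[OF adjacentD(1) P])
lemma D_L2: "K \<in> adjacent \<Longrightarrow> D K \<in> L2 K" by (rule continuous_L2[OF adjacentD(1) D])

lemma field_L2: "field \<in> L2 \<Omega>" and field_div_L2: "field_div \<in> L2 \<Omega>"
proof -
  have K: "K \<subseteq> \<Omega>" "K \<in> sets lebesgue" if "K \<in> adjacent" for K
    by (rule elem_props(3,4)[OF adjacentD(1)[OF that]])+
  show "field \<in> L2 \<Omega>" unfolding field_def
    by (rule L2_sum[OF finite_adjacent L2_indicator[OF K \<Omega>_lebesgue L2_scale[OF P_L2]]])
  show "field_div \<in> L2 \<Omega>" unfolding field_div_def
    by (rule L2_sum[OF finite_adjacent L2_indicator[OF K \<Omega>_lebesgue L2_scale[OF D_L2]]])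
qed

text \<open>Summing Green's formula over the adjacent elements leaves the surface terms, which
  \<open>side_test_function\<close> cancels.\<close>

lemma field_weak_divergence: "is_weak_divergence \<Omega> field field_div"
  unfolding is_weak_divergence_def
proof (intro conjI ballI field_div_L2)
  fix \<phi> :: "real ^ 'n \<Rightarrow> real" assume \<phi>: "\<phi> \<in> test_functions \<Omega>"
  note \<phi>L2 = test_function_L2[OF open_\<Omega> bounded_\<Omega> \<phi>] and C1 = test_function_C1[OF \<phi>]
  have K: "K \<subseteq> \<Omega> \<and> K \<in> sets lebesgue" if "K \<in> adjacent" for K
    using elem_props(3,4)[OF adjacentD(1)[OF that]] by simp
  have "l2_inner \<Omega> field (gradient \<phi>) = (\<Sum>K\<in>adjacent. side K * l2_inner K (P K) (gradient \<phi>))"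
    unfolding field_def
    by (subst l2_inner_piecewise[OF finite_adjacent K \<Omega>_lebesgue L2_scale[OF P_L2] \<phi>L2(2)])
      (simp_all add: l2_inner_scale_left)
  moreover have "l2_inner \<Omega> field_div \<phi> = (\<Sum>K\<in>adjacent. side K * l2_inner K (D K) \<phi>)"
    unfolding field_div_def
    by (subst l2_inner_piecewise[OF finite_adjacent K \<Omega>_lebesgue L2_scale[OF D_L2] \<phi>L2(1)])
      (simp_all only: l2_inner_scale_left)
  moreover have "l2_inner K (D K) \<phi> + l2_inner K (P K) (gradient \<phi>) = (LINT s|surface_measure F. r s * \<phi> s)"
    if "K \<in> adjacent" for K
  proof -
    have "\<phi> \<in> L2 K" "gradient \<phi> \<in> L2 K"
      using continuous_L2[OF adjacentD(1)[OF that]] C1_continuous[OF C1] C1_continuous_gradient[OF C1] by auto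
    then have "l2_inner K (D K) \<phi> + l2_inner K (P K) (gradient \<phi>)
        = (LINT x|lebesgue_on K. D K x \<bullet> \<phi> x + P K x \<bullet> gradient \<phi> x)"
      unfolding l2_inner_def
      by (intro Bochner_Integration.integral_add[symmetric] L2_integrable_inner P_L2 D_L2 that)
    then show ?thesis using green[OF that C1] by simp
  qed
  ultimately have "l2_inner \<Omega> field (gradient \<phi>) + l2_inner \<Omega> field_div \<phi>
      = (\<Sum>K\<in>adjacent. side K * (LINT s|surface_measure F. r s * \<phi> s))"
    by (simp add: sum.distrib[symmetric] distrib_left[symmetric] add.commute)
  then show "l2_inner \<Omega> field (gradient \<phi>) = - l2_inner \<Omega> field_div \<phi>"
    using side_test_function[OF \<phi>, of r] by linarith
qed

lemma field_Hdiv: "field \<in> Hdiv \<Omega>"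
  unfolding Hdiv_def using field_L2 field_weak_divergence by (intro CollectI conjI exI)

lemma field_eq: "x \<in> K \<Longrightarrow> K \<in> \<T> \<Longrightarrow> field x = (if K \<in> adjacent then side K *\<^sub>R P K x else 0)"
  unfolding field_def by (rule piecewise_eq)

lemma field_div_eq:
  assumes "x \<in> K" "K \<in> \<T>" shows "field_div x = (if K \<in> adjacent then side K * D K x else 0)"
  using piecewise_eq[OF assms, of "\<lambda>L. side L *\<^sub>R D L x"] by (simp only: field_div_def real_scaleR_def)

text \<open>\<open>tr_div\<close> refers to a chosen weak divergence. By uniqueness it may be
  replaced by \<open>field_div\<close>, and the elements away from \<open>F\<close> drop
  out.\<close>

lemma tr_div_field:
  assumes v: "v \<in> H1_broken \<Omega> \<T>"
  shows "tr_div \<Omega> \<T> field v =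
    (\<Sum>K\<in>adjacent. side K * (l2_inner K (D K) v + l2_inner K (P K) (weak_gradient K v)))"
proof -
  let ?w = "weak_divergence \<Omega> field"
  have w: "is_weak_divergence \<Omega> field ?w" by (rule weak_divergence_is_weak_divergence[OF field_weak_divergence])
  then have wL2: "?w \<in> L2 \<Omega>" by (simp add: is_weak_divergence_def)
  have ae: "AE x in lebesgue_on \<Omega>. ?w x = field_div x"
    by (rule weak_divergence_unique[OF open_\<Omega> bounded_\<Omega> w field_weak_divergence])
  have *: "l2_inner K ?w v + l2_inner K field (weak_gradient K v) =
     (if K \<in> adjacent then side K * (l2_inner K (D K) v + l2_inner K (P K) (weak_gradient K v)) else 0)"
    if K: "K \<in> \<T>" for K
  proof -
    note sub = elem_props(3,4)[OF K] \<Omega>_lebesgue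
    note vL2 = H1_element[OF v K]
    have "l2_inner K ?w v = l2_inner K field_div v"
      by (rule l2_inner_AE_cong[OF L2_restrict[OF wL2 sub] L2_restrict[OF field_div_L2 sub] vL2(1) vL2(1)
            AE_lebesgue_on_subset[OF ae sub]]) simp
    also have "\<dots> = l2_inner K (\<lambda>x. (if K \<in> adjacent then side K else 0) *\<^sub>R D K x) v"
      by (rule l2_inner_cong) (simp add: field_div_eq[OF _ K])
    finally have 1: "l2_inner K ?w v = (if K \<in> adjacent then side K else 0) * l2_inner K (D K) v"
      by (simp only: l2_inner_scale_left)
    have "l2_inner K field (weak_gradient K v) = l2_inner K (\<lambda>x. (if K \<in> adjacent then side K else 0) *\<^sub>R P K x) (weak_gradient K v)"
      by (rule l2_inner_cong) (simp add: field_eq[OF _ K])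
    then have 2: "l2_inner K field (weak_gradient K v) = (if K \<in> adjacent then side K else 0) * l2_inner K (P K) (weak_gradient K v)"
      by (simp only: l2_inner_scale_left)
    show ?thesis unfolding 1 2 by (simp add: distrib_left)
  qed
  have "tr_div \<Omega> \<T> field v = (\<Sum>K\<in>\<T>. if K \<in> adjacent then side K * (l2_inner K (D K) v + l2_inner K (P K) (weak_gradient K v)) else 0)"
    using v by (simp add: tr_div_def *)
  also have "\<dots> = (\<Sum>K\<in>adjacent. side K * (l2_inner K (D K) v + l2_inner K (P K) (weak_gradient K v)))"
    unfolding sum.inter_restrict[OF finite_\<T>, symmetric] by (rule sum.cong) (use adjacentD(1) in auto)
  finally show ?thesis .
qed

text \<open>For an elementwise C1 function \<open>green\<close> collapses the volume pairing to
  \<open>F\<close>, once the chosen weak gradient is replaced by the classical one.\<close>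

lemma tr_div_field_C1:
  assumes v: "v \<in> H1_broken \<Omega> \<T>"
    and w: "\<And>K. K \<in> adjacent \<Longrightarrow> C1_with_gradient (w K) (w' K)"
    and eq: "\<And>K x. K \<in> adjacent \<Longrightarrow> x \<in> K \<Longrightarrow> v x = w K x"
  shows "tr_div \<Omega> \<T> field v = (\<Sum>K\<in>adjacent. side K * (LINT s|surface_measure F. r s * w K s))"
  unfolding tr_div_field[OF v]
proof (intro sum.cong refl arg_cong2[where f = "(*)"])
  fix K assume K: "K \<in> adjacent"
  note K' = adjacentD(1)[OF K]
  have wg: "is_weak_gradient K v (w' K)"
    by (rule C1_weak_gradient[OF elem_props(1,2)[OF K'] w[OF K] eq[OF K] refl]) assumption
  then have wL2: "w' K \<in> L2 K" by (simp add: is_weak_gradient_def)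
  have wKL2: "w K \<in> L2 K" by (rule continuous_L2[OF K' C1_continuous[OF w[OF K]]])
  note h1 = H1_element[OF v K']
  have "l2_inner K (P K) (weak_gradient K v) = l2_inner K (P K) (w' K)"
    by (rule l2_inner_AE_cong[OF P_L2[OF K] P_L2[OF K] h1(3) wL2 _ weak_gradient_unique[OF elem_props(1,2)[OF K'] h1(2) wg]])
      simp
  moreover have "l2_inner K (D K) v = l2_inner K (D K) (w K)" by (rule l2_inner_cong) (simp add: eq[OF K])
  ultimately have "l2_inner K (D K) v + l2_inner K (P K) (weak_gradient K v)
      = (LINT x|lebesgue_on K. D K x * w K x + P K x \<bullet> w' K x)"
    using L2_integrable_inner[OF P_L2[OF K] wL2] L2_integrable_inner[OF D_L2[OF K] wKL2]
    by (simp add: l2_inner_def)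
  then show "l2_inner K (D K) v + l2_inner K (P K) (weak_gradient K v) = (LINT s|surface_measure F. r s * w K s)"
    using green[OF K w[OF K]] by simp
qed

end

end

subsection \<open>The jump across a facet\<close>

context simplex_element
begin

lemma surface_integral_add:
  fixes f g :: "real ^ 'n \<Rightarrow> real"
  assumes "z \<in> C" "continuous_on UNIV f" "continuous_on UNIV g"
  shows "(LINT s|surface_measure (facet z). f s + g s) =
    (LINT s|surface_measure (facet z). f s) + (LINT s|surface_measure (facet z). g s)"
proof -
  have c: "continuous_on UNIV (\<lambda>s. if b then f s else g s)" for b by (cases b) (simp_all add: assms)
  have "(LINT s|surface_measure (facet z). (\<Sum>b\<in>UNIV. (if b then f s else g s))) =
    (\<Sum>b\<in>UNIV. (LINT s|surface_measure (facet z). (if b then f s else g s)))"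
    by (rule surface_integral_sum[OF assms(1)]) (rule c)
  then show ?thesis by (simp add: UNIV_bool add.commute)
qed

lemma height_le_diameter: assumes z0: "z0 \<in> C" shows "height z0 \<le> diameter T"
proof -
  obtain a where a: "a \<in> C" "a \<noteq> z0" using C_other[OF z0] by blast
  have "1 = bary_grad z0 \<bullet> (z0 - a)" using bary_grad_diff[OF z0 z0 a(1)] a(2) by simp
  also have "\<dots> \<le> norm (bary_grad z0) * norm (z0 - a)" by (rule norm_cauchy_schwarz)
  also have "\<dots> \<le> norm (bary_grad z0) * diameter T"
    by (intro mult_left_mono norm_vertex_diff z0 a) simp
  finally show ?thesis
    using bary_grad_nz[OF z0] by (simp add: height_def field_simps)
qed

lemma facet_function_sum:
  "(\<Sum>i\<in>I. s i * facet_function z0 (d i) (\<gamma> i) x) = facet_function z0 (\<lambda>z. \<Sum>i\<in>I. s i * d i z) (\<Sum>i\<in>I. s i * \<gamma> i) x"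
proof -
  have "(\<Sum>i\<in>I. s i * (\<Sum>z\<in>C - {z0}. d i z * bary z x)) = (\<Sum>z\<in>C - {z0}. (\<Sum>i\<in>I. s i * d i z) * bary z x)"
    by (simp only: sum_distrib_left sum_distrib_right mult.assoc) (rule sum.swap)
  then show ?thesis
    by (simp add: facet_function_def distrib_left sum.distrib sum_distrib_right mult.assoc)
qed

lemma facet_coefficient_max:
  fixes d :: "real ^ 'n \<Rightarrow> real"
  obtains M where "\<bar>\<gamma>\<bar> \<le> M" "\<forall>z\<in>C - {z0}. \<bar>d z\<bar> \<le> M" "M = \<bar>\<gamma>\<bar> \<or> (\<exists>v\<in>C - {z0}. M = \<bar>d v\<bar>)"
proof -
  let ?A = "insert \<bar>\<gamma>\<bar> ((\<lambda>z. \<bar>d z\<bar>) ` (C - {z0}))"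
  have f: "finite ?A" using fin by simp
  have "Max ?A \<in> ?A" by (rule Max_in[OF f]) simp
  then have "Max ?A = \<bar>\<gamma>\<bar> \<or> (\<exists>v\<in>C - {z0}. Max ?A = \<bar>d v\<bar>)" by (rule insertE) (auto elim!: imageE)
  moreover have "\<bar>\<gamma>\<bar> \<le> Max ?A" by (rule Max_ge[OF f]) simp
  moreover have "\<bar>d z\<bar> \<le> Max ?A" if "z \<in> C - {z0}" for z by (rule Max_ge[OF f]) (use that in simp)
  ultimately show thesis by (intro that[of "Max ?A"] ballI)
qed

end

text \<open>\<open>v\<close> plays the role of \<open>u\<^sub>h\<close>: it enters through its
  elementwise C1 extensions \<open>w\<close>, their facet traces and its conformity against
  \<open>RT0\<close>.\<close>

locale discrete_jump = mesh_facet \<Omega> \<T> T F for \<Omega> :: "(real ^ 'n) set" and \<T> T F +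
  fixes \<kappa> \<epsilon> :: real and u v :: "real ^ 'n \<Rightarrow> real"
    and w :: "(real ^ 'n) set \<Rightarrow> real ^ 'n \<Rightarrow> real" and w' :: "(real ^ 'n) set \<Rightarrow> real ^ 'n \<Rightarrow> real ^ 'n"
  assumes regular: "shape_regular \<kappa> \<T>" and \<epsilon>: "0 < \<epsilon>"
    and u: "u \<in> H1_broken \<Omega> \<T>" and v: "v \<in> H1_broken \<Omega> \<T>"
    and u_conforming: "\<And>\<tau>. \<tau> \<in> Hdiv \<Omega> \<Longrightarrow> tr_div \<Omega> \<T> \<tau> u = 0"
    and v_conforming: "\<And>\<tau>. \<tau> \<in> RT0 \<Omega> \<T> \<Longrightarrow> tr_div \<Omega> \<T> \<tau> v = 0"
    and w: "\<And>K. K \<in> \<T> \<Longrightarrow> C1_with_gradient (w K) (w' K)"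
    and v_eq: "\<And>K x. K \<in> \<T> \<Longrightarrow> x \<in> K \<Longrightarrow> v x = w K x"
    and w_facet: "\<And>K z0. K \<in> \<T> \<Longrightarrow> z0 \<in> vertices K \<Longrightarrow>
      \<exists>d \<gamma>. \<forall>x. barycentric K z0 x = 0 \<longrightarrow> w K x = simplex_element.facet_function K (vertices K) z0 d \<gamma> x"
begin

definition err :: "real ^ 'n \<Rightarrow> real" where "err x = u x - v x"

definition err_grad :: "(real ^ 'n) set \<Rightarrow> real ^ 'n \<Rightarrow> real ^ 'n" where
  "err_grad K x = weak_gradient K u x - weak_gradient K v x"

text \<open>Built from the extensions \<open>w K\<close>, this function is C1 on the whole space and
  coincides with the jump on \<open>F\<close>.\<close>

definition facet_jump :: "real ^ 'n \<Rightarrow> real" where "facet_jump x = (\<Sum>K\<in>adjacent. side K * w K x)"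

definition jump_sq :: real where "jump_sq = (LINT s|surface_measure F. (facet_jump s)\<^sup>2)"

definition diam_ratio :: real where "diam_ratio = 1 + \<kappa> * 4 ^ CARD('n)"

sublocale T: simplex_element T "vertices T" by (rule elem[OF T])

lemma F_eq: "convex hull (vertices T - {opp T}) = F" by (rule opp_vertex(2)[OF adjacent_T])

lemma opp_T: "opp T \<in> vertices T" by (rule opp_vertex(1)[OF adjacent_T])

lemma space_F: "space (surface_measure F) = F"
  using T.space_surface_measure[of "opp T"] by (simp only: F_eq)

lemma regular_element: "K \<in> \<T> \<Longrightarrow> diameter K ^ CARD('n) / measure lebesgue K \<le> \<kappa>"
  using regular by (simp add: shape_regular_def)

lemma \<kappa>_pos: "0 < \<kappa>" by (rule T.diameter_le_height(2)[OF opp_T regular_element[OF T]])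

lemma diam_ratio_ge_1: "1 \<le> diam_ratio" using \<kappa>_pos by (simp add: diam_ratio_def)

lemma diameter_adjacent:
  assumes K: "K \<in> adjacent" and L: "L \<in> adjacent"
  shows "diameter K \<le> diam_ratio * diameter L"
proof -
  note K' = adjacentD[OF K] and L' = adjacentD[OF L]
  interpret K: simplex_element K "vertices K" by (rule elem[OF K'(1)])
  interpret L: simplex_element L "vertices L" by (rule elem[OF L'(1)])
  note oK = opp_vertex[OF K] and oL = opp_vertex[OF L]
  let ?d = "CARD('n)" and ?h = "diameter K" and ?l = "diameter L"
  have hp: "0 < ?h" "0 < ?l" by (rule K.diameter_pos L.diameter_pos)+
  have mp: "0 < measure lebesgue K" by (rule K.measure_T_pos)
  have a: "K.area (opp K) \<le> 4 ^ ?d * ?l ^ (?d - 1)"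
  proof (rule K.area_le[OF oK(1) hp(2)])
    fix x y assume "x \<in> K.facet (opp K)" "y \<in> K.facet (opp K)"
    then have "x \<in> L.facet (opp L)" "y \<in> L.facet (opp L)" by (simp_all only: oK(2) oL(2))
    then show "norm (x - y) \<le> ?l"
      using L.facet_subset_hull[of "opp L"] by (intro L.norm_diff_hull_le_diameter) (rule subsetD, assumption+)+
  qed
  have "?h * ?h ^ (?d - 1) = ?h ^ ?d" by (simp add: power_eq_if)
  also have "\<dots> \<le> \<kappa> * measure lebesgue K" using regular_element[OF K'(1)] mp by (simp add: field_simps)
  also have "\<dots> \<le> \<kappa> * (real ?d * measure lebesgue K)"
  proof -
    have "1 * measure lebesgue K \<le> real ?d * measure lebesgue K"
      by (rule mult_right_mono) (use K.card_ge_2 in simp_all)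
    then show ?thesis using \<kappa>_pos by simp
  qed
  also have "\<dots> = \<kappa> * (K.height (opp K) * K.area (opp K))" by (simp only: K.volume_height_area[OF oK(1)])
  also have "\<dots> \<le> \<kappa> * (?h * (4 ^ ?d * ?l ^ (?d - 1)))"
    using \<kappa>_pos K.height_le_diameter[OF oK(1)] a hp K.area_nonneg by (intro mult_left_mono mult_mono) auto
  finally have "?h * ?h ^ (?d - 1) \<le> ?h * (\<kappa> * 4 ^ ?d * ?l ^ (?d - 1))" by (simp add: algebra_simps)
  then have 1: "?h ^ (?d - 1) \<le> \<kappa> * 4 ^ ?d * ?l ^ (?d - 1)" using hp(1) by simp
  show ?thesis
  proof (rule ccontr)
    assume "\<not> ?thesis"
    then have lt: "diam_ratio * ?l < ?h" by simp
    have "\<kappa> * 4 ^ ?d * ?l ^ (?d - 1) \<le> diam_ratio * ?l ^ (?d - 1)"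
      using hp by (intro mult_right_mono) (simp_all add: diam_ratio_def)
    also have "diam_ratio * ?l ^ (?d - 1) \<le> diam_ratio ^ (?d - 1) * ?l ^ (?d - 1)"
      using diam_ratio_ge_1 hp self_le_power[of diam_ratio "?d - 1"] T.card_ge_2 by (intro mult_right_mono) auto
    also have "\<dots> = (diam_ratio * ?l) ^ (?d - 1)" by (simp add: power_mult_distrib)
    also have "\<dots> < ?h ^ (?d - 1)"
      using lt diam_ratio_ge_1 hp T.card_ge_2 by (intro power_strict_mono) auto
    finally show False using 1 by simp
  qed
qed

lemma w_continuous: "K \<in> \<T> \<Longrightarrow> continuous_on S (w K)" by (rule C1_continuous[OF w])

lemma facet_jump_continuous: "continuous_on S facet_jump"
  unfolding facet_jump_def by (intro continuous_intros w_continuous adjacentD)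

lemma C0_adjacent: "K \<in> adjacent \<Longrightarrow> vertices T - {opp T} = vertices K - {opp K}"
  by (rule facet_pair.C0_eq[OF pair])

lemma facet_function_adjacent:
  "K \<in> adjacent \<Longrightarrow> barycentric T (opp T) x = 0 \<Longrightarrow>
    simplex_element.facet_function K (vertices K) (opp K) d \<gamma> x = T.facet_function (opp T) d \<gamma> x"
  by (rule facet_pair.facet_function_eq[OF pair])

lemma hyperplane_adjacent:
  "K \<in> adjacent \<Longrightarrow> barycentric T (opp T) x = 0 \<longleftrightarrow> barycentric K (opp K) x = 0"
  by (rule facet_pair.hyperplane_eq[OF pair])

lemma area_adjacent:
  "K \<in> adjacent \<Longrightarrow> T.area (opp T) = simplex_element.area (vertices K) (opp K)"
  by (rule facet_pair.area_eq[OF pair])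

lemma F_hyperplane: assumes "x \<in> F" shows "barycentric T (opp T) x = 0"
proof -
  have "x \<in> {x. barycentric T (opp T) x = 0 \<and> (\<forall>z\<in>vertices T. 0 \<le> barycentric T z x)}"
    using assms unfolding T.facet_bary[OF opp_T, symmetric] F_eq .
  then show ?thesis by (elim CollectE conjE)
qed

lemma facet_jump_facet_function:
  obtains d \<gamma> where "\<forall>x. barycentric T (opp T) x = 0 \<longrightarrow> facet_jump x = T.facet_function (opp T) d \<gamma> x"
proof -
  have "\<exists>d \<gamma>. \<forall>x. barycentric T (opp T) x = 0 \<longrightarrow> w K x = T.facet_function (opp T) d \<gamma> x" if K: "K \<in> adjacent" for K
  proof -
    obtain d \<gamma> where d: "\<forall>x. barycentric K (opp K) x = 0 \<longrightarrow>
        w K x = simplex_element.facet_function K (vertices K) (opp K) d \<gamma> x"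
      using w_facet[OF adjacentD(1)[OF K] opp_vertex(1)[OF K]] by (elim exE)
    have "w K x = T.facet_function (opp T) d \<gamma> x" if x: "barycentric T (opp T) x = 0" for x
      using d[rule_format, OF hyperplane_adjacent[OF K, THEN iffD1, OF x]] facet_function_adjacent[OF K x] by simp
    then show ?thesis by (intro exI allI impI)
  qed
  then have "\<forall>K\<in>adjacent. \<exists>d \<gamma>. \<forall>x. barycentric T (opp T) x = 0 \<longrightarrow> w K x = T.facet_function (opp T) d \<gamma> x" by (rule ballI)
  then obtain d where "\<forall>K\<in>adjacent. \<exists>\<gamma>. \<forall>x. barycentric T (opp T) x = 0 \<longrightarrow> w K x = T.facet_function (opp T) (d K) \<gamma> x"
    by (drule_tac bchoice) (elim exE)
  then obtain \<gamma> where \<gamma>: "\<forall>K\<in>adjacent. \<forall>x. barycentric T (opp T) x = 0 \<longrightarrow> w K x = T.facet_function (opp T) (d K) (\<gamma> K) x"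
    by (drule_tac bchoice) (elim exE)
  show thesis
  proof (rule that, intro allI impI)
    fix x assume x: "barycentric T (opp T) x = 0"
    have "facet_jump x = (\<Sum>K\<in>adjacent. side K * T.facet_function (opp T) (d K) (\<gamma> K) x)"
      unfolding facet_jump_def using \<gamma> x by (intro sum.cong refl) simp
    then show "facet_jump x = T.facet_function (opp T) (\<lambda>z. \<Sum>K\<in>adjacent. side K * d K z) (\<Sum>K\<in>adjacent. side K * \<gamma> K) x"
      by (simp only: T.facet_function_sum)
  qed
qed

lemma green_flux:
  assumes K: "K \<in> adjacent"
    and g: "\<And>z. z \<in> vertices K - {opp K} \<Longrightarrow> C1_with_gradient (g z) (g' z)"
    and r: "\<And>x. x \<in> F \<Longrightarrow> (\<Sum>z\<in>vertices K - {opp K}. barycentric K z x * g z x) = r x"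
    and k: "C1_with_gradient k k'"
  shows "(LINT x|lebesgue_on K. simplex_element.flux_div K (vertices K) (opp K) g g' x * k x
      + simplex_element.flux K (vertices K) (opp K) g x \<bullet> k' x) = (LINT s|surface_measure F. r s * k s)"
proof -
  interpret K: simplex_element K "vertices K" by (rule elem[OF adjacentD(1)[OF K]])
  have "(LINT s|surface_measure F. (\<Sum>z\<in>vertices K - {opp K}. barycentric K z s * g z s) * k s)
      = (LINT s|surface_measure F. r s * k s)"
    by (rule Bochner_Integration.integral_cong[OF refl]) (simp add: space_F r)
  then show ?thesis
    using K.flux_green[OF opp_vertex(1)[OF K] g k] by (simp only: opp_vertex(2)[OF K])
qed

lemma surface_facet_jump:
  assumes "continuous_on UNIV r"
  shows "(\<Sum>K\<in>adjacent. side K * (LINT s|surface_measure F. r s * w K s)) = (LINT s|surface_measure F. r s * facet_jump s)"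
proof -
  have c: "continuous_on UNIV (\<lambda>s. side K * (r s * w K s))" if "K \<in> adjacent" for K
    by (intro continuous_intros assms w_continuous adjacentD that)
  have "(\<Sum>K\<in>adjacent. side K * (LINT s|surface_measure F. r s * w K s))
      = (\<Sum>K\<in>adjacent. (LINT s|surface_measure F. side K * (r s * w K s)))" by simp
  also have "\<dots> = (LINT s|surface_measure F. (\<Sum>K\<in>adjacent. side K * (r s * w K s)))"
    using T.surface_integral_sum[OF opp_T, of adjacent "\<lambda>K s. side K * (r s * w K s)"] c by (simp only: F_eq)
  also have "\<dots> = (LINT s|surface_measure F. r s * facet_jump s)"
    by (simp add: facet_jump_def sum_distrib_left mult.left_commute)
  finally show ?thesis .
qed

lemma w_tr_div:
  assumes "\<And>K. K \<in> adjacent \<Longrightarrow> continuous_on UNIV (P K)"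
    and "\<And>K. K \<in> adjacent \<Longrightarrow> continuous_on UNIV (D K)"
    and "\<And>K k k'. K \<in> adjacent \<Longrightarrow> C1_with_gradient k k' \<Longrightarrow>
      (LINT x|lebesgue_on K. D K x * k x + P K x \<bullet> k' x) = (LINT s|surface_measure F. r s * k s)"
    and "continuous_on UNIV r"
  shows "tr_div \<Omega> \<T> (field P) v = (LINT s|surface_measure F. r s * facet_jump s)"
  by (rule trans[OF tr_div_field_C1[of P D r v w w', OF assms(1-3) v w[OF adjacentD(1)] v_eq[OF adjacentD(1)]]
    surface_facet_jump[OF assms(4)]])

text \<open>Coefficients 1 on every edge give the lowest-order Raviart-Thomas field with normal
  component 1 on \<open>F\<close>; conformity of \<open>v\<close> against it is the claim.\<close>

lemma integral_facet_jump: "(LINT s|surface_measure F. facet_jump s) = 0"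
proof -
  define P where "P K = simplex_element.flux K (vertices K) (opp K) (\<lambda>z x. 1)" for K
  define D where "D K = simplex_element.flux_div K (vertices K) (opp K) (\<lambda>z x. 1) (\<lambda>z x. 0)" for K
  have 1: "continuous_on UNIV (P K)" "continuous_on UNIV (D K)" if K: "K \<in> adjacent" for K
    unfolding P_def D_def
    by (rule simplex_element.flux_continuous[OF elem[OF adjacentD(1)[OF K]] opp_vertex(1)[OF K] C1_const]
        simplex_element.flux_div_continuous[OF elem[OF adjacentD(1)[OF K]] opp_vertex(1)[OF K] C1_const])+
  have 2: "(LINT x|lebesgue_on K. D K x * k x + P K x \<bullet> k' x) = (LINT s|surface_measure F. 1 * k s)"
    if K: "K \<in> adjacent" and k: "C1_with_gradient k k'" for K k k'
    unfolding P_def D_def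
  proof (rule green_flux[OF K C1_const _ k])
    fix x assume "x \<in> F"
    then have "barycentric K (opp K) x = 0" using F_hyperplane hyperplane_adjacent[OF K] by simp
    then show "(\<Sum>z\<in>vertices K - {opp K}. barycentric K z x * 1) = 1"
      using simplex_element.sum_bary_facet[OF elem[OF adjacentD(1)[OF K]] opp_vertex(1)[OF K]] by simp
  qed
  have "field P \<in> RT0 \<Omega> \<T>"
    unfolding RT0_def
  proof (intro CollectI conjI ballI)
    show "field P \<in> Hdiv \<Omega>" by (rule field_Hdiv[of P D "\<lambda>x. 1", OF 1 2])
    fix K assume K: "K \<in> \<T>"
    define c where "c = (if K \<in> adjacent then side K / simplex_element.height K (opp K) else 0)"
    have "field P x = (- c) *\<^sub>R opp K + c *\<^sub>R x" if x: "x \<in> K" for x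
    proof (cases "K \<in> adjacent")
      case True
      interpret K: simplex_element K "vertices K" by (rule elem[OF K])
      note o = opp_vertex(1)[OF True]
      \<comment> \<open>The missing term at \<open>opp K\<close> is zero, and the full sum is
        \<open>x - opp K\<close>.\<close>
      have "(\<Sum>z\<in>vertices K - {opp K}. K.bary z x *\<^sub>R (z - opp K)) = (\<Sum>z\<in>vertices K. K.bary z x *\<^sub>R (z - opp K))"
        using o by (intro sum.mono_neutral_left) (auto simp: K.fin)
      also have "\<dots> = x - opp K"
        by (simp add: scaleR_diff_right sum_subtractf K.bary_comb scaleR_left.sum[symmetric] K.bary_sum)
      finally have "P K x = (1 / K.height (opp K)) *\<^sub>R (x - opp K)" by (simp add: P_def K.flux_def)
      moreover have "field P x = side K *\<^sub>R P K x" using field_eq[of P D "\<lambda>x. 1", OF 1 2 x K] by (simp only: True if_True)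
      ultimately show ?thesis by (simp only: c_def True if_True) (simp add: scaleR_diff_right)
    next
      case False
      then show ?thesis using field_eq[of P D "\<lambda>x. 1", OF 1 2 x K] by (simp only: c_def False if_False) simp
    qed
    then show "\<exists>a\<in>P0. \<exists>c\<in>P0. \<forall>x\<in>K. field P x = a x + c x *\<^sub>R x"
      unfolding P0_def by (intro bexI[of _ "\<lambda>x. (- c) *\<^sub>R opp K"] bexI[of _ "\<lambda>x. c"] ballI CollectI exI conjI) simp_all
  qed
  then have "tr_div \<Omega> \<T> (field P) v = 0" by (rule v_conforming)
  then show ?thesis using w_tr_div[of P D "\<lambda>x. 1", OF 1 2] by simp
qed

lemma err_L2: assumes "K \<in> \<T>" shows "err \<in> L2 K" "err_grad K \<in> L2 K" "is_weak_gradient K err (err_grad K)"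
  unfolding err_def[abs_def] err_grad_def[abs_def]
  using H1_element[OF u assms] H1_element[OF v assms] is_weak_gradient_diff[OF elem_props(1,2)[OF assms]]
  by (auto intro: L2_diff)

lemma jump_sq_nonneg: "0 \<le> jump_sq" by (simp add: jump_sq_def integral_nonneg_AE)

text \<open>The pairing of the glued field with \<open>u - v\<close> is \<open>- jump_sq\<close>.
  The Young weights leave \<open>jump_sq / 8\<close> from each of two terms per element; with at
  most two elements, half of \<open>jump_sq\<close> is absorbed on the left, which doubles the
  constant 8.\<close>

lemma duality:
  assumes P: "\<And>K. K \<in> adjacent \<Longrightarrow> continuous_on UNIV (P K)"
    and D: "\<And>K. K \<in> adjacent \<Longrightarrow> continuous_on UNIV (D K)"
    and green: "\<And>K k k'. K \<in> adjacent \<Longrightarrow> C1_with_gradient k k' \<Longrightarrow>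
      (LINT x|lebesgue_on K. D K x * k x + P K x \<bullet> k' x) = (LINT s|surface_measure F. r s * k s)"
    and r: "continuous_on UNIV r" "(LINT s|surface_measure F. r s * facet_jump s) = jump_sq"
    and \<sigma>: "0 < B" "0 < \<sigma>1" "0 < \<sigma>2"
    and D_le: "\<And>K. K \<in> adjacent \<Longrightarrow> l2_inner K (D K) (D K) \<le> B * jump_sq / \<sigma>1"
    and P_le: "\<And>K. K \<in> adjacent \<Longrightarrow> l2_inner K (P K) (P K) \<le> B * jump_sq * \<sigma>2"
  shows "jump_sq \<le> 16 * B * (\<Sum>K\<in>adjacent. l2_inner K err err / \<sigma>1 + \<sigma>2 * l2_inner K (err_grad K) (err_grad K))"
proof -
  let ?E = "\<lambda>K. l2_inner K err err / \<sigma>1 + \<sigma>2 * l2_inner K (err_grad K) (err_grad K)"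
  have tu: "tr_div \<Omega> \<T> (field P) u = (\<Sum>K\<in>adjacent. side K * (l2_inner K (D K) u + l2_inner K (P K) (weak_gradient K u)))"
    by (rule tr_div_field[OF P D green u])
  have tv: "tr_div \<Omega> \<T> (field P) v = (\<Sum>K\<in>adjacent. side K * (l2_inner K (D K) v + l2_inner K (P K) (weak_gradient K v)))"
    by (rule tr_div_field[OF P D green v])
  have 1: "tr_div \<Omega> \<T> (field P) v = jump_sq" using w_tr_div[OF P D green r(1)] r(2) by simp
  have 2: "tr_div \<Omega> \<T> (field P) u = 0" by (rule u_conforming[OF field_Hdiv[OF P D green]])
  have "- jump_sq = tr_div \<Omega> \<T> (field P) u - tr_div \<Omega> \<T> (field P) v" using 1 2 by simp
  also have "\<dots> = (\<Sum>K\<in>adjacent. side K * (l2_inner K (D K) err + l2_inner K (P K) (err_grad K)))"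
    unfolding tu tv sum_subtractf[symmetric]
  proof (rule sum.cong[OF refl])
    fix K assume K: "K \<in> adjacent"
    note K' = adjacentD(1)[OF K]
    show "side K * (l2_inner K (D K) u + l2_inner K (P K) (weak_gradient K u)) -
        side K * (l2_inner K (D K) v + l2_inner K (P K) (weak_gradient K v)) =
        side K * (l2_inner K (D K) err + l2_inner K (P K) (err_grad K))"
      unfolding err_def[abs_def] err_grad_def[abs_def]
        l2_inner_diff_right[OF H1_element(1)[OF u K'] H1_element(1)[OF v K'] continuous_L2[OF K' D[OF K]]]
        l2_inner_diff_right[OF H1_element(3)[OF u K'] H1_element(3)[OF v K'] continuous_L2[OF K' P[OF K]]]
      by (simp add: algebra_simps)
  qed
  finally have eq: "- jump_sq = (\<Sum>K\<in>adjacent. side K * (l2_inner K (D K) err + l2_inner K (P K) (err_grad K)))" .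
  have le: "\<bar>side K * (l2_inner K (D K) err + l2_inner K (P K) (err_grad K))\<bar> \<le> jump_sq / 4 + 8 * B * ?E K"
    if K: "K \<in> adjacent" for K
  proof -
    note K' = adjacentD(1)[OF K]
    have a: "\<bar>l2_inner K (D K) err\<bar> \<le> \<sigma>1 / (8 * B) * l2_inner K (D K) (D K) + l2_inner K err err / (\<sigma>1 / (8 * B))"
      by (rule l2_inner_young[OF continuous_L2[OF K' D[OF K]] err_L2(1)[OF K']]) (use \<sigma> in simp)
    have a0: "l2_inner K err err / (\<sigma>1 / (8 * B)) = 8 * B * (l2_inner K err err / \<sigma>1)" by simp
    have "\<sigma>1 / (8 * B) * l2_inner K (D K) (D K) \<le> \<sigma>1 / (8 * B) * (B * jump_sq / \<sigma>1)"
      by (rule mult_left_mono[OF D_le[OF K]]) (use \<sigma> in simp)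
    also have "\<dots> = jump_sq / 8" using \<sigma> by (simp add: field_simps)
    finally have a': "\<bar>l2_inner K (D K) err\<bar> \<le> jump_sq / 8 + 8 * B * (l2_inner K err err / \<sigma>1)"
      using a unfolding a0 by linarith
    have b: "\<bar>l2_inner K (P K) (err_grad K)\<bar> \<le> 1 / (8 * B * \<sigma>2) * l2_inner K (P K) (P K)
        + l2_inner K (err_grad K) (err_grad K) / (1 / (8 * B * \<sigma>2))"
      by (rule l2_inner_young[OF continuous_L2[OF K' P[OF K]] err_L2(2)[OF K']]) (use \<sigma> in simp)
    have b0: "l2_inner K (err_grad K) (err_grad K) / (1 / (8 * B * \<sigma>2)) = 8 * B * (\<sigma>2 * l2_inner K (err_grad K) (err_grad K))"
      by simp
    have "1 / (8 * B * \<sigma>2) * l2_inner K (P K) (P K) \<le> 1 / (8 * B * \<sigma>2) * (B * jump_sq * \<sigma>2)"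
      by (rule mult_left_mono[OF P_le[OF K]]) (use \<sigma> in simp)
    also have "\<dots> = jump_sq / 8" using \<sigma> by (simp add: field_simps)
    finally have b': "\<bar>l2_inner K (P K) (err_grad K)\<bar> \<le> jump_sq / 8 + 8 * B * (\<sigma>2 * l2_inner K (err_grad K) (err_grad K))"
      using b unfolding b0 by linarith
    have "\<bar>side K * (l2_inner K (D K) err + l2_inner K (P K) (err_grad K))\<bar>
        = \<bar>l2_inner K (D K) err + l2_inner K (P K) (err_grad K)\<bar>" by (simp only: side_def abs_mult) simp
    also have "\<dots> \<le> jump_sq / 8 + 8 * B * (l2_inner K err err / \<sigma>1) + (jump_sq / 8 + 8 * B * (\<sigma>2 * l2_inner K (err_grad K) (err_grad K)))"
      using a' b' by linarith
    also have "\<dots> = jump_sq / 4 + 8 * B * ?E K" by (simp only: distrib_left)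
    finally show ?thesis .
  qed
  have "jump_sq = \<bar>\<Sum>K\<in>adjacent. side K * (l2_inner K (D K) err + l2_inner K (P K) (err_grad K))\<bar>"
    unfolding eq[symmetric] using jump_sq_nonneg by simp
  also have "\<dots> \<le> (\<Sum>K\<in>adjacent. jump_sq / 4 + 8 * B * ?E K)"
    using sum_abs[of "\<lambda>K. side K * (l2_inner K (D K) err + l2_inner K (P K) (err_grad K))" adjacent] sum_mono[of adjacent, OF le]
    by (rule order_trans)
  also have "\<dots> = (\<Sum>K\<in>adjacent. jump_sq / 4) + 8 * B * (\<Sum>K\<in>adjacent. ?E K)"
    by (subst sum.distrib) (simp only: sum_distrib_left)
  also have "(\<Sum>K\<in>adjacent. jump_sq / 4) \<le> 2 * (jump_sq / 4)" by (rule sum_adjacent_le) (use jump_sq_nonneg in simp_all)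
  finally show ?thesis by simp
qed

end

context discrete_jump
begin

text \<open>196 is the square of 14, the largest of the factors 2, 5 and 14 in the field estimates.
  The other factors come from shape regularity, from bounding coefficients by
  \<open>jump_sq\<close>, and from comparing diameters.\<close>

definition jump_const :: real where
  "jump_const = 196 * (\<kappa> * 4 ^ CARD('n)) * coefficient_bound CARD('n) * diam_ratio"

lemma jump_const_pos: "0 < jump_const"
  using \<kappa>_pos diam_ratio_ge_1 coefficient_bound_pos[of "CARD('n)"] by (simp add: jump_const_def)

lemma l2_self: "l2_inner S f f = (LINT x|lebesgue_on S. (norm (f x))\<^sup>2)"
  by (simp add: l2_inner_def power2_norm_eq_inner)

text \<open>The requirements of \<open>duality\<close> on a single element, bundled so that the
  fields can be selected element by element with \<open>bchoice\<close>.\<close>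

definition admissible :: "(real ^ 'n \<Rightarrow> real) \<Rightarrow> real \<Rightarrow> real \<Rightarrow> (real ^ 'n) set \<Rightarrow>
    (real ^ 'n \<Rightarrow> real ^ 'n) \<Rightarrow> (real ^ 'n \<Rightarrow> real) \<Rightarrow> bool" where
  "admissible r \<sigma>1 \<sigma>2 K p D \<longleftrightarrow> continuous_on UNIV p \<and> continuous_on UNIV D \<and>
    (\<forall>k k'. C1_with_gradient k k' \<longrightarrow>
      (LINT x|lebesgue_on K. D x * k x + p x \<bullet> k' x) = (LINT s|surface_measure F. r s * k s)) \<and>
    l2_inner K D D \<le> jump_const * jump_sq / \<sigma>1 \<and> l2_inner K p p \<le> jump_const * jump_sq * \<sigma>2"

lemma duality_admissible:
  assumes ex: "\<And>K. K \<in> adjacent \<Longrightarrow> \<exists>p. \<exists>D. admissible r \<sigma>1 \<sigma>2 K p D"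
    and r: "continuous_on UNIV r" "(LINT s|surface_measure F. r s * facet_jump s) = jump_sq"
    and \<sigma>: "0 < \<sigma>1" "0 < \<sigma>2"
  shows "jump_sq \<le> 16 * jump_const * (\<Sum>K\<in>adjacent. l2_inner K err err / \<sigma>1 + \<sigma>2 * l2_inner K (err_grad K) (err_grad K))"
proof -
  have "\<forall>K\<in>adjacent. \<exists>p. \<exists>D. admissible r \<sigma>1 \<sigma>2 K p D" by (rule ballI) (rule ex)
  from bchoice[OF this] obtain P where "\<forall>K\<in>adjacent. \<exists>D. admissible r \<sigma>1 \<sigma>2 K (P K) D" by (elim exE)
  from bchoice[OF this] obtain D where PD: "\<forall>K\<in>adjacent. admissible r \<sigma>1 \<sigma>2 K (P K) (D K)" by (elim exE)
  note a = PD[THEN bspec, unfolded admissible_def]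
  show ?thesis
  proof (rule duality[of P D r, OF _ _ _ r jump_const_pos \<sigma>])
    show "continuous_on UNIV (P K)" if "K \<in> adjacent" for K using a[OF that] by (elim conjE)
    show "continuous_on UNIV (D K)" if "K \<in> adjacent" for K using a[OF that] by (elim conjE)
    show "l2_inner K (D K) (D K) \<le> jump_const * jump_sq / \<sigma>1" if "K \<in> adjacent" for K using a[OF that] by (elim conjE)
    show "l2_inner K (P K) (P K) \<le> jump_const * jump_sq * \<sigma>2" if "K \<in> adjacent" for K using a[OF that] by (elim conjE)
    show "(LINT x|lebesgue_on K. D K x * k x + P K x \<bullet> k' x) = (LINT s|surface_measure F. r s * k s)"
      if "K \<in> adjacent" "C1_with_gradient k k'" for K k k'
      by (rule a[OF that(1), THEN conjunct2, THEN conjunct2, THEN conjunct1, rule_format, OF that(2)])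
  qed
qed

lemma jump_const_ge:
  assumes "0 \<le> c" "c \<le> 196" "0 \<le> X" "X \<le> coefficient_bound CARD('n) * jump_sq" "0 \<le> t" "t \<le> diam_ratio * \<sigma>"
  shows "(\<kappa> * 4 ^ CARD('n)) * c * X * t \<le> jump_const * jump_sq * \<sigma>"
proof -
  have X': "0 \<le> coefficient_bound CARD('n) * jump_sq" using assms(3,4) by linarith
  have "(\<kappa> * 4 ^ CARD('n)) * c * X * t \<le> (\<kappa> * 4 ^ CARD('n)) * 196 * (coefficient_bound CARD('n) * jump_sq) * (diam_ratio * \<sigma>)"
    by (intro mult_mono order_refl mult_nonneg_nonneg[OF _ X'] assms mult_nonneg_nonneg)
      (use \<kappa>_pos in simp_all)
  then show ?thesis by (simp add: jump_const_def mult_ac)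
qed

definition error :: "(real ^ 'n) set \<Rightarrow> real" where
  "error K = l2_inner K err err + \<epsilon>\<^sup>2 * l2_inner K (err_grad K) (err_grad K)"

lemma error_nonneg: "0 \<le> error K" by (simp add: error_def l2_inner_self_nonneg)

context
  fixes d :: "real ^ 'n \<Rightarrow> real" and \<gamma> M :: real
  assumes facet_jump_eq: "\<And>x. barycentric T (opp T) x = 0 \<Longrightarrow> facet_jump x = T.facet_function (opp T) d \<gamma> x"
    and M: "\<bar>\<gamma>\<bar> \<le> M" "\<And>z. z \<in> vertices T - {opp T} \<Longrightarrow> \<bar>d z\<bar> \<le> M"
      "M = \<bar>\<gamma>\<bar> \<or> (\<exists>v\<in>vertices T - {opp T}. M = \<bar>d v\<bar>)"
begin

lemma area_M: "T.area (opp T) * M\<^sup>2 \<le> coefficient_bound CARD('n) * jump_sq"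
proof -
  have "(LINT s|surface_measure F. (T.facet_function (opp T) d \<gamma> s)\<^sup>2) = jump_sq"
    unfolding jump_sq_def by (rule Bochner_Integration.integral_cong[OF refl]) (simp add: space_F facet_jump_eq F_hyperplane)
  then show ?thesis using T.coefficient_estimate[OF opp_T M] by (simp only: F_eq)
qed

lemma M_adjacent: "K \<in> adjacent \<Longrightarrow> z \<in> vertices K - {opp K} \<Longrightarrow> \<bar>d z\<bar> \<le> M"
  using M(2) by (simp only: C0_adjacent)

lemma facet_function_facet_jump:
  assumes "K \<in> adjacent" "x \<in> F"
  shows "barycentric K (opp K) x = 0"
    "simplex_element.facet_function K (vertices K) (opp K) d \<gamma> x = facet_jump x"
proof -
  note h = F_hyperplane[OF assms(2)]
  show "barycentric K (opp K) x = 0" by (rule hyperplane_adjacent[OF assms(1), THEN iffD1, OF h])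
  show "simplex_element.facet_function K (vertices K) (opp K) d \<gamma> x = facet_jump x"
    using facet_jump_eq[OF h] facet_function_adjacent[OF assms(1) h] by simp
qed

text \<open>Both weights are \<epsilon>: relative to \<open>jump_sq\<close>, a layer of width
  \<epsilon> has squared norms of order \<epsilon> for the field and \<open>1 / \<epsilon>\<close>
  for its divergence.\<close>

lemma layer_field_exists:
  assumes K: "K \<in> adjacent" and small: "\<epsilon> \<le> diam_ratio * diameter K"
  shows "\<exists>p. \<exists>D. admissible facet_jump \<epsilon> \<epsilon> K p D"
proof -
  note K' = adjacentD(1)[OF K]
  interpret K: simplex_element K "vertices K" by (rule elem[OF K'])
  note o = opp_vertex(1)[OF K]
  let ?h = "diameter K"
  have h: "0 < ?h" by (rule K.diameter_pos)
  \<comment> \<open>The ratio may fall below 1 when only the other element is larger than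
    \<epsilon>. The cutoff then extends over the whole element, and \<open>small\<close> still
    bounds the divergence.\<close>
  define s where "s = max 1 (?h / \<epsilon>)"
  have s: "1 \<le> s" by (simp add: s_def)
  obtain g g' where g: "\<And>z. z \<in> vertices K - {opp K} \<Longrightarrow> C1_with_gradient (g z) (g' z)"
    and tr: "\<And>x. K.bary (opp K) x = 0 \<Longrightarrow> (\<Sum>z\<in>vertices K - {opp K}. K.bary z x * g z x) = K.facet_function (opp K) d \<gamma> x"
    and P: "(LINT x|lebesgue_on K. (norm (K.flux (opp K) g x))\<^sup>2)
        \<le> (\<kappa> * 4 ^ CARD('n)) * (2 * M)\<^sup>2 * (diameter K / s) * K.area (opp K)"
    and D: "(LINT x|lebesgue_on K. (norm (K.flux_div (opp K) g g' x))\<^sup>2)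
        \<le> (\<kappa> * 4 ^ CARD('n)) * (14 * M)\<^sup>2 * (s / diameter K) * K.area (opp K)"
  proof -
    show thesis
    proof (rule K.boundary_layer_field[OF o M(1) M_adjacent[OF K] regular_element[OF K'] s])
      fix g :: "real ^ 'n \<Rightarrow> real ^ 'n \<Rightarrow> real" and g' :: "real ^ 'n \<Rightarrow> real ^ 'n \<Rightarrow> real ^ 'n"
      assume g0: "\<And>z. z \<in> vertices K - {opp K} \<Longrightarrow> C1_with_gradient (g z) (g' z)"
      assume tr0: "\<And>x. K.bary (opp K) x = 0 \<Longrightarrow> (\<Sum>z\<in>vertices K - {opp K}. K.bary z x * g z x) = K.facet_function (opp K) d \<gamma> x"
      assume P0: "(LINT x|lebesgue_on K. (norm (K.flux (opp K) g x))\<^sup>2)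
        \<le> (\<kappa> * 4 ^ CARD('n)) * (2 * M)\<^sup>2 * (diameter K / s) * K.area (opp K)"
      assume D0: "(LINT x|lebesgue_on K. (norm (K.flux_div (opp K) g g' x))\<^sup>2)
        \<le> (\<kappa> * 4 ^ CARD('n)) * (14 * M)\<^sup>2 * (s / diameter K) * K.area (opp K)"
      show thesis by (rule that[of g g', OF g0 tr0 P0 D0])
    qed
  qed
  define X where "X = K.area (opp K) * M\<^sup>2"
  have X: "0 \<le> X" "X \<le> coefficient_bound CARD('n) * jump_sq"
    using area_M K.area_nonneg[of "opp K"] by (simp_all add: X_def area_adjacent[OF K])
  have "s * \<epsilon> \<ge> ?h" using \<epsilon> by (simp add: s_def field_simps max_def)
  then have t1: "?h / s \<le> diam_ratio * (\<epsilon> / diam_ratio)" using s diam_ratio_ge_1 by (simp add: field_simps)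
  have t1': "?h / s \<le> \<epsilon>" using \<open>s * \<epsilon> \<ge> ?h\<close> s by (simp add: field_simps)
  have "?h / s \<le> diam_ratio * \<epsilon>"
  proof -
    have "1 * \<epsilon> \<le> diam_ratio * \<epsilon>" by (rule mult_right_mono[OF diam_ratio_ge_1]) (use \<epsilon> in simp)
    then show ?thesis using t1' by simp
  qed
  then have 1: "(\<kappa> * 4 ^ CARD('n)) * 4 * X * (?h / s) \<le> jump_const * jump_sq * \<epsilon>"
    by (intro jump_const_ge X) (use h s in auto)
  have "s / ?h \<le> diam_ratio * (1 / \<epsilon>)"
  proof (cases "?h / \<epsilon> \<le> 1")
    case True
    then have "s = 1" by (simp add: s_def)
    then show ?thesis using small h \<epsilon> by (simp add: field_simps)
  next
    case False
    then have "s = ?h / \<epsilon>" by (simp add: s_def)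
    then show ?thesis using diam_ratio_ge_1 h \<epsilon> by (simp add: field_simps)
  qed
  then have 2: "(\<kappa> * 4 ^ CARD('n)) * 196 * X * (s / ?h) \<le> jump_const * jump_sq * (1 / \<epsilon>)"
    by (intro jump_const_ge X) (use h s in auto)
  have 3: "(LINT x|lebesgue_on K. K.flux_div (opp K) g g' x * k x + K.flux (opp K) g x \<bullet> k' x) = (LINT s|surface_measure F. facet_jump s * k s)"
    if "C1_with_gradient k k'" for k k'
    by (rule green_flux[OF K g _ that]) (simp_all add: tr facet_function_facet_jump[OF K])
  have 4: "l2_inner K (K.flux_div (opp K) g g') (K.flux_div (opp K) g g') \<le> jump_const * jump_sq / \<epsilon>"
    using D 2 unfolding l2_self X_def by (simp add: power_mult_distrib mult_ac)
  have 5: "l2_inner K (K.flux (opp K) g) (K.flux (opp K) g) \<le> jump_const * jump_sq * \<epsilon>"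
    using P 1 unfolding l2_self X_def by (simp add: power_mult_distrib mult_ac)
  show ?thesis unfolding admissible_def
    by (intro exI[of _ "K.flux (opp K) g"] exI[of _ "K.flux_div (opp K) g g'"] conjI allI impI 3 4 5
        K.flux_continuous[OF o g] K.flux_div_continuous[OF o g])
qed

text \<open>The mean of the jump over \<open>F\<close>: on the facet each vertex coordinate has mean
  \<open>1 / CARD('n)\<close>, and the bubble has mean
  \<open>T.bubble_divergence / CARD('n)\<close>.\<close>

definition facet_jump_mean :: real where
  "facet_jump_mean = ((\<Sum>z\<in>vertices T - {opp T}. d z) + \<gamma> * T.bubble_divergence) / real CARD('n)"

text \<open>The divergence is zero, so the first weight may be any positive number;
  \<open>\<epsilon>\<^sup>2 / diameter T\<close> turns the bound of \<open>duality\<close> into a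
  multiple of \<open>error\<close>. The subtracted mean is the same from either side, so the two
  fields match on \<open>F\<close>.\<close>

lemma free_field_exists:
  assumes K: "K \<in> adjacent"
  shows "\<exists>p. \<exists>D. admissible (\<lambda>s. facet_jump s - facet_jump_mean) (\<epsilon>\<^sup>2 / diameter T) (diameter T) K p D"
proof -
  note K' = adjacentD(1)[OF K]
  interpret K: simplex_element K "vertices K" by (rule elem[OF K'])
  note o = opp_vertex(1)[OF K]
  obtain g g' where g: "\<And>z. z \<in> vertices K - {opp K} \<Longrightarrow> C1_with_gradient (g z) (g' z)"
    and tr: "\<And>x. K.bary (opp K) x = 0 \<Longrightarrow> (\<Sum>z\<in>vertices K - {opp K}. K.bary z x * g z x) =
       K.facet_function (opp K) d \<gamma> x - ((\<Sum>z\<in>vertices K - {opp K}. d z) + \<gamma> * K.bubble_divergence) / real CARD('n)"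
    and D: "\<And>x. K.flux_div (opp K) g g' x = 0"
    and P: "(LINT x|lebesgue_on K. (norm (K.flux (opp K) g x))\<^sup>2)
        \<le> (\<kappa> * 4 ^ CARD('n)) * (5 * M)\<^sup>2 * diameter K * K.area (opp K)"
  proof -
    show thesis
    proof (rule K.divergence_free_field[OF o M(1) M_adjacent[OF K] regular_element[OF K']])
      fix g :: "real ^ 'n \<Rightarrow> real ^ 'n \<Rightarrow> real" and g' :: "real ^ 'n \<Rightarrow> real ^ 'n \<Rightarrow> real ^ 'n"
      assume g0: "\<And>z. z \<in> vertices K - {opp K} \<Longrightarrow> C1_with_gradient (g z) (g' z)"
      assume tr0: "\<And>x. K.bary (opp K) x = 0 \<Longrightarrow> (\<Sum>z\<in>vertices K - {opp K}. K.bary z x * g z x) =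
       K.facet_function (opp K) d \<gamma> x - ((\<Sum>z\<in>vertices K - {opp K}. d z) + \<gamma> * K.bubble_divergence) / real CARD('n)"
      assume D0: "\<And>x. K.flux_div (opp K) g g' x = 0"
      assume P0: "(LINT x|lebesgue_on K. (norm (K.flux (opp K) g x))\<^sup>2)
        \<le> (\<kappa> * 4 ^ CARD('n)) * (5 * M)\<^sup>2 * diameter K * K.area (opp K)"
      show thesis by (rule that[of g g', OF g0 tr0 D0 P0])
    qed
  qed
  have mean: "((\<Sum>z\<in>vertices K - {opp K}. d z) + \<gamma> * K.bubble_divergence) / real CARD('n) = facet_jump_mean"
    unfolding facet_jump_mean_def C0_adjacent[OF K] facet_pair.bubble_divergence_eq[OF pair[OF K]] ..
  define X where "X = K.area (opp K) * M\<^sup>2"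
  have X: "0 \<le> X" "X \<le> coefficient_bound CARD('n) * jump_sq"
    using area_M K.area_nonneg[of "opp K"] by (simp_all add: X_def area_adjacent[OF K])
  have 1: "(\<kappa> * 4 ^ CARD('n)) * 25 * X * diameter K \<le> jump_const * jump_sq * diameter T"
    by (intro jump_const_ge X diameter_adjacent[OF K adjacent_T]) (use K.diameter_pos in auto)
  have 3: "(LINT x|lebesgue_on K. K.flux_div (opp K) g g' x * k x + K.flux (opp K) g x \<bullet> k' x)
      = (LINT s|surface_measure F. (facet_jump s - facet_jump_mean) * k s)"
    if "C1_with_gradient k k'" for k k'
    by (rule green_flux[OF K g _ that]) (simp_all only: tr facet_function_facet_jump[OF K] mean)
  have "l2_inner K (K.flux_div (opp K) g g') (K.flux_div (opp K) g g') = 0" by (simp add: l2_self D)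
  moreover have "0 \<le> jump_const * jump_sq / (\<epsilon>\<^sup>2 / diameter T)"
    by (intro divide_nonneg_nonneg mult_nonneg_nonneg less_imp_le[OF jump_const_pos] jump_sq_nonneg zero_le_power2
        less_imp_le[OF T.diameter_pos])
  ultimately have 4: "l2_inner K (K.flux_div (opp K) g g') (K.flux_div (opp K) g g') \<le> jump_const * jump_sq / (\<epsilon>\<^sup>2 / diameter T)"
    by (rule ord_eq_le_trans)
  have "(\<kappa> * 4 ^ CARD('n)) * (5 * M)\<^sup>2 * diameter K * K.area (opp K) = (\<kappa> * 4 ^ CARD('n)) * 25 * X * diameter K"
    by (simp add: X_def power_mult_distrib)
  then have 5: "l2_inner K (K.flux (opp K) g) (K.flux (opp K) g) \<le> jump_const * jump_sq * diameter T"
    using P 1 unfolding l2_self by linarith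
  show ?thesis unfolding admissible_def
    by (intro exI[of _ "K.flux (opp K) g"] exI[of _ "K.flux_div (opp K) g g'"] conjI allI impI 3 4 5
        K.flux_continuous[OF o g] K.flux_div_continuous[OF o g])
qed

text \<open>The weight joins what the jump needs, \<epsilon>, to what the tangential jump needs
  after an inverse estimate. If \<epsilon> is below some adjacent diameter, the first part dominates
  up to the factor \<open>diam_ratio\<close>; otherwise the second part does.\<close>

lemma jump_bound:
  "(\<epsilon> + \<epsilon>\<^sup>2 / diameter T) * jump_sq \<le> (1 + diam_ratio) * (16 * jump_const * (\<Sum>K\<in>adjacent. error K))"
proof (cases "\<exists>L\<in>adjacent. \<epsilon> < diameter L")
  case True
  then obtain L where L: "L \<in> adjacent" "\<epsilon> < diameter L" by (elim bexE)
  have small: "\<epsilon> \<le> diam_ratio * diameter K" if K: "K \<in> adjacent" for K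
    using L(2) diameter_adjacent[OF L(1) K] by linarith
  have "(LINT s|surface_measure F. facet_jump s * facet_jump s) = jump_sq" by (simp add: jump_sq_def power2_eq_square)
  then have "jump_sq \<le> 16 * jump_const * (\<Sum>K\<in>adjacent. l2_inner K err err / \<epsilon> + \<epsilon> * l2_inner K (err_grad K) (err_grad K))"
    by (intro duality_admissible[OF layer_field_exists[OF _ small]] facet_jump_continuous \<epsilon>)
  then have "\<epsilon> * jump_sq \<le> \<epsilon> * (16 * jump_const * (\<Sum>K\<in>adjacent. l2_inner K err err / \<epsilon> + \<epsilon> * l2_inner K (err_grad K) (err_grad K)))"
    using \<epsilon> by (intro mult_left_mono) auto
  also have "\<dots> = 16 * jump_const * (\<Sum>K\<in>adjacent. error K)"
    using \<epsilon> by (simp add: error_def sum_distrib_left distrib_left power2_eq_square mult_ac)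
  finally have 1: "\<epsilon> * jump_sq \<le> 16 * jump_const * (\<Sum>K\<in>adjacent. error K)" .
  have "\<epsilon>\<^sup>2 / diameter T \<le> diam_ratio * \<epsilon>"
    using small[OF adjacent_T] \<epsilon> T.diameter_pos by (simp add: power2_eq_square field_simps)
  then have "(\<epsilon> + \<epsilon>\<^sup>2 / diameter T) * jump_sq \<le> ((1 + diam_ratio) * \<epsilon>) * jump_sq"
    by (intro mult_right_mono jump_sq_nonneg) (simp add: algebra_simps)
  also have "\<dots> = (1 + diam_ratio) * (\<epsilon> * jump_sq)" by simp
  also have "\<dots> \<le> (1 + diam_ratio) * (16 * jump_const * (\<Sum>K\<in>adjacent. error K))"
    using diam_ratio_ge_1 by (intro mult_left_mono 1) simp
  finally show ?thesis .
next
  case False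
  then have le: "diameter T \<le> \<epsilon>" using adjacent_T by (auto simp: not_less)
  note hT = T.diameter_pos
  have c1: "continuous_on UNIV (\<lambda>s. facet_jump s * facet_jump s)" and c2: "continuous_on UNIV (\<lambda>s. (- facet_jump_mean) * facet_jump s)"
    by (intro continuous_intros facet_jump_continuous)+
  have "(LINT s|surface_measure F. facet_jump s * facet_jump s + (- facet_jump_mean) * facet_jump s) =
      (LINT s|surface_measure F. facet_jump s * facet_jump s) + (LINT s|surface_measure F. (- facet_jump_mean) * facet_jump s)"
    using T.surface_integral_add[OF opp_T c1 c2] by (simp only: F_eq)
  \<comment> \<open>The mean subtracted from the trace is invisible in this pairing, since
    \<open>facet_jump\<close> integrates to zero.\<close>
  then have jump_sq: "(LINT s|surface_measure F. (facet_jump s - facet_jump_mean) * facet_jump s) = jump_sq"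
    by (simp add: jump_sq_def power2_eq_square left_diff_distrib integral_facet_jump)
  have "jump_sq \<le> 16 * jump_const * (\<Sum>K\<in>adjacent. l2_inner K err err / (\<epsilon>\<^sup>2 / diameter T) + diameter T * l2_inner K (err_grad K) (err_grad K))"
    by (intro duality_admissible[OF free_field_exists] continuous_intros facet_jump_continuous jump_sq) (use \<epsilon> hT in simp_all)
  then have "\<epsilon>\<^sup>2 / diameter T * jump_sq \<le> \<epsilon>\<^sup>2 / diameter T *
      (16 * jump_const * (\<Sum>K\<in>adjacent. l2_inner K err err / (\<epsilon>\<^sup>2 / diameter T) + diameter T * l2_inner K (err_grad K) (err_grad K)))"
    using \<epsilon> hT by (intro mult_left_mono) auto
  also have "\<dots> = 16 * jump_const * (\<Sum>K\<in>adjacent. \<epsilon>\<^sup>2 / diameter T * (l2_inner K err err / (\<epsilon>\<^sup>2 / diameter T) + diameter T * l2_inner K (err_grad K) (err_grad K)))"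
    by (simp only: sum_distrib_left mult.left_commute)
  also have "(\<Sum>K\<in>adjacent. \<epsilon>\<^sup>2 / diameter T * (l2_inner K err err / (\<epsilon>\<^sup>2 / diameter T) + diameter T * l2_inner K (err_grad K) (err_grad K))) = (\<Sum>K\<in>adjacent. error K)"
    by (rule sum.cong[OF refl]) (use \<epsilon> hT in \<open>simp add: error_def distrib_left\<close>)
  finally have 1: "\<epsilon>\<^sup>2 / diameter T * jump_sq \<le> 16 * jump_const * (\<Sum>K\<in>adjacent. error K)" .
  have "\<epsilon> \<le> \<epsilon>\<^sup>2 / diameter T" using le \<epsilon> hT by (simp add: power2_eq_square field_simps)
  then have "(\<epsilon> + \<epsilon>\<^sup>2 / diameter T) * jump_sq \<le> (2 * (\<epsilon>\<^sup>2 / diameter T)) * jump_sq"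
    by (intro mult_right_mono jump_sq_nonneg) simp
  also have "\<dots> = 2 * (\<epsilon>\<^sup>2 / diameter T * jump_sq)" by simp
  also have "\<dots> \<le> 2 * (16 * jump_const * (\<Sum>K\<in>adjacent. error K))" using 1 by simp
  also have "\<dots> \<le> (1 + diam_ratio) * (16 * jump_const * (\<Sum>K\<in>adjacent. error K))"
    using diam_ratio_ge_1 jump_const_pos error_nonneg by (intro mult_right_mono mult_nonneg_nonneg sum_nonneg) auto
  finally show ?thesis .
qed

end

end

section \<open>Jumps of the discrete function and of its gradient\<close>

lemma (in simplex_element) elem_trace_eq:
  fixes f :: "real ^ 'n \<Rightarrow> 'b::euclidean_space"
  assumes f: "continuous_on UNIV f" and v: "\<And>y. y \<in> T \<Longrightarrow> v y = f y" and x: "x \<in> convex hull C"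
  shows "elem_trace T v x = f x"
  unfolding elem_trace_def
proof (rule tendsto_Lim)
  have "x islimpt T"
  proof (cases "x \<in> T")
    case True
    then show ?thesis using open_T by (intro interior_limit_point) (simp add: interior_open)
  next
    case False
    have "x \<in> closure T" unfolding closure_T by (rule x)
    then show ?thesis using False by (simp add: closure_def)
  qed
  then show "at x within T \<noteq> bot" by (simp add: trivial_limit_within)
  have "(f \<longlongrightarrow> f x) (at x within T)"
    using continuous_on_subset[OF f subset_UNIV, of "insert x T"]
    by (auto simp: continuous_on_def intro: tendsto_within_subset)
  moreover have "\<forall>\<^sub>F y in at x within T. f y = v y" by (simp add: eventually_at_filter v)
  ultimately show "(v \<longlongrightarrow> f x) (at x within T)" by (rule tendsto_cong[THEN iffD1, rotated])
qed

lemma (in mesh_facet) jump_eq: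
  fixes f :: "real ^ 'n \<Rightarrow> 'b::euclidean_space"
  assumes h: "\<And>K. K \<in> adjacent \<Longrightarrow> elem_trace K f x = h K"
  shows "jump \<T> T F f x = (\<Sum>K\<in>adjacent. side K *\<^sub>R h K)"
proof -
  let ?A = "{K \<in> \<T>. K \<noteq> T \<and> F \<in> facets K}"
  have A: "adjacent = insert T ?A" using T F by (auto simp: adjacent_def)
  have f: "finite ?A" using finite_\<T> by simp
  have "(\<Sum>K\<in>adjacent. side K *\<^sub>R h K) = h T + (\<Sum>K\<in>?A. - h K)"
    unfolding A using f by (subst sum.insert) (auto simp: side_def intro!: sum.cong)
  also have "\<dots> = h T - (\<Sum>K\<in>?A. h K)" by (simp add: sum_negf)
  also have "(\<Sum>K\<in>?A. h K) = (\<Sum>K\<in>?A. elem_trace K f x)"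
    by (rule sum.cong[OF refl]) (simp add: h adjacent_def)
  finally show ?thesis by (simp add: jump_def h adjacent_T)
qed

lemma gradient_on_open:
  assumes "open S" "x \<in> S" "C1_with_gradient f f'" "\<And>y. y \<in> S \<Longrightarrow> v y = f y"
  shows "gradient v x = f' x"
proof (rule gradient_eqI)
  show "(v has_derivative (\<lambda>h. f' x \<bullet> h)) (at x)"
    by (rule has_derivative_transform_within_open[OF C1_has_derivative[OF assms(3), of x UNIV] assms(1,2)])
      (simp add: assms(4))
qed

lemma l2_norm_facet_sq:
  fixes w :: "real ^ 'n \<Rightarrow> 'b::euclidean_space"
  shows "(l2_norm_facet F w)\<^sup>2 = (LINT x | surface_measure F. (norm (w x))\<^sup>2)"
  by (simp add: l2_norm_facet_def integral_nonneg_AE)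

context discrete_jump
begin

definition facet_jump_grad :: "real ^ 'n \<Rightarrow> real ^ 'n" where "facet_jump_grad x = (\<Sum>K\<in>adjacent. side K *\<^sub>R w' K x)"

lemma facet_jump_C1: "C1_with_gradient facet_jump facet_jump_grad"
  unfolding facet_jump_def[abs_def] facet_jump_grad_def[abs_def] by (intro C1_sum C1_cmult w adjacentD)

lemma F_hull: assumes "K \<in> adjacent" "x \<in> F" shows "x \<in> convex hull (vertices K)"
proof -
  have "x \<in> convex hull (vertices K - {opp K})" unfolding opp_vertex(2)[OF assms(1)] by (rule assms(2))
  then show ?thesis using hull_mono[of "vertices K - {opp K}" "vertices K" convex] by (rule subsetD[rotated]) blast
qed

lemma jump_v: assumes "x \<in> F" shows "jump \<T> T F v x = facet_jump x"
proof -
  have "elem_trace K v x = w K x" if "K \<in> adjacent" for K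
    by (rule simplex_element.elem_trace_eq[OF elem[OF adjacentD(1)[OF that]] w_continuous[OF adjacentD(1)[OF that]]
        v_eq[OF adjacentD(1)[OF that]] F_hull[OF that assms]])
  from jump_eq[of v x "\<lambda>K. w K x", OF this] show ?thesis by (simp add: facet_jump_def)
qed

lemma jump_gradient: assumes "x \<in> F" shows "jump \<T> T F (gradient v) x = facet_jump_grad x"
proof -
  have "elem_trace K (gradient v) x = w' K x" if K: "K \<in> adjacent" for K
  proof (rule simplex_element.elem_trace_eq[OF elem[OF adjacentD(1)[OF K]]
        C1_continuous_gradient[OF w[OF adjacentD(1)[OF K]]] _ F_hull[OF K assms]])
    fix y assume "y \<in> K"
    then show "gradient v y = w' K y"
      by (rule gradient_on_open[OF elem_props(1)[OF adjacentD(1)[OF K]] _ w[OF adjacentD(1)[OF K]] v_eq[OF adjacentD(1)[OF K]]])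
  qed
  from jump_eq[of "gradient v" x "\<lambda>K. w' K x", OF this] show ?thesis by (simp add: facet_jump_grad_def)
qed

lemma l2_jump: "(l2_norm_facet F (jump \<T> T F v))\<^sup>2 = jump_sq"
  unfolding l2_norm_facet_sq jump_sq_def
  by (rule Bochner_Integration.integral_cong[OF refl]) (simp add: space_F jump_v)

definition tangential_const :: real where
  "tangential_const = 36 * (\<kappa> * 4 ^ CARD('n))\<^sup>2 * coefficient_bound CARD('n)"

text \<open>An inverse estimate on the facet: the tangential gradient is bounded by the largest
  coefficient over the diameter, and that coefficient by the jump through \<open>area_M\<close>. The
  36 in \<open>tangential_const\<close> is the square of the 6 in
  \<open>tangential_bound\<close>.\<close>

lemma l2_tangential:
  "diameter T * (l2_norm_facet F (\<lambda>x. tangential F (jump \<T> T F (gradient v) x)))\<^sup>2 \<le> tangential_const * (jump_sq / diameter T)"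
proof -
  obtain d \<gamma> where "\<forall>x. barycentric T (opp T) x = 0 \<longrightarrow> facet_jump x = T.facet_function (opp T) d \<gamma> x"
    by (rule facet_jump_facet_function)
  note facet_jump_eq = this[rule_format]
  obtain M where M': "\<bar>\<gamma>\<bar> \<le> M" "\<forall>z\<in>vertices T - {opp T}. \<bar>d z\<bar> \<le> M"
      "M = \<bar>\<gamma>\<bar> \<or> (\<exists>v\<in>vertices T - {opp T}. M = \<bar>d v\<bar>)"
    by (rule T.facet_coefficient_max)
  note M = M'(1) M'(2)[rule_format] M'(3)
  note hT = T.diameter_pos
  let ?B = "6 * M * (\<kappa> * 4 ^ CARD('n)) / diameter T"
  have bnd: "norm (tangential F (facet_jump_grad x)) \<le> ?B" if "x \<in> F" for x
    using T.tangential_bound[OF opp_T facet_jump_C1 facet_jump_eq M(1,2) regular_element[OF T], of x] that by (simp only: F_eq)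
  have c: "continuous_on UNIV (\<lambda>x. (norm (tangential F (facet_jump_grad x)))\<^sup>2)"
    unfolding tangential_def by (intro continuous_intros C1_continuous_gradient[OF facet_jump_C1])
  have "(l2_norm_facet F (\<lambda>x. tangential F (jump \<T> T F (gradient v) x)))\<^sup>2
      = (LINT x|surface_measure F. (norm (tangential F (facet_jump_grad x)))\<^sup>2)"
    unfolding l2_norm_facet_sq
    by (rule Bochner_Integration.integral_cong[OF refl]) (simp add: space_F jump_gradient)
  also have "\<dots> \<le> (LINT x|surface_measure F. ?B\<^sup>2)"
    using T.surface_integral_mono[OF opp_T c continuous_on_const[of UNIV "?B\<^sup>2"]] bnd unfolding F_eq
    by (simp add: power_mono)
  also have "\<dots> = ?B\<^sup>2 * T.area (opp T)" using T.surface_integral_const[OF opp_T, of "?B\<^sup>2"] by (simp only: F_eq)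
  finally have "diameter T * (l2_norm_facet F (\<lambda>x. tangential F (jump \<T> T F (gradient v) x)))\<^sup>2
      \<le> diameter T * (?B\<^sup>2 * T.area (opp T))"
    using hT by (intro mult_left_mono) auto
  also have "\<dots> = 36 * (\<kappa> * 4 ^ CARD('n))\<^sup>2 * (T.area (opp T) * M\<^sup>2) / diameter T"
    using hT by (simp add: power_divide power_mult_distrib power2_eq_square)
  also have "\<dots> \<le> 36 * (\<kappa> * 4 ^ CARD('n))\<^sup>2 * (coefficient_bound CARD('n) * jump_sq) / diameter T"
    using hT area_M[OF facet_jump_eq M] by (intro divide_right_mono mult_left_mono) auto
  finally show ?thesis by (simp add: tangential_const_def)
qed

definition facet_const :: real where
  "facet_const = (1 + tangential_const) * ((1 + diam_ratio) * (16 * jump_const))"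

lemma tangential_const_nonneg: "0 \<le> tangential_const"
  using coefficient_bound_pos[of "CARD('n)"] by (simp add: tangential_const_def)

lemma facet_const_nonneg: "0 \<le> facet_const"
  using tangential_const_nonneg diam_ratio_ge_1 jump_const_pos by (simp add: facet_const_def)

lemma facet_terms:
  "\<epsilon> * (l2_norm_facet F (jump \<T> T F v))\<^sup>2
    + \<epsilon>\<^sup>2 * diameter T * (l2_norm_facet F (\<lambda>x. tangential F (jump \<T> T F (gradient v) x)))\<^sup>2
   \<le> facet_const * (\<Sum>K\<in>adjacent. error K)"
proof -
  obtain d \<gamma> where "\<forall>x. barycentric T (opp T) x = 0 \<longrightarrow> facet_jump x = T.facet_function (opp T) d \<gamma> x"
    by (rule facet_jump_facet_function)
  note facet_jump_eq = this[rule_format]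
  obtain M where M': "\<bar>\<gamma>\<bar> \<le> M" "\<forall>z\<in>vertices T - {opp T}. \<bar>d z\<bar> \<le> M"
      "M = \<bar>\<gamma>\<bar> \<or> (\<exists>v\<in>vertices T - {opp T}. M = \<bar>d v\<bar>)"
    by (rule T.facet_coefficient_max)
  note M = M'(1) M'(2)[rule_format] M'(3)
  have jb: "(\<epsilon> + \<epsilon>\<^sup>2 / diameter T) * jump_sq \<le> (1 + diam_ratio) * (16 * jump_const * (\<Sum>K\<in>adjacent. error K))"
    by (rule jump_bound[OF facet_jump_eq M])
  note hT = T.diameter_pos
  let ?X = "\<epsilon>\<^sup>2 / diameter T * jump_sq"
  have X: "0 \<le> ?X" "0 \<le> \<epsilon> * jump_sq" using hT \<epsilon> jump_sq_nonneg by simp_all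
  have "\<epsilon>\<^sup>2 * diameter T * (l2_norm_facet F (\<lambda>x. tangential F (jump \<T> T F (gradient v) x)))\<^sup>2
      \<le> \<epsilon>\<^sup>2 * (tangential_const * (jump_sq / diameter T))"
    unfolding mult.assoc by (rule mult_left_mono[OF l2_tangential]) simp
  also have "\<dots> = tangential_const * ?X" by simp
  finally have 1: "\<epsilon>\<^sup>2 * diameter T * (l2_norm_facet F (\<lambda>x. tangential F (jump \<T> T F (gradient v) x)))\<^sup>2 \<le> tangential_const * ?X" .
  have 2: "0 \<le> tangential_const * (\<epsilon> * jump_sq)" using tangential_const_nonneg X(2) by (rule mult_nonneg_nonneg)
  have "\<epsilon> * jump_sq + tangential_const * ?X \<le> (1 + tangential_const) * ((\<epsilon> + \<epsilon>\<^sup>2 / diameter T) * jump_sq)"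
    unfolding distrib_right distrib_left mult_1_left using 2 X(1) by linarith
  also have "\<dots> \<le> (1 + tangential_const) * ((1 + diam_ratio) * (16 * jump_const * (\<Sum>K\<in>adjacent. error K)))"
    by (rule mult_left_mono[OF jb]) (rule add_nonneg_nonneg[OF zero_le_one tangential_const_nonneg])
  also have "\<dots> = facet_const * (\<Sum>K\<in>adjacent. error K)" by (simp only: facet_const_def mult.assoc)
  finally show ?thesis using 1 unfolding l2_jump by linarith
qed

section \<open>From adjacent elements to the patch\<close>

abbreviation neighbourhood :: "(real ^ 'n) set set" where
  "neighbourhood \<equiv> {K \<in> \<T>. closure T \<inter> closure K \<noteq> {}}"

lemma patch_lebesgue: "patch \<T> T \<in> sets lebesgue" by (simp add: patch_def)

lemma patch_cover: "patch \<T> T \<subseteq> (\<Union>K\<in>neighbourhood. closure K)"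
  unfolding patch_def by (rule subset_trans[OF interior_subset]) blast

lemma neighbour_subset_patch: assumes "K \<in> neighbourhood" shows "K \<subseteq> patch \<T> T"
  unfolding patch_def
proof (rule interior_maximal)
  show "K \<subseteq> \<Union> {closure T' | T'. T' \<in> \<T> \<and> closure T \<inter> closure T' \<noteq> {}}"
    using assms closure_subset[of K] by blast
  show "open K" using assms elem_props(1) by blast
qed

lemma adjacent_neighbour: assumes "K \<in> adjacent" shows "K \<in> neighbourhood"
proof -
  have "F \<noteq> {}" using F by (auto simp: facets_def facet_of_def)
  then obtain x where x: "x \<in> F" by blast
  have "x \<in> closure K"
    unfolding simplex_element.closure_T[OF elem[OF adjacentD(1)[OF assms]]] by (rule F_hull[OF assms x])
  moreover have "x \<in> closure T"
    unfolding simplex_element.closure_T[OF elem[OF T]] by (rule F_hull[OF adjacent_T x])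
  ultimately show ?thesis using adjacentD(1)[OF assms] by blast
qed

text \<open>The error and its broken gradient are known to be square integrable on each element; the
  elements fill the patch up to a null set, which transfers this to the patch.\<close>

lemma L2_patch:
  fixes g :: "real ^ 'n \<Rightarrow> 'b::euclidean_space"
  assumes "\<And>K. K \<in> \<T> \<Longrightarrow> g \<in> L2 K"
  shows "g \<in> L2 (patch \<T> T)"
proof (rule L2_union[OF _ _ patch_lebesgue patch_cover])
  show "finite neighbourhood" using finite_\<T> by simp
  show "convex K \<and> open K \<and> K \<subseteq> patch \<T> T" if "K \<in> neighbourhood" for K
    using simplex_element.convex_T[OF elem, of K] elem_props(1)[of K] neighbour_subset_patch[OF that] that by simp
  show "g \<in> L2 K" if "K \<in> neighbourhood" for K using that assms by simp
  show "K = L" if "K \<in> neighbourhood" "L \<in> neighbourhood" "x \<in> K" "x \<in> L" for K L x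
    using that elem_disjoint[of K L x] by simp
qed

lemma broken_gradient_eq: assumes x: "x \<in> K" and K: "K \<in> \<T>"
  shows "broken_gradient \<T> g x = weak_gradient K g x"
proof -
  have "broken_gradient \<T> g x = (\<Sum>L\<in>\<T>. if L = K then weak_gradient L g x else 0)"
    unfolding broken_gradient_def
  proof (rule sum.cong[OF refl])
    fix L assume L: "L \<in> \<T>"
    have "x \<in> L \<longleftrightarrow> L = K" using elem_disjoint[OF K L x] x by blast
    then show "indicat_real L x *\<^sub>R weak_gradient L g x = (if L = K then weak_gradient L g x else 0)"
      by (simp add: indicator_def)
  qed
  then show ?thesis using K finite_\<T> by simp
qed

text \<open>\<open>err_grad\<close> is a difference of two chosen weak gradients, whereas the broken
  gradient of \<open>err\<close> uses the one chosen for the difference. They agree almost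
  everywhere.\<close>

lemma err_gradient: assumes K: "K \<in> \<T>"
  shows "weak_gradient K err \<in> L2 K" "AE x in lebesgue_on K. err_grad K x = weak_gradient K err x"
proof -
  have g: "is_weak_gradient K err (weak_gradient K err)"
    by (rule weak_gradient_is_weak_gradient[OF err_L2(3)[OF K]])
  then show "weak_gradient K err \<in> L2 K" by (simp add: is_weak_gradient_def)
  show "AE x in lebesgue_on K. err_grad K x = weak_gradient K err x"
    by (rule weak_gradient_unique[OF elem_props(1,2)[OF K] err_L2(3)[OF K] g])
qed

lemma broken_gradient_err_L2: "K \<in> \<T> \<Longrightarrow> broken_gradient \<T> err \<in> L2 K"
  by (rule L2_AE_cong[OF err_gradient(1)]) (auto intro!: AE_I2 simp: broken_gradient_eq elem_props)

definition patch_error :: real where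
  "patch_error = (l2_norm (patch \<T> T) err)\<^sup>2 + \<epsilon>\<^sup>2 * (l2_norm (patch \<T> T) (broken_gradient \<T> err))\<^sup>2"

lemma error_le_patch: assumes K: "K \<in> neighbourhood"
  shows "error K \<le> patch_error"
proof -
  have K': "K \<in> \<T>" using K by simp
  note sub = neighbour_subset_patch[OF K] elem_props(4)[OF K'] patch_lebesgue
  have "l2_inner K (err_grad K) (err_grad K) = l2_inner K (weak_gradient K err) (weak_gradient K err)"
    by (rule l2_inner_AE_cong[OF err_L2(2)[OF K'] err_gradient(1)[OF K'] err_L2(2)[OF K'] err_gradient(1)[OF K']
        err_gradient(2)[OF K'] err_gradient(2)[OF K']])
  also have "\<dots> = l2_inner K (broken_gradient \<T> err) (broken_gradient \<T> err)"
    by (rule l2_inner_cong) (simp add: broken_gradient_eq[OF _ K'])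
  also have "\<dots> \<le> (l2_norm (patch \<T> T) (broken_gradient \<T> err))\<^sup>2"
    unfolding l2_norm_sq by (rule l2_inner_self_mono[OF L2_patch[OF broken_gradient_err_L2] sub])
  finally have "\<epsilon>\<^sup>2 * l2_inner K (err_grad K) (err_grad K) \<le> \<epsilon>\<^sup>2 * (l2_norm (patch \<T> T) (broken_gradient \<T> err))\<^sup>2"
    by (rule mult_left_mono) simp
  moreover have "l2_inner K err err \<le> (l2_norm (patch \<T> T) err)\<^sup>2"
    unfolding l2_norm_sq by (rule l2_inner_self_mono[OF L2_patch[OF err_L2(1)] sub])
  ultimately show ?thesis by (simp add: error_def patch_error_def)
qed

lemma facet_terms_patch:
  "\<epsilon> * (l2_norm_facet F (jump \<T> T F v))\<^sup>2
    + \<epsilon>\<^sup>2 * diameter T * (l2_norm_facet F (\<lambda>x. tangential F (jump \<T> T F (gradient v) x)))\<^sup>2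
   \<le> 2 * facet_const * patch_error"
proof -
  have "0 \<le> patch_error" by (simp add: patch_error_def)
  then have "(\<Sum>K\<in>adjacent. error K) \<le> 2 * patch_error"
    by (intro sum_adjacent_le error_le_patch adjacent_neighbour)
  then have "facet_const * (\<Sum>K\<in>adjacent. error K) \<le> facet_const * (2 * patch_error)"
    by (rule mult_left_mono[OF _ facet_const_nonneg])
  then show ?thesis using facet_terms by simp
qed

end

subsection \<open>The local error estimate\<close>

lemma l2_inner_self_add:
  fixes f g :: "real ^ 'n \<Rightarrow> 'b::euclidean_space"
  assumes f: "f \<in> L2 S" and g: "g \<in> L2 S"
  shows "l2_inner S (\<lambda>x. f x + g x) (\<lambda>x. f x + g x) \<le> 2 * l2_inner S f f + 2 * l2_inner S g g"
proof -
  have "l2_inner S (\<lambda>x. f x + g x) (\<lambda>x. f x + g x) \<le> (LINT x|lebesgue_on S. 2 * (f x \<bullet> f x) + 2 * (g x \<bullet> g x))"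
    unfolding l2_inner_def
  proof (rule integral_mono)
    show "integrable (lebesgue_on S) (\<lambda>x. (f x + g x) \<bullet> (f x + g x))"
      by (rule L2_integrable_inner[OF L2_add[OF f g] L2_add[OF f g]])
    show "integrable (lebesgue_on S) (\<lambda>x. 2 * (f x \<bullet> f x) + 2 * (g x \<bullet> g x))"
      using L2_integrable_inner[OF f f] L2_integrable_inner[OF g g] by simp
    fix x
    have "0 \<le> (f x - g x) \<bullet> (f x - g x)" by (rule inner_ge_zero)
    then show "(f x + g x) \<bullet> (f x + g x) \<le> 2 * (f x \<bullet> f x) + 2 * (g x \<bullet> g x)"
      by (simp add: inner_diff_left inner_diff_right inner_add_left inner_add_right inner_commute)
  qed
  also have "\<dots> = 2 * l2_inner S f f + 2 * l2_inner S g g"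
    using L2_integrable_inner[OF f f] L2_integrable_inner[OF g g] by (simp add: l2_inner_def)
  finally show ?thesis .
qed

context simplex_element
begin

lemma const_L2: "(\<lambda>x. c :: 'b::euclidean_space) \<in> L2 T"
  by (rule L2_bounded_continuous[OF open_T bounded_T, of "\<lambda>x. c"]) auto

lemma Pi0_properties:
  assumes g: "g \<in> L2 T"
  obtains c where "Pi0 T g = (\<lambda>x. c)" "\<forall>k. l2_inner T (\<lambda>x. g x - c) (\<lambda>x. k) = 0"
proof -
  define m where "m = measure lebesgue T"
  have m: "0 < m" unfolding m_def by (rule measure_T_pos)
  have i: "integrable (lebesgue_on T) g" using L2_integrable_inner[OF g const_L2[of "1::real"]] by simp
  have ic: "integrable (lebesgue_on T) (\<lambda>x. c)" for c :: real by (rule integrable_continuous_T) simp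
  have ms: "measure (lebesgue_on T) T = m"
    using T_lmeasurable by (simp add: m_def measure_restrict_space fmeasurableD)
  have eq: "l2_inner T (\<lambda>x. g x - c) (\<lambda>x. k) = ((LINT x|lebesgue_on T. g x) - m * c) * k" for c k :: real
    using i ic by (simp add: l2_inner_def ms)
  define c where "c = (LINT x|lebesgue_on T. g x) / m"
  have orth: "l2_inner T (\<lambda>x. g x - c) (\<lambda>x. k) = 0" for k using m by (simp add: eq c_def)
  have "Pi0 T g = (\<lambda>x. c)"
    unfolding Pi0_def
  proof (rule the_equality)
    show "(\<lambda>x. c) \<in> P0 \<and> (\<forall>q\<in>P0. l2_inner T (\<lambda>x. g x - c) q = 0)"
      using orth by (auto simp: P0_def)
    fix p assume p: "p \<in> P0 \<and> (\<forall>q\<in>P0. l2_inner T (\<lambda>x. g x - p x) q = 0)"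
    then obtain b where b: "p = (\<lambda>x. b)" by (auto simp: P0_def)
    have "(\<lambda>x::real ^ 'n. 1::real) \<in> P0" by (auto simp: P0_def)
    then have "l2_inner T (\<lambda>x. g x - b) (\<lambda>x. 1) = 0" using p b by simp
    then have "b = c" using m by (simp add: eq c_def field_simps)
    then show "p = (\<lambda>x. c)" using b by simp
  qed
  then show thesis using orth by (intro that[of c]) auto
qed

text \<open>Pythagoras: \<open>g - c\<close> is orthogonal to the constants, so replacing
  \<open>c\<close> by \<open>a\<close> adds the squared norm of \<open>c - a\<close>.\<close>

lemma Pi0_best:
  assumes g: "g \<in> L2 T"
  shows "l2_inner T (\<lambda>x. g x - Pi0 T g x) (\<lambda>x. g x - Pi0 T g x) \<le> l2_inner T (\<lambda>x. g x - a) (\<lambda>x. g x - a)"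
proof -
  obtain c where c: "Pi0 T g = (\<lambda>x. c)" and orth: "\<forall>k. l2_inner T (\<lambda>x. g x - c) (\<lambda>x. k) = 0"
    by (rule Pi0_properties[OF g])
  have h: "(\<lambda>x. g x - c) \<in> L2 T" by (rule L2_diff[OF g const_L2])
  let ?h = "\<lambda>x. g x - c"
  have "l2_inner T (\<lambda>x. g x - a) (\<lambda>x. g x - a) = (LINT x|lebesgue_on T. ?h x \<bullet> ?h x + 2 * (?h x \<bullet> (c - a)) + (c - a) * (c - a))"
    unfolding l2_inner_def by (rule Bochner_Integration.integral_cong[OF refl]) (simp add: algebra_simps)
  also have "\<dots> = l2_inner T ?h ?h + 2 * l2_inner T ?h (\<lambda>x. c - a) + (LINT x|lebesgue_on T. (c - a) * (c - a))"
    using L2_integrable_inner[OF h h] L2_integrable_inner[OF h const_L2[of "c - a"]]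
      integrable_continuous_T[OF continuous_on_const, of "(c - a) * (c - a)"]
    unfolding l2_inner_def
    by (subst Bochner_Integration.integral_add, simp, simp)+ simp
  also have "\<dots> = l2_inner T ?h ?h + (LINT x|lebesgue_on T. (c - a) * (c - a))" using orth by simp
  finally have "l2_inner T ?h ?h \<le> l2_inner T (\<lambda>x. g x - a) (\<lambda>x. g x - a)"
    using Bochner_Integration.integral_nonneg[of "lebesgue_on T" "\<lambda>x. (c - a) * (c - a)"] by simp
  then show ?thesis by (simp only: c)
qed

lemma l2_inner_components:
  fixes g :: "real ^ 'n \<Rightarrow> real ^ 'n"
  assumes g: "g \<in> L2 T"
  shows "l2_inner T g g = (\<Sum>i\<in>UNIV. l2_inner T (\<lambda>x. g x $ i) (\<lambda>x. g x $ i))"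
  unfolding l2_inner_def inner_vec_def
  by (rule Bochner_Integration.integral_sum) (rule L2_integrable_inner[OF L2_component[OF g] L2_component[OF g]])

lemma Pi0_vec_best:
  fixes g :: "real ^ 'n \<Rightarrow> real ^ 'n"
  assumes g: "g \<in> L2 T"
  shows "l2_inner T (\<lambda>x. g x - Pi0_vec T g x) (\<lambda>x. g x - Pi0_vec T g x) \<le> l2_inner T (\<lambda>x. g x - a) (\<lambda>x. g x - a)"
proof -
  have "\<forall>i. \<exists>c. Pi0 T (\<lambda>y. g y $ i) = (\<lambda>x. c)"
    by (intro allI, rule Pi0_properties[OF L2_component[OF g]]) (rule exI)
  then obtain c where c: "\<forall>i. Pi0 T (\<lambda>y. g y $ i) = (\<lambda>x. c i)" by (drule_tac choice) (elim exE)
  have P: "Pi0_vec T g = (\<lambda>x. vec_lambda c)" by (simp add: Pi0_vec_def fun_eq_iff c)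
  have h: "(\<lambda>x. g x - Pi0_vec T g x) \<in> L2 T" unfolding P by (rule L2_diff[OF g const_L2])
  have h': "(\<lambda>x. g x - a) \<in> L2 T" by (rule L2_diff[OF g const_L2])
  show ?thesis
    unfolding l2_inner_components[OF h] l2_inner_components[OF h']
  proof (rule sum_mono)
    fix i
    show "l2_inner T (\<lambda>x. (g x - Pi0_vec T g x) $ i) (\<lambda>x. (g x - Pi0_vec T g x) $ i)
        \<le> l2_inner T (\<lambda>x. (g x - a) $ i) (\<lambda>x. (g x - a) $ i)"
      using Pi0_best[OF L2_component[OF g], of i "a $ i"] by (simp add: Pi0_vec_def)
  qed
qed

end

text \<open>Passes from a bound with an arbitrary constant competitor to the infimum, without
  discussing whether it is attained.\<close>

lemma le_INF_scaled:
  fixes f :: "'a \<Rightarrow> real"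
  assumes "A \<noteq> {}" "\<And>p. p \<in> A \<Longrightarrow> X \<le> Y + c * f p" "0 < c"
  shows "X \<le> Y + c * (INF p\<in>A. f p)"
proof -
  have "(X - Y) / c \<le> (INF p\<in>A. f p)"
  proof (rule cINF_greatest[OF assms(1)])
    fix p assume "p \<in> A"
    then show "(X - Y) / c \<le> f p" using assms(2)[of p] assms(3) by (simp add: field_simps)
  qed
  then show ?thesis using assms(3) by (simp add: field_simps)
qed

lemma P0_nonempty: "P0 \<noteq> {}" by (auto simp: P0_def)

text \<open>\<open>facet_const\<close> with its definitions unfolded. Outside the locale it shows
  that the constant depends only on the dimension and \<open>\<kappa>\<close>, so it can be fixed
  before \<epsilon> and the mesh.\<close>

definition indicator_const :: "nat \<Rightarrow> real \<Rightarrow> real" where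
  "indicator_const m \<kappa> = (let k = \<kappa> * 4 ^ m in (1 + 36 * k\<^sup>2 * coefficient_bound m) *
     ((1 + (1 + k)) * (16 * (196 * k * coefficient_bound m * (1 + k)))))"

context discrete_jump
begin

lemma T_neighbour: "T \<in> neighbourhood"
  by (rule adjacent_neighbour[OF adjacent_T])

text \<open>The competitor for \<open>v - f\<close> is \<open>a - c\<close> with \<open>c\<close>
  the mean of \<open>f\<close>. The difference splits into \<open>u - a\<close>, the oscillation of
  \<open>f\<close> and the error, and two uses of \<open>l2_inner_self_add\<close> produce the
  factor 4.\<close>

lemma mean_term:
  assumes f: "f \<in> L2 T"
  shows "(l2_norm T (\<lambda>x. (v x - f x) - Pi0 T (\<lambda>y. v y - f y) x))\<^sup>2
    \<le> 4 * l2_inner T err err + 4 * (l2_norm T (\<lambda>x. f x - Pi0 T f x))\<^sup>2 + 4 * (INF v\<^sub>h\<in>P0. (l2_norm T (\<lambda>x. u x - v\<^sub>h x))\<^sup>2)"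
proof (rule le_INF_scaled[OF P0_nonempty])
  note vL2 = H1_element(1)[OF v T] and uL2 = H1_element(1)[OF u T]
  fix p :: "real ^ 'n \<Rightarrow> real" assume "p \<in> P0"
  then obtain a where p: "p = (\<lambda>x. a)" by (auto simp: P0_def)
  obtain c where c: "Pi0 T f = (\<lambda>x. c)" by (rule T.Pi0_properties[OF f])
  have 1: "(\<lambda>x. u x - a) \<in> L2 T" by (rule L2_diff[OF uL2 T.const_L2])
  have 2: "(\<lambda>x. - 1 *\<^sub>R (f x - c)) \<in> L2 T" by (rule L2_scale[OF L2_diff[OF f T.const_L2]])
  have 3: "(\<lambda>x. - 1 *\<^sub>R err x) \<in> L2 T" by (rule L2_scale[OF err_L2(1)[OF T]])
  have neg: "l2_inner T (\<lambda>x. - 1 *\<^sub>R g x) (\<lambda>x. - 1 *\<^sub>R g x) = l2_inner T g g" for g :: "real ^ 'n \<Rightarrow> real"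
    by (rule l2_inner_cong) simp
  have "(l2_norm T (\<lambda>x. (v x - f x) - Pi0 T (\<lambda>y. v y - f y) x))\<^sup>2
      \<le> l2_inner T (\<lambda>x. (v x - f x) - (a - c)) (\<lambda>x. (v x - f x) - (a - c))"
    unfolding l2_norm_sq by (rule T.Pi0_best[OF L2_diff[OF vL2 f]])
  also have "\<dots> = l2_inner T (\<lambda>x. ((u x - a) + - 1 *\<^sub>R (f x - c)) + - 1 *\<^sub>R err x) (\<lambda>x. ((u x - a) + - 1 *\<^sub>R (f x - c)) + - 1 *\<^sub>R err x)"
    by (rule l2_inner_cong) (simp add: err_def algebra_simps)
  finally have s1: "(l2_norm T (\<lambda>x. (v x - f x) - Pi0 T (\<lambda>y. v y - f y) x))\<^sup>2
      \<le> l2_inner T (\<lambda>x. ((u x - a) + - 1 *\<^sub>R (f x - c)) + - 1 *\<^sub>R err x) (\<lambda>x. ((u x - a) + - 1 *\<^sub>R (f x - c)) + - 1 *\<^sub>R err x)" .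
  have s2: "l2_inner T (\<lambda>x. ((u x - a) + - 1 *\<^sub>R (f x - c)) + - 1 *\<^sub>R err x) (\<lambda>x. ((u x - a) + - 1 *\<^sub>R (f x - c)) + - 1 *\<^sub>R err x)
      \<le> 2 * l2_inner T (\<lambda>x. (u x - a) + - 1 *\<^sub>R (f x - c)) (\<lambda>x. (u x - a) + - 1 *\<^sub>R (f x - c)) + 2 * l2_inner T err err"
    using l2_inner_self_add[OF L2_add[OF 1 2] 3] by (simp only: neg)
  have s3: "l2_inner T (\<lambda>x. (u x - a) + - 1 *\<^sub>R (f x - c)) (\<lambda>x. (u x - a) + - 1 *\<^sub>R (f x - c))
      \<le> 2 * l2_inner T (\<lambda>x. u x - a) (\<lambda>x. u x - a) + 2 * l2_inner T (\<lambda>x. f x - c) (\<lambda>x. f x - c)"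
    using l2_inner_self_add[OF 1 2] by (simp only: neg)
  show "(l2_norm T (\<lambda>x. (v x - f x) - Pi0 T (\<lambda>y. v y - f y) x))\<^sup>2
      \<le> 4 * l2_inner T err err + 4 * (l2_norm T (\<lambda>x. f x - Pi0 T f x))\<^sup>2 + 4 * (l2_norm T (\<lambda>x. u x - p x))\<^sup>2"
    using s1 s2 s3 l2_inner_self_nonneg[of T err] unfolding l2_norm_sq c p by linarith
qed simp

text \<open>On \<open>T\<close> the gradient of \<open>v\<close> is that of \<open>u\<close> minus
  \<open>err_grad T\<close>, so a constant close to the gradient of \<open>u\<close> is also a good
  competitor for that of \<open>v\<close>.\<close>

lemma gradient_term:
  "\<epsilon>\<^sup>2 * (l2_norm T (\<lambda>x. gradient v x - Pi0_vec T (gradient v) x))\<^sup>2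
    \<le> 2 * (\<epsilon>\<^sup>2 * l2_inner T (err_grad T) (err_grad T))
      + 2 * (INF \<tau>\<^sub>h\<in>P0. \<epsilon>\<^sup>2 * (l2_norm T (\<lambda>x. broken_gradient \<T> u x - \<tau>\<^sub>h x))\<^sup>2)"
proof (rule le_INF_scaled[OF P0_nonempty])
  fix p :: "real ^ 'n \<Rightarrow> real ^ 'n" assume "p \<in> P0"
  then obtain a where p: "p = (\<lambda>x. a)" by (auto simp: P0_def)
  note vg = H1_element(2,3)[OF v T] and ug = H1_element(2,3)[OF u T]
  have "is_weak_gradient T v (gradient v)"
    by (rule C1_weak_gradient[OF elem_props(1,2)[OF T] w[OF T] v_eq[OF T]
        gradient_on_open[OF elem_props(1)[OF T] _ w[OF T] v_eq[OF T]]])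
  note gv = this and ae = weak_gradient_unique[OF elem_props(1,2)[OF T] this vg(1)]
  have gL2: "gradient v \<in> L2 T" using gv by (simp add: is_weak_gradient_def)
  have 1: "(\<lambda>x. weak_gradient T u x - a) \<in> L2 T" by (rule L2_diff[OF ug(2) T.const_L2])
  have 2: "(\<lambda>x. - 1 *\<^sub>R err_grad T x) \<in> L2 T" by (rule L2_scale[OF err_L2(2)[OF T]])
  have "(l2_norm T (\<lambda>x. gradient v x - Pi0_vec T (gradient v) x))\<^sup>2
      \<le> l2_inner T (\<lambda>x. gradient v x - a) (\<lambda>x. gradient v x - a)"
    unfolding l2_norm_sq by (rule T.Pi0_vec_best[OF gL2])
  also have "\<dots> = l2_inner T (\<lambda>x. (weak_gradient T u x - a) + - 1 *\<^sub>R err_grad T x) (\<lambda>x. (weak_gradient T u x - a) + - 1 *\<^sub>R err_grad T x)"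
  proof -
    have "AE x in lebesgue_on T. gradient v x - a = (weak_gradient T u x - a) + - 1 *\<^sub>R err_grad T x"
      using ae by eventually_elim (simp add: err_grad_def)
    then show ?thesis
      by (intro l2_inner_AE_cong L2_diff[OF gL2 T.const_L2] L2_add[OF 1 2])
  qed
  also have "\<dots> \<le> 2 * l2_inner T (\<lambda>x. weak_gradient T u x - a) (\<lambda>x. weak_gradient T u x - a)
      + 2 * l2_inner T (\<lambda>x. - 1 *\<^sub>R err_grad T x) (\<lambda>x. - 1 *\<^sub>R err_grad T x)"
    by (rule l2_inner_self_add[OF 1 2])
  also have "l2_inner T (\<lambda>x. - 1 *\<^sub>R err_grad T x) (\<lambda>x. - 1 *\<^sub>R err_grad T x) = l2_inner T (err_grad T) (err_grad T)"
    by (rule l2_inner_cong) simp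
  also have "l2_inner T (\<lambda>x. weak_gradient T u x - a) (\<lambda>x. weak_gradient T u x - a)
      = (l2_norm T (\<lambda>x. broken_gradient \<T> u x - p x))\<^sup>2"
    unfolding l2_norm_sq by (rule l2_inner_cong) (simp add: broken_gradient_eq[OF _ T] p)
  finally have "\<epsilon>\<^sup>2 * (l2_norm T (\<lambda>x. gradient v x - Pi0_vec T (gradient v) x))\<^sup>2
      \<le> \<epsilon>\<^sup>2 * (2 * (l2_norm T (\<lambda>x. broken_gradient \<T> u x - p x))\<^sup>2 + 2 * l2_inner T (err_grad T) (err_grad T))"
    by (rule mult_left_mono) simp
  then show "\<epsilon>\<^sup>2 * (l2_norm T (\<lambda>x. gradient v x - Pi0_vec T (gradient v) x))\<^sup>2
      \<le> 2 * (\<epsilon>\<^sup>2 * l2_inner T (err_grad T) (err_grad T)) + 2 * (\<epsilon>\<^sup>2 * (l2_norm T (\<lambda>x. broken_gradient \<T> u x - p x))\<^sup>2)"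
    by (simp add: algebra_simps)
qed simp

lemma err_eq: "err = (\<lambda>x. u x - v x)" by (simp add: err_def fun_eq_iff)

lemma facet_const_eq: "facet_const = indicator_const CARD('n) \<kappa>"
  by (simp add: facet_const_def tangential_const_def diam_ratio_def jump_const_def indicator_const_def Let_def)

lemma facet_estimate:
  "\<epsilon> * (l2_norm_facet F (jump \<T> T F v))\<^sup>2
    + \<epsilon>\<^sup>2 * diameter T * (l2_norm_facet F (\<lambda>x. tangential F (jump \<T> T F (gradient v) x)))\<^sup>2
   \<le> 2 * indicator_const CARD('n) \<kappa> * ((l2_norm (patch \<T> T) (\<lambda>x. u x - v x))\<^sup>2
      + \<epsilon>\<^sup>2 * (l2_norm (patch \<T> T) (broken_gradient \<T> (\<lambda>x. u x - v x)))\<^sup>2)"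
  using facet_terms_patch unfolding patch_error_def err_eq facet_const_eq .

lemma indicator_const_nonneg: "0 \<le> indicator_const CARD('n) \<kappa>"
  using facet_const_nonneg unfolding facet_const_eq .

lemma element_estimate:
  assumes f: "f \<in> L2 T"
  shows "(l2_norm T (\<lambda>x. (v x - f x) - Pi0 T (\<lambda>y. v y - f y) x))\<^sup>2
      + \<epsilon>\<^sup>2 * (l2_norm T (\<lambda>x. gradient v x - Pi0_vec T (gradient v) x))\<^sup>2
    \<le> 4 * ((l2_norm (patch \<T> T) (\<lambda>x. u x - v x))\<^sup>2
        + \<epsilon>\<^sup>2 * (l2_norm (patch \<T> T) (broken_gradient \<T> (\<lambda>x. u x - v x)))\<^sup>2)
      + 4 * (INF v\<^sub>h\<in>P0. (l2_norm T (\<lambda>x. u x - v\<^sub>h x))\<^sup>2)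
      + 2 * (INF \<tau>\<^sub>h\<in>P0. \<epsilon>\<^sup>2 * (l2_norm T (\<lambda>x. broken_gradient \<T> u x - \<tau>\<^sub>h x))\<^sup>2)
      + 4 * (l2_norm T (\<lambda>x. f x - Pi0 T f x))\<^sup>2"
proof -
  have "0 \<le> \<epsilon>\<^sup>2 * l2_inner T (err_grad T) (err_grad T)" by (simp add: l2_inner_self_nonneg)
  then have "4 * l2_inner T err err + 2 * (\<epsilon>\<^sup>2 * l2_inner T (err_grad T) (err_grad T)) \<le> 4 * error T"
    unfolding error_def distrib_left by linarith
  also have "\<dots> \<le> 4 * patch_error" using error_le_patch[OF T_neighbour] by linarith
  finally show ?thesis
    using mean_term[OF f] gradient_term unfolding patch_error_def err_eq by linarith
qed

end

lemma INF_P0_nonneg: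
  fixes f :: "(real ^ 'n \<Rightarrow> 'b) \<Rightarrow> real"
  assumes "\<And>p. 0 \<le> f p" shows "0 \<le> (INF p\<in>P0. f p)"
  by (rule cINF_greatest[OF P0_nonempty]) (rule assms)

lemma discrete_function_representation:
  fixes \<T> :: "(real ^ 'n) set set"
  assumes dim: "CARD('n) = 2 \<or> CARD('n) = 3" and mesh: "conforming_mesh \<Omega> \<T>"
    and v: "v \<in> discrete_space \<epsilon> \<T>"
  shows "\<exists>w w'. \<forall>K\<in>\<T>. C1_with_gradient (w K) (w' K) \<and> (\<forall>x\<in>K. v x = w K x) \<and>
    (\<forall>z0\<in>vertices K. \<exists>d \<gamma>. \<forall>x. barycentric K z0 x = 0 \<longrightarrow>
       w K x = simplex_element.facet_function K (vertices K) z0 d \<gamma> x)"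
proof -
  have "\<forall>K\<in>\<T>. \<exists>w. \<exists>w'. C1_with_gradient w w' \<and> (\<forall>x\<in>K. v x = w x) \<and>
    (\<forall>z0\<in>vertices K. \<exists>d \<gamma>. \<forall>x. barycentric K z0 x = 0 \<longrightarrow>
       w x = simplex_element.facet_function K (vertices K) z0 d \<gamma> x)"
  proof (rule ballI)
    fix K assume K: "K \<in> \<T>"
    interpret K: simplex_element K "vertices K" by (rule mesh_simplex_element[OF dim mesh K])
    have "\<exists>w\<in>local_space \<epsilon> K. \<forall>x\<in>K. v x = w x" using v K by (simp add: discrete_space_def)
    then obtain w where w: "w \<in> local_space \<epsilon> K" and eq: "\<forall>x\<in>K. v x = w x" by (elim bexE)
    have "\<exists>w'. C1_with_gradient w w' \<and> (\<forall>z0\<in>vertices K. \<exists>d \<gamma>. \<forall>x. K.bary z0 x = 0 \<longrightarrow> w x = K.facet_function z0 d \<gamma> x)"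
      (is "\<exists>w'. ?Q w'")
    proof (rule K.local_space_representation[OF w])
      fix w' :: "real ^ 'n \<Rightarrow> real ^ 'n"
      assume a: "C1_with_gradient w w'"
        and b: "\<And>z0. z0 \<in> vertices K \<Longrightarrow> \<exists>d \<gamma>. \<forall>x. K.bary z0 x = 0 \<longrightarrow> w x = K.facet_function z0 d \<gamma> x"
      show "\<exists>w'. ?Q w'" by (rule exI[of _ w'], rule conjI[OF a], rule ballI, rule b)
    qed
    then obtain w' where "C1_with_gradient w w'"
      "\<forall>z0\<in>vertices K. \<exists>d \<gamma>. \<forall>x. K.bary z0 x = 0 \<longrightarrow> w x = K.facet_function z0 d \<gamma> x"
      by (elim exE conjE)
    then show "\<exists>w. \<exists>w'. C1_with_gradient w w' \<and> (\<forall>x\<in>K. v x = w x) \<and>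
      (\<forall>z0\<in>vertices K. \<exists>d \<gamma>. \<forall>x. K.bary z0 x = 0 \<longrightarrow> w x = K.facet_function z0 d \<gamma> x)"
      using eq by (intro exI[of _ w] exI[of _ w'] conjI)
  qed
  from bchoice[OF this] obtain w where "\<forall>K\<in>\<T>. \<exists>w'. C1_with_gradient (w K) w' \<and> (\<forall>x\<in>K. v x = w K x) \<and>
    (\<forall>z0\<in>vertices K. \<exists>d \<gamma>. \<forall>x. barycentric K z0 x = 0 \<longrightarrow>
       w K x = simplex_element.facet_function K (vertices K) z0 d \<gamma> x)" by (elim exE)
  from bchoice[OF this] show ?thesis by (rule exI[of _ w])
qed

lemma discrete_function_H1_broken:
  fixes \<T> :: "(real ^ 'n) set set"
  assumes dim: "CARD('n) = 2 \<or> CARD('n) = 3" and mesh: "conforming_mesh \<Omega> \<T>" and \<Omega>: "open \<Omega>"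
    and w: "\<And>K. K \<in> \<T> \<Longrightarrow> C1_with_gradient (w K) (w' K)"
    and eq: "\<And>K x. K \<in> \<T> \<Longrightarrow> x \<in> K \<Longrightarrow> v x = w K x"
  shows "v \<in> H1_broken \<Omega> \<T>"
proof -
  note el = mesh_simplex_element[OF dim mesh]
  have op: "open K" and bd: "bounded K" and cv: "convex K" if "K \<in> \<T>" for K
    using simplex_element.open_T[OF el[OF that]] simplex_element.bounded_T[OF el[OF that]]
      simplex_element.convex_T[OF el[OF that]] .
  have fin: "finite \<T>" and sub: "\<And>K. K \<in> \<T> \<Longrightarrow> K \<subseteq> \<Omega>" and cover: "closure \<Omega> = (\<Union>K\<in>\<T>. closure K)"
    using mesh unfolding conforming_mesh_def by simp_all
  have L2: "v \<in> L2 K" if K: "K \<in> \<T>" for K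
    by (rule L2_bounded_continuous[OF op[OF K] bd[OF K] C1_continuous[OF w[OF K]] eq[OF K]])
  have "v \<in> H1 K" if K: "K \<in> \<T>" for K
    unfolding H1_def using L2[OF K] C1_weak_gradient[OF op[OF K] bd[OF K] w[OF K] eq[OF K] refl]
    by (intro CollectI conjI exI)
  moreover have "v \<in> L2 \<Omega>"
  proof (rule L2_union[OF fin _ _ _ L2])
    show "convex K \<and> open K \<and> K \<subseteq> \<Omega>" if "K \<in> \<T>" for K using op[OF that] cv[OF that] sub[OF that] by simp
    show "\<Omega> \<in> sets lebesgue" using \<Omega> by auto
    show "\<Omega> \<subseteq> (\<Union>K\<in>\<T>. closure K)" unfolding cover[symmetric] by (rule closure_subset)
    show "K = L" if "K \<in> \<T>" "L \<in> \<T>" "x \<in> K" "x \<in> L" for K L x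
      using mesh_disjoint[OF mesh that(1,2)] that(3,4) by blast
  qed
  ultimately show ?thesis by (simp add: H1_broken_def)
qed

theorem corollary18:
  fixes \<Omega> :: "(real ^ 'n) set" and \<kappa> :: real
  assumes dim: "CARD('n) = 2 \<or> CARD('n) = 3"
    and domain: "polyhedral_lipschitz_domain \<Omega>"
  shows "\<exists>C > 0. \<forall>\<epsilon> \<T> f u l u\<^sub>h l\<^sub>h T.
    0 < \<epsilon> \<longrightarrow> \<epsilon> \<le> 1 \<longrightarrow>
    conforming_mesh \<Omega> \<T> \<longrightarrow> shape_regular \<kappa> \<T> \<longrightarrow>
    f \<in> L2 \<Omega> \<longrightarrow>
    mixed_solution \<Omega> \<T> \<epsilon> (H1_broken \<Omega> \<T>) (trace_space \<Omega> \<T>) f u l \<longrightarrow>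
    mixed_solution \<Omega> \<T> \<epsilon> (discrete_space \<epsilon> \<T>) (discrete_trace_space \<Omega> \<T>) f u\<^sub>h l\<^sub>h \<longrightarrow>
    T \<in> \<T> \<longrightarrow>
    indicator_sq \<T> \<epsilon> f u\<^sub>h T
      \<le> C * ((l2_norm (patch \<T> T) (\<lambda>x. u x - u\<^sub>h x))\<^sup>2
             + \<epsilon>\<^sup>2 * (l2_norm (patch \<T> T) (broken_gradient \<T> (\<lambda>x. u x - u\<^sub>h x)))\<^sup>2
             + (INF v\<^sub>h \<in> P0. (l2_norm T (\<lambda>x. u x - v\<^sub>h x))\<^sup>2)
             + (INF \<tau>\<^sub>h \<in> P0. \<epsilon>\<^sup>2 * (l2_norm T (\<lambda>x. broken_gradient \<T> u x - \<tau>\<^sub>h x))\<^sup>2)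
             + (l2_norm T (\<lambda>x. f x - Pi0 T f x))\<^sup>2)"
proof -
  define c where "c = indicator_const CARD('n) \<kappa>"
  \<comment> \<open>4 is the element constant, and 8 stands for the factor 2 of
    \<open>facet_estimate\<close> on at most four facets. The modulus makes \<open>C\<close>
    positive before anything is known about \<open>\<kappa>\<close>; only a given mesh shows
    \<open>0 \<le> c\<close>.\<close>
  define C where "C = 4 + 8 * \<bar>c\<bar>"
  have open_\<Omega>: "open \<Omega>" and bounded_\<Omega>: "bounded \<Omega>"
    using domain unfolding polyhedral_lipschitz_domain_def by simp_all
  show ?thesis
  proof (intro exI[of _ C] conjI allI impI)
    show "0 < C" by (simp add: C_def add_pos_nonneg)
    fix \<epsilon> :: real and \<T> and f u u\<^sub>h :: "real ^ 'n \<Rightarrow> real" and l l\<^sub>h :: "(real ^ 'n \<Rightarrow> real) \<Rightarrow> real"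
      and T :: "(real ^ 'n) set"
    assume \<epsilon>: "0 < \<epsilon>" and mesh: "conforming_mesh \<Omega> \<T>" and regular: "shape_regular \<kappa> \<T>"
      and f: "f \<in> L2 \<Omega>"
      and sol: "mixed_solution \<Omega> \<T> \<epsilon> (H1_broken \<Omega> \<T>) (trace_space \<Omega> \<T>) f u l"
      and sol\<^sub>h: "mixed_solution \<Omega> \<T> \<epsilon> (discrete_space \<epsilon> \<T>) (discrete_trace_space \<Omega> \<T>) f u\<^sub>h l\<^sub>h"
      and T: "T \<in> \<T>"
    have u: "u \<in> H1_broken \<Omega> \<T>" using sol by (simp add: mixed_solution_def)
    \<comment> \<open>Since \<epsilon> is nonzero, the second equation of the mixed problem says
      that the trace functionals themselves vanish on \<open>u\<close>.\<close>
    have u_conf: "tr_div \<Omega> \<T> \<tau> u = 0" if "\<tau> \<in> Hdiv \<Omega>" for \<tau>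
      using sol that \<epsilon> by (simp add: mixed_solution_def trace_space_def form_b_def)
    have uh: "u\<^sub>h \<in> discrete_space \<epsilon> \<T>" using sol\<^sub>h by (simp add: mixed_solution_def)
    have uh_conf: "tr_div \<Omega> \<T> \<tau> u\<^sub>h = 0" if "\<tau> \<in> RT0 \<Omega> \<T>" for \<tau>
      using sol\<^sub>h that \<epsilon> by (simp add: mixed_solution_def discrete_trace_space_def form_b_def)
    obtain w w' where ww: "\<forall>K\<in>\<T>. C1_with_gradient (w K) (w' K) \<and> (\<forall>x\<in>K. u\<^sub>h x = w K x) \<and>
      (\<forall>z0\<in>vertices K. \<exists>d \<gamma>. \<forall>x. barycentric K z0 x = 0 \<longrightarrow>
         w K x = simplex_element.facet_function K (vertices K) z0 d \<gamma> x)"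
      using discrete_function_representation[OF dim mesh uh] by (elim exE)
    have w: "C1_with_gradient (w K) (w' K)" if "K \<in> \<T>" for K by (rule conjunct1[OF bspec[OF ww that]])
    have w_eq: "u\<^sub>h x = w K x" if "K \<in> \<T>" "x \<in> K" for K x
      by (rule bspec[OF conjunct1[OF conjunct2[OF bspec[OF ww that(1)]]] that(2)])
    have w_facet: "\<exists>d \<gamma>. \<forall>x. barycentric K z0 x = 0 \<longrightarrow>
         w K x = simplex_element.facet_function K (vertices K) z0 d \<gamma> x" if "K \<in> \<T>" "z0 \<in> vertices K" for K z0
      by (rule bspec[OF conjunct2[OF conjunct2[OF bspec[OF ww that(1)]]] that(2)])
    have uh': "u\<^sub>h \<in> H1_broken \<Omega> \<T>" by (rule discrete_function_H1_broken[OF dim mesh open_\<Omega> w w_eq])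
    interpret T: simplex_element T "vertices T" by (rule mesh_simplex_element[OF dim mesh T])
    have loc: "discrete_jump \<Omega> \<T> T F \<kappa> \<epsilon> u u\<^sub>h w w'" if "F \<in> facets T" for F
      by (intro discrete_jump.intro mesh_facet.intro discrete_jump_axioms.intro
          dim open_\<Omega> bounded_\<Omega> mesh T that regular \<epsilon> u uh' u_conf uh_conf w w_eq w_facet)
    have f': "f \<in> L2 T"
      using mesh T T.T_lmeasurable open_\<Omega> by (intro L2_restrict[OF f]) (auto simp: conforming_mesh_def fmeasurableD)
    have facets: "facets T = T.facet ` vertices T" unfolding T.facets_eq by blast
    have fin: "finite (facets T)" unfolding facets using T.fin by simp
    \<comment> \<open>One facet per vertex makes at most \<open>3 + 1\<close> facets.\<close>
    have "card (facets T) \<le> card (vertices T)" unfolding facets by (rule card_image_le[OF T.fin])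
    then have card: "real (card (facets T)) \<le> 4" using T.card_C T.card_le_3 by simp
    \<comment> \<open>The element estimate and the sign of \<open>c\<close> come from
      \<open>discrete_jump\<close>, which is entered through some facet.\<close>
    obtain F0 where F0: "F0 \<in> facets T" using T.C_nonempty unfolding facets by blast
    define E where "E = (l2_norm (patch \<T> T) (\<lambda>x. u x - u\<^sub>h x))\<^sup>2
      + \<epsilon>\<^sup>2 * (l2_norm (patch \<T> T) (broken_gradient \<T> (\<lambda>x. u x - u\<^sub>h x)))\<^sup>2"
    define I1 where "I1 = (INF v\<^sub>h \<in> P0. (l2_norm T (\<lambda>x. u x - v\<^sub>h x))\<^sup>2)"
    define I2 where "I2 = (INF \<tau>\<^sub>h \<in> P0. \<epsilon>\<^sup>2 * (l2_norm T (\<lambda>x. broken_gradient \<T> u x - \<tau>\<^sub>h x))\<^sup>2)"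
    define osc where "osc = (l2_norm T (\<lambda>x. f x - Pi0 T f x))\<^sup>2"
    have nonneg: "0 \<le> E" "0 \<le> I1" "0 \<le> I2" "0 \<le> osc"
      unfolding E_def I1_def I2_def osc_def by (simp_all add: INF_P0_nonneg)
    have c: "0 \<le> c" unfolding c_def by (rule discrete_jump.indicator_const_nonneg[OF loc[OF F0]])
    let ?g = "\<lambda>F. \<epsilon> * (l2_norm_facet F (jump \<T> T F u\<^sub>h))\<^sup>2
        + \<epsilon>\<^sup>2 * diameter T * (l2_norm_facet F (\<lambda>x. tangential F (jump \<T> T F (gradient u\<^sub>h) x)))\<^sup>2"
    have "(\<Sum>F\<in>facets T. ?g F) \<le> real (card (facets T)) * (2 * c * E)"
      by (rule sum_bounded_above) (unfold c_def E_def, rule discrete_jump.facet_estimate[OF loc])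
    also have "\<dots> \<le> 4 * (2 * c * E)"
      by (intro mult_right_mono card mult_nonneg_nonneg c nonneg) simp
    finally have "(\<Sum>F\<in>facets T. ?g F) \<le> 8 * c * E" by simp
    then have facet_part: "\<epsilon> * (\<Sum>F\<in>facets T. (l2_norm_facet F (jump \<T> T F u\<^sub>h))\<^sup>2)
        + \<epsilon>\<^sup>2 * diameter T * (\<Sum>F\<in>facets T. (l2_norm_facet F (\<lambda>x. tangential F (jump \<T> T F (gradient u\<^sub>h) x)))\<^sup>2)
        \<le> 8 * c * E"
      by (simp only: sum.distrib sum_distrib_left)
    have "indicator_sq \<T> \<epsilon> f u\<^sub>h T \<le> 4 * E + 4 * I1 + 2 * I2 + 4 * osc + 8 * c * E"
      using discrete_jump.element_estimate[OF loc[OF F0] f'] facet_part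
      unfolding indicator_sq_def E_def[symmetric] I1_def[symmetric] I2_def[symmetric] osc_def[symmetric]
      by linarith
    also have "\<dots> \<le> C * (E + I1 + I2 + osc)"
    proof -
      have "C * (E + I1 + I2 + osc) = 4 * E + 4 * I1 + 4 * I2 + 4 * osc + 8 * c * E + 8 * (c * (I1 + I2 + osc))"
        using c by (simp add: C_def algebra_simps)
      moreover have "0 \<le> c * (I1 + I2 + osc)" using c nonneg by simp
      ultimately show ?thesis using nonneg by linarith
    qed
    finally show "indicator_sq \<T> \<epsilon> f u\<^sub>h T
      \<le> C * ((l2_norm (patch \<T> T) (\<lambda>x. u x - u\<^sub>h x))\<^sup>2
             + \<epsilon>\<^sup>2 * (l2_norm (patch \<T> T) (broken_gradient \<T> (\<lambda>x. u x - u\<^sub>h x)))\<^sup>2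
             + (INF v\<^sub>h \<in> P0. (l2_norm T (\<lambda>x. u x - v\<^sub>h x))\<^sup>2)
             + (INF \<tau>\<^sub>h \<in> P0. \<epsilon>\<^sup>2 * (l2_norm T (\<lambda>x. broken_gradient \<T> u x - \<tau>\<^sub>h x))\<^sup>2)
             + (l2_norm T (\<lambda>x. f x - Pi0 T f x))\<^sup>2)"
      unfolding E_def I1_def I2_def osc_def .
  qed
qed

end
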